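(* Let $\beta>0$, let $\mathsf{x}(N)\in\Sigma_N$ be a sequence of points in the bulk, and let $\mathsf{P}^\beta_\infty$ be any weak limit point, as $N\to\infty$, of the laws $\mathsf{P}^\beta_{N,\mathsf{x}}$ of the two-dimensional one-component plasma seen from $\mathsf{x}(N)$. Let $\chi=(\chi_i)_{i\ge 0}$ be a fixed smooth dyadic partition of unity of $\mathbb{R}^2$ (as in the context). Then for every bounded Borel set $\Lambda\subset\mathbb{R}^2$, with complement $\bar\Lambda=\mathbb{R}^2\setminus\Lambda$, for $\mathsf{P}^\beta_\infty$-a.e. $\mathbf{X}$, and for every point configuration $\mathbf{X}'$ in $\Lambda$ having the same number of points as $\mathbf{X}$ has in $\Lambda$, the quantity $$\iint_{\Lambda\times\bar\Lambda}-\log|x-y|\;\mathrm{d}\big(\mathbf{X}'-\mathbf{X}_\Lambda\big)(x)\;\sum_{i=0}^p\chi_i(y)\,\mathrm{d}\big(\mathbf{X}_{\bar\Lambda}-\mathrm{Leb}\big)(y)$$ converges, as $p\to\infty$, to a finite limit (denoted $\mathsf{M}_\Lambda(\mathbf{X}',\mathbf{X})$).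
   Context: Finite system. For $N\ge1$, $\Sigma_N\subset\mathbb{R}^2$ is the closed disk of center $0$ and radius $\sqrt{N/\pi}$. For $X_N=(x_1,\dots,x_N)\in\Sigma_N^N$ set $\mathbf{X}_N=\sum_{i=1}^N\delta_{x_i}$ and $$\mathsf{F}_N(\mathbf{X}_N)=\tfrac12\iint_{\Sigma_N\times\Sigma_N,\,x\ne y}-\log|x-y|\,\mathrm{d}(\mathbf{X}_N-\mathrm{Leb})(x)\,\mathrm{d}(\mathbf{X}_N-\mathrm{Leb})(y).$$ $\mathbb{P}_N^\beta$ is the probability measure on $\Sigma_N^N$ with density proportional to $e^{-\beta\mathsf{F}_N(\mathbf{X}_N)}$ with respect to Lebesgue measure. Point configurations. $\mathrm{Conf}$ is the space of locally finite point configurations in $\mathbb{R}^2$ (identified with sums of Dirac masses), with the vague topology (coarsest making $\mathbf{X}\mapsto\int f\,\mathrm{d}\mathbf{X}$ continuous for all continuous compactly supported $f$) and its Borel $\sigma$-algebra. $\mathbf{X}_\Lambda$ is the restriction of $\mathbf{X}$ to $\Lambda$. Probability measures on $\mathrm{Conf}$ (point processes) carry the weak topology (convergence of expectations of bounded continuous functions on $\mathrm{Conf}$). Limit points. For $\mathsf{x}\in\Sigma_N$, $\mathsf{P}^\beta_{N,\mathsf{x}}$ is the law of $\sum_{i=1}^N\delta_{x_i-\mathsf{x}}$ when $X_N\sim\mathbb{P}_N^\beta$. A sequence $\mathsf{x}(N)\in\Sigma_N$ is in the bulk if $\liminf_{N\to\infty}N^{-1/2}\,\mathrm{dist}(\mathsf{x}(N),\partial\Sigma_N)>0$.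 A limit point is a weak limit of $\mathsf{P}^\beta_{N,\mathsf{x}(N)}$ along some subsequence. Dyadic partition of unity. $\chi_i:\mathbb{R}^2\to[0,\infty)$ are smooth with $\sum_{i\ge0}\chi_i\equiv1$; $\chi_0$ is supported on the disk $\mathfrak{D}(2)$ (where $\mathfrak{D}(r)$ is the disk of center $0$ and radius $r$); for $i\ge1$, $\chi_i$ is supported on $\mathfrak{D}(2^{i+1})\setminus\mathfrak{D}(2^{i-1})$; and there is a constant $C_\chi$ such that for all $i\ge 0$ and $k=0,1,2,3$ the $k$-th derivative of $\chi_i$ is bounded in sup norm by $C_\chi2^{-ik}$. *)

theory Defs
  imports "HOL-Probability.Probability"
begin

text \<open>Locally finite point configurations of the plane. Points may be repeated (a configuration
  is a sum of Dirac masses), so a configuration is given by its multiplicity function.\<close>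

typedef conf = "{m :: real^2 \<Rightarrow> nat. \<forall>r. finite {x \<in> cball 0 r. m x \<noteq> 0}}"
  morphisms mult_at Abs_conf
  by (intro exI[of _ "\<lambda>_. 0"]) simp

definition conf_measure :: "conf \<Rightarrow> (real^2) measure" where
  "conf_measure X =
     distr (density (count_space UNIV) (\<lambda>x. of_nat (mult_at X x))) borel (\<lambda>x. x)"

definition conf_restrict :: "conf \<Rightarrow> (real^2) set \<Rightarrow> conf" where
  "conf_restrict X A = Abs_conf (\<lambda>x. if x \<in> A then mult_at X x else 0)"

definition conf_of_points :: "nat \<Rightarrow> (nat \<Rightarrow> real^2) \<Rightarrow> conf" where
  "conf_of_points N x = Abs_conf (\<lambda>z. card {i. i < N \<and> x i = z})"

text \<open>The vague topology, as the type class topology.\<close>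

instantiation conf :: topological_space
begin

definition open_conf :: "conf set \<Rightarrow> bool" where
  "open_conf = generate_topology
     {{X. (LINT x|conf_measure X. f x) \<in> V} | (f :: real^2 \<Rightarrow> real) V.
        continuous_on UNIV f \<and> compact (closure {x. f x \<noteq> 0}) \<and> open V}"

instance
  by standard (auto simp: open_conf_def intro: generate_topology.intros)

end

text \<open>The integral of f over A against the product of the differences
  (\<mu>1 - \<nu>1) and (\<mu>2 - \<nu>2) of positive measures, expanded bilinearly.\<close>

definition diff_integral ::
  "'a measure \<Rightarrow> 'a measure \<Rightarrow> 'b measure \<Rightarrow> 'b measure \<Rightarrow> ('a \<times> 'b) set
     \<Rightarrow> ('a \<Rightarrow> 'b \<Rightarrow> real) \<Rightarrow> real" where
  "diff_integral \<mu>1 \<nu>1 \<mu>2 \<nu>2 A f =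
       (LINT z:A|(\<mu>1 \<Otimes>\<^sub>M \<mu>2). f (fst z) (snd z))
     - (LINT z:A|(\<mu>1 \<Otimes>\<^sub>M \<nu>2). f (fst z) (snd z))
     - (LINT z:A|(\<nu>1 \<Otimes>\<^sub>M \<mu>2). f (fst z) (snd z))
     + (LINT z:A|(\<nu>1 \<Otimes>\<^sub>M \<nu>2). f (fst z) (snd z))"

definition Sigma_disk :: "nat \<Rightarrow> (real^2) set" where
  "Sigma_disk N = cball 0 (sqrt (real N / pi))"

definition energy :: "nat \<Rightarrow> conf \<Rightarrow> real" where
  "energy N X = 1/2 *
     diff_integral (conf_measure X) lborel (conf_measure X) lborel
       {(x, y). x \<in> Sigma_disk N \<and> y \<in> Sigma_disk N \<and> x \<noteq> y}
       (\<lambda>x y. - ln (norm (x - y)))"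

definition ocp_base :: "nat \<Rightarrow> (nat \<Rightarrow> real^2) measure" where
  "ocp_base N = (\<Pi>\<^sub>M i\<in>{..<N}. restrict_space lborel (Sigma_disk N))"

definition ocp_weight :: "real \<Rightarrow> nat \<Rightarrow> (nat \<Rightarrow> real^2) \<Rightarrow> ennreal" where
  "ocp_weight \<beta> N x = ennreal (exp (- \<beta> * energy N (conf_of_points N x)))"

definition ocp :: "real \<Rightarrow> nat \<Rightarrow> (nat \<Rightarrow> real^2) measure" where
  "ocp \<beta> N = density (ocp_base N)
     (\<lambda>x. ocp_weight \<beta> N x / (\<integral>\<^sup>+ y. ocp_weight \<beta> N y \<partial>ocp_base N))"

definition ocp_seen_from :: "real \<Rightarrow> nat \<Rightarrow> real^2 \<Rightarrow> conf measure" where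
  "ocp_seen_from \<beta> N a = distr (ocp \<beta> N) borel (\<lambda>x. conf_of_points N (\<lambda>i. x i - a))"

definition in_bulk :: "(nat \<Rightarrow> real^2) \<Rightarrow> bool" where
  "in_bulk a \<longleftrightarrow> (\<forall>N\<ge>1. a N \<in> Sigma_disk N) \<and>
     liminf (\<lambda>N. ereal (infdist (a N) (frontier (Sigma_disk N)) / sqrt (real N))) > 0"

definition weak_conv_conf :: "(nat \<Rightarrow> conf measure) \<Rightarrow> conf measure \<Rightarrow> bool" where
  "weak_conv_conf P Q \<longleftrightarrow>
     (\<forall>f :: conf \<Rightarrow> real. continuous_on UNIV f \<and> bounded (range f) \<longrightarrow>
        (\<lambda>n. LINT X|P n. f X) \<longlonglongrightarrow> (LINT X|Q. f X))"

definition ocp_limit_point :: "real \<Rightarrow> (nat \<Rightarrow> real^2) \<Rightarrow> conf measure \<Rightarrow> bool" where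
  "ocp_limit_point \<beta> a P \<longleftrightarrow> prob_space P \<and> sets P = sets borel \<and>
     (\<exists>r. strict_mono r \<and> weak_conv_conf (\<lambda>n. ocp_seen_from \<beta> (r n) (a (r n))) P)"

text \<open>iter_deriv f [v1, ..., vk] x is the k-th derivative of f at x,
  a k-linear form, evaluated at (v1, ..., vk).\<close>

fun iter_deriv :: "('a::real_normed_vector \<Rightarrow> real) \<Rightarrow> 'a list \<Rightarrow> 'a \<Rightarrow> real" where
  "iter_deriv f [] = f"
| "iter_deriv f (v # vs) = (\<lambda>x. frechet_derivative (iter_deriv f vs) (at x) v)"

definition smooth_fun :: "('a::real_normed_vector \<Rightarrow> real) \<Rightarrow> bool" where
  "smooth_fun f \<longleftrightarrow> (\<forall>vs x. iter_deriv f vs differentiable (at x))"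

text \<open>The sup norm of a k-th derivative is taken with respect to the operator norm of k-linear
  forms. As the functions are continuous, closed and open disks give the same support conditions.\<close>

definition dyadic_partition :: "(nat \<Rightarrow> real^2 \<Rightarrow> real) \<Rightarrow> bool" where
  "dyadic_partition \<phi> \<longleftrightarrow>
     (\<forall>i. smooth_fun (\<phi> i)) \<and>
     (\<forall>i x. \<phi> i x \<ge> 0) \<and>
     (\<forall>x. (\<lambda>i. \<phi> i x) sums 1) \<and>
     (\<forall>x. x \<notin> cball 0 2 \<longrightarrow> \<phi> 0 x = 0) \<and>
     (\<forall>i\<ge>1. \<forall>x. x \<notin> cball 0 (2 ^ (i + 1)) - cball 0 (2 ^ (i - 1)) \<longrightarrow> \<phi> i x = 0) \<and>
     (\<exists>C. \<forall>i. \<forall>k\<le>3. \<forall>vs x. length vs = k \<and> (\<forall>v\<in>set vs. norm v \<le> 1) \<longrightarrow>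
        \<bar>iter_deriv (\<phi> i) vs x\<bar> \<le> C / 2 ^ (i * k))"

definition truncated_move ::
  "(nat \<Rightarrow> real^2 \<Rightarrow> real) \<Rightarrow> (real^2) set \<Rightarrow> conf \<Rightarrow> conf \<Rightarrow> nat \<Rightarrow> real" where
  "truncated_move \<phi> \<Lambda> X' X p =
     diff_integral (conf_measure X') (conf_measure (conf_restrict X \<Lambda>))
       (conf_measure (conf_restrict X (- \<Lambda>))) lborel
       (\<Lambda> \<times> (- \<Lambda>)) (\<lambda>x y. - ln (norm (x - y)) * (\<Sum>i\<le>p. \<phi> i y))"

end

theory Submission
  imports Defs "HOL-Real_Asymp.Real_Asymp"
begin

text \<open>Fix \<open>X\<close> and write \<open>H s\<close> for the potential of the charges and the background, smoothed at scale
  \<open>s\<close>. For a test function \<open>f\<close> the fluctuation of the charges against \<open>f\<close> is \<open>-1/(2 pi)\<close> times the integral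
  of the potential against the Laplacian of \<open>f\<close>, so it is small as soon as \<open>H 1\<close> oscillates little.

  Resampling a single charge inside a disc leaves the Gibbs measure invariant, hence with high
  probability no charge of the disc could lower the energy by much more than a logarithm by moving
  inside it. For such a configuration, \<open>H 1\<close> on the disc exceeds its minimum only by a multiple of the
  logarithm of the radius: at a maximum point of \<open>H 1\<close> minus a paraboloid there is a charge within
  distance one, and that charge sees a potential which is low by Jensen's inequality. An a priori
  bound on the oscillation is needed to localise the maximum; on the whole system it follows from the
  positive definiteness of the kernel, and it descends through the scales \<open>8^k R\<close>.

  The resulting event is open in the vague topology, so it survives in the limit. The increment at
  scale \<open>2^i\<close> of the energy of a move is, by charge neutrality of \<open>X' - X\<close>, a combination of fluctuations of
  dipole potentials, whose Laplacians are of order \<open>8^(-i)\<close>; the increments are thus of order \<open>i 2^(-i)\<close>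
  outside events of summable probability, and Borel-Cantelli gives convergence.\<close>

section \<open>Green's identity\<close>

text \<open>A limit point comes with no Gibbs description of its own, so every probabilistic bound
  is proved for finite \<open>N\<close>, uniformly in the centre, and only masses of open events
  about integrals of compactly supported functions are passed on. All moves can share one null set
  because the finite bound is deterministic on a single good event: there the oscillation of
  \<open>spot 1\<close> controls every test function at once, and neither the dipole position nor
  \<open>X'\<close> costs probability. The exponents are tuned as follows. A disc of radius
  \<open>R\<close> with at most \<open>C1 * R\<^sup>2\<close> charges is unsettled with probability
  at most area times count times \<open>exp (- \<beta> * T)\<close>; taking
  \<open>T = 6 / \<beta> * ln R\<close> leaves a multiple of \<open>1 / R\<^sup>2\<close>, summable
  over the scales \<open>8^k * R\<close> and over dyadic \<open>R\<close>. A fluctuation is bounded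
  by Laplacian times area times oscillation, which at \<open>R = 8 * 2^i\<close> is of order
  \<open>8^(-i) * 4^i * i\<close>. Neutrality supplies the decisive factor \<open>2^(-i)\<close>: a
  single charge has Laplacians of order \<open>i * 4^(-i)\<close>, and no decay would
  result.\<close>

lemma distr_norm_square_lborel:
  "distr lborel borel (\<lambda>y::real^2. (norm y)\<^sup>2) = density lborel (\<lambda>t. ennreal pi * indicator {0..} t)"
proof (rule measure_eqI_generator_eq[where E="range (\<lambda>a::real. {..a})" and \<Omega>=UNIV and A="\<lambda>i. {..real i}"])
  show "Int_stable (range (\<lambda>a::real. {..a}))"
    by (auto simp: Int_stable_def)
  show "range (\<lambda>a::real. {..a}) \<subseteq> Pow UNIV" by simp
  show "sets (distr lborel borel (\<lambda>y::real^2. (norm y)\<^sup>2)) = sigma_sets UNIV (range (\<lambda>a::real. {..a}))"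
    by (simp add: borel_eq_atMost)
  show "sets (density lborel (\<lambda>t. ennreal pi * indicator {0..} t)) = sigma_sets UNIV (range (\<lambda>a::real. {..a}))"
    by (simp add: borel_eq_atMost)
  show "range (\<lambda>i. {..real i}) \<subseteq> range (\<lambda>a::real. {..a})" by auto
  show "(\<Union>i. {..real i}) = (UNIV::real set)"
    using real_arch_simple by auto
  have *: "emeasure (distr lborel borel (\<lambda>y::real^2. (norm y)\<^sup>2)) {..a} = ennreal (pi * max 0 a)" for a
  proof (cases "a \<ge> 0")
    case True
    have "(\<lambda>y::real^2. (norm y)\<^sup>2) -` {..a} = cball 0 (sqrt a)"
      using True by (auto simp: real_le_rsqrt real_sqrt_le_iff) (metis True abs_norm_cancel norm_ge_zero power_mono real_sqrt_pow2)
    thus ?thesis using True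
      by (subst emeasure_distr) (auto simp: emeasure_cball unit_ball_vol_2 mult.commute)
  next
    case False
    have "(\<lambda>y::real^2. (norm y)\<^sup>2) -` {..a} = {}"
      using False by (auto simp: not_le) (meson dual_order.strict_trans2 linorder_not_less zero_le_power2)
    thus ?thesis using False
      by (subst emeasure_distr) auto
  qed
  have **: "emeasure (density lborel (\<lambda>t. ennreal pi * indicator {0..} t)) {..a} = ennreal (pi * max 0 a)" for a :: real
  proof -
    have "emeasure (density lborel (\<lambda>t. ennreal pi * indicator {0..} t)) {..a} = (\<integral>\<^sup>+t. ennreal pi * indicator {0..a} t \<partial>lborel)"
      by (subst emeasure_density) (auto intro!: nn_integral_cong simp: indicator_def)
    also have "\<dots> = ennreal pi * ennreal (max 0 a)"
      by (subst nn_integral_cmult_indicator) (auto simp: max_def)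
    finally show ?thesis by (simp add: ennreal_mult)
  qed
  show "emeasure (distr lborel borel (\<lambda>y::real^2. (norm y)\<^sup>2)) {..real i} \<noteq> \<infinity>" for i
    by (simp add: *)
  show "emeasure (distr lborel borel (\<lambda>y::real^2. (norm y)\<^sup>2)) X =
     emeasure (density lborel (\<lambda>t. ennreal pi * indicator {0..} t)) X" if "X \<in> range (\<lambda>a::real. {..a})" for X
    using that by (auto simp: * **)
qed

text \<open>The area \<open>pi * t\<close> of the disc of squared radius \<open>t\<close> is linear
  in \<open>t\<close>, so in the squared norm the radial density is the constant \<open>pi\<close>.
  This takes the place of polar coordinates throughout.\<close>

lemma nn_integral_radial:
  assumes [measurable]: "f \<in> borel_measurable borel"
  shows "(\<integral>\<^sup>+y. f ((norm (y::real^2))\<^sup>2) \<partial>lborel) = ennreal pi * (\<integral>\<^sup>+t. f t * indicator {0..} t \<partial>lborel)"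
proof -
  have "(\<integral>\<^sup>+y. f ((norm (y::real^2))\<^sup>2) \<partial>lborel) = (\<integral>\<^sup>+t. f t \<partial>distr lborel borel (\<lambda>y::real^2. (norm y)\<^sup>2))"
    by (subst nn_integral_distr) auto
  also have "\<dots> = (\<integral>\<^sup>+t. ennreal pi * indicator {0..} t * f t \<partial>lborel)"
    by (subst distr_norm_square_lborel, subst nn_integral_density) auto
  also have "\<dots> = ennreal pi * (\<integral>\<^sup>+t. f t * indicator {0..} t \<partial>lborel)"
    by (subst nn_integral_cmult[symmetric]) (auto simp: mult_ac)
  finally show ?thesis .
qed

text \<open>Differentiability along one direction suffices for integration by parts: translation
  invariance of Lebesgue measure makes the integral of a directional derivative vanish.\<close>

definition has_dderiv :: "('a::euclidean_space \<Rightarrow> real) \<Rightarrow> 'a \<Rightarrow> ('a \<Rightarrow> real) \<Rightarrow> bool" where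
  "has_dderiv f v f' \<longleftrightarrow> (\<forall>y. ((\<lambda>t. f (y + t *\<^sub>R v)) has_real_derivative f' y) (at 0))"

lemma has_dderiv_at:
  assumes "has_dderiv f v f'"
  shows "((\<lambda>t. f (y + t *\<^sub>R v)) has_real_derivative f' (y + t *\<^sub>R v)) (at t)"
proof -
  have "((\<lambda>s. f ((y + t *\<^sub>R v) + s *\<^sub>R v)) has_real_derivative f' (y + t *\<^sub>R v)) (at 0)"
    using assms by (auto simp: has_dderiv_def)
  hence "((\<lambda>s. f (y + (s + t) *\<^sub>R v)) has_real_derivative f' (y + t *\<^sub>R v)) (at 0)"
    by (simp add: algebra_simps)
  thus ?thesis using DERIV_shift[of "\<lambda>s. f (y + s *\<^sub>R v)" "f' (y + t *\<^sub>R v)" 0 t]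
    by simp
qed

lemma has_dderiv_outside:
  fixes f :: "'a::euclidean_space \<Rightarrow> real"
  assumes d: "has_dderiv f v f'" and 0: "\<And>y. norm y > r \<Longrightarrow> f y = 0" and y: "norm y > r"
  shows "f' y = 0"
proof -
  have "open ((\<lambda>t. norm (y + t *\<^sub>R v)) -` {r<..})"
    by (intro open_vimage continuous_intros)
  moreover have "0 \<in> (\<lambda>t. norm (y + t *\<^sub>R v)) -` {r<..}" using y by simp
  ultimately have ev: "eventually (\<lambda>t. t \<in> (\<lambda>t. norm (y + t *\<^sub>R v)) -` {r<..}) (nhds 0)"
    by (rule eventually_nhds_in_open)
  have "((\<lambda>t. f (y + t *\<^sub>R v)) has_real_derivative 0) (at 0)"
    by (subst DERIV_cong_ev[OF refl _ refl, where g="\<lambda>_. 0"])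
       (use ev in \<open>auto elim!: eventually_mono intro: 0\<close>)
  moreover have "((\<lambda>t. f (y + t *\<^sub>R v)) has_real_derivative f' y) (at 0)"
    using d by (auto simp: has_dderiv_def)
  ultimately show ?thesis using DERIV_unique by blast
qed

lemma integrable_compact_supp:
  fixes f :: "'a::euclidean_space \<Rightarrow> real"
  assumes "continuous_on UNIV f" "\<And>y. norm y > r \<Longrightarrow> f y = 0"
  shows "integrable lborel f"
proof -
  have "integrable lborel (\<lambda>x. indicator (cball 0 r) x *\<^sub>R f x)"
    by (rule borel_integrable_compact) (auto intro: continuous_on_subset[OF assms(1)])
  moreover have "(\<lambda>x. indicator (cball 0 r) x *\<^sub>R f x) = f"
    using assms(2) by (force simp: indicator_def)
  ultimately show ?thesis by simp
qed

lemma bounded_compact_supp: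
  fixes f :: "'a::euclidean_space \<Rightarrow> real"
  assumes "continuous_on UNIV f" "\<And>y. norm y > r \<Longrightarrow> f y = 0"
  obtains B where "B > 0" "\<And>y. \<bar>f y\<bar> \<le> B"
proof -
  have "compact (f ` cball 0 r)"
    by (intro compact_continuous_image continuous_on_subset[OF assms(1)]) auto
  hence "bounded (f ` cball 0 r)" by (rule compact_imp_bounded)
  then obtain B where B: "B > 0" "\<And>y. y \<in> cball 0 r \<Longrightarrow> \<bar>f y\<bar> \<le> B"
    unfolding bounded_pos by auto
  have "\<bar>f y\<bar> \<le> B" for y
    using B assms(2)[of y] by (cases "norm y > r") auto
  thus ?thesis using B(1) that by blast
qed

lemma integral_dderiv_zero:
  fixes F :: "'a::euclidean_space \<Rightarrow> real"
  assumes d: "has_dderiv F v F'" and c: "continuous_on UNIV F" "continuous_on UNIV F'"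
    and 0: "\<And>y. norm y > r \<Longrightarrow> F y = 0"
  shows "(\<integral>y. F' y \<partial>lborel) = 0"
proof -
  have z1: "\<And>y. norm y > r \<Longrightarrow> F' y = 0"
    using has_dderiv_outside[OF d 0] by blast
  obtain B where B: "B > 0" "\<And>y. \<bar>F' y\<bar> \<le> B"
    using bounded_compact_supp[OF c(2) z1] by blast
  have intF: "integrable lborel F" by (rule integrable_compact_supp[OF c(1) 0])
  define s where "s n y = (F (y + (1 / real (Suc n)) *\<^sub>R v) - F y) * real (Suc n)" for n y
  have int0: "(\<integral>y. s n y \<partial>lborel) = 0" for n
  proof -
    let ?w = "(1 / real (Suc n)) *\<^sub>R v"
    have m: "F \<in> borel_measurable borel" using c(1) by (simp add: borel_measurable_continuous_onI)
    have i: "integrable lborel (\<lambda>y. F (y + ?w))"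
      using integrable_distr_eq[of "\<lambda>y. ?w + y" lborel borel F] intF m
      unfolding lborel_distr_plus by (simp add: add.commute)
    have e: "(\<integral>y. F (y + ?w) \<partial>lborel) = (\<integral>y. F y \<partial>lborel)"
      using integral_distr[of "\<lambda>y. ?w + y" lborel borel F] m
      unfolding lborel_distr_plus by (simp add: add.commute)
    show ?thesis unfolding s_def using i e intF by simp
  qed
  \<comment> \<open>Each difference quotient has integral zero. The mean value theorem bounds it by
    \<open>B\<close>, on a ball enlarged by \<open>norm v\<close> because the quotient at
    \<open>y\<close> also samples \<open>F\<close> up to one full step \<open>v\<close>
    away.\<close>
  have "(\<lambda>n. \<integral>y. s n y \<partial>lborel) \<longlonglongrightarrow> (\<integral>y. F' y \<partial>lborel)"
  proof (rule integral_dominated_convergence[where w="\<lambda>y. B * indicator (cball 0 (\<bar>r\<bar> + norm v)) y"])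
    show "F' \<in> borel_measurable lborel" using c(2) by (simp add: borel_measurable_continuous_onI)
    show "s n \<in> borel_measurable lborel" for n
      unfolding s_def using c(1)
      by (auto intro!: borel_measurable_continuous_onI continuous_intros continuous_on_compose2[OF c(1)])
    show "integrable lborel (\<lambda>y. B * indicator (cball 0 (\<bar>r\<bar> + norm v)) y :: real)"
      by (intro integrable_mult_right integrable_real_indicator) (auto simp: emeasure_cball less_top[symmetric] emeasure_lborel_cball_finite)
    show "AE y in lborel. (\<lambda>n. s n y) \<longlonglongrightarrow> F' y"
    proof (rule AE_I2)
      fix y
      have "((\<lambda>t. (F (y + t *\<^sub>R v) - F y) / t) \<longlongrightarrow> F' y) (at 0)"
        using d unfolding has_dderiv_def DERIV_def by (auto dest!: spec[of _ y])
      moreover have "filterlim (\<lambda>n. 1 / real (Suc n)) (at 0) sequentially"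
        by real_asymp
      ultimately have "(\<lambda>n. (F (y + (1 / real (Suc n)) *\<^sub>R v) - F y) / (1 / real (Suc n))) \<longlonglongrightarrow> F' y"
        by (rule filterlim_compose)
      thus "(\<lambda>n. s n y) \<longlonglongrightarrow> F' y" by (simp add: s_def)
    qed
    show "AE y in lborel. norm (s n y) \<le> B * indicator (cball 0 (\<bar>r\<bar> + norm v)) y" for n
    proof (rule AE_I2)
      fix y
      let ?t = "1 / real (Suc n)"
      have t: "0 < ?t" "?t \<le> 1" by auto
      show "norm (s n y) \<le> B * indicator (cball 0 (\<bar>r\<bar> + norm v)) y"
      proof (cases "norm y \<le> \<bar>r\<bar> + norm v")
        case True
        have "\<exists>z. z > 0 \<and> z < ?t \<and> F (y + ?t *\<^sub>R v) - F (y + 0 *\<^sub>R v) = (?t - 0) * F' (y + z *\<^sub>R v)"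
          by (rule MVT2) (use t has_dderiv_at[OF d] in auto)
        then obtain z where "F (y + ?t *\<^sub>R v) - F y = ?t * F' (y + z *\<^sub>R v)" by auto
        hence "s n y = F' (y + z *\<^sub>R v)" by (simp add: s_def)
        thus ?thesis using True B by simp
      next
        case False
        have "norm y \<le> norm (y + ?t *\<^sub>R v) + norm (?t *\<^sub>R v)"
          by (metis add_diff_cancel_right' norm_triangle_ineq4)
        moreover have "norm (?t *\<^sub>R v) \<le> norm v" using t by (simp add: mult_left_le_one_le field_simps)
        ultimately have "norm (y + ?t *\<^sub>R v) > r" "norm y > r" using False norm_ge_zero[of v] by linarith+
        thus ?thesis using 0 B by (simp add: s_def)
      qed
    qed
  qed
  thus ?thesis by (simp add: int0 LIMSEQ_const_iff)
qed

text \<open>Both derivatives are carried as explicit functions, so that the product rule and Green's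
  identity become algebra. Continuity is joint in all variables although differentiation is only
  along \<open>v\<close>.\<close>

definition C2_along :: "'a::euclidean_space \<Rightarrow> ('a \<Rightarrow> real) \<Rightarrow> ('a \<Rightarrow> real) \<Rightarrow> ('a \<Rightarrow> real) \<Rightarrow> bool" where
  "C2_along v f f1 f2 \<longleftrightarrow> has_dderiv f v f1 \<and> has_dderiv f1 v f2 \<and>
     continuous_on UNIV f \<and> continuous_on UNIV f1 \<and> continuous_on UNIV f2"

text \<open>The integrand \<open>q * f2 - f * q2\<close> is the derivative along \<open>v\<close> of
  \<open>q * f1 - f * q1\<close>. Compact support of the one factor \<open>f\<close> is enough,
  which later lets \<open>q\<close> be a smoothed logarithm or a polynomial.\<close>

lemma green_along:
  assumes f: "C2_along v f f1 f2" and q: "C2_along v q q1 q2"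
    and 0: "\<And>y. norm y > r \<Longrightarrow> f y = 0"
  shows "integrable lborel (\<lambda>y. q y * f2 y)" "integrable lborel (\<lambda>y. f y * q2 y)"
    "(\<integral>y. q y * f2 y \<partial>lborel) = (\<integral>y. f y * q2 y \<partial>lborel)"
proof -
  note F = f[unfolded C2_along_def] and Q = q[unfolded C2_along_def]
  have 1: "\<And>y. norm y > r \<Longrightarrow> f1 y = 0" using has_dderiv_outside[of f v f1 r] F 0 by blast
  have 2: "\<And>y. norm y > r \<Longrightarrow> f2 y = 0" using has_dderiv_outside[of f1 v f2 r] F 1 by blast
  show i1: "integrable lborel (\<lambda>y. q y * f2 y)"
    by (rule integrable_compact_supp[where r=r]) (use F Q 2 in \<open>auto intro!: continuous_intros\<close>)
  show i2: "integrable lborel (\<lambda>y. f y * q2 y)"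
    by (rule integrable_compact_supp[where r=r]) (use F Q 0 in \<open>auto intro!: continuous_intros\<close>)
  have "(\<integral>y. (q y * f2 y - f y * q2 y) \<partial>lborel) = 0"
  proof (rule integral_dderiv_zero[where F="\<lambda>y. q y * f1 y - f y * q1 y" and v=v and r=r])
    show "has_dderiv (\<lambda>y. q y * f1 y - f y * q1 y) v (\<lambda>y. q y * f2 y - f y * q2 y)"
      unfolding has_dderiv_def
    proof
      fix y
      have a: "((\<lambda>t. f (y + t *\<^sub>R v)) has_real_derivative f1 y) (at 0)"
        "((\<lambda>t. f1 (y + t *\<^sub>R v)) has_real_derivative f2 y) (at 0)"
        "((\<lambda>t. q (y + t *\<^sub>R v)) has_real_derivative q1 y) (at 0)"
        "((\<lambda>t. q1 (y + t *\<^sub>R v)) has_real_derivative q2 y) (at 0)"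
        using F Q by (auto simp: has_dderiv_def)
      show "((\<lambda>t. q (y + t *\<^sub>R v) * f1 (y + t *\<^sub>R v) - f (y + t *\<^sub>R v) * q1 (y + t *\<^sub>R v))
        has_real_derivative q y * f2 y - f y * q2 y) (at 0)"
        by (rule derivative_eq_intros a refl)+ (simp add: algebra_simps)
    qed
  qed (use F Q 0 1 in \<open>auto intro!: continuous_intros\<close>)
  thus "(\<integral>y. q y * f2 y \<partial>lborel) = (\<integral>y. f y * q2 y \<partial>lborel)" using i1 i2 by simp
qed

text \<open>Only the sum of the two second derivatives is exposed, because every later estimate is
  in terms of \<open>l\<close>; the hidden witnesses make \<open>f\<close> and \<open>l\<close>
  continuous.\<close>

definition has_lap :: "(real^2 \<Rightarrow> real) \<Rightarrow> (real^2 \<Rightarrow> real) \<Rightarrow> bool" where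
  "has_lap f l \<longleftrightarrow> (\<exists>f1 f2 g1 g2. C2_along (axis 1 1) f f1 f2 \<and> C2_along (axis 2 1) f g1 g2 \<and>
     l = (\<lambda>y. f2 y + g2 y))"

lemma has_lap_continuous: "has_lap f l \<Longrightarrow> continuous_on UNIV f" "has_lap f l \<Longrightarrow> continuous_on UNIV l"
  by (auto simp: has_lap_def C2_along_def intro!: continuous_intros)

lemma has_lap_outside:
  assumes "has_lap f l" "\<And>y. norm y > r \<Longrightarrow> f y = 0" "norm y > r"
  shows "l y = 0"
proof -
  have *: "f2 y = 0" if "C2_along v f f1 f2" for v f1 f2
    using has_dderiv_outside[of f v f1 r, OF _ assms(2)] has_dderiv_outside[of f1 v f2 r] that assms(3)
    unfolding C2_along_def by blast
  from assms(1) obtain f1 f2 g1 g2 where "C2_along (axis 1 1) f f1 f2" "C2_along (axis 2 1) f g1 g2"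
    "l = (\<lambda>y. f2 y + g2 y)" by (auto simp: has_lap_def)
  thus ?thesis using *[of "axis 1 1" f1 f2] *[of "axis 2 1" g1 g2] by simp
qed

lemma green:
  assumes "has_lap f lf" "has_lap q lq" "\<And>y. norm y > r \<Longrightarrow> f y = 0"
  shows "integrable lborel (\<lambda>y. q y * lf y)" "integrable lborel (\<lambda>y. f y * lq y)"
    "(\<integral>y. q y * lf y \<partial>lborel) = (\<integral>y. f y * lq y \<partial>lborel)"
proof -
  obtain f1 f2 g1 g2 where f: "C2_along (axis 1 1) f f1 f2" "C2_along (axis 2 1) f g1 g2" "lf = (\<lambda>y. f2 y + g2 y)"
    using assms(1) by (auto simp: has_lap_def)
  obtain q1 q2 p1 p2 where q: "C2_along (axis 1 1) q q1 q2" "C2_along (axis 2 1) q p1 p2" "lq = (\<lambda>y. q2 y + p2 y)"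
    using assms(2) by (auto simp: has_lap_def)
  note a = green_along[OF f(1) q(1) assms(3)] and b = green_along[OF f(2) q(2) assms(3)]
  show "integrable lborel (\<lambda>y. q y * lf y)" "integrable lborel (\<lambda>y. f y * lq y)"
    "(\<integral>y. q y * lf y \<partial>lborel) = (\<integral>y. f y * lq y \<partial>lborel)"
    using a b by (simp_all add: f(3) q(3) distrib_left)
qed

lemma C2_along_translate:
  assumes "C2_along v f f1 f2"
  shows "C2_along v (\<lambda>y. f (y - x)) (\<lambda>y. f1 (y - x)) (\<lambda>y. f2 (y - x))"
proof -
  have *: "y + t *\<^sub>R v - x = (y - x) + t *\<^sub>R v" for y t by simp
  have **: "continuous_on UNIV g \<Longrightarrow> continuous_on UNIV (\<lambda>y. g (y - x))" for g :: "'a \<Rightarrow> real"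
    by (auto intro!: continuous_intros continuous_on_compose2[of UNIV g])
  show ?thesis using assms unfolding C2_along_def has_dderiv_def * by (auto intro!: **)
qed

lemma has_lap_translate: "has_lap f l \<Longrightarrow> has_lap (\<lambda>y. f (y - x)) (\<lambda>y. l (y - x))"
  unfolding has_lap_def using C2_along_translate[where x=x] by blast

lemma C2_along_diff:
  assumes "C2_along v f f1 f2" "C2_along v g g1 g2"
  shows "C2_along v (\<lambda>y. f y - g y) (\<lambda>y. f1 y - g1 y) (\<lambda>y. f2 y - g2 y)"
  using assms unfolding C2_along_def has_dderiv_def
  by (auto intro!: continuous_intros derivative_intros)

lemma has_lap_diff:
  assumes "has_lap f lf" "has_lap g lg"
  shows "has_lap (\<lambda>y. f y - g y) (\<lambda>y. lf y - lg y)"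
proof -
  obtain f1 f2 g1 g2 where f: "C2_along (axis 1 1) f f1 f2" "C2_along (axis 2 1) f g1 g2" "lf = (\<lambda>y. f2 y + g2 y)"
    using assms(1) by (auto simp: has_lap_def)
  obtain q1 q2 p1 p2 where q: "C2_along (axis 1 1) g q1 q2" "C2_along (axis 2 1) g p1 p2" "lg = (\<lambda>y. q2 y + p2 y)"
    using assms(2) by (auto simp: has_lap_def)
  show ?thesis unfolding has_lap_def
    by (intro exI conjI, rule C2_along_diff[OF f(1) q(1)], rule C2_along_diff[OF f(2) q(2)]) (auto simp: f q)
qed

lemma C2_along_const: "C2_along v (\<lambda>_. c) (\<lambda>_. 0) (\<lambda>_. 0)"
  by (auto simp: C2_along_def has_dderiv_def)

lemma has_lap_const: "has_lap (\<lambda>_. c) (\<lambda>_. 0)"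
  unfolding has_lap_def using C2_along_const[of _ c] by (intro exI conjI) (auto simp: fun_eq_iff)

lemma norm_add_scaleR_square:
  fixes y v :: "'a::real_inner"
  shows "(norm (y + t *\<^sub>R v))\<^sup>2 = (norm y)\<^sup>2 + 2 * t * (y \<bullet> v) + t\<^sup>2 * (norm v)\<^sup>2"
  by (simp add: power2_norm_eq_inner inner_add_left inner_add_right inner_commute algebra_simps)
     (simp add: power2_eq_square)

text \<open>A profile in the squared norm avoids the singularity of the norm at the origin: along a
  line the squared norm is a quadratic polynomial, and the chain rule does the rest.\<close>

lemma C2_along_radial:
  fixes \<psi> \<psi>1 \<psi>2 :: "real \<Rightarrow> real" and v :: "'a::euclidean_space"
  assumes d: "\<And>t. (\<psi> has_real_derivative \<psi>1 t) (at t)" "\<And>t. (\<psi>1 has_real_derivative \<psi>2 t) (at t)"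
    and c: "continuous_on UNIV \<psi>2"
  shows "C2_along v (\<lambda>y. \<psi> ((norm y)\<^sup>2)) (\<lambda>y. 2 * (y \<bullet> v) * \<psi>1 ((norm y)\<^sup>2))
    (\<lambda>y. 4 * (y \<bullet> v)\<^sup>2 * \<psi>2 ((norm y)\<^sup>2) + 2 * (norm v)\<^sup>2 * \<psi>1 ((norm y)\<^sup>2))"
proof -
  have c0: "continuous_on UNIV \<psi>" "continuous_on UNIV \<psi>1"
    using d by (auto intro!: DERIV_continuous_on simp: )
  have n: "((\<lambda>t. (norm (y + t *\<^sub>R v))\<^sup>2) has_real_derivative 2 * (y \<bullet> v)) (at 0)" for y
    unfolding norm_add_scaleR_square by (auto intro!: derivative_eq_intros)
  have i: "((\<lambda>t. (y + t *\<^sub>R v) \<bullet> v) has_real_derivative (norm v)\<^sup>2) (at 0)" for y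
    by (auto simp: inner_add_left power2_norm_eq_inner intro!: derivative_eq_intros)
  have p: "((\<lambda>t. \<psi> ((norm (y + t *\<^sub>R v))\<^sup>2)) has_real_derivative \<psi>1 ((norm y)\<^sup>2) * (2 * (y \<bullet> v))) (at 0)" for y
    by (rule DERIV_chain2[OF _ n]) (use d(1) in simp)
  have p1: "((\<lambda>t. \<psi>1 ((norm (y + t *\<^sub>R v))\<^sup>2)) has_real_derivative \<psi>2 ((norm y)\<^sup>2) * (2 * (y \<bullet> v))) (at 0)" for y
    by (rule DERIV_chain2[OF _ n]) (use d(2) in simp)
  show ?thesis unfolding C2_along_def
  proof (intro conjI)
    show "has_dderiv (\<lambda>y. \<psi> ((norm y)\<^sup>2)) v (\<lambda>y. 2 * (y \<bullet> v) * \<psi>1 ((norm y)\<^sup>2))"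
      using p by (simp add: has_dderiv_def mult_ac)
    show "has_dderiv (\<lambda>y. 2 * (y \<bullet> v) * \<psi>1 ((norm y)\<^sup>2)) v
     (\<lambda>y. 4 * (y \<bullet> v)\<^sup>2 * \<psi>2 ((norm y)\<^sup>2) + 2 * (norm v)\<^sup>2 * \<psi>1 ((norm y)\<^sup>2))"
      unfolding has_dderiv_def
    proof
      fix y
      show "((\<lambda>t. 2 * ((y + t *\<^sub>R v) \<bullet> v) * \<psi>1 ((norm (y + t *\<^sub>R v))\<^sup>2)) has_real_derivative
        4 * (y \<bullet> v)\<^sup>2 * \<psi>2 ((norm y)\<^sup>2) + 2 * (norm v)\<^sup>2 * \<psi>1 ((norm y)\<^sup>2)) (at 0)"
        by (rule derivative_eq_intros i p1 refl)+ (simp add: power2_eq_square algebra_simps)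
    qed
  qed (auto intro!: continuous_intros continuous_on_compose2[OF c0(1)] continuous_on_compose2[OF c0(2)] continuous_on_compose2[OF c])
qed

lemma norm_square_real2: "(norm (y::real^2))\<^sup>2 = (y \<bullet> axis 1 1)\<^sup>2 + (y \<bullet> axis 2 1)\<^sup>2"
  by (simp add: norm_vec_def L2_set_def sum_2 inner_axis real_sqrt_pow2)

lemma has_lap_radial:
  fixes \<psi> \<psi>1 \<psi>2 :: "real \<Rightarrow> real"
  assumes d: "\<And>t. (\<psi> has_real_derivative \<psi>1 t) (at t)" "\<And>t. (\<psi>1 has_real_derivative \<psi>2 t) (at t)"
    and c: "continuous_on UNIV \<psi>2"
  shows "has_lap (\<lambda>y. \<psi> ((norm y)\<^sup>2)) (\<lambda>y. 4 * (norm y)\<^sup>2 * \<psi>2 ((norm y)\<^sup>2) + 4 * \<psi>1 ((norm y)\<^sup>2))"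
  unfolding has_lap_def
  by (intro exI conjI, rule C2_along_radial[OF d c], rule C2_along_radial[OF d c])
     (auto simp: fun_eq_iff norm_square_real2 algebra_simps)

lemma has_lap_norm_square: "has_lap (\<lambda>y. c * (norm y)\<^sup>2) (\<lambda>_. 4 * c)"
  using has_lap_radial[of "\<lambda>t. c * t" "\<lambda>_. c" "\<lambda>_. 0"] by (auto intro!: derivative_eq_intros)

section \<open>The smoothed logarithm\<close>

definition lnk :: "real^2 \<Rightarrow> real" where "lnk u = - ln (norm u)"

text \<open>\<open>Lk s\<close> is the convolution of \<open>lnk\<close> with the probability density \<open>kap s\<close>.\<close>

definition kap :: "real \<Rightarrow> real^2 \<Rightarrow> real" where
  "kap s u = 2 / (pi * s\<^sup>2) * max 0 (1 - (norm u)\<^sup>2 / s\<^sup>2)"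

definition Lk :: "real \<Rightarrow> real^2 \<Rightarrow> real" where
  "Lk s u = (if norm u < s then - ln s + (1 - (norm u)\<^sup>2 / s\<^sup>2) / 2 + (1 - (norm u)\<^sup>2 / s\<^sup>2)\<^sup>2 / 4
     else - ln (norm u))"

lemma lnk_measurable[measurable]: "lnk \<in> borel_measurable borel"
  unfolding lnk_def by measurable

lemma lnk_minus: "lnk (- u) = lnk u" by (simp add: lnk_def)
lemma kap_minus: "kap s (- u) = kap s u" by (simp add: kap_def)
lemma Lk_minus: "Lk s (- u) = Lk s u" by (simp add: Lk_def)

lemma kap_nonneg: "kap s u \<ge> 0"
  by (simp add: kap_def)

lemma kap_le: "kap s u \<le> 2 / (pi * s\<^sup>2)"
proof -
  have "max 0 (1 - (norm u)\<^sup>2 / s\<^sup>2) \<le> 1" by simp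
  thus ?thesis unfolding kap_def by (intro mult_left_le) auto
qed

lemma kap_outside: "s > 0 \<Longrightarrow> norm u \<ge> s \<Longrightarrow> kap s u = 0"
  by (simp add: kap_def max_def divide_simps power_mono not_le)

lemma kap_continuous: "continuous_on A (kap s)"
  unfolding kap_def divide_inverse by (intro continuous_intros)

lemma kap_measurable[measurable]: "kap s \<in> borel_measurable borel"
  using kap_continuous[of UNIV s] by (rule borel_measurable_continuous_onI)

lemma Lk_eq_lnk: "norm u \<ge> s \<Longrightarrow> Lk s u = lnk u"
  by (simp add: Lk_def lnk_def)

lemma Lk_ge: 
  assumes "s > 0" shows "Lk s u \<ge> - ln (max s (norm u))"
proof (cases "norm u < s")
  case True
  hence "(norm u)\<^sup>2 / s\<^sup>2 \<le> 1" using assms by (simp add: divide_simps power_mono)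
  thus ?thesis using True by (simp add: Lk_def max_def)
qed (simp add: Lk_def max_def)

text \<open>The bound is the value \<open>Lk s 0\<close>, where \<open>1/2 + 1/4\<close> is added to
  the boundary value \<open>- ln s\<close>.\<close>

lemma Lk_le_zero:
  assumes "s > 0" shows "Lk s u \<le> - ln s + 3/4"
proof (cases "norm u < s")
  case True
  define r where "r = (norm u)\<^sup>2 / s\<^sup>2"
  have r: "0 \<le> r" "r \<le> 1" using True assms unfolding r_def by (auto simp add: divide_simps power_mono)
  have "(1 - r)\<^sup>2 \<le> 1" using r by (simp add: power_le_one)
  moreover have "Lk s u = - ln s + (1 - r) / 2 + (1 - r)\<^sup>2 / 4" using True by (simp add: Lk_def r_def)
  moreover have "(1 - r) / 2 \<le> 1 / 2" using r by simp
  moreover have "(1 - r)\<^sup>2 / 4 \<le> 1 / 4" using \<open>(1 - r)\<^sup>2 \<le> 1\<close> by simp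
  ultimately show ?thesis by linarith
next
  case False
  hence "ln s \<le> ln (norm u)" using assms by (simp add: ln_mono)
  thus ?thesis using False by (simp add: Lk_def)
qed

text \<open>On the left stands the second order Taylor polynomial of the right side at
  \<open>r = 1\<close>; all further coefficients in powers of \<open>1 - r\<close> are positive. In
  the proof the difference has the explicit derivative
  \<open>- (1 - x)\<^sup>2 / (2 * x)\<close>.\<close>

lemma ln_ge_quadratic:
  assumes "0 < r" "r \<le> (1::real)"
  shows "(1 - r) / 2 + (1 - r)\<^sup>2 / 4 \<le> - ln r / 2"
proof -
  define F where "F = (\<lambda>r::real. - ln r / 2 - (1 - r) / 2 - (1 - r)\<^sup>2 / 4)"
  have "F 1 \<le> F r"
  proof (rule DERIV_nonpos_imp_nonincreasing[OF assms(2)])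
    fix x assume x: "r \<le> x" "x \<le> 1"
    have "(F has_real_derivative - (1 - x)\<^sup>2 / (2 * x)) (at x)"
      unfolding F_def using x assms
      by (auto intro!: derivative_eq_intros simp: field_simps power2_eq_square)
    moreover have "- (1 - x)\<^sup>2 / (2 * x) \<le> 0" using x assms by simp
    ultimately show "\<exists>y. (F has_real_derivative y) (at x) \<and> y \<le> 0" by blast
  qed
  moreover have "F 1 = 0" "F r = - ln r / 2 - (1 - r) / 2 - (1 - r)\<^sup>2 / 4" by (auto simp: F_def)
  ultimately show ?thesis by linarith
qed

text \<open>Averaging over discs lowers a superharmonic function; with the explicit profile this
  becomes the Taylor estimate above.\<close>

lemma Lk_le_lnk:
  assumes "s > 0" "u \<noteq> 0" shows "Lk s u \<le> lnk u"
proof (cases "norm u < s")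
  case True
  define r where "r = (norm u)\<^sup>2 / s\<^sup>2"
  have r: "0 < r" "r \<le> 1" using True assms unfolding r_def by (auto simp add: divide_simps power_mono)
  have "ln r = 2 * ln (norm u) - 2 * ln s"
    using assms unfolding r_def by (simp add: ln_div ln_realpow)
  moreover have "Lk s u = - ln s + (1 - r) / 2 + (1 - r)\<^sup>2 / 4" using True by (simp add: Lk_def r_def)
  moreover have "lnk u = - ln (norm u)" by (simp add: lnk_def)
  ultimately show ?thesis using ln_ge_quadratic[OF r] by linarith
qed (simp add: Lk_eq_lnk)

text \<open>\<open>Lprof\<close> is the profile of \<open>Lk\<close> as a function of the squared norm. In the disc it is the
  second order Taylor polynomial of the logarithm at the boundary, which makes it twice
  continuously differentiable.\<close>

definition Lprof :: "real \<Rightarrow> real \<Rightarrow> real" where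
  "Lprof \<tau> t = (if t \<in> {..<\<tau>} then - ln \<tau> / 2 + (1 - t / \<tau>) / 2 + (1 - t / \<tau>)\<^sup>2 / 4 else - ln t / 2)"
definition Lprof1 :: "real \<Rightarrow> real \<Rightarrow> real" where
  "Lprof1 \<tau> t = (if t \<in> {..<\<tau>} then - (2 - t / \<tau>) / (2 * \<tau>) else - 1 / (2 * t))"
definition Lprof2 :: "real \<Rightarrow> real \<Rightarrow> real" where
  "Lprof2 \<tau> t = (if t \<in> {..<\<tau>} then 1 / (2 * \<tau>\<^sup>2) else 1 / (2 * t\<^sup>2))"

lemma Lprof_deriv:
  assumes "\<tau> > 0"
  shows "(Lprof \<tau> has_real_derivative Lprof1 \<tau> t) (at t)"
    "(Lprof1 \<tau> has_real_derivative Lprof2 \<tau> t) (at t)"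
    "continuous_on UNIV (Lprof2 \<tau>)"
proof -
  have cl: "closure {..<\<tau>} = {..\<tau>}" "closure {\<tau>..} = {\<tau>..}" by auto
  have U: "UNIV = {..<\<tau>} \<union> {\<tau>..}" by auto
  have "((\<lambda>t. - ln \<tau> / 2 + (1 - t / \<tau>) / 2 + (1 - t / \<tau>)\<^sup>2 / 4) has_real_derivative - (2 - t / \<tau>) / (2 * \<tau>)) (at t within A)" for A
    using assms by (auto intro!: derivative_eq_intros simp: field_simps power2_eq_square)
  moreover have "((\<lambda>t. - ln t / 2) has_real_derivative - 1 / (2 * t)) (at t within A)" if "t \<ge> \<tau>" for A
    using assms that by (auto intro!: derivative_eq_intros simp: field_simps)
  ultimately have "((\<lambda>t. if t \<in> {..<\<tau>} then - ln \<tau> / 2 + (1 - t / \<tau>) / 2 + (1 - t / \<tau>)\<^sup>2 / 4 else - ln t / 2)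
    has_vector_derivative (if t \<in> {..<\<tau>} then - (2 - t / \<tau>) / (2 * \<tau>) else - 1 / (2 * t))) (at t within UNIV)"
    using assms
    by (intro has_vector_derivative_If_within_closures[OF _ U])
       (auto simp: cl has_real_derivative_iff_has_vector_derivative[symmetric])
  thus "(Lprof \<tau> has_real_derivative Lprof1 \<tau> t) (at t)"
    by (simp add: Lprof_def[abs_def] Lprof1_def has_real_derivative_iff_has_vector_derivative)
  have "((\<lambda>t. - (2 - t / \<tau>) / (2 * \<tau>)) has_real_derivative 1 / (2 * \<tau>\<^sup>2)) (at t within A)" for A
    using assms by (auto intro!: derivative_eq_intros simp: field_simps power2_eq_square)
  moreover have "((\<lambda>t. - 1 / (2 * t)) has_real_derivative 1 / (2 * t\<^sup>2)) (at t within A)" if "t \<ge> \<tau>" for A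
    using assms that by (auto intro!: derivative_eq_intros simp: field_simps power2_eq_square)
  ultimately have "((\<lambda>t. if t \<in> {..<\<tau>} then - (2 - t / \<tau>) / (2 * \<tau>) else - 1 / (2 * t))
    has_vector_derivative (if t \<in> {..<\<tau>} then 1 / (2 * \<tau>\<^sup>2) else 1 / (2 * t\<^sup>2))) (at t within UNIV)"
    using assms
    by (intro has_vector_derivative_If_within_closures[OF _ U])
       (auto simp: cl has_real_derivative_iff_has_vector_derivative[symmetric])
  thus "(Lprof1 \<tau> has_real_derivative Lprof2 \<tau> t) (at t)"
    by (simp add: Lprof1_def[abs_def] Lprof2_def has_real_derivative_iff_has_vector_derivative)
  have e: "Lprof2 \<tau> = (\<lambda>t. 1 / (2 * (max \<tau> t)\<^sup>2))"
    by (auto simp: Lprof2_def fun_eq_iff max_def)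
  show "continuous_on UNIV (Lprof2 \<tau>)"
    unfolding e using assms by (intro continuous_intros) (auto simp: max_def)
qed

lemma Lk_Lprof:
  assumes "s > 0" shows "Lk s u = Lprof (s\<^sup>2) ((norm u)\<^sup>2)"
proof (cases "norm u < s")
  case True
  hence "(norm u)\<^sup>2 < s\<^sup>2" using assms by (simp add: power_strict_mono)
  thus ?thesis using True assms by (simp add: Lk_def Lprof_def ln_realpow)
next
  case False
  hence "\<not> (norm u)\<^sup>2 < s\<^sup>2" using assms by (simp add: not_less power_mono)
  moreover have "norm u > 0" using False assms by linarith
  ultimately show ?thesis using False assms by (simp add: Lk_def Lprof_def ln_realpow)
qed

lemma C2_along_Lk:
  assumes "s > 0"
  shows "C2_along v (Lk s) (\<lambda>y. 2 * (y \<bullet> v) * Lprof1 (s\<^sup>2) ((norm y)\<^sup>2))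
    (\<lambda>y. 4 * (y \<bullet> v)\<^sup>2 * Lprof2 (s\<^sup>2) ((norm y)\<^sup>2) + 2 * (norm v)\<^sup>2 * Lprof1 (s\<^sup>2) ((norm y)\<^sup>2))"
proof -
  have t: "s\<^sup>2 > 0" using assms by simp
  have e: "Lk s = (\<lambda>y. Lprof (s\<^sup>2) ((norm y)\<^sup>2))" using Lk_Lprof[OF assms] by auto
  show ?thesis unfolding e
    by (rule C2_along_radial[OF Lprof_deriv(1)[OF t] Lprof_deriv(2)[OF t] Lprof_deriv(3)[OF t]])
qed

text \<open>This identifies \<open>kap s\<close> as the charge density of \<open>Lk s\<close>.
  Inside the disc the two terms of the radial Laplacian combine to the linear profile of
  \<open>kap s\<close>; outside they cancel because the logarithm is harmonic.\<close>

lemma has_lap_Lk: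
  assumes "s > 0" shows "has_lap (Lk s) (\<lambda>y. - 2 * pi * kap s y)"
proof -
  have t: "s\<^sup>2 > 0" using assms by simp
  have e: "Lk s = (\<lambda>y. Lprof (s\<^sup>2) ((norm y)\<^sup>2))" using Lk_Lprof[OF assms] by auto
  have "4 * (norm y)\<^sup>2 * Lprof2 (s\<^sup>2) ((norm y)\<^sup>2) + 4 * Lprof1 (s\<^sup>2) ((norm y)\<^sup>2) = - 2 * pi * kap s y" for y :: "real^2"
  proof -
    define t where "t = (norm y)\<^sup>2"
    define \<tau> where "\<tau> = s\<^sup>2"
    have "\<tau> > 0" using assms by (simp add: \<tau>_def)
    have "4 * t * Lprof2 \<tau> t + 4 * Lprof1 \<tau> t = - 2 * pi * (2 / (pi * \<tau>) * max 0 (1 - t / \<tau>))"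
    proof (cases "t < \<tau>")
      case True
      hence "1 - t / \<tau> \<ge> 0" using \<open>\<tau> > 0\<close> by (simp add: divide_simps)
      moreover have "4 * t * (1 / (2 * \<tau>\<^sup>2)) + 4 * (- (2 - t / \<tau>) / (2 * \<tau>)) = - 2 * pi * (2 / (pi * \<tau>) * (1 - t / \<tau>))"
      proof -
        have "\<tau> \<noteq> 0" using \<open>\<tau> > 0\<close> by linarith
        thus ?thesis by (simp add: field_simps power2_eq_square)
      qed
      ultimately show ?thesis using True by (simp only: Lprof2_def Lprof1_def max_absorb2 lessThan_iff if_True)
    next
      case False
      hence "1 - t / \<tau> \<le> 0" using \<open>\<tau> > 0\<close> by (simp add: divide_simps)
      hence "max 0 (1 - t / \<tau>) = 0" by simp
      moreover have "t > 0" using False \<open>\<tau> > 0\<close> by linarith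
      ultimately show ?thesis using False by (simp add: Lprof2_def Lprof1_def power2_eq_square)
    qed
    thus ?thesis by (simp add: t_def \<tau>_def kap_def)
  qed
  hence e2: "(\<lambda>y. - 2 * pi * kap s y) = (\<lambda>y. 4 * (norm y)\<^sup>2 * Lprof2 (s\<^sup>2) ((norm y)\<^sup>2) + 4 * Lprof1 (s\<^sup>2) ((norm y)\<^sup>2))"
    by (simp add: fun_eq_iff)
  show ?thesis unfolding e e2
    by (rule has_lap_radial[OF Lprof_deriv(1)[OF t] Lprof_deriv(2)[OF t] Lprof_deriv(3)[OF t]])
qed

lemma Lk_continuous: "s > 0 \<Longrightarrow> continuous_on A (Lk s)"
  using has_lap_continuous(1)[OF has_lap_Lk] continuous_on_subset by blast

lemma Lk_measurable: "s > 0 \<Longrightarrow> Lk s \<in> borel_measurable borel"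
  using Lk_continuous[of s UNIV] by (rule borel_measurable_continuous_onI)

section \<open>Moments of the smoothing kernel\<close>

lemma integrable_lborel_translate:
  fixes f :: "'a::euclidean_space \<Rightarrow> real"
  shows "integrable lborel f \<Longrightarrow> integrable lborel (\<lambda>y. f (y - x))"
  using integrable_distr[of "\<lambda>y. - x + y" lborel borel f] unfolding lborel_distr_plus by simp

lemma integral_lborel_translate:
  fixes f :: "'a::euclidean_space \<Rightarrow> real"
  assumes "f \<in> borel_measurable borel"
  shows "(\<integral>y. f (y - x) \<partial>lborel) = (\<integral>y. f y \<partial>lborel)"
  using integral_distr[of "\<lambda>y. - x + y" lborel borel f] assms unfolding lborel_distr_plus by simp

lemma lborel_distr_uminus_euclidean: "distr lborel borel uminus = (lborel :: 'a::euclidean_space measure)"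
  using lborel_affine[of "-1" "0::'a"] by (simp add: density_1 one_ennreal_def[symmetric])

lemma integral_lborel_uminus:
  fixes f :: "'a::euclidean_space \<Rightarrow> real"
  assumes "f \<in> borel_measurable borel"
  shows "(\<integral>y. f (- y) \<partial>lborel) = (\<integral>y. f y \<partial>lborel)"
  using integral_distr[of uminus lborel borel f] assms by (simp add: lborel_distr_uminus_euclidean)

text \<open>In the squared norm \<open>t\<close> the density is linear on
  \<open>[0, s\<^sup>2]\<close>, so mass and second moment are integrals of polynomials. The moment
  \<open>s\<^sup>2 / 3\<close> is the shift that smoothing gives to a quadratic background.\<close>

lemma
  assumes s: "s > 0"
  shows integrable_kap: "integrable lborel (kap s)"
    and integral_kap: "(\<integral>u. kap s u \<partial>lborel) = 1"
    and integrable_norm_kap: "integrable lborel (\<lambda>u. (norm u)\<^sup>2 * kap s u)"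
    and integral_norm_kap: "(\<integral>u. (norm u)\<^sup>2 * kap s u \<partial>lborel) = s\<^sup>2 / 3"
proof -
  show "integrable lborel (kap s)"
    by (rule integrable_compact_supp[where r=s]) (use s kap_continuous kap_outside in auto)
  show "integrable lborel (\<lambda>u. (norm u)\<^sup>2 * kap s u)"
    by (rule integrable_compact_supp[where r=s]) (use s kap_continuous kap_outside in \<open>auto intro!: continuous_intros\<close>)
  let ?k = "\<lambda>t. 2 / (pi * s\<^sup>2) * max 0 (1 - t / s\<^sup>2)"
  have k: "?k t = 2 / (pi * s\<^sup>2) * (1 - t / s\<^sup>2)" if "t \<le> s\<^sup>2" for t using that s by (simp add: max_def divide_simps)
  have k0: "?k t = 0" if "t > s\<^sup>2" for t using that s by (simp add: max_def divide_simps)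
  have "(\<integral>\<^sup>+u. ennreal (kap s u) \<partial>lborel) = ennreal pi * (\<integral>\<^sup>+t. ennreal (?k t) * indicator {0..} t \<partial>lborel)"
    unfolding kap_def by (subst nn_integral_radial[symmetric]) auto
  also have "(\<integral>\<^sup>+t. ennreal (?k t) * indicator {0..} t \<partial>lborel)
     = (\<integral>\<^sup>+t. ennreal (2 / (pi * s\<^sup>2) * (1 - t / s\<^sup>2)) * indicator {0..s\<^sup>2} t \<partial>lborel)"
  proof (intro nn_integral_cong)
    fix t :: real
    show "ennreal (?k t) * indicator {0..} t = ennreal (2 / (pi * s\<^sup>2) * (1 - t / s\<^sup>2)) * indicator {0..s\<^sup>2} t"
      proof (cases "t > s\<^sup>2")
      case True thus ?thesis using k0[OF True] by (simp add: indicator_def)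
    next
      case False
      hence "?k t = 2 / (pi * s\<^sup>2) * (1 - t / s\<^sup>2)" by (intro k) simp
      thus ?thesis using False by (simp only:) (simp add: indicator_def)
    qed
  qed
  also have "\<dots> = ennreal (2 / (pi * s\<^sup>2) * (s\<^sup>2 - (s\<^sup>2)\<^sup>2 / (2 * s\<^sup>2)) - 2 / (pi * s\<^sup>2) * (0 - 0\<^sup>2 / (2 * s\<^sup>2)))"
    by (rule nn_integral_FTC_Icc) (use s in \<open>auto intro!: derivative_eq_intros simp: field_simps\<close>)
  also have "ennreal pi * \<dots> = 1"
    using s by (simp add: ennreal_mult[symmetric] power2_eq_square field_simps)
  finally have "(\<integral>\<^sup>+u. ennreal (kap s u) \<partial>lborel) = 1" .
  thus "(\<integral>u. kap s u \<partial>lborel) = 1"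
    by (subst integral_eq_nn_integral) (auto simp: kap_nonneg)
  have "(\<integral>\<^sup>+u. ennreal ((norm u)\<^sup>2 * kap s u) \<partial>lborel) = ennreal pi * (\<integral>\<^sup>+t. ennreal (t * ?k t) * indicator {0..} t \<partial>lborel)"
    unfolding kap_def by (subst nn_integral_radial[symmetric]) auto
  also have "(\<integral>\<^sup>+t. ennreal (t * ?k t) * indicator {0..} t \<partial>lborel)
     = (\<integral>\<^sup>+t. ennreal (2 / (pi * s\<^sup>2) * (t - t\<^sup>2 / s\<^sup>2)) * indicator {0..s\<^sup>2} t \<partial>lborel)"
  proof (intro nn_integral_cong)
    fix t :: real
    show "ennreal (t * ?k t) * indicator {0..} t = ennreal (2 / (pi * s\<^sup>2) * (t - t\<^sup>2 / s\<^sup>2)) * indicator {0..s\<^sup>2} t"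
    proof (cases "t > s\<^sup>2")
      case True thus ?thesis using k0[OF True] s by (simp add: indicator_def)
    next
      case False
      hence "?k t = 2 / (pi * s\<^sup>2) * (1 - t / s\<^sup>2)" by (intro k) simp
      hence "t * ?k t = 2 / (pi * s\<^sup>2) * (t - t\<^sup>2 / s\<^sup>2)"
        by (simp only:) (simp add: power2_eq_square right_diff_distrib mult_ac)
      thus ?thesis using False by (simp only:) (simp add: indicator_def)
    qed
  qed
  also have "\<dots> = ennreal (2 / (pi * s\<^sup>2) * ((s\<^sup>2)\<^sup>2 / 2 - (s\<^sup>2)^3 / (3 * s\<^sup>2)) - 2 / (pi * s\<^sup>2) * (0\<^sup>2 / 2 - 0^3 / (3 * s\<^sup>2)))"
  proof (rule nn_integral_FTC_Icc[where F="\<lambda>t. 2 / (pi * s\<^sup>2) * (t\<^sup>2 / 2 - t ^ 3 / (3 * s\<^sup>2))"])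
    fix t assume "t \<in> {0..s\<^sup>2}"
    hence t: "0 \<le> t" "t \<le> s\<^sup>2" by auto
    show "((\<lambda>t. 2 / (pi * s\<^sup>2) * (t\<^sup>2 / 2 - t ^ 3 / (3 * s\<^sup>2))) has_real_derivative 2 / (pi * s\<^sup>2) * (t - t\<^sup>2 / s\<^sup>2)) (at t)"
      using s by (auto intro!: derivative_eq_intros simp: field_simps)
    have "t * t \<le> t * s\<^sup>2" using t by (intro mult_left_mono) auto
    hence "t\<^sup>2 / s\<^sup>2 \<le> t" using s by (simp add: divide_simps power2_eq_square)
    thus "0 \<le> 2 / (pi * s\<^sup>2) * (t - t\<^sup>2 / s\<^sup>2)" by simp
  qed (use s in auto)
  also have "ennreal pi * \<dots> = ennreal (s\<^sup>2 / 3)"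
    using s by (simp add: ennreal_mult[symmetric] power2_eq_square power3_eq_cube field_simps)
  finally have "(\<integral>\<^sup>+u. ennreal ((norm u)\<^sup>2 * kap s u) \<partial>lborel) = ennreal (s\<^sup>2 / 3)" .
  thus "(\<integral>u. (norm u)\<^sup>2 * kap s u \<partial>lborel) = s\<^sup>2 / 3"
    by (subst integral_eq_nn_integral) (auto simp: kap_nonneg)
qed

lemma integral_kap_centered:
  assumes "s > 0"
  shows "integrable lborel (\<lambda>y. kap s (y - y0))" "(\<integral>y. kap s (y - y0) \<partial>lborel) = 1"
  using integrable_lborel_translate[OF integrable_kap[OF assms]] integral_lborel_translate[of "kap s" y0] integral_kap[OF assms]
  by simp_all

text \<open>With \<open>u = y - y0\<close> the square splits into three terms; the mixed one
  integrates to zero because \<open>kap s\<close> is even.\<close>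

lemma smear_norm_square:
  assumes s: "s > 0"
  shows "integrable lborel (\<lambda>y. (norm y)\<^sup>2 * kap s (y - y0))"
    "(\<integral>y. (norm y)\<^sup>2 * kap s (y - y0) \<partial>lborel) = (norm y0)\<^sup>2 + s\<^sup>2 / 3"
proof -
  let ?F = "\<lambda>u. (norm (u + y0))\<^sup>2 * kap s u"
  have e: "?F u = (norm u)\<^sup>2 * kap s u + (2 * (u \<bullet> y0) * kap s u + (norm y0)\<^sup>2 * kap s u)" for u
    using norm_add_scaleR_square[of u 1 y0] by (simp add: algebra_simps)
  have i: "integrable lborel (\<lambda>u. 2 * (u \<bullet> y0) * kap s u)"
    by (rule integrable_compact_supp[where r=s]) (use s kap_continuous kap_outside in \<open>auto intro!: continuous_intros\<close>)
  have "(\<integral>u. 2 * (u \<bullet> y0) * kap s u \<partial>lborel) = (\<integral>u. 2 * (- u \<bullet> y0) * kap s (- u) \<partial>lborel)"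
    by (rule integral_lborel_uminus[symmetric]) measurable
  also have "\<dots> = - (\<integral>u. 2 * (u \<bullet> y0) * kap s u \<partial>lborel)"
    by (simp add: kap_minus)
  finally have z: "(\<integral>u. 2 * (u \<bullet> y0) * kap s u \<partial>lborel) = 0" by simp
  have iF: "integrable lborel ?F"
    unfolding e using i integrable_norm_kap[OF s] integrable_kap[OF s] by simp
  have tr: "(\<lambda>y. ?F (y - y0)) = (\<lambda>y. (norm y)\<^sup>2 * kap s (y - y0))" by simp
  show "integrable lborel (\<lambda>y. (norm y)\<^sup>2 * kap s (y - y0))"
    using integrable_lborel_translate[OF iF, of y0] unfolding tr .
  have "(\<integral>y. (norm y)\<^sup>2 * kap s (y - y0) \<partial>lborel) = (\<integral>u. ?F u \<partial>lborel)"
    using integral_lborel_translate[of ?F y0] unfolding tr by simp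
  also have "\<dots> = (norm y0)\<^sup>2 + s\<^sup>2 / 3"
    unfolding e using i integrable_norm_kap[OF s] integrable_kap[OF s] z integral_norm_kap[OF s] integral_kap[OF s] by simp
  finally show "(\<integral>y. (norm y)\<^sup>2 * kap s (y - y0) \<partial>lborel) = (norm y0)\<^sup>2 + s\<^sup>2 / 3" .
qed

section \<open>The logarithm as a fundamental solution, and its convolution with the smoothing
  kernel\<close>

lemma integrable_lnk_sq:
  "integrable lborel (\<lambda>u. indicator (cball 0 R) u * lnk u)"
proof -
  \<comment> \<open>\<open>ln z \<le> z - 1\<close> at \<open>z = t powr (-1/2)\<close> turns the
    logarithmic singularity at 0 into an integrable power.\<close>
  have b: "\<bar>ln t / 2\<bar> \<le> t powr (-1/2) + t" if "t > 0" for t :: real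
  proof -
    have "ln t \<le> t - 1" using that by (rule ln_le_minus_one)
    moreover have "ln (t powr (-1/2)) \<le> t powr (-1/2) - 1" by (rule ln_le_minus_one) (use that in auto)
    hence "- ln t / 2 \<le> t powr (-1/2)" using that by (simp add: ln_powr)
    ultimately show ?thesis using that powr_ge_zero[of t "-1/2"] by linarith
  qed
  let ?f = "\<lambda>t. ennreal (\<bar>ln t / 2\<bar>) * indicator {..R\<^sup>2} t"
  have "(\<integral>\<^sup>+u. ennreal (norm (indicator (cball 0 R) u * lnk u)) \<partial>lborel) \<le> (\<integral>\<^sup>+u. ?f ((norm (u::real^2))\<^sup>2) \<partial>lborel)"
  proof (intro nn_integral_mono)
    fix u :: "real^2"
    show "ennreal (norm (indicator (cball 0 R) u * lnk u)) \<le> ?f ((norm u)\<^sup>2)"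
    proof (cases "u \<in> cball 0 R \<and> u \<noteq> 0")
      case True
      hence "(norm u)\<^sup>2 \<le> R\<^sup>2" by (simp add: power_mono)
      thus ?thesis using True by (simp add: lnk_def ln_realpow)
    qed (auto simp: lnk_def)
  qed
  also have "\<dots> = ennreal pi * (\<integral>\<^sup>+t. ?f t * indicator {0..} t \<partial>lborel)"
    by (rule nn_integral_radial) measurable
  also have "(\<integral>\<^sup>+t. ?f t * indicator {0..} t \<partial>lborel) \<le> (\<integral>\<^sup>+t. ennreal (t powr (-1/2)) * indicator {0..R\<^sup>2} t + ennreal (R\<^sup>2) * indicator {0..R\<^sup>2} t \<partial>lborel)"
  proof (intro nn_integral_mono)
    fix t :: real
    show "?f t * indicator {0..} t \<le> ennreal (t powr (-1/2)) * indicator {0..R\<^sup>2} t + ennreal (R\<^sup>2) * indicator {0..R\<^sup>2} t"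
      using b[of t] by (cases "t = 0") (auto simp: indicator_def ennreal_plus[symmetric] simp del: ennreal_plus intro!: ennreal_leI)
  qed
  also have "\<dots> = (\<integral>\<^sup>+t. ennreal (t powr (-1/2)) * indicator {0..R\<^sup>2} t \<partial>lborel) + ennreal (R\<^sup>2) * ennreal (R\<^sup>2)"
    by (subst nn_integral_add) (auto simp: nn_integral_cmult_indicator)
  also have "(\<integral>\<^sup>+t. ennreal (t powr (-1/2)) * indicator {0..R\<^sup>2} t \<partial>lborel) = ennreal ((R\<^sup>2) powr (-1/2+1) / (-1/2+1))"
    by (rule nn_integral_has_integral_lebesgue') (use has_integral_powr_from_0[of "-1/2" "R\<^sup>2"] in auto)
  also have "ennreal pi * (ennreal ((R\<^sup>2) powr (-1/2+1) / (-1/2+1)) + ennreal (R\<^sup>2) * ennreal (R\<^sup>2)) < \<infinity>"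
    by (simp add: ennreal_mult_less_top)
  finally have fin: "(\<integral>\<^sup>+u. ennreal (norm (indicator (cball 0 R) u * lnk u)) \<partial>lborel) < \<infinity>"
    by (simp add: mult_left_mono)
  moreover have "(\<lambda>u. indicator (cball 0 R) u * lnk u) \<in> borel_measurable lborel"
    by (auto intro!: borel_measurable_times borel_measurable_indicator)
  ultimately show ?thesis by (intro integrableI_bounded)
qed

lemma integrable_lnk_mult:
  assumes f: "f \<in> borel_measurable borel" "\<And>y. \<bar>f y\<bar> \<le> B" "\<And>y. norm y > r \<Longrightarrow> f y = 0"
  shows "integrable lborel (\<lambda>y. lnk (y - x) * f y)"
proof -
  define R where "R = \<bar>r\<bar> + norm x"
  have "integrable lborel (\<lambda>y. B * (indicator (cball 0 R) (y - x) * lnk (y - x)))"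
    using integrable_lborel_translate[OF integrable_lnk_sq[of R], of x] by simp
  moreover have "norm (lnk (y - x) * f y) \<le> norm (B * (indicator (cball 0 R) (y - x) * lnk (y - x)))" for y
  proof (cases "norm y > r")
    case False
    have "norm (y - x) \<le> R" unfolding R_def using False norm_triangle_ineq4[of y x] by linarith
    moreover have "\<bar>f y\<bar> \<le> \<bar>B\<bar>" using f(2)[of y] by linarith
    ultimately show ?thesis by (simp add: abs_mult mult.commute mult_right_mono)
  qed (simp add: f(3))
  ultimately show ?thesis
    using f(1) by (elim Bochner_Integration.integrable_bound) (auto intro!: borel_measurable_times measurable_compose[OF _ lnk_measurable])
qed

lemma smear_tendsto:
  fixes f :: "real^2 \<Rightarrow> real"
  assumes c: "continuous_on UNIV f"
  shows "(\<lambda>n. \<integral>y. f y * kap (1 / real (Suc n)) (y - x) \<partial>lborel) \<longlonglongrightarrow> f x"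
proof (rule LIMSEQ_I)
  fix e :: real assume e: "e > 0"
  have "isCont f x" using c by (simp add: continuous_on_eq_continuous_at)
  then obtain d where d: "d > 0" "\<And>y. dist y x < d \<Longrightarrow> dist (f y) (f x) < e / 2"
    using e unfolding continuous_at_eps_delta by (metis half_gt_zero)
  obtain n0 where n0: "1 / real (Suc n0) < d" using d(1) nat_approx_posE by blast
  show "\<exists>n0. \<forall>n\<ge>n0. norm ((\<integral>y. f y * kap (1 / real (Suc n)) (y - x) \<partial>lborel) - f x) < e"
  proof (intro exI allI impI)
    fix n assume n: "n \<ge> n0"
    let ?s = "1 / real (Suc n)"
    have s: "?s > 0" by simp
    have sd: "?s < d" using n0 n by (smt (verit) frac_le of_nat_0_less_iff of_nat_mono Suc_le_mono zero_less_Suc)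
    have ik: "integrable lborel (\<lambda>y. kap ?s (y - x))" by (rule integral_kap_centered(1)[OF s])
    have ig: "integrable lborel (\<lambda>y. (f y - f x) * kap ?s (y - x))"
    proof (rule integrable_compact_supp[where r="norm x + ?s"])
      show "continuous_on UNIV (\<lambda>y. (f y - f x) * kap ?s (y - x))"
        by (intro continuous_intros c continuous_on_compose2[OF kap_continuous[of UNIV]]) auto
      fix y :: "real^2" assume "norm y > norm x + ?s"
      hence "norm (y - x) \<ge> ?s" using norm_triangle_ineq2[of y x] by linarith
      thus "(f y - f x) * kap ?s (y - x) = 0" using kap_outside[OF s] by simp
    qed
    have "(\<integral>y. f y * kap ?s (y - x) \<partial>lborel) = (\<integral>y. (f y - f x) * kap ?s (y - x) + f x * kap ?s (y - x) \<partial>lborel)"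
      by (simp add: algebra_simps)
    also have "\<dots> = (\<integral>y. (f y - f x) * kap ?s (y - x) \<partial>lborel) + f x"
      using ig ik integral_kap_centered(2)[OF s, of x] by simp
    finally have "norm ((\<integral>y. f y * kap ?s (y - x) \<partial>lborel) - f x) = norm (\<integral>y. (f y - f x) * kap ?s (y - x) \<partial>lborel)"
      by simp
    also have "\<dots> \<le> (\<integral>y. norm ((f y - f x) * kap ?s (y - x)) \<partial>lborel)" by (rule integral_norm_bound)
    also have "\<dots> \<le> (\<integral>y. (e / 2) * kap ?s (y - x) \<partial>lborel)"
    proof (rule integral_mono)
      fix y
      show "norm ((f y - f x) * kap ?s (y - x)) \<le> (e / 2) * kap ?s (y - x)"
      proof (cases "norm (y - x) \<ge> ?s")
        case False
        hence "dist (f y) (f x) < e / 2" by (intro d(2)) (use sd in \<open>simp add: dist_norm\<close>)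
        hence "\<bar>f y - f x\<bar> \<le> e / 2" by (simp add: dist_real_def)
        thus ?thesis unfolding real_norm_def abs_mult abs_of_nonneg[OF kap_nonneg]
          by (rule mult_right_mono[OF _ kap_nonneg])
      qed (use kap_outside[OF s] in simp)
    qed (use ig ik in auto)
    also have "\<dots> = e / 2" using ik integral_kap_centered(2)[OF s, of x] by simp
    finally show "norm ((\<integral>y. f y * kap ?s (y - x) \<partial>lborel) - f x) < e" using e by simp
  qed
qed

lemma AE_lborel_neq: "AE y in lborel. y \<noteq> (x::'a::euclidean_space)"
  by (rule AE_lborel_singleton)

text \<open>Green's identity is applied to the twice differentiable \<open>Lk\<close> at scale
  \<open>1 / (n + 1)\<close>, whose Laplacian is up to the factor \<open>- 2 * pi\<close> an
  approximate identity; then the scale tends to zero under domination by \<open>lnk\<close>.\<close>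

lemma fundamental_solution:
  assumes f: "has_lap f l" and 0: "\<And>y. norm y > r \<Longrightarrow> f y = 0"
  shows "integrable lborel (\<lambda>y. lnk (y - x) * l y)" "(\<integral>y. lnk (y - x) * l y \<partial>lborel) = - 2 * pi * f x"
proof -
  have l0: "l y = 0" if "norm y > r" for y using has_lap_outside[OF f 0 that] .
  have lc: "continuous_on UNIV l" using has_lap_continuous[OF f] by simp
  obtain B where B: "B > 0" "\<And>y. \<bar>l y\<bar> \<le> B" using bounded_compact_supp[OF lc l0] by blast
  have lm: "l \<in> borel_measurable borel" using lc by (rule borel_measurable_continuous_onI)
  show i: "integrable lborel (\<lambda>y. lnk (y - x) * l y)"
    by (rule integrable_lnk_mult[OF lm B(2) l0])
  let ?s = "\<lambda>n. 1 / real (Suc n)"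
  have g: "(\<integral>y. Lk (?s n) (y - x) * l y \<partial>lborel) = - 2 * pi * (\<integral>y. f y * kap (?s n) (y - x) \<partial>lborel)" for n
  proof -
    have "(\<integral>y. Lk (?s n) (y - x) * l y \<partial>lborel) = (\<integral>y. f y * (- 2 * pi * kap (?s n) (y - x)) \<partial>lborel)"
      by (rule green(3)[OF f has_lap_translate[OF has_lap_Lk] 0]) auto
    also have "\<dots> = (\<integral>y. (- 2 * pi) * (f y * kap (?s n) (y - x)) \<partial>lborel)" by (simp add: mult_ac)
    finally show ?thesis by simp
  qed
  have "(\<lambda>n. \<integral>y. Lk (?s n) (y - x) * l y \<partial>lborel) \<longlonglongrightarrow> (\<integral>y. lnk (y - x) * l y \<partial>lborel)"
  proof (rule integral_dominated_convergence[where w="\<lambda>y. norm (lnk (y - x) * l y)"])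
    show "(\<lambda>y. lnk (y - x) * l y) \<in> borel_measurable lborel" using i by auto
    show "(\<lambda>y. Lk (?s n) (y - x) * l y) \<in> borel_measurable lborel" for n
      using lm by (auto intro!: borel_measurable_times measurable_compose[OF _ Lk_measurable])
    show "integrable lborel (\<lambda>y. norm (lnk (y - x) * l y))" using i by simp
    show "AE y in lborel. (\<lambda>n. Lk (?s n) (y - x) * l y) \<longlonglongrightarrow> lnk (y - x) * l y"
      using AE_lborel_neq[of x]
    proof eventually_elim
      fix y assume "y \<noteq> x"
      hence "norm (y - x) > 0" by simp
      then obtain n0 where "?s n0 < norm (y - x)" using nat_approx_posE by blast
      hence "?s n \<le> norm (y - x)" if "n \<ge> n0" for n
        using that by (smt (verit) frac_le of_nat_0_less_iff of_nat_mono Suc_le_mono zero_less_Suc)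
      hence "eventually (\<lambda>n. Lk (?s n) (y - x) * l y = lnk (y - x) * l y) sequentially"
        by (intro eventually_sequentiallyI[of n0]) (simp add: Lk_eq_lnk)
      thus "(\<lambda>n. Lk (?s n) (y - x) * l y) \<longlonglongrightarrow> lnk (y - x) * l y"
        by (rule tendsto_eventually)
    qed
    show "AE y in lborel. norm (Lk (?s n) (y - x) * l y) \<le> norm (lnk (y - x) * l y)" for n
      using AE_lborel_neq[of x]
    proof eventually_elim
      fix y assume ne: "y \<noteq> x"
      \<comment> \<open>The scale is at most 1, so inside the smoothing disc both functions are
        nonnegative and \<open>Lk_le_lnk\<close> compares the absolute values; outside they
        coincide.\<close>
      have "\<bar>Lk (?s n) (y - x)\<bar> \<le> \<bar>lnk (y - x)\<bar>"
      proof (cases "norm (y - x) < ?s n")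
        case True
        have "- ln (max (?s n) (norm (y - x))) \<ge> 0" using True by (simp add: max_def ln_div)
        hence "Lk (?s n) (y - x) \<ge> 0" using Lk_ge[of "?s n" "y - x"] by simp
        moreover have "Lk (?s n) (y - x) \<le> lnk (y - x)" using ne by (intro Lk_le_lnk) auto
        ultimately show ?thesis by simp
      qed (simp add: Lk_eq_lnk)
      thus "norm (Lk (?s n) (y - x) * l y) \<le> norm (lnk (y - x) * l y)"
        by (simp add: abs_mult mult_right_mono)
    qed
  qed
  moreover have "(\<lambda>n. - 2 * pi * (\<integral>y. f y * kap (?s n) (y - x) \<partial>lborel)) \<longlonglongrightarrow> - 2 * pi * f x"
    by (intro tendsto_mult_left smear_tendsto has_lap_continuous(1)[OF f])
  ultimately show "(\<integral>y. lnk (y - x) * l y \<partial>lborel) = - 2 * pi * f x"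
    unfolding g using LIMSEQ_unique by blast
qed

lemma integrable_smear_lnk:
  assumes s: "s > 0"
  shows "integrable lborel (\<lambda>y. lnk (y - x) * kap s (y - y0))"
proof (rule integrable_lnk_mult[where r="norm y0 + s" and B="2 / (pi * s\<^sup>2)"])
  show "(\<lambda>y. kap s (y - y0)) \<in> borel_measurable borel" by measurable
  show "\<bar>kap s (y - y0)\<bar> \<le> 2 / (pi * s\<^sup>2)" for y using kap_nonneg kap_le by simp
  fix y :: "real^2" assume "norm y > norm y0 + s"
  hence "norm (y - y0) \<ge> s" using norm_triangle_ineq2[of y y0] by linarith
  thus "kap s (y - y0) = 0" by (rule kap_outside[OF s])
qed

text \<open>\<open>Lk s - Lk S\<close> vanishes far out, so the fundamental solution applies to it,
  while neither term alone has compact support. Hence the error in the wanted convolution formula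
  does not depend on the scale.\<close>

lemma smear_lnk_diff:
  assumes s: "s > 0" and S: "S > 0"
  shows "Lk s x - (\<integral>y. lnk (y - x) * kap s y \<partial>lborel) = Lk S x - (\<integral>y. lnk (y - x) * kap S y \<partial>lborel)"
proof -
  have f: "has_lap (\<lambda>y. Lk s y - Lk S y) (\<lambda>y. - 2 * pi * kap s y - - 2 * pi * kap S y)"
    by (intro has_lap_diff has_lap_Lk s S)
  have z: "norm y > max s S \<Longrightarrow> Lk s y - Lk S y = 0" for y by (simp add: Lk_eq_lnk)
  have i: "integrable lborel (\<lambda>y. lnk (y - x) * kap s y)" "integrable lborel (\<lambda>y. lnk (y - x) * kap S y)"
    using integrable_smear_lnk[of _ x 0] s S by auto
  have "- 2 * pi * (Lk s x - Lk S x) = (\<integral>y. lnk (y - x) * (- 2 * pi * kap s y - - 2 * pi * kap S y) \<partial>lborel)"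
    by (rule fundamental_solution(2)[OF f z, symmetric])
  also have "\<dots> = (\<integral>y. (- 2 * pi) * (lnk (y - x) * kap s y) - (- 2 * pi) * (lnk (y - x) * kap S y) \<partial>lborel)"
    by (simp add: algebra_simps)
  also have "\<dots> = (- 2 * pi) * ((\<integral>y. lnk (y - x) * kap s y \<partial>lborel) - (\<integral>y. lnk (y - x) * kap S y \<partial>lborel))"
    using i by (simp add: right_diff_distrib)
  finally show ?thesis by (simp only: mult_cancel_left) simp
qed

text \<open>The error is independent of the scale by \<open>smear_lnk_diff\<close>, so it may be
  computed at scales tending to zero, where both of its terms tend to \<open>lnk x\<close>.\<close>

lemma smear_lnk_nonzero:
  assumes s: "s > 0" and x: "x \<noteq> 0"
  shows "(\<integral>y. lnk (y - x) * kap s y \<partial>lborel) = Lk s x"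
proof -
  \<comment> \<open>Half the distance to the singularity: for \<open>y\<close> within
    \<open>s0\<close> of the origin, \<open>lnk (y - x)\<close> agrees with the continuous function
    \<open>Lk s0 (y - x)\<close>.\<close>
  define s0 where "s0 = norm x / 2"
  have s0: "s0 > 0" using x by (simp add: s0_def)
  let ?s = "\<lambda>n. 1 / real (Suc n)"
  have "(\<lambda>n. \<integral>y. Lk s0 (y - x) * kap (?s n) (y - 0) \<partial>lborel) \<longlonglongrightarrow> Lk s0 (0 - x)"
    by (rule smear_tendsto) (intro continuous_on_compose2[OF Lk_continuous[OF s0, of UNIV]] continuous_intros, auto)
  moreover have "Lk s0 (0 - x) = lnk x" using x by (simp add: Lk_minus Lk_eq_lnk s0_def)
  ultimately have lim: "(\<lambda>n. lnk x - (\<integral>y. Lk s0 (y - x) * kap (?s n) y \<partial>lborel)) \<longlonglongrightarrow> lnk x - lnk x"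
    by (intro tendsto_diff tendsto_const) simp
  obtain n0 where n0: "?s n0 < s0" using s0 nat_approx_posE by blast
  have "Lk s x - (\<integral>y. lnk (y - x) * kap s y \<partial>lborel) = lnk x - (\<integral>y. Lk s0 (y - x) * kap (?s n) y \<partial>lborel)"
    if "n \<ge> n0" for n
  proof -
    have sn: "?s n < s0" using n0 that by (smt (verit) frac_le of_nat_0_less_iff of_nat_mono Suc_le_mono zero_less_Suc)
    have "lnk (y - x) * kap (?s n) y = Lk s0 (y - x) * kap (?s n) y" for y
    proof (cases "norm y \<ge> ?s n")
      case False
      hence "norm (y - x) \<ge> s0" using sn norm_triangle_ineq2[of x y] unfolding s0_def by (simp add: norm_minus_commute)
      thus ?thesis by (simp add: Lk_eq_lnk)
    next
      case True thus ?thesis using kap_outside[of "?s n" y] by simp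
    qed
    hence 1: "(\<integral>y. lnk (y - x) * kap (?s n) y \<partial>lborel) = (\<integral>y. Lk s0 (y - x) * kap (?s n) y \<partial>lborel)"
      by (intro Bochner_Integration.integral_cong refl)
    have 2: "Lk (?s n) x = lnk x" using sn s0 unfolding s0_def by (intro Lk_eq_lnk) linarith
    have "Lk s x - (\<integral>y. lnk (y - x) * kap s y \<partial>lborel) = Lk (?s n) x - (\<integral>y. lnk (y - x) * kap (?s n) y \<partial>lborel)"
      by (rule smear_lnk_diff[OF s]) simp
    thus ?thesis unfolding 1 2 .
  qed
  hence "eventually (\<lambda>n. lnk x - (\<integral>y. Lk s0 (y - x) * kap (?s n) y \<partial>lborel)
      = Lk s x - (\<integral>y. lnk (y - x) * kap s y \<partial>lborel)) sequentially"
    by (intro eventually_sequentiallyI[of n0]) simp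
  hence "(\<lambda>n. Lk s x - (\<integral>y. lnk (y - x) * kap s y \<partial>lborel)) \<longlonglongrightarrow> lnk x - lnk x"
    by (rule Lim_transform_eventually[OF lim])
  thus ?thesis by (simp add: LIMSEQ_const_iff)
qed

text \<open>The value at the centre is the limit of the values at points on an axis. After a shift
  the moving point sits in the continuous factor \<open>kap s\<close>, so that the logarithm stays
  fixed and dominates.\<close>

lemma smear_lnk_zero:
  assumes s: "s > 0"
  shows "(\<integral>y. lnk y * kap s y \<partial>lborel) = Lk s 0"
proof -
  let ?x = "\<lambda>n. (1 / real (Suc n)) *\<^sub>R (axis 1 1 :: real^2)"
  have x0: "?x \<longlonglongrightarrow> 0 *\<^sub>R axis 1 1" by (intro tendsto_scaleR tendsto_const) real_asymp
  have nx: "norm (?x n) \<le> 1" for n by (simp add: norm_axis_1)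
  have e: "(\<integral>u. lnk u * kap s (u + ?x n) \<partial>lborel) = Lk s (?x n)" for n
  proof -
    have "(\<integral>u. lnk u * kap s (u + ?x n) \<partial>lborel) = (\<integral>y. lnk (y - ?x n) * kap s y \<partial>lborel)"
      using integral_lborel_translate[of "\<lambda>u. lnk u * kap s (u + ?x n)" "?x n"] by simp
    also have "\<dots> = Lk s (?x n)" by (rule smear_lnk_nonzero[OF s]) (simp add: axis_eq_0_iff)
    finally show ?thesis .
  qed
  have "(\<lambda>n. \<integral>u. lnk u * kap s (u + ?x n) \<partial>lborel) \<longlonglongrightarrow> (\<integral>u. lnk u * kap s u \<partial>lborel)"
  proof (rule integral_dominated_convergence[where w="\<lambda>u. 2 / (pi * s\<^sup>2) * norm (indicator (cball 0 (s + 1)) u * lnk u)"])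
    show "integrable lborel (\<lambda>u. 2 / (pi * s\<^sup>2) * norm (indicator (cball 0 (s + 1)) u * lnk u))"
      by (intro integrable_mult_right integrable_norm integrable_lnk_sq)
    show "AE u in lborel. (\<lambda>n. lnk u * kap s (u + ?x n)) \<longlonglongrightarrow> lnk u * kap s u"
    proof (rule AE_I2)
      fix u
      have "isCont (kap s) u" using kap_continuous[of UNIV s] by (simp add: continuous_on_eq_continuous_at)
      moreover have "(\<lambda>n. u + ?x n) \<longlonglongrightarrow> u + 0 *\<^sub>R axis 1 1" by (intro tendsto_add tendsto_const x0)
      hence "(\<lambda>n. u + ?x n) \<longlonglongrightarrow> u" by simp
      ultimately have "(\<lambda>n. kap s (u + ?x n)) \<longlonglongrightarrow> kap s u" by (rule isCont_tendsto_compose)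
      thus "(\<lambda>n. lnk u * kap s (u + ?x n)) \<longlonglongrightarrow> lnk u * kap s u" by (intro tendsto_mult tendsto_const)
    qed
    show "AE u in lborel. norm (lnk u * kap s (u + ?x n)) \<le> 2 / (pi * s\<^sup>2) * norm (indicator (cball 0 (s + 1)) u * lnk u)" for n
    proof (rule AE_I2)
      fix u
      show "norm (lnk u * kap s (u + ?x n)) \<le> 2 / (pi * s\<^sup>2) * norm (indicator (cball 0 (s + 1)) u * lnk u)"
      proof (cases "norm (u + ?x n) \<ge> s")
        case False
        have "norm u \<le> norm (u + ?x n) + norm (?x n)" by (metis add_diff_cancel_right' norm_triangle_ineq4)
        hence "norm u \<le> s + 1" using False nx[of n] by linarith
        hence "u \<in> cball 0 (s + 1)" by simp
        hence i: "indicator (cball 0 (s + 1)) u * lnk u = lnk u" by simp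
        have "norm (kap s (u + ?x n)) \<le> 2 / (pi * s\<^sup>2)" using kap_le[of s "u + ?x n"] kap_nonneg[of s "u + ?x n"] by simp
        hence "norm (kap s (u + ?x n)) * norm (lnk u) \<le> 2 / (pi * s\<^sup>2) * norm (lnk u)"
          by (intro mult_right_mono) auto
        thus ?thesis unfolding i norm_mult by (simp only: mult.commute)
      qed (use kap_outside[OF s] in simp)
    qed
  qed measurable
  moreover have "(\<lambda>n. Lk s (?x n)) \<longlonglongrightarrow> Lk s (0 *\<^sub>R axis 1 1)"
  proof (rule isCont_tendsto_compose[OF _ x0])
    show "isCont (Lk s) (0 *\<^sub>R axis 1 1)" using Lk_continuous[OF s, of UNIV] by (simp add: continuous_on_eq_continuous_at)
  qed
  hence "(\<lambda>n. Lk s (?x n)) \<longlonglongrightarrow> Lk s 0" by simp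
  ultimately show ?thesis unfolding e by (rule LIMSEQ_unique)
qed

lemma smear_lnk:
  assumes s: "s > 0"
  shows "(\<integral>y. lnk (y - x) * kap s (y - y0) \<partial>lborel) = Lk s (y0 - x)"
proof -
  have "(\<integral>y. lnk (y - x) * kap s (y - y0) \<partial>lborel) = (\<integral>y. lnk (y - (x - y0)) * kap s y \<partial>lborel)"
    using integral_lborel_translate[of "\<lambda>y. lnk (y - (x - y0)) * kap s y" y0] by (simp add: algebra_simps)
  also have "\<dots> = Lk s (x - y0)"
    using smear_lnk_nonzero[OF s, of "x - y0"] smear_lnk_zero[OF s] by (cases "x - y0 = 0") auto
  also have "\<dots> = Lk s (y0 - x)" using Lk_minus[of s "x - y0"] by simp
  finally show ?thesis .
qed

section \<open>Local regularity of the potential\<close>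

text \<open>In the disc the background of density one contributes \<open>pi/2 |y|^2\<close> up to a constant. Smoothing
  adds \<open>pi s^2/6\<close> to the background term, which \<open>spot s\<close> omits.\<close>

definition pot :: "nat set \<Rightarrow> (nat \<Rightarrow> real^2) \<Rightarrow> real^2 \<Rightarrow> real" where
  "pot J x y = (\<Sum>j\<in>J. lnk (y - x j)) + pi / 2 * (norm y)\<^sup>2"

definition spot :: "real \<Rightarrow> nat set \<Rightarrow> (nat \<Rightarrow> real^2) \<Rightarrow> real^2 \<Rightarrow> real" where
  "spot s J x y = (\<Sum>j\<in>J. Lk s (y - x j)) + pi / 2 * (norm y)\<^sup>2"

lemma pot_measurable[measurable]: "pot J x \<in> borel_measurable borel"
  unfolding pot_def by measurable

lemma spot_continuous: "s > 0 \<Longrightarrow> continuous_on A (spot s J x)"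
  unfolding spot_def
  by (intro continuous_intros continuous_on_compose2[OF Lk_continuous[of s UNIV]]) auto

lemma smear_pot:
  assumes s: "s > 0"
  shows "integrable lborel (\<lambda>y. pot J x y * kap s (y - y0))"
    "(\<integral>y. pot J x y * kap s (y - y0) \<partial>lborel) = spot s J x y0 + pi * s\<^sup>2 / 6"
proof -
  have e: "pot J x y * kap s (y - y0) = (\<Sum>j\<in>J. lnk (y - x j) * kap s (y - y0)) + pi / 2 * ((norm y)\<^sup>2 * kap s (y - y0))" for y
    by (simp add: pot_def distrib_right sum_distrib_right)
  show "integrable lborel (\<lambda>y. pot J x y * kap s (y - y0))"
    unfolding e by (intro Bochner_Integration.integrable_add Bochner_Integration.integrable_sum integrable_mult_right integrable_smear_lnk smear_norm_square s)
  show "(\<integral>y. pot J x y * kap s (y - y0) \<partial>lborel) = spot s J x y0 + pi * s\<^sup>2 / 6"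
  proof -
    have "(\<integral>y. (\<Sum>j\<in>J. lnk (y - x j) * kap s (y - y0)) + pi / 2 * ((norm y)\<^sup>2 * kap s (y - y0)) \<partial>lborel)
      = (\<integral>y. (\<Sum>j\<in>J. lnk (y - x j) * kap s (y - y0)) \<partial>lborel) + (\<integral>y. pi / 2 * ((norm y)\<^sup>2 * kap s (y - y0)) \<partial>lborel)"
      by (intro Bochner_Integration.integral_add Bochner_Integration.integrable_sum integrable_mult_right integrable_smear_lnk smear_norm_square s)
    also have "(\<integral>y. (\<Sum>j\<in>J. lnk (y - x j) * kap s (y - y0)) \<partial>lborel) = (\<Sum>j\<in>J. Lk s (y0 - x j))"
      by (subst Bochner_Integration.integral_sum) (simp_all add: integrable_smear_lnk smear_lnk s)
    also have "(\<integral>y. pi / 2 * ((norm y)\<^sup>2 * kap s (y - y0)) \<partial>lborel) = pi / 2 * ((norm y0)\<^sup>2 + s\<^sup>2 / 3)"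
      by (simp only: integral_mult_right_zero smear_norm_square(2)[OF s])
    finally show ?thesis unfolding e by (simp add: spot_def algebra_simps)
  qed
qed

lemma spot_le_pot:
  assumes "s > 0" "\<And>j. j \<in> J \<Longrightarrow> y \<noteq> x j"
  shows "spot s J x y \<le> pot J x y"
  unfolding spot_def pot_def using assms by (auto intro!: sum_mono Lk_le_lnk)

lemma spot_remove: "finite J \<Longrightarrow> i \<in> J \<Longrightarrow> spot s J x y = spot s (J - {i}) x y + Lk s (y - x i)"
  by (simp add: spot_def sum.remove)

text \<open>The tangent line of \<open>exp\<close> at the mean exponent \<open>m\<close> is
  integrated against \<open>p\<close>. In this form nothing has to be known about the integrability
  of the exponential: the right side may be infinite.\<close>

lemma jensen_exp:
  fixes p W :: "'a \<Rightarrow> real"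
  assumes p: "integrable M p" "(\<integral>y. p y \<partial>M) = 1" "\<And>y. p y \<ge> 0"
    and W: "integrable M (\<lambda>y. W y * p y)"
  shows "ennreal (exp (\<beta> * (c - (\<integral>y. W y * p y \<partial>M)))) \<le> (\<integral>\<^sup>+y. ennreal (exp (\<beta> * (c - W y)) * p y) \<partial>M)"
proof -
  define I where "I = (\<integral>y. W y * p y \<partial>M)"
  define m where "m = \<beta> * (c - I)"
  let ?f = "\<lambda>y. exp m * ((1 + \<beta> * c - m) * p y - \<beta> * (W y * p y))"
  have int: "integrable M ?f" using p W by simp
  have "(\<integral>y. ?f y \<partial>M) = exp m * ((1 + \<beta> * c - m) * 1 - \<beta> * I)"
    using p W by (simp add: I_def[symmetric])
  also have "\<dots> = exp m" by (simp add: m_def algebra_simps)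
  finally have "(\<integral>y. ?f y \<partial>M) = exp m" .
  hence "ennreal (exp m) = ennreal (\<integral>y. ?f y \<partial>M)" by simp
  also have "\<dots> \<le> ennreal (\<integral>y. max 0 (?f y) \<partial>M)"
    by (intro ennreal_leI integral_mono int integrable_max) auto
  also have "\<dots> = (\<integral>\<^sup>+y. ennreal (max 0 (?f y)) \<partial>M)"
    by (rule nn_integral_eq_integral[symmetric]) (use int in auto)
  also have "\<dots> \<le> (\<integral>\<^sup>+y. ennreal (exp (\<beta> * (c - W y)) * p y) \<partial>M)"
  proof (intro nn_integral_mono ennreal_leI)
    fix y
    have "1 + (\<beta> * (c - W y) - m) \<le> exp (\<beta> * (c - W y) - m)" by (rule exp_ge_add_one_self)
    hence "exp m * (1 + (\<beta> * (c - W y) - m)) \<le> exp m * exp (\<beta> * (c - W y) - m)" by simp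
    also have "\<dots> = exp (\<beta> * (c - W y))" by (simp add: exp_diff)
    finally have "exp m * (1 + (\<beta> * (c - W y) - m)) * p y \<le> exp (\<beta> * (c - W y)) * p y"
      by (rule mult_right_mono) (rule p)
    moreover have "exp m * (1 + (\<beta> * (c - W y) - m)) * p y = ?f y" by (simp add: algebra_simps)
    ultimately show "max 0 (?f y) \<le> exp (\<beta> * (c - W y)) * p y" using p(3)[of y] by simp
  qed
  finally show ?thesis by (simp add: m_def I_def)
qed

text \<open>The logarithm is harmonic up to fourth order for the mean over four points: the product of
  the four shifted norms is \<open>\<bar>z^4 - t^4\<bar>\<close> in complex notation.\<close>

lemma four_point_ln:
  fixes z :: "real^2"
  assumes t: "0 < t" "t < norm z"
  shows "ln (norm (z + t *\<^sub>R axis 1 1)) + ln (norm (z - t *\<^sub>R axis 1 1)) + ln (norm (z + t *\<^sub>R axis 2 1))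
    + ln (norm (z - t *\<^sub>R axis 2 1)) \<le> 4 * ln (norm z) + t ^ 4 / (norm z) ^ 4"
proof -
  define a where "a = z \<bullet> axis 1 1"
  define b where "b = z \<bullet> axis 2 1"
  define u where "u = a\<^sup>2 + b\<^sup>2"
  have u: "(norm z)\<^sup>2 = u" by (simp add: u_def a_def b_def norm_square_real2)
  have up: "u > 0" using t u by (metis less_trans zero_less_power)
  have pos: "norm (z + r *\<^sub>R v) > 0" if "norm v = 1" "\<bar>r\<bar> = t" for r and v :: "real^2"
  proof -
    have "norm z \<le> norm (z + r *\<^sub>R v) + norm (r *\<^sub>R v)" by (metis add_diff_cancel_right' norm_triangle_ineq4)
    moreover have "norm (r *\<^sub>R v) = t" using that by simp
    ultimately show ?thesis using t by linarith
  qed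
  have n1: "norm (axis i 1 :: real^2) = 1" for i by (simp add: norm_axis_1)
  have N: "(norm (z + r *\<^sub>R axis i 1))\<^sup>2 = u + 2 * r * (z \<bullet> axis i 1) + r\<^sup>2" for r i
    unfolding norm_add_scaleR_square u n1 by simp
  define p1 where "p1 = (norm (z + t *\<^sub>R axis 1 1))\<^sup>2"
  define p2 where "p2 = (norm (z + (-t) *\<^sub>R axis 1 1))\<^sup>2"
  define p3 where "p3 = (norm (z + t *\<^sub>R axis 2 1))\<^sup>2"
  define p4 where "p4 = (norm (z + (-t) *\<^sub>R axis 2 1))\<^sup>2"
  have P: "p1 > 0" "p2 > 0" "p3 > 0" "p4 > 0"
    unfolding p1_def p2_def p3_def p4_def using pos[OF n1] t by (auto intro!: zero_less_power simp del: scaleR_minus_left)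
  have "p1 * p2 * (p3 * p4) = (u\<^sup>2 - t^4)\<^sup>2 + 16 * t^4 * (a\<^sup>2 * b\<^sup>2)"
    unfolding p1_def p2_def p3_def p4_def N a_def[symmetric] b_def[symmetric] unfolding u_def by algebra
  \<comment> \<open>With \<open>u\<close> the squared norm of \<open>z\<close>, this is the triangle
    inequality for \<open>z^4 - t^4\<close>, squared and written in real terms.\<close>
  also have "\<dots> \<le> (u\<^sup>2 + t^4)\<^sup>2"
  proof -
    have "4 * (a\<^sup>2 * b\<^sup>2) \<le> u\<^sup>2" unfolding u_def using zero_le_power2[of "a\<^sup>2 - b\<^sup>2"] by (simp add: power2_eq_square algebra_simps)
    hence "4 * t^4 * (4 * (a\<^sup>2 * b\<^sup>2)) \<le> 4 * t^4 * u\<^sup>2" by (intro mult_left_mono) auto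
    thus ?thesis by (simp add: power2_eq_square algebra_simps)
  qed
  finally have "ln (p1 * p2 * (p3 * p4)) \<le> ln ((u\<^sup>2 + t^4)\<^sup>2)"
    using P by (intro ln_mono) (auto intro!: mult_pos_pos)
  also have "\<dots> = 2 * ln (u\<^sup>2 + t^4)" using up by (simp add: ln_realpow add_pos_nonneg)
  also have "u\<^sup>2 + t^4 = u\<^sup>2 * (1 + t^4 / u\<^sup>2)" using up by (simp add: field_simps)
  also have "ln \<dots> = ln (u\<^sup>2) + ln (1 + t^4 / u\<^sup>2)" using up by (intro ln_mult_pos) (auto intro!: add_pos_nonneg)
  also have "ln (1 + t^4 / u\<^sup>2) \<le> t^4 / u\<^sup>2" by (rule ln_add_one_self_le_self) simp
  finally have "ln p1 + ln p2 + (ln p3 + ln p4) \<le> 2 * (ln (u\<^sup>2) + t^4 / u\<^sup>2)" using P by (simp add: ln_mult)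
  moreover have "ln p1 = 2 * ln (norm (z + t *\<^sub>R axis 1 1))" "ln p2 = 2 * ln (norm (z - t *\<^sub>R axis 1 1))"
    "ln p3 = 2 * ln (norm (z + t *\<^sub>R axis 2 1))" "ln p4 = 2 * ln (norm (z - t *\<^sub>R axis 2 1))"
    unfolding p1_def p2_def p3_def p4_def by (simp_all add: ln_realpow)
  moreover have "ln (u\<^sup>2) = 4 * ln (norm z)" unfolding u[symmetric] by (simp add: ln_realpow)
  moreover have "t^4 / u\<^sup>2 = t^4 / (norm z)^4" unfolding u[symmetric] by simp
  ultimately show ?thesis by argo
qed

text \<open>Away from the charges \<open>spot 1\<close> minus the paraboloid is strictly
  subharmonic: the background contributes \<open>2 * pi\<close> to the Laplacian and the paraboloid
  takes away 4. An interior maximum with all charges farther than 1 would contradict this; the value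
  at \<open>ys\<close> is compared with the mean over four points at distance
  \<open>t\<close>.\<close>

lemma max_spot_near_charge:
  assumes J: "finite J" and d: "dist ys y0 < \<rho>"
    and mx: "\<And>y. y \<in> cball y0 \<rho> \<Longrightarrow> spot 1 J x y - (norm (y - y0))\<^sup>2 \<le> spot 1 J x ys - (norm (ys - y0))\<^sup>2"
  shows "\<exists>j\<in>J. norm (ys - x j) \<le> 1"
proof (rule ccontr)
  assume "\<not> ?thesis"
  hence far: "\<And>j. j \<in> J \<Longrightarrow> norm (ys - x j) > 1" by force
  define \<delta> where "\<delta> = Min (insert (\<rho> - dist ys y0) ((\<lambda>j. norm (ys - x j) - 1) ` J))"
  have \<delta>: "\<delta> > 0" unfolding \<delta>_def using J d far by (subst Min_gr_iff) auto
  have \<delta>1: "\<delta> \<le> \<rho> - dist ys y0" unfolding \<delta>_def using J by (intro Min_le) auto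
  have \<delta>2: "\<delta> \<le> norm (ys - x j) - 1" if "j \<in> J" for j unfolding \<delta>_def using J that by (intro Min_le) auto
  \<comment> \<open>Below \<open>\<delta>\<close> the four points stay in the ball and at distance
    at least 1 from every charge, where \<open>Lk 1\<close> is the logarithm. Below
    \<open>1 / (card J + 1)\<close> the quartic errors of all charges together are at most
    \<open>t\<^sup>2\<close>, while the background leaves a surplus above
    \<open>2 * t\<^sup>2\<close>.\<close>
  define t where "t = min \<delta> (1 / (real (card J) + 1)) / 2"
  have t: "t > 0" "t < \<delta>" "t \<le> 1 / (real (card J) + 1)"
    unfolding t_def using \<delta> by (auto simp: min_def field_simps)
  have c1: "1 / (real (card J) + 1) \<le> 1" by simp
  have "2 * t \<le> 1 / (real (card J) + 1)" unfolding t_def by simp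
  hence "2 * t \<le> 1" using c1 by (rule order_trans)
  hence "t < 1" using t(1) by linarith
  note t = t this
  have n1: "norm (axis i 1 :: real^2) = 1" for i by (simp add: norm_axis_1)
  let ?G = "\<lambda>y. spot 1 J x y - (norm (y - y0))\<^sup>2"
  let ?A = "\<lambda>F. F (ys + t *\<^sub>R axis 1 1) + F (ys - t *\<^sub>R axis 1 1) + F (ys + t *\<^sub>R axis 2 1) + F (ys - t *\<^sub>R axis 2 1) :: real"
  have in_ball: "ys + r *\<^sub>R axis i 1 \<in> cball y0 \<rho>" if "\<bar>r\<bar> = t" for r i
  proof -
    have "dist y0 (ys + r *\<^sub>R axis i 1) \<le> dist y0 ys + dist ys (ys + r *\<^sub>R axis i 1)" by (rule dist_triangle)
    also have "dist ys (ys + r *\<^sub>R axis i 1) = t" using that by (simp add: dist_norm n1)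
    finally show ?thesis using t \<delta>1 by (simp add: dist_commute)
  qed
  have up: "?A ?G \<le> 4 * ?G ys"
    using mx[OF in_ball[of t 1]] mx[OF in_ball[of "-t" 1]] mx[OF in_ball[of t 2]] mx[OF in_ball[of "-t" 2]] t by simp
  have sq: "?A (\<lambda>y. (norm (y - w))\<^sup>2) = 4 * (norm (ys - w))\<^sup>2 + 4 * t\<^sup>2" for w
  proof -
    have e: "(norm (ys + r *\<^sub>R axis i 1 - w))\<^sup>2 = (norm (ys - w))\<^sup>2 + 2 * r * ((ys - w) \<bullet> axis i 1) + r\<^sup>2" for r i
      using norm_add_scaleR_square[of "ys - w" r "axis i 1"] n1 by (simp add: algebra_simps)
    show ?thesis using e[of t 1] e[of "-t" 1] e[of t 2] e[of "-t" 2] by simp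
  qed
  have lk: "?A (\<lambda>y. Lk 1 (y - x j)) \<ge> 4 * Lk 1 (ys - x j) - t ^ 4" if j: "j \<in> J" for j
  proof -
    define z where "z = ys - x j"
    have z: "norm z > 1" "t < norm z" using far[OF j] t by (auto simp: z_def)
    have o: "Lk 1 (z + r *\<^sub>R axis i 1) = - ln (norm (z + r *\<^sub>R axis i 1))" if "\<bar>r\<bar> = t" for r i
    proof -
      have "norm z \<le> norm (z + r *\<^sub>R axis i 1) + norm (r *\<^sub>R axis i 1 :: real^2)"
        by (metis add_diff_cancel_right' norm_triangle_ineq4)
      hence "norm (z + r *\<^sub>R axis i 1) \<ge> 1" using that \<delta>2[OF j] t n1 by (simp add: z_def)
      thus ?thesis by (simp add: Lk_def)
    qed
    have "t ^ 4 / norm z ^ 4 \<le> t ^ 4" using z by (simp add: divide_simps mult_le_cancel_left1 one_le_power)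
    moreover have "Lk 1 z = - ln (norm z)" using z by (simp add: Lk_def)
    ultimately have "Lk 1 (z + t *\<^sub>R axis 1 1) + Lk 1 (z + (-t) *\<^sub>R axis 1 1) + Lk 1 (z + t *\<^sub>R axis 2 1)
      + Lk 1 (z + (-t) *\<^sub>R axis 2 1) \<ge> 4 * Lk 1 z - t ^ 4"
      using four_point_ln[OF t(1) z(2)] o[of t 1] o[of "-t" 1] o[of t 2] o[of "-t" 2] t by simp
    thus ?thesis by (simp add: z_def algebra_simps)
  qed
  have "?A (\<lambda>y. \<Sum>j\<in>J. Lk 1 (y - x j)) = (\<Sum>j\<in>J. ?A (\<lambda>y. Lk 1 (y - x j)))"
    by (simp add: sum.distrib)
  also have "\<dots> \<ge> (\<Sum>j\<in>J. 4 * Lk 1 (ys - x j) - t ^ 4)" by (intro sum_mono lk)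
  finally have s: "?A (\<lambda>y. \<Sum>j\<in>J. Lk 1 (y - x j)) \<ge> 4 * (\<Sum>j\<in>J. Lk 1 (ys - x j)) - real (card J) * t ^ 4"
    by (simp add: sum_subtractf sum_distrib_left)
  have "?A ?G \<ge> 4 * ?G ys + 2 * pi * t\<^sup>2 - 4 * t\<^sup>2 - real (card J) * t ^ 4"
  proof -
    have "?A (\<lambda>y. pi / 2 * (norm y)\<^sup>2) = pi / 2 * ?A (\<lambda>y. (norm (y - 0))\<^sup>2)"
      by (simp only: distrib_left diff_zero)
    also have "\<dots> = 4 * (pi / 2 * (norm ys)\<^sup>2) + 2 * pi * t\<^sup>2"
      unfolding sq by (simp add: algebra_simps)
    finally have p: "?A (\<lambda>y. pi / 2 * (norm y)\<^sup>2) = 4 * (pi / 2 * (norm ys)\<^sup>2) + 2 * pi * t\<^sup>2" .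
    have gen: "4 * (s0 + p0 - n0) + P - 4 * T - c \<le>
        s1 + p1 - n1 + (s2 + p2 - n2) + (s3 + p3 - n3) + (s4 + p4 - n4)"
      if "p1 + p2 + p3 + p4 = 4 * p0 + P" "4 * s0 - c \<le> s1 + s2 + s3 + s4"
        "n1 + n2 + n3 + n4 = 4 * n0 + 4 * T" for s0 p0 n0 P T c s1 p1 n1 s2 p2 n2 s3 p3 n3 s4 p4 n4 :: real
      using that by argo
    show ?thesis unfolding spot_def by (rule gen[OF p s sq[of y0]])
  qed
  hence le: "2 * pi * t\<^sup>2 - 4 * t\<^sup>2 - real (card J) * t ^ 4 \<le> 0" using up by linarith
  have "real (card J) * t \<le> 1" using t(1,3) by (simp add: field_simps)
  hence "real (card J) * t * t^3 \<le> 1 * t^3" using t by (intro mult_right_mono) auto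
  moreover have "t ^ 3 \<le> t\<^sup>2" using t by (intro power_decreasing) auto
  moreover have "real (card J) * t * t^3 = real (card J) * t^4" by (simp add: power_numeral_reduce)
  moreover have "3 * t\<^sup>2 < pi * t\<^sup>2" using t pi_gt3 by simp
  moreover have "t\<^sup>2 > 0" using t by simp
  ultimately show False using le by linarith
qed

text \<open>The oscillation reached on a disc of radius \<open>R\<close>: 17 is the constant of
  \<open>kap1_le_kap3\<close>, \<open>T\<close> the gain that a settled charge may still have,
  \<open>ln (2 * R)\<close> bounds the smoothed interaction across the disc, and 7 absorbs the
  constants \<open>pi / 6\<close>, \<open>3 / 4\<close> and \<open>pi * 9 / 6\<close> of the
  smoothing.\<close>

definition tau :: "real \<Rightarrow> real \<Rightarrow> real" where
  "tau T R = 17 * (T + ln (2 * R) + 7)"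

text \<open>No charge in \<open>B\<close> can lower the energy much, in exponential mean, by moving inside \<open>B\<close>.\<close>

definition settled :: "real \<Rightarrow> real \<Rightarrow> nat set \<Rightarrow> (nat \<Rightarrow> real^2) \<Rightarrow> (real^2) set \<Rightarrow> bool" where
  "settled \<beta> T J x B \<longleftrightarrow> (\<forall>i\<in>J. x i \<in> B \<longrightarrow>
     (\<integral>\<^sup>+y. ennreal (exp (\<beta> * (pot (J - {i}) x (x i) - pot (J - {i}) x y))) * indicator B y \<partial>lborel)
       \<le> ennreal (exp (\<beta> * T)))"

section \<open>From settled charges to a logarithmic oscillation bound\<close>

lemma AE_not_charge: "finite J \<Longrightarrow> AE y in lborel. \<forall>j\<in>J. y \<noteq> (x j :: real^2)"
  by (subst AE_finite_all) (auto intro: AE_lborel_neq)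

lemma AE_pot_ge:
  assumes "finite J" "\<And>y. y \<in> B \<Longrightarrow> m \<le> spot 1 J x y"
  shows "AE y in lborel. y \<in> B \<longrightarrow> m \<le> pot J x y"
  using AE_not_charge[OF assms(1), of x]
proof eventually_elim
  case (elim y)
  thus ?case using spot_le_pot[of 1 J y x] assms(2)[of y] by force
qed

text \<open>Points within 1 of \<open>b\<close> lie within 2 of \<open>c\<close>, where
  \<open>kap 3\<close> is still at least \<open>2 / (9 * pi) * (5 / 9)\<close>. Against the maximum
  \<open>2 / pi\<close> of \<open>kap 1\<close> the ratio is \<open>81 / 5\<close>, rounded up to
  17.\<close>

lemma kap1_le_kap3:
  assumes "norm (b - c) \<le> 1"
  shows "kap 1 (y - b) \<le> 17 * kap 3 (y - c)"
proof (cases "norm (y - b) < 1")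
  case True
  have "norm (y - c) \<le> norm (y - b) + norm (b - c)" using norm_triangle_ineq[of "y - b" "b - c"] by simp
  hence "(norm (y - c))\<^sup>2 \<le> 2\<^sup>2" using True assms by (intro power_mono) auto
  hence "5 / 9 \<le> 1 - (norm (y - c))\<^sup>2 / 3\<^sup>2" by simp
  hence "5 / 9 \<le> max 0 (1 - (norm (y - c))\<^sup>2 / 3\<^sup>2)" by (rule max.coboundedI2)
  hence "2 / (pi * 3\<^sup>2) * (5 / 9) \<le> kap 3 (y - c)" unfolding kap_def by (rule mult_left_mono) simp
  moreover have "kap 1 (y - b) \<le> 2 / pi" using kap_le[of 1 "y - b"] by simp
  moreover have "2 / pi \<le> 17 * (2 / (pi * 3\<^sup>2) * (5 / 9))" by (simp add: divide_simps)
  ultimately show ?thesis by linarith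
next
  case False
  thus ?thesis using kap_outside[of 1 "y - b"] kap_nonneg[of 3 "y - c"] by simp
qed

text \<open>Two estimates are chained. Moving the charge \<open>j\<close> to a smeared position
  around the minimum \<open>y1\<close> cannot gain more than \<open>T\<close>, so by Jensen the
  potential of the other charges at \<open>x j\<close> is at most \<open>m\<close> plus logarithmic
  terms. Since the potential stays above \<open>m\<close>, a Harnack-type comparison of the kernels
  around \<open>ys\<close> and \<open>x j\<close> carries this bound over to
  \<open>ys\<close>.\<close>

lemma spot_upper_near_charge:
  assumes J: "finite J" "j \<in> J" "inj_on x J" and \<beta>: "\<beta> > 0" and R: "R \<ge> 1"
    and B: "x j \<in> cball a R" "settled \<beta> T J x (cball a R)"
    and m: "\<And>y. y \<in> cball a (R - 1) \<Longrightarrow> m \<le> spot 1 J x y"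
    and y1: "y1 \<in> cball a (R - 1)" "spot 1 J x y1 = m"
    and ys: "norm (ys - x j) \<le> 1" and xj: "dist a (x j) \<le> R - 4"
  shows "spot 1 J x ys \<le> m + tau T R"
proof -
  let ?V = "pot (J - {j}) x"
  define I where "I = (\<integral>y. ?V y * kap 1 (y - y1) \<partial>lborel)"
  have "ennreal (exp (\<beta> * (?V (x j) - I))) \<le> (\<integral>\<^sup>+y. ennreal (exp (\<beta> * (?V (x j) - ?V y)) * kap 1 (y - y1)) \<partial>lborel)"
    unfolding I_def by (rule jensen_exp) (use integral_kap_centered[of 1 y1] smear_pot(1)[of 1] kap_nonneg in auto)
  also have "\<dots> \<le> (\<integral>\<^sup>+y. ennreal (exp (\<beta> * (?V (x j) - ?V y))) * indicator (cball a R) y \<partial>lborel)"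
  proof (intro nn_integral_mono)
    fix y
    show "ennreal (exp (\<beta> * (?V (x j) - ?V y)) * kap 1 (y - y1)) \<le> ennreal (exp (\<beta> * (?V (x j) - ?V y))) * indicator (cball a R) y"
    proof (cases "norm (y - y1) < 1")
      case True
      have "dist a y \<le> dist a y1 + dist y1 y" by (rule dist_triangle)
      hence yB: "y \<in> cball a R" using True y1 by (simp add: dist_norm norm_minus_commute)
      have "2 / pi \<le> 1" using pi_ge_two by (simp add: divide_simps)
      moreover have "kap 1 (y - y1) \<le> 2 / pi" using kap_le[of 1 "y - y1"] by simp
      ultimately have "kap 1 (y - y1) \<le> 1" by linarith
      thus ?thesis using yB kap_nonneg by (auto intro!: ennreal_leI mult_left_le)
    qed (use kap_outside[of 1 "y - y1"] in simp)
  qed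
  also have "\<dots> \<le> ennreal (exp (\<beta> * T))" using B J(2) unfolding settled_def by auto
  finally have "\<beta> * (?V (x j) - I) \<le> \<beta> * T" by simp
  hence 1: "?V (x j) \<le> I + T" using \<beta> by simp
  have "I = spot 1 (J - {j}) x y1 + pi / 6" unfolding I_def using smear_pot(2)[of 1 "J - {j}" x y1] by simp
  also have "spot 1 (J - {j}) x y1 = m - Lk 1 (y1 - x j)" using spot_remove[OF J(1,2), of 1 x y1] y1(2) by simp
  finally have I: "I = m - Lk 1 (y1 - x j) + pi / 6" .
  have "- Lk 1 (y1 - x j) \<le> ln (2 * R)"
  proof -
    have "dist y1 (x j) \<le> dist a y1 + dist a (x j)" by (rule dist_triangle3)
    hence "max 1 (norm (y1 - x j)) \<le> 2 * R" using y1 B R by (simp add: dist_norm)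
    hence "ln (max 1 (norm (y1 - x j))) \<le> ln (2 * R)" by (intro ln_mono) auto
    thus ?thesis using Lk_ge[of 1 "y1 - x j"] by simp
  qed
  hence 2: "I \<le> m + ln (2 * R) + pi / 6" using I by simp
  \<comment> \<open>The charge sitting at \<open>x j\<close> enters only through its smoothed value
    \<open>Lk 3 0\<close>, since its own unsmoothed potential is singular there. Distinctness keeps
    the other charges away from \<open>x j\<close>.\<close>
  have "spot 3 J x (x j) = spot 3 (J - {j}) x (x j) + Lk 3 0" using spot_remove[OF J(1,2), of 3 x "x j"] by simp
  moreover have "spot 3 (J - {j}) x (x j) \<le> ?V (x j)"
    by (rule spot_le_pot) (use J in \<open>auto simp: inj_on_def\<close>)
  moreover have "Lk 3 0 \<le> 3 / 4" proof -
    have "ln (3::real) \<ge> 0" by simp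
    thus ?thesis using Lk_le_zero[of 3 0] by linarith
  qed
  ultimately have 3: "spot 3 J x (x j) \<le> ?V (x j) + 3 / 4" by linarith
  have i1: "integrable lborel (\<lambda>y. (pot J x y - m) * kap 1 (y - ys))"
    "(\<integral>y. (pot J x y - m) * kap 1 (y - ys) \<partial>lborel) = spot 1 J x ys + pi / 6 - m"
    using smear_pot[of 1 J x ys] integral_kap_centered[of 1 ys] by (simp_all add: left_diff_distrib)
  have i3: "integrable lborel (\<lambda>y. (pot J x y - m) * kap 3 (y - x j))"
    "(\<integral>y. (pot J x y - m) * kap 3 (y - x j) \<partial>lborel) = spot 3 J x (x j) + pi * 9 / 6 - m"
    using smear_pot[of 3 J x "x j"] integral_kap_centered[of 3 "x j"] by (simp_all add: left_diff_distrib)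
  have ae: "AE y in lborel. y \<in> cball a (R - 1) \<longrightarrow> m \<le> pot J x y"
    by (rule AE_pot_ge[OF J(1)]) (rule m)
  \<comment> \<open>After subtracting \<open>m\<close> the potential is nonnegative almost
    everywhere where the kernels live: both supports lie within 3 of \<open>x j\<close>, hence
    within \<open>R - 1\<close> of \<open>a\<close>. So the inequality of the kernels passes to the
    integrals.\<close>
  have "(\<integral>y. (pot J x y - m) * kap 1 (y - ys) \<partial>lborel) \<le> (\<integral>y. 17 * ((pot J x y - m) * kap 3 (y - x j)) \<partial>lborel)"
  proof (rule integral_mono_AE)
    show "AE y in lborel. (pot J x y - m) * kap 1 (y - ys) \<le> 17 * ((pot J x y - m) * kap 3 (y - x j))"
      using ae
    proof eventually_elim
      case (elim y)
      show ?case
      proof (cases "norm (y - x j) < 3")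
        case True
        have "dist a y \<le> dist a (x j) + dist (x j) y" by (rule dist_triangle)
        hence "y \<in> cball a (R - 1)" using True xj by (simp add: dist_norm norm_minus_commute)
        hence "pot J x y - m \<ge> 0" using elim by simp
        hence "(pot J x y - m) * kap 1 (y - ys) \<le> (pot J x y - m) * (17 * kap 3 (y - x j))"
          by (intro mult_left_mono kap1_le_kap3 ys)
        thus ?thesis by (simp add: mult_ac)
      next
        case False
        have "norm (y - x j) \<le> norm (y - ys) + norm (ys - x j)" using norm_triangle_ineq[of "y - ys" "ys - x j"] by simp
        hence "norm (y - ys) \<ge> 1" using False ys by linarith
        thus ?thesis using False kap_outside[of 1 "y - ys"] kap_outside[of 3 "y - x j"] by simp
      qed
    qed
  qed (use i1 i3 in auto)
  hence "spot 1 J x ys + pi / 6 - m \<le> 17 * (spot 3 J x (x j) + pi * 9 / 6 - m)"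
    using i1 i3 by simp
  moreover have "pi \<le> 16 / 5" using pi_approx by simp
  hence "pi * 10 / 6 + 3 / 4 \<le> 7" by simp
  ultimately show ?thesis unfolding tau_def using 1 2 3 pi_gt_zero by argo
qed

text \<open>On the boundary of the ball of radius \<open>R / 8\<close> the paraboloid takes away
  \<open>(R / 8)\<^sup>2\<close>, more than the crude oscillation \<open>\<Theta>\<close>. The
  penalised maximum is therefore interior and lies near a charge, and the crude bound is traded for
  the logarithmic one. At \<open>y0\<close> itself the penalty is zero.\<close>

lemma spot_local_upper:
  assumes J: "finite J" "inj_on x J" and \<beta>: "\<beta> > 0" and R: "R \<ge> 16"
    and B: "settled \<beta> T J x (cball a R)"
    and m: "\<And>y. y \<in> cball a (R - 1) \<Longrightarrow> m \<le> spot 1 J x y"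
    and y1: "y1 \<in> cball a (R - 1)" "spot 1 J x y1 = m"
    and crude: "\<And>y. y \<in> cball a (3 * R / 4) \<Longrightarrow> spot 1 J x y \<le> m + \<Theta>" and \<Theta>: "\<Theta> < (R / 8)\<^sup>2"
    and y0: "y0 \<in> cball a (R / 2)"
  shows "spot 1 J x y0 \<le> m + tau T R"
proof -
  let ?G = "\<lambda>y. spot 1 J x y - (norm (y - y0))\<^sup>2"
  have "continuous_on (cball y0 (R / 8)) ?G" by (intro continuous_intros spot_continuous) auto
  then obtain ys where ys: "ys \<in> cball y0 (R / 8)" and mx: "\<And>y. y \<in> cball y0 (R / 8) \<Longrightarrow> ?G y \<le> ?G ys"
    using continuous_attains_sup[of "cball y0 (R / 8)" ?G] R by auto
  have "dist a ys \<le> dist a y0 + dist y0 ys" by (rule dist_triangle)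
  hence da: "dist a ys \<le> 5 * R / 8" using ys y0 by simp
  have G0: "spot 1 J x y0 \<le> ?G ys" using mx[of y0] R by simp
  have "dist ys y0 \<noteq> R / 8"
  proof
    assume "dist ys y0 = R / 8"
    hence "?G ys = spot 1 J x ys - (R / 8)\<^sup>2" by (simp only: dist_norm)
    also have "\<dots> < m" using crude[of ys] da R \<Theta> by simp
    also have "\<dots> \<le> spot 1 J x y0" using y0 R by (intro m) auto
    finally show False using G0 by linarith
  qed
  hence "dist ys y0 < R / 8" using ys by (simp add: dist_commute)
  then obtain j where j: "j \<in> J" "norm (ys - x j) \<le> 1"
    using max_spot_near_charge[OF J(1) _ mx] by blast
  have "dist a (x j) \<le> dist a ys + dist ys (x j)" by (rule dist_triangle)
  hence "dist a (x j) \<le> R - 4" using da j R by (simp add: dist_norm)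
  hence "spot 1 J x ys \<le> m + tau T R"
    using R by (intro spot_upper_near_charge[OF J(1) j(1) J(2) \<beta> _ _ B m y1 j(2)]) auto
  thus ?thesis using G0 by (smt (verit) zero_le_power2)
qed

text \<open>Inserting \<open>kap 1\<close> with total mass 1 and exchanging integrals turns the
  integral of the potential into one of \<open>spot 1\<close>, which is bounded. The radii
  \<open>r + 1\<close> and \<open>r + 2\<close> account for the support of the kernel on either
  side. Truncation at zero by \<open>ennreal\<close> changes the integrand only on a null
  set.\<close>

lemma pot_L1_bound:
  assumes J: "finite J" and r: "r \<ge> 0"
    and m: "\<And>y. y \<in> cball a (r + 2) \<Longrightarrow> m \<le> spot 1 J x y"
    and up: "\<And>y. y \<in> cball a (r + 1) \<Longrightarrow> spot 1 J x y \<le> m + t" and t: "t \<ge> 0"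
  shows "(\<integral>\<^sup>+y. ennreal (pot J x y - m) * indicator (cball a r) y \<partial>lborel) \<le> ennreal (pi * (r + 1)\<^sup>2 * (t + 1))"
proof -
  let ?F = "\<lambda>y. ennreal (pot J x y - m) * indicator (cball a r) y"
  have ae: "AE y in lborel. y \<in> cball a (r + 2) \<longrightarrow> m \<le> pot J x y"
    by (rule AE_pot_ge[OF J]) (rule m)
  have k1: "(\<integral>\<^sup>+z. ennreal (kap 1 (y - z)) \<partial>lborel) = 1" for y
  proof -
    have "(\<integral>\<^sup>+z. ennreal (kap 1 (y - z)) \<partial>lborel) = (\<integral>\<^sup>+z. ennreal (kap 1 (z - y)) \<partial>lborel)"
      by (metis (no_types) kap_minus minus_diff_eq)
    thus ?thesis using integral_kap_centered[of 1 y] by (simp add: nn_integral_eq_integral kap_nonneg)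
  qed
  have [measurable]: "cball a r \<in> sets borel" by simp
  have "(\<integral>\<^sup>+y. ?F y \<partial>lborel) = (\<integral>\<^sup>+y. ?F y * (\<integral>\<^sup>+z. ennreal (kap 1 (y - z)) \<partial>lborel) \<partial>lborel)"
    unfolding k1 by simp
  also have "\<dots> = (\<integral>\<^sup>+y. \<integral>\<^sup>+z. ?F y * ennreal (kap 1 (y - z)) \<partial>lborel \<partial>lborel)"
    by (intro nn_integral_cong nn_integral_cmult[symmetric]) measurable
  also have "\<dots> = (\<integral>\<^sup>+z. \<integral>\<^sup>+y. ?F y * ennreal (kap 1 (y - z)) \<partial>lborel \<partial>lborel)"
    by (rule lborel_pair.Fubini') measurable
  also have "\<dots> \<le> (\<integral>\<^sup>+z. ennreal (t + 1) * indicator (cball a (r + 1)) z \<partial>lborel)"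
  proof (intro nn_integral_mono)
    fix z
    show "(\<integral>\<^sup>+y. ?F y * ennreal (kap 1 (y - z)) \<partial>lborel) \<le> ennreal (t + 1) * indicator (cball a (r + 1)) z"
    proof (cases "z \<in> cball a (r + 1)")
      case True
      have i: "integrable lborel (\<lambda>y. (pot J x y - m) * kap 1 (y - z))"
        "(\<integral>y. (pot J x y - m) * kap 1 (y - z) \<partial>lborel) = spot 1 J x z + pi / 6 - m"
        using smear_pot[of 1 J x z] integral_kap_centered[of 1 z] by (simp_all add: left_diff_distrib)
      have nonneg: "AE y in lborel. 0 \<le> (pot J x y - m) * kap 1 (y - z)"
        using ae
      proof eventually_elim
        case (elim y)
        show ?case
        proof (cases "norm (y - z) < 1")
          case nz: True
          have "dist a y \<le> dist a z + dist z y" by (rule dist_triangle)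
          hence "y \<in> cball a (r + 2)" using True nz by (simp add: dist_norm norm_minus_commute)
          thus ?thesis using elim kap_nonneg by simp
        qed (use kap_outside[of 1 "y - z"] in simp)
      qed
      have "(\<integral>\<^sup>+y. ?F y * ennreal (kap 1 (y - z)) \<partial>lborel) \<le> (\<integral>\<^sup>+y. ennreal ((pot J x y - m) * kap 1 (y - z)) \<partial>lborel)"
        by (intro nn_integral_mono) (auto simp: indicator_def ennreal_mult'' kap_nonneg)
      also have "\<dots> = ennreal (spot 1 J x z + pi / 6 - m)"
        using i nonneg by (simp add: nn_integral_eq_integral)
      also have "\<dots> \<le> ennreal (t + 1)" using up[OF True] pi_less_4 by (intro ennreal_leI) simp
      finally show ?thesis using True by simp
    next
      case False
      have "?F y * ennreal (kap 1 (y - z)) = 0" for y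
      proof (cases "y \<in> cball a r")
        case True
        have "dist a z \<le> dist a y + dist y z" by (rule dist_triangle)
        hence "norm (y - z) \<ge> 1" using True False by (simp add: dist_norm)
        thus ?thesis using kap_outside[of 1 "y - z"] by simp
      qed simp
      hence "(\<integral>\<^sup>+y. ?F y * ennreal (kap 1 (y - z)) \<partial>lborel) = (\<integral>\<^sup>+y. 0 \<partial>(lborel :: (real^2) measure))"
        by (intro nn_integral_cong)
      thus ?thesis by simp
    qed
  qed
  also have "\<dots> = ennreal (t + 1) * ennreal (pi * (r + 1)\<^sup>2)"
    using r by (subst nn_integral_cmult_indicator) (auto simp: emeasure_cball unit_ball_vol_2)
  also have "\<dots> = ennreal (pi * (r + 1)\<^sup>2 * (t + 1))" using t by (subst ennreal_mult[symmetric]) (auto simp: mult_ac)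
  finally show ?thesis .
qed

text \<open>\<open>Lk r - Lk (4 * r)\<close> is nonnegative and at least
  \<open>ln 4 - 3 / 4\<close>, hence \<open>1 / 2\<close>, on the disc of radius \<open>r\<close>.
  Charges are thus counted by the difference of two averages of the potential: the larger scale is
  bounded below through \<open>m\<close>, the smaller one above through
  \<open>pot_L1_bound\<close>.\<close>

lemma charge_count_bound:
  assumes J: "finite J" and r: "r \<ge> 1"
    and m: "\<And>y. y \<in> cball a (4 * r) \<Longrightarrow> m \<le> spot 1 J x y"
    and up: "\<And>y. y \<in> cball a (r + 1) \<Longrightarrow> spot 1 J x y \<le> m + t" and t: "t \<ge> 0" "t + 1 \<le> r\<^sup>2"
  shows "real (card {j\<in>J. x j \<in> cball a r}) \<le> 32 * r\<^sup>2"
proof (cases "r + 2 \<le> 4 * r")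
  case False thus ?thesis using r by simp
next
  case r4: True
  have [measurable]: "cball a r \<in> sets borel" by simp
  define n where "n = real (card {j\<in>J. x j \<in> cball a r})"
  have "(\<Sum>j\<in>J. if x j \<in> cball a r then 1 / 2 else 0) \<le> (\<Sum>j\<in>J. Lk r (a - x j) - Lk (4 * r) (a - x j))"
  proof (intro sum_mono)
    fix j
    show "(if x j \<in> cball a r then 1 / 2 else 0) \<le> Lk r (a - x j) - Lk (4 * r) (a - x j)"
    proof (cases "norm (a - x j) \<le> r")
      case True
      hence "max r (norm (a - x j)) = r" by simp
      hence "Lk r (a - x j) \<ge> - ln r" using Lk_ge[of r "a - x j"] r by simp
      moreover have "Lk (4 * r) (a - x j) \<le> - ln (4 * r) + 3 / 4" using r by (intro Lk_le_zero) auto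
      moreover have "ln (4 * r) = 2 * ln 2 + ln r"
        using r ln_mult_pos[of 4 r] ln_realpow[of 2 2] by simp
      ultimately show ?thesis using True ln2_ge_two_thirds by (simp add: dist_norm)
    next
      case False
      have "Lk (4 * r) (a - x j) \<le> lnk (a - x j)" using False r by (intro Lk_le_lnk) auto
      moreover have "Lk r (a - x j) = lnk (a - x j)" using False by (simp add: Lk_eq_lnk)
      ultimately show ?thesis using False by (simp add: dist_norm)
    qed
  qed
  also have "(\<Sum>j\<in>J. if x j \<in> cball a r then 1 / 2 else 0) = n / 2"
    using J by (simp add: n_def sum.If_cases Int_def conj_commute)
  also have "(\<Sum>j\<in>J. Lk r (a - x j) - Lk (4 * r) (a - x j)) = spot r J x a - spot (4 * r) J x a"
    by (simp add: spot_def sum_subtractf)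
  finally have 1: "n / 2 \<le> spot r J x a - spot (4 * r) J x a" .
  have i: "integrable lborel (\<lambda>y. (pot J x y - m) * kap s (y - a))"
    "(\<integral>y. (pot J x y - m) * kap s (y - a) \<partial>lborel) = spot s J x a + pi * s\<^sup>2 / 6 - m" if "s > 0" for s
    using smear_pot[OF that, of J x a] integral_kap_centered[OF that, of a] by (simp_all add: left_diff_distrib)
  have ae: "AE y in lborel. y \<in> cball a (4 * r) \<longrightarrow> m \<le> pot J x y" by (rule AE_pot_ge[OF J m])
  have nn: "AE y in lborel. 0 \<le> (pot J x y - m) * kap s (y - a)" if "0 < s" "s \<le> 4 * r" for s
    using ae
  proof eventually_elim
    case (elim y)
    thus ?case using kap_outside[of s "y - a"] kap_nonneg[of s "y - a"] that
      by (cases "norm (y - a) < s") (auto simp: dist_norm norm_minus_commute)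
  qed
  have "0 \<le> (\<integral>y. (pot J x y - m) * kap (4 * r) (y - a) \<partial>lborel)" using r by (intro integral_nonneg_AE nn) auto
  hence 2: "m \<le> spot (4 * r) J x a + pi * (4 * r)\<^sup>2 / 6" using i(2)[of "4 * r"] r by simp
  have "ennreal (spot r J x a + pi * r\<^sup>2 / 6 - m) = (\<integral>\<^sup>+y. ennreal ((pot J x y - m) * kap r (y - a)) \<partial>lborel)"
    using i[of r] nn[of r] r by (simp add: nn_integral_eq_integral)
  also have "\<dots> \<le> (\<integral>\<^sup>+y. ennreal (2 / (pi * r\<^sup>2)) * (ennreal (pot J x y - m) * indicator (cball a r) y) \<partial>lborel)"
  proof (intro nn_integral_mono)
    fix y
    show "ennreal ((pot J x y - m) * kap r (y - a)) \<le> ennreal (2 / (pi * r\<^sup>2)) * (ennreal (pot J x y - m) * indicator (cball a r) y)"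
    proof (cases "norm (y - a) < r")
      case True
      hence "ennreal ((pot J x y - m) * kap r (y - a)) = ennreal (kap r (y - a)) * ennreal (pot J x y - m)"
        using ennreal_mult'[OF kap_nonneg[of r "y - a"], of "pot J x y - m"] by (simp only: mult.commute)
      also have "\<dots> \<le> ennreal (2 / (pi * r\<^sup>2)) * ennreal (pot J x y - m)"
        by (intro mult_right_mono ennreal_leI kap_le) auto
      finally show ?thesis using True by (simp add: dist_norm norm_minus_commute)
    qed (use kap_outside[of r "y - a"] r in simp)
  qed
  also have "\<dots> = ennreal (2 / (pi * r\<^sup>2)) * (\<integral>\<^sup>+y. ennreal (pot J x y - m) * indicator (cball a r) y \<partial>lborel)"
    by (rule nn_integral_cmult) measurable
  also have "\<dots> \<le> ennreal (2 / (pi * r\<^sup>2)) * ennreal (pi * (r + 1)\<^sup>2 * (t + 1))"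
    using r r4 t by (intro mult_left_mono pot_L1_bound J m up) auto
  also have "\<dots> = ennreal (2 / (pi * r\<^sup>2) * (pi * (r + 1)\<^sup>2 * (t + 1)))"
    using t r by (intro ennreal_mult[symmetric]) auto
  also have "2 / (pi * r\<^sup>2) * (pi * (r + 1)\<^sup>2 * (t + 1)) \<le> 8 * (t + 1)"
  proof -
    have "(r + 1)\<^sup>2 \<le> (2 * r)\<^sup>2" using r by (intro power_mono) auto
    hence "(r + 1)\<^sup>2 / r\<^sup>2 \<le> 4" using r by (simp add: divide_simps power_mult_distrib)
    hence "2 * ((r + 1)\<^sup>2 / r\<^sup>2) * (t + 1) \<le> 2 * 4 * (t + 1)" using t by (intro mult_right_mono) auto
    moreover have "2 / (pi * r\<^sup>2) * (pi * (r + 1)\<^sup>2 * (t + 1)) = 2 * ((r + 1)\<^sup>2 / r\<^sup>2) * (t + 1)" by simp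
    ultimately show ?thesis by linarith
  qed
  finally have "ennreal (spot r J x a + pi * r\<^sup>2 / 6 - m) \<le> ennreal (8 * (t + 1))" by (simp add: ennreal_leI)
  hence 3: "spot r J x a + pi * r\<^sup>2 / 6 - m \<le> 8 * (t + 1)" using t by (subst (asm) ennreal_le_iff) auto
  \<comment> \<open>The factor 15 is \<open>16 - 1\<close>, the difference of the background terms
    at the radii \<open>4 * r\<close> and \<open>r\<close>.\<close>
  have "n / 2 \<le> 8 * (t + 1) + pi * (15 * r\<^sup>2) / 6" using 1 2 3 by (simp add: power_mult_distrib)
  also have "pi * (15 * r\<^sup>2) / 6 \<le> 8 * r\<^sup>2"
  proof -
    have "pi \<le> 16 / 5" using pi_approx by simp
    hence "pi * (15 * r\<^sup>2) \<le> 16 / 5 * (15 * r\<^sup>2)" by (intro mult_right_mono) auto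
    thus ?thesis by simp
  qed
  also have "8 * (t + 1) + 8 * r\<^sup>2 \<le> 16 * r\<^sup>2" using t by simp
  finally show ?thesis by (simp add: n_def)
qed

lemma has_lap_supp:
  assumes f: "has_lap f l" and 0: "\<And>y. y \<notin> cball a r \<Longrightarrow> f y = 0" and y: "y \<notin> cball a r"
  shows "l y = 0"
proof -
  have "has_lap (\<lambda>y. f (y - (- a))) (\<lambda>y. l (y - (- a)))" by (rule has_lap_translate[OF f])
  hence "l ((y - a) - (- a)) = 0"
    by (rule has_lap_outside[where r=r]) (use 0 y in \<open>auto simp: dist_norm norm_minus_commute\<close>)
  thus ?thesis by simp
qed

text \<open>The integral of \<open>pot J x * l\<close> is \<open>- 2 * pi\<close> times the
  fluctuation: each charge contributes through the fundamental solution, and the quadratic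
  background has Laplacian \<open>2 * pi\<close>. The sup norm of \<open>l\<close> then multiplies
  the \<open>L1\<close> norm of \<open>pot J x - m\<close>.\<close>

lemma fluctuation_bound:
  assumes J: "finite J" and r: "r \<ge> 0"
    and m: "\<And>y. y \<in> cball a (r + 2) \<Longrightarrow> m \<le> spot 1 J x y"
    and up: "\<And>y. y \<in> cball a (r + 1) \<Longrightarrow> spot 1 J x y \<le> m + t" and t: "t \<ge> 0"
    and f: "has_lap f l" and 0: "\<And>y. y \<notin> cball a r \<Longrightarrow> f y = 0" and B: "\<And>y. \<bar>l y\<bar> \<le> B"
  shows "\<bar>(\<Sum>j\<in>J. f (x j)) - (\<integral>y. f y \<partial>lborel)\<bar> \<le> B * (r + 1)\<^sup>2 * (t + 1)"
proof -
  have 01: "f y = 0" if "norm y > norm a + r" for y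
  proof (rule 0)
    have "norm y \<le> norm (y - a) + norm a" using norm_triangle_ineq[of "y - a" a] by simp
    thus "y \<notin> cball a r" using that by (simp add: dist_norm norm_minus_commute)
  qed
  have ae: "AE y in lborel. y \<in> cball a (r + 2) \<longrightarrow> m \<le> pot J x y"
    by (rule AE_pot_ge[OF J]) (rule m)
  have [measurable]: "cball a r \<in> sets borel" by simp
  have B0: "B \<ge> 0" using B[of 0] by linarith
  have lm: "l \<in> borel_measurable borel" using has_lap_continuous(2)[OF f] by (rule borel_measurable_continuous_onI)
  have q: "integrable lborel (\<lambda>y. pi / 2 * (norm y)\<^sup>2 * l y)" "(\<integral>y. pi / 2 * (norm y)\<^sup>2 * l y \<partial>lborel) = 2 * pi * (\<integral>y. f y \<partial>lborel)"
    using green(1,3)[OF f has_lap_norm_square[of "pi / 2"] 01] by simp_all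
  \<comment> \<open>The Laplacian of a compactly supported function integrates to zero, so the lower
    bound \<open>m\<close> may be subtracted from the potential before absolute values are
    taken.\<close>
  have c: "integrable lborel (\<lambda>y. m * l y)" "(\<integral>y. m * l y \<partial>lborel) = 0"
    using green(1,3)[OF f has_lap_const[of m] 01] by simp_all
  have s: "integrable lborel (\<lambda>y. \<Sum>j\<in>J. lnk (y - x j) * l y)"
    "(\<integral>y. (\<Sum>j\<in>J. lnk (y - x j) * l y) \<partial>lborel) = (\<Sum>j\<in>J. - 2 * pi * f (x j))"
    using fundamental_solution[OF f 01] by (auto simp: Bochner_Integration.integral_sum)
  have e: "(pot J x y - m) * l y = (\<Sum>j\<in>J. lnk (y - x j) * l y) + pi / 2 * (norm y)\<^sup>2 * l y - m * l y" for y
    by (simp add: pot_def left_diff_distrib distrib_right sum_distrib_right)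
  have i: "integrable lborel (\<lambda>y. (pot J x y - m) * l y)" unfolding e using q c s by auto
  have "(\<integral>y. (pot J x y - m) * l y \<partial>lborel) = (\<Sum>j\<in>J. - 2 * pi * f (x j)) + 2 * pi * (\<integral>y. f y \<partial>lborel)"
    unfolding e using q c s by simp
  also have "\<dots> = - 2 * pi * ((\<Sum>j\<in>J. f (x j)) - (\<integral>y. f y \<partial>lborel))"
    by (simp add: sum_distrib_left[symmetric] sum_negf algebra_simps)
  finally have "2 * pi * \<bar>(\<Sum>j\<in>J. f (x j)) - (\<integral>y. f y \<partial>lborel)\<bar> = \<bar>\<integral>y. (pot J x y - m) * l y \<partial>lborel\<bar>"
    by (simp add: abs_mult)
  hence "ennreal (2 * pi * \<bar>(\<Sum>j\<in>J. f (x j)) - (\<integral>y. f y \<partial>lborel)\<bar>) = ennreal (norm (\<integral>y. (pot J x y - m) * l y \<partial>lborel))"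
    by simp
  also have "\<dots> \<le> (\<integral>\<^sup>+y. ennreal (norm ((pot J x y - m) * l y)) \<partial>lborel)"
    using i by (rule integral_norm_bound_ennreal)
  also have "\<dots> \<le> (\<integral>\<^sup>+y. ennreal B * (ennreal (pot J x y - m) * indicator (cball a r) y) \<partial>lborel)"
  proof (rule nn_integral_mono_AE)
    show "AE y in lborel. ennreal (norm ((pot J x y - m) * l y)) \<le> ennreal B * (ennreal (pot J x y - m) * indicator (cball a r) y)"
      using ae
    proof eventually_elim
      case (elim y)
      show ?case
      proof (cases "y \<in> cball a r")
        case True
        hence p: "pot J x y - m \<ge> 0" using elim by simp
        hence "norm ((pot J x y - m) * l y) \<le> B * (pot J x y - m)"
          using mult_left_mono[OF B[of y] p] by (simp add: abs_mult mult.commute)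
        hence "ennreal (norm ((pot J x y - m) * l y)) \<le> ennreal (B * (pot J x y - m))" by (rule ennreal_leI)
        thus ?thesis using True B0 by (simp add: ennreal_mult')
      qed (use has_lap_supp[OF f 0] in simp)
    qed
  qed
  also have "\<dots> = ennreal B * (\<integral>\<^sup>+y. ennreal (pot J x y - m) * indicator (cball a r) y \<partial>lborel)"
    by (rule nn_integral_cmult) measurable
  also have "\<dots> \<le> ennreal B * ennreal (pi * (r + 1)\<^sup>2 * (t + 1))"
    by (intro mult_left_mono pot_L1_bound J m up t r) auto
  also have "\<dots> = ennreal (B * (pi * (r + 1)\<^sup>2 * (t + 1)))" using B0 t by (simp add: ennreal_mult)
  finally have "2 * pi * \<bar>(\<Sum>j\<in>J. f (x j)) - (\<integral>y. f y \<partial>lborel)\<bar> \<le> B * (pi * (r + 1)\<^sup>2 * (t + 1))"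
    using B0 t by (subst (asm) ennreal_le_iff) auto
  hence "pi * (2 * \<bar>(\<Sum>j\<in>J. f (x j)) - (\<integral>y. f y \<partial>lborel)\<bar>) \<le> pi * (B * (r + 1)\<^sup>2 * (t + 1))"
    by (simp add: mult_ac)
  hence "2 * \<bar>(\<Sum>j\<in>J. f (x j)) - (\<integral>y. f y \<partial>lborel)\<bar> \<le> B * (r + 1)\<^sup>2 * (t + 1)"
    by (rule mult_left_le_imp_le) simp
  moreover have "\<bar>(\<Sum>j\<in>J. f (x j)) - (\<integral>y. f y \<partial>lborel)\<bar> \<le> 2 * \<bar>(\<Sum>j\<in>J. f (x j)) - (\<integral>y. f y \<partial>lborel)\<bar>" by simp
  ultimately show ?thesis by (rule order_trans[rotated])
qed

text \<open>Descent through the scales \<open>8^k R\<close>. The oscillation bound at one scale excludes large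
  voids and high densities at the next smaller one, where it is then improved.\<close>

lemma spot_descent:
  fixes Tf :: "real \<Rightarrow> real"
  assumes J: "finite J" "inj_on x J" and \<beta>: "\<beta> > 0" and R: "R \<ge> 16" and C1: "C1 \<ge> 32"
    and T: "\<And>\<rho>. \<rho> \<ge> R \<Longrightarrow> 0 \<le> tau (Tf (8 * \<rho>)) (8 * \<rho>) \<and> tau (Tf (8 * \<rho>)) (8 * \<rho>) < (\<rho> / 8)\<^sup>2
        \<and> tau (Tf (8 * \<rho>)) (8 * \<rho>) + 1 \<le> \<rho>\<^sup>2"
    and S: "\<And>k. k \<le> K \<Longrightarrow> real (card {j\<in>J. x j \<in> cball a (8^k * R)}) \<le> C1 * (8^k * R)\<^sup>2
        \<Longrightarrow> settled \<beta> (Tf (8^k * R)) J x (cball a (8^k * R))"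
    and top: "real (card {j\<in>J. x j \<in> cball a (8^K * R)}) \<le> C1 * (8^K * R)\<^sup>2"
      "\<And>y y'. y \<in> cball a (8^K * R) \<Longrightarrow> y' \<in> cball a (8^K * R) \<Longrightarrow> spot 1 J x y \<le> spot 1 J x y' + \<Theta>"
      "\<Theta> < (8^K * R / 8)\<^sup>2"
  shows "\<exists>m. (\<forall>y\<in>cball a (R - 1). m \<le> spot 1 J x y) \<and>
    (\<forall>y\<in>cball a (R / 2). spot 1 J x y \<le> m + tau (Tf R) R)"
proof -
  define P where "P = (\<lambda>\<rho>. \<exists>m. (\<forall>y\<in>cball a (\<rho> - 1). m \<le> spot 1 J x y) \<and>
    (\<forall>y\<in>cball a (\<rho> / 2). spot 1 J x y \<le> m + tau (Tf \<rho>) \<rho>))"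
  have min: "\<exists>y1. y1 \<in> cball a (\<rho> - 1) \<and> (\<forall>y\<in>cball a (\<rho> - 1). spot 1 J x y1 \<le> spot 1 J x y)" if "\<rho> \<ge> 16" for \<rho>
    using continuous_attains_inf[of "cball a (\<rho> - 1)" "spot 1 J x"] that spot_continuous[of 1 _ J x] by auto
  have big: "8^k * R \<ge> R" for k using R by simp
  have "P (8^0 * R)"
  proof (rule inc_induct[where P="\<lambda>k. P (8^k * R)" and j=K])
    show "P (8^K * R)"
    proof -
      let ?r = "8^K * R"
      have r: "?r \<ge> 16" using big[of K] R by linarith
      obtain y1 where y1: "y1 \<in> cball a (?r - 1)" "\<And>y. y \<in> cball a (?r - 1) \<Longrightarrow> spot 1 J x y1 \<le> spot 1 J x y"
        using min[OF r] by blast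
      have st: "settled \<beta> (Tf ?r) J x (cball a ?r)" using S[of K] top(1) by simp
      have "spot 1 J x y0 \<le> spot 1 J x y1 + tau (Tf ?r) ?r" if "y0 \<in> cball a (?r / 2)" for y0
      proof (rule spot_local_upper[OF J \<beta> r st y1(2) y1(1) refl _ top(3) that])
        fix y assume "y \<in> cball a (3 * ?r / 4)"
        hence "y \<in> cball a ?r" using r by simp
        moreover have "y1 \<in> cball a ?r" using y1 by simp
        ultimately show "spot 1 J x y \<le> spot 1 J x y1 + \<Theta>" by (rule top(2))
      qed
      thus ?thesis unfolding P_def using y1 by blast
    qed
  next
    fix k assume k: "k < K" and IH: "P (8 ^ Suc k * R)"
    let ?r = "8^k * R"
    have r: "?r \<ge> 16" using big[of k] R by linarith
    let ?t = "tau (Tf (8 * ?r)) (8 * ?r)"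
    have t: "0 \<le> ?t" "?t < (?r / 8)\<^sup>2" "?t + 1 \<le> ?r\<^sup>2" using T[OF big[of k]] by auto
    have "P (8 * ?r)" using IH by (simp add: mult_ac)
    moreover have "8 * ?r / 2 = 4 * ?r" by simp
    ultimately obtain m where m: "\<And>y. y \<in> cball a (8 * ?r - 1) \<Longrightarrow> m \<le> spot 1 J x y"
      "\<And>y. y \<in> cball a (4 * ?r) \<Longrightarrow> spot 1 J x y \<le> m + ?t"
      unfolding P_def by metis
    \<comment> \<open>The upper bound inherited from scale \<open>8 * ?r\<close> holds on radius
      \<open>4 * ?r\<close>, the lower bound on radius \<open>8 * ?r - 1\<close>. This suffices both
      for counting the charges at radius \<open>?r\<close> and for the crude bound used
      below.\<close>
    have "real (card {j\<in>J. x j \<in> cball a ?r}) \<le> 32 * ?r\<^sup>2"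
      by (rule charge_count_bound[OF J(1) _ m(1) m(2) t(1,3)]) (use r in auto)
    also have "\<dots> \<le> C1 * ?r\<^sup>2" using C1 by (intro mult_right_mono) auto
    finally have st: "settled \<beta> (Tf ?r) J x (cball a ?r)" using S[of k] k by simp
    obtain y1 where y1: "y1 \<in> cball a (?r - 1)" "\<And>y. y \<in> cball a (?r - 1) \<Longrightarrow> spot 1 J x y1 \<le> spot 1 J x y"
      using min[OF r] by blast
    \<comment> \<open>The new reference value is the minimum on the smaller disc; it is at least
      \<open>m\<close>, so the old upper bound stays valid relative to it.\<close>
    have "m \<le> spot 1 J x y1" using y1 r by (intro m) auto
    have "spot 1 J x y0 \<le> spot 1 J x y1 + tau (Tf ?r) ?r" if "y0 \<in> cball a (?r / 2)" for y0
    proof (rule spot_local_upper[OF J \<beta> r st y1(2) y1(1) refl _ t(2) that])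
      fix y assume "y \<in> cball a (3 * ?r / 4)"
      hence "y \<in> cball a (4 * ?r)" using r by simp
      thus "spot 1 J x y \<le> spot 1 J x y1 + ?t" using m(2)[of y] \<open>m \<le> spot 1 J x y1\<close> by linarith
    qed
    thus "P ?r" unfolding P_def using y1 by blast
  qed simp
  thus ?thesis unfolding P_def by simp
qed

section \<open>Positive definiteness of the kernel\<close>

lemma nn_integral_exp_decay:
  assumes "u > 0"
  shows "(\<integral>\<^sup>+t. ennreal (exp (- (t * u))) * indicator {0<..} t \<partial>lborel) = ennreal (1 / u)"
proof -
  have "(\<integral>\<^sup>+t. ennreal (exp (- (t * u))) * indicator {0<..} t \<partial>lborel)
      = (\<integral>\<^sup>+t. ennreal (exp (- (t * u))) * indicator {0..} t \<partial>lborel)"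
    by (rule nn_integral_cong_AE)
       (use AE_lborel_neq[of "0::real"] in \<open>auto elim!: eventually_mono simp: indicator_def\<close>)
  also have "\<dots> = ennreal (0 - (- exp (- (0 * u)) / u))"
  proof (rule nn_integral_FTC_atLeast[where F="\<lambda>t. - exp (- (t * u)) / u"])
    show "((\<lambda>t. - exp (- (t * u)) / u) \<longlongrightarrow> 0) at_top" using assms by real_asymp
  qed (use assms in \<open>auto intro!: derivative_eq_intros\<close>)
  finally show ?thesis by simp
qed

text \<open>The integrand is the integral of \<open>exp (- (t * u))\<close> over \<open>u\<close> in
  \<open>[s, 1]\<close>; exchanging the integrals leaves \<open>1 / u\<close>. The condition
  \<open>s \<le> 1\<close> keeps everything nonnegative, so that Tonelli applies.\<close>

lemma frullani_exp:
  assumes s: "0 < s" "s \<le> 1"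
  shows "(\<integral>\<^sup>+t. ennreal ((exp (- (t * s)) - exp (- t)) / t) * indicator {0<..} t \<partial>lborel) = ennreal (- ln s)"
proof -
  have "ennreal ((exp (- (t * s)) - exp (- t)) / t) * indicator {0<..} t
    = (\<integral>\<^sup>+u. (ennreal (exp (- (t * u))) * indicator {0<..} t) * indicator {s..1} u \<partial>lborel)" for t :: real
  proof (cases "t > 0")
    case True
    have "(\<integral>\<^sup>+u. ennreal (exp (- (t * u))) * indicator {s..1} u \<partial>lborel)
        = ennreal (- exp (- (t * 1)) / t - (- exp (- (t * s)) / t))"
      by (rule nn_integral_FTC_Icc[where F="\<lambda>u. - exp (- (t * u)) / t"])
         (use True s in \<open>auto intro!: derivative_eq_intros\<close>)
    thus ?thesis using True by (simp add: diff_divide_distrib)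
  qed simp
  hence "(\<integral>\<^sup>+t. ennreal ((exp (- (t * s)) - exp (- t)) / t) * indicator {0<..} t \<partial>lborel)
    = (\<integral>\<^sup>+t. \<integral>\<^sup>+u. (ennreal (exp (- (t * u))) * indicator {0<..} t) * indicator {s..1} u \<partial>lborel \<partial>lborel)"
    by (simp only:)
  also have "\<dots> = (\<integral>\<^sup>+u. \<integral>\<^sup>+t. (ennreal (exp (- (t * u))) * indicator {0<..} t) * indicator {s..1} u \<partial>lborel \<partial>lborel)"
    by (rule lborel_pair.Fubini') measurable
  also have "\<dots> = (\<integral>\<^sup>+u. ennreal (1 / u) * indicator {s..1} u \<partial>lborel)"
  proof (intro nn_integral_cong)
    fix u :: real
    have "(\<integral>\<^sup>+t. (ennreal (exp (- (t * u))) * indicator {0<..} t) * indicator {s..1} u \<partial>lborel)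
       = (\<integral>\<^sup>+t. ennreal (exp (- (t * u))) * indicator {0<..} t \<partial>lborel) * indicator {s..1} u"
      by (rule nn_integral_multc) measurable
    also have "\<dots> = ennreal (1 / u) * indicator {s..1} u"
      using s by (cases "u \<in> {s..1}") (auto simp: nn_integral_exp_decay)
    finally show "(\<integral>\<^sup>+t. (ennreal (exp (- (t * u))) * indicator {0<..} t) * indicator {s..1} u \<partial>lborel)
       = ennreal (1 / u) * indicator {s..1} u" .
  qed
  also have "\<dots> = ennreal (ln 1 - ln s)"
    by (rule nn_integral_FTC_Icc) (use s in \<open>auto intro!: derivative_eq_intros\<close>)
  finally show ?thesis by simp
qed

lemma nn_integral_gauss:
  assumes "t > 0"
  shows "(\<integral>\<^sup>+z. ennreal (exp (- 4 * t * (norm (z - w :: real^2))\<^sup>2)) \<partial>lborel) = ennreal (pi / (4 * t))"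
proof -
  have "(\<integral>\<^sup>+z. ennreal (exp (- 4 * t * (norm (z - w))\<^sup>2)) \<partial>lborel) = (\<integral>\<^sup>+z. ennreal (exp (- 4 * t * (norm (z :: real^2))\<^sup>2)) \<partial>lborel)"
    using nn_integral_distr[of "\<lambda>z. - w + z" lborel borel "\<lambda>z. ennreal (exp (- 4 * t * (norm z)\<^sup>2))"]
    unfolding lborel_distr_plus by (simp add: eq_commute)
  also have "\<dots> = ennreal pi * (\<integral>\<^sup>+u. ennreal (exp (- (u * (4 * t)))) * indicator {0..} u \<partial>lborel)"
    by (subst nn_integral_radial[symmetric]) (auto simp: mult_ac)
  also have "(\<integral>\<^sup>+u. ennreal (exp (- (u * (4 * t)))) * indicator {0..} u \<partial>lborel)
     = (\<integral>\<^sup>+u. ennreal (exp (- (u * (4 * t)))) * indicator {0<..} u \<partial>lborel)"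
    by (rule nn_integral_cong_AE)
       (use AE_lborel_neq[of "0::real"] in \<open>auto elim!: eventually_mono simp: indicator_def\<close>)
  also have "ennreal pi * \<dots> = ennreal (pi / (4 * t))"
    using assms by (subst nn_integral_exp_decay) (auto simp: ennreal_mult[symmetric])
  finally show ?thesis .
qed

text \<open>A Gaussian kernel is a convolution square.\<close>

lemma gauss_psd:
  fixes M :: "'i \<Rightarrow> (real^2) measure" and c :: "'i \<Rightarrow> real"
  assumes M: "\<And>i. prob_space (M i)" "\<And>i. sets (M i) = sets borel" and t: "t > 0"
  shows "0 \<le> (\<Sum>a\<in>I. \<Sum>b\<in>I. c a * c b * (\<integral>x. \<integral>y. exp (- t * (norm (x - y))\<^sup>2) \<partial>M b \<partial>M a))"
proof -
  interpret prob_space "M i" for i by (rule M(1))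
  have [measurable_cong]: "sets (M i) = sets borel" for i by (rule M(2))
  interpret P: pair_sigma_finite "M i" "lborel :: (real^2) measure" for i ..
  interpret Q: pair_sigma_finite "M i" "M j" for i j ..
  define f where "f z x = exp (- 2 * t * (norm (x - z))\<^sup>2)" for x z :: "real^2"
  have f01: "0 \<le> f z x" "f z x \<le> 1" for z x using t by (auto simp: f_def)
  have [measurable]: "(\<lambda>p. f (fst p) (snd p)) \<in> borel_measurable (borel \<Otimes>\<^sub>M borel)" unfolding f_def by measurable
  have [measurable]: "f z \<in> borel_measurable borel" for z unfolding f_def by measurable
  have [measurable]: "(\<lambda>z. f z x) \<in> borel_measurable borel" for x unfolding f_def by measurable
  define \<phi> where "\<phi> a z = (\<integral>x. f z x \<partial>M a)" for a z
  have if': "integrable (M a) (f z)" for a z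
    by (rule integrable_const_bound[where B=1]) (use f01 in auto)
  have \<phi>n: "ennreal (\<phi> a z) = (\<integral>\<^sup>+x. ennreal (f z x) \<partial>M a)" for a z
    unfolding \<phi>_def using f01 by (subst nn_integral_eq_integral[OF if']) auto
  have \<phi>0: "\<phi> a z \<ge> 0" for a z unfolding \<phi>_def using f01 by (intro integral_nonneg_AE) auto
  have [measurable]: "(\<lambda>z. \<phi> a z) \<in> borel_measurable borel" for a
    unfolding \<phi>_def f_def by measurable
  let ?G = "\<lambda>a b. \<integral>x. \<integral>y. exp (- t * (norm (x - y))\<^sup>2) \<partial>M b \<partial>M a"
  have G: "(\<integral>\<^sup>+x. \<integral>\<^sup>+y. ennreal (exp (- t * (norm (x - y))\<^sup>2)) \<partial>M b \<partial>M a) = ennreal (?G a b)" for a b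
  proof -
    have i: "integrable (M b) (\<lambda>y. exp (- t * (norm (x - y))\<^sup>2))" for x
      by (rule integrable_const_bound[where B=1]) (use t in auto)
    have "(\<integral>\<^sup>+y. ennreal (exp (- t * (norm (x - y))\<^sup>2)) \<partial>M b) = ennreal (\<integral>y. exp (- t * (norm (x - y))\<^sup>2) \<partial>M b)" for x
      by (rule nn_integral_eq_integral[OF i]) auto
    moreover have "integrable (M a) (\<lambda>x. \<integral>y. exp (- t * (norm (x - y))\<^sup>2) \<partial>M b)"
    proof (rule integrable_const_bound[where B=1])
      show "AE x in M a. norm (\<integral>y. exp (- t * (norm (x - y))\<^sup>2) \<partial>M b) \<le> 1"
      proof (rule AE_I2)
        fix x
        have "(\<integral>y. exp (- t * (norm (x - y))\<^sup>2) \<partial>M b) \<le> (\<integral>y. 1 \<partial>M b)"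
          by (intro integral_mono i) (use t in auto)
        moreover have "0 \<le> (\<integral>y. exp (- t * (norm (x - y))\<^sup>2) \<partial>M b)" by (intro integral_nonneg_AE) auto
        ultimately show "norm (\<integral>y. exp (- t * (norm (x - y))\<^sup>2) \<partial>M b) \<le> 1" by (simp add: prob_space)
      qed
    qed measurable
    ultimately show ?thesis by (simp add: nn_integral_eq_integral integral_nonneg_AE)
  qed
  have \<phi>\<phi>: "(\<integral>\<^sup>+z. ennreal (\<phi> a z * \<phi> b z) \<partial>lborel) = ennreal (pi / (4 * t) * ?G a b)" for a b
  proof -
    have "(\<integral>\<^sup>+z. ennreal (\<phi> a z * \<phi> b z) \<partial>lborel) = (\<integral>\<^sup>+z. (\<integral>\<^sup>+x. \<integral>\<^sup>+y. ennreal (f z x) * ennreal (f z y) \<partial>M b \<partial>M a) \<partial>lborel)"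
    proof (intro nn_integral_cong)
      fix z
      have "ennreal (\<phi> a z * \<phi> b z) = (\<integral>\<^sup>+x. ennreal (f z x) \<partial>M a) * (\<integral>\<^sup>+y. ennreal (f z y) \<partial>M b)"
        by (simp add: ennreal_mult \<phi>0 \<phi>n)
      also have "\<dots> = (\<integral>\<^sup>+x. ennreal (f z x) * (\<integral>\<^sup>+y. ennreal (f z y) \<partial>M b) \<partial>M a)"
        by (rule nn_integral_multc[symmetric]) measurable
      also have "\<dots> = (\<integral>\<^sup>+x. \<integral>\<^sup>+y. ennreal (f z x) * ennreal (f z y) \<partial>M b \<partial>M a)"
        by (intro nn_integral_cong nn_integral_cmult[symmetric]) measurable
      finally show "ennreal (\<phi> a z * \<phi> b z) = (\<integral>\<^sup>+x. \<integral>\<^sup>+y. ennreal (f z x) * ennreal (f z y) \<partial>M b \<partial>M a)" .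
    qed
    also have "\<dots> = (\<integral>\<^sup>+x. \<integral>\<^sup>+z. \<integral>\<^sup>+y. ennreal (f z x) * ennreal (f z y) \<partial>M b \<partial>lborel \<partial>M a)"
      unfolding f_def by (rule P.Fubini') measurable
    also have "\<dots> = (\<integral>\<^sup>+x. \<integral>\<^sup>+y. \<integral>\<^sup>+z. ennreal (f z x) * ennreal (f z y) \<partial>lborel \<partial>M b \<partial>M a)"
      unfolding f_def by (intro nn_integral_cong P.Fubini') measurable
    also have "\<dots> = (\<integral>\<^sup>+x. \<integral>\<^sup>+y. ennreal (pi / (4 * t)) * ennreal (exp (- t * (norm (x - y))\<^sup>2)) \<partial>M b \<partial>M a)"
    proof (intro nn_integral_cong)
      fix x y
      have "f z x * f z y = exp (- t * (norm (x - y))\<^sup>2) * exp (- 4 * t * (norm (z - (1/2) *\<^sub>R (x + y)))\<^sup>2)" for z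
      proof -
        \<comment> \<open>Parallelogram law about the midpoint of \<open>x\<close> and
          \<open>y\<close>: the product of the two Gaussians in \<open>z\<close> is the wanted
          kernel times a Gaussian whose integral \<open>pi / (4 * t)\<close> does not depend on
          \<open>x\<close> and \<open>y\<close>.\<close>
        have "2 * (norm (x - z))\<^sup>2 + 2 * (norm (y - z))\<^sup>2 = (norm (x - y))\<^sup>2 + 4 * (norm (z - (1/2) *\<^sub>R (x + y)))\<^sup>2"
          by (simp add: power2_norm_eq_inner inner_diff_left inner_diff_right inner_add_left inner_add_right inner_commute algebra_simps)
        hence "- t * (2 * (norm (x - z))\<^sup>2 + 2 * (norm (y - z))\<^sup>2) = - t * ((norm (x - y))\<^sup>2 + 4 * (norm (z - (1/2) *\<^sub>R (x + y)))\<^sup>2)"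
          by simp
        hence "- 2 * t * (norm (x - z))\<^sup>2 + (- 2 * t * (norm (y - z))\<^sup>2)
            = - t * (norm (x - y))\<^sup>2 + (- 4 * t * (norm (z - (1/2) *\<^sub>R (x + y)))\<^sup>2)" by (simp add: algebra_simps)
        thus ?thesis unfolding f_def by (simp only: exp_add[symmetric])
      qed
      hence "(\<integral>\<^sup>+z. ennreal (f z x) * ennreal (f z y) \<partial>lborel)
        = (\<integral>\<^sup>+z. ennreal (exp (- t * (norm (x - y))\<^sup>2)) * ennreal (exp (- 4 * t * (norm (z - (1/2) *\<^sub>R (x + y)))\<^sup>2)) \<partial>lborel)"
        using f01 by (simp only: ennreal_mult[symmetric] exp_ge_zero)
      also have "\<dots> = ennreal (exp (- t * (norm (x - y))\<^sup>2)) * ennreal (pi / (4 * t))"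
        by (subst nn_integral_cmult) (simp_all only: nn_integral_gauss[OF t], measurable)
      finally show "(\<integral>\<^sup>+z. ennreal (f z x) * ennreal (f z y) \<partial>lborel) = ennreal (pi / (4 * t)) * ennreal (exp (- t * (norm (x - y))\<^sup>2))"
        by (simp only: mult.commute)
    qed
    also have "\<dots> = (\<integral>\<^sup>+x. ennreal (pi / (4 * t)) * (\<integral>\<^sup>+y. ennreal (exp (- t * (norm (x - y))\<^sup>2)) \<partial>M b) \<partial>M a)"
      by (intro nn_integral_cong nn_integral_cmult) measurable
    also have "\<dots> = ennreal (pi / (4 * t)) * ennreal (?G a b)"
      unfolding G[symmetric] by (rule nn_integral_cmult) measurable
    also have "\<dots> = ennreal (pi / (4 * t) * ?G a b)"
      using t by (intro ennreal_mult[symmetric] integral_nonneg_AE AE_I2) auto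
    finally show ?thesis .
  qed
  have ip: "integrable lborel (\<lambda>z. \<phi> a z * \<phi> b z)" for a b
    by (rule integrableI_nonneg) (use \<phi>0 \<phi>\<phi> in auto)
  have vp: "(\<integral>z. \<phi> a z * \<phi> b z \<partial>lborel) = pi / (4 * t) * ?G a b" for a b
    using \<phi>0 \<phi>\<phi>[of a b] t by (subst integral_eq_nn_integral) (auto intro!: mult_nonneg_nonneg integral_nonneg_AE AE_I2)
  have "0 \<le> (\<integral>z. (\<Sum>a\<in>I. c a * \<phi> a z)\<^sup>2 \<partial>lborel)" by simp
  also have "\<dots> = (\<integral>z. (\<Sum>a\<in>I. \<Sum>b\<in>I. c a * c b * (\<phi> a z * \<phi> b z)) \<partial>lborel)"
    by (simp add: power2_eq_square sum_product mult_ac)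
  also have "\<dots> = (\<Sum>a\<in>I. \<Sum>b\<in>I. c a * c b * (pi / (4 * t) * ?G a b))"
    using ip vp by (simp add: Bochner_Integration.integral_sum)
  also have "\<dots> = pi / (4 * t) * (\<Sum>a\<in>I. \<Sum>b\<in>I. c a * c b * ?G a b)"
    by (simp add: sum_distrib_left mult_ac)
  finally have "pi / (4 * t) * 0 \<le> pi / (4 * t) * (\<Sum>a\<in>I. \<Sum>b\<in>I. c a * c b * ?G a b)" by simp
  thus ?thesis by (rule mult_left_le_imp_le) (use t in simp)
qed

text \<open>Division by \<open>A\<close>, the largest value of the shifted squared distance on the
  supports, brings the argument of the logarithm below 1. Frullani's formula then writes the kernel
  as a mixture of Gaussians in \<open>x - y\<close> with an \<open>exp (- t)\<close> subtracted;
  this constant and the \<open>ln A\<close> of the normalisation are cancelled by the vanishing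
  total charge.\<close>

lemma log_kernel_psd:
  fixes M :: "'i \<Rightarrow> (real^2) measure" and c :: "'i \<Rightarrow> real"
  assumes M: "\<And>i. prob_space (M i)" "\<And>i. sets (M i) = sets borel" "\<And>i. AE x in M i. norm x \<le> r"
    and \<delta>: "\<delta> > 0" and c: "(\<Sum>a\<in>I. c a) = 0"
  shows "0 \<le> (\<Sum>a\<in>I. \<Sum>b\<in>I. c a * c b * (\<integral>x. \<integral>y. - ln ((norm (x - y))\<^sup>2 + \<delta>) / 2 \<partial>M b \<partial>M a))"
proof -
  interpret prob_space "M i" for i by (rule M(1))
  have [measurable_cong]: "sets (M i) = sets borel" for i by (rule M(2))
  interpret P: pair_sigma_finite "M i" "lborel :: real measure" for i ..
  define A where "A = 4 * r\<^sup>2 + \<delta>"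
  have A: "A > 0" using \<delta> by (simp add: A_def add_nonneg_pos)
  define s where "s x y = ((norm (x - y))\<^sup>2 + \<delta>) / A" for x y :: "real^2"
  have s0: "s x y > 0" for x y unfolding s_def using A \<delta> by (simp add: add_nonneg_pos)
  have s1: "s x y \<le> 1" if "norm x \<le> r" "norm y \<le> r" for x y
  proof -
    have "norm (x - y) \<le> 2 * r" using norm_triangle_ineq4[of x y] that by linarith
    hence "(norm (x - y))\<^sup>2 \<le> (2 * r)\<^sup>2" by (intro power_mono) auto
    thus ?thesis unfolding s_def A_def using A unfolding A_def by (simp add: power_mult_distrib)
  qed
  have smin: "s x y \<ge> \<delta> / A" for x y unfolding s_def using A by (simp add: divide_right_mono)
  define k where "k x y = - ln (s x y)" for x y
  have [measurable]: "(\<lambda>p. s (fst p) (snd p)) \<in> borel_measurable (borel \<Otimes>\<^sub>M borel)" "s x \<in> borel_measurable borel" for x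
    unfolding s_def by measurable
  have [measurable]: "(\<lambda>p. k (fst p) (snd p)) \<in> borel_measurable (borel \<Otimes>\<^sub>M borel)" "k x \<in> borel_measurable borel" for x
    unfolding k_def by measurable
  have k0: "k x y \<ge> 0" if "norm x \<le> r" "norm y \<le> r" for x y
    unfolding k_def using s0 s1[OF that] by simp
  define kB where "kB = \<bar>ln (\<delta> / A)\<bar>"
  have kB: "\<bar>k x y\<bar> \<le> kB" if "norm x \<le> r" "norm y \<le> r" for x y
  proof -
    have "ln (\<delta> / A) \<le> ln (s x y)" using smin[of x y] \<delta> A by (intro ln_mono) auto
    thus ?thesis using k0[OF that] unfolding k_def kB_def by linarith
  qed
  have ik: "integrable (M b) (k x)" if "norm x \<le> r" for b x
    by (rule integrable_const_bound[where B=kB]) (use M(3)[of b] kB[OF that] in \<open>auto elim!: eventually_mono\<close>)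
  have nk: "0 \<le> (\<integral>y. k x y \<partial>M b)" "(\<integral>y. k x y \<partial>M b) \<le> kB" if "norm x \<le> r" for b x
  proof -
    show "0 \<le> (\<integral>y. k x y \<partial>M b)"
      by (rule integral_nonneg_AE) (use M(3)[of b] k0[OF that] in \<open>auto elim!: eventually_mono\<close>)
    have "(\<integral>y. k x y \<partial>M b) \<le> (\<integral>y. kB \<partial>M b)"
      by (rule integral_mono_AE[OF ik[OF that]]) (use M(3)[of b] kB[OF that, THEN abs_le_D1] in \<open>auto elim!: eventually_mono\<close>)
    thus "(\<integral>y. k x y \<partial>M b) \<le> kB" by (simp add: prob_space)
  qed
  have ik2: "integrable (M a) (\<lambda>x. \<integral>y. k x y \<partial>M b)" for a b
    by (rule integrable_const_bound[where B=kB]) (use M(3)[of a] nk in \<open>auto elim!: eventually_mono\<close>)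
  define E where "E a b = (\<integral>x. \<integral>y. k x y \<partial>M b \<partial>M a)" for a b
  define G where "G t a b = (\<integral>x. \<integral>y. exp (- t * (norm (x - y))\<^sup>2) \<partial>M b \<partial>M a)" for t a b
  \<comment> \<open>\<open>g t\<close> is the double integral of the Frullani integrand at
    \<open>t\<close>. With the shift \<open>\<delta>\<close> factored out, what remains is the
    Gaussian form \<open>G\<close> at parameter \<open>t / A\<close> minus a constant.\<close>
  define g where "g t a b = (exp (- (t * \<delta> / A)) * G (t / A) a b - exp (- t)) / t * indicator {0<..} t" for t a b
  have g: "ennreal (g t a b) = (\<integral>\<^sup>+x. \<integral>\<^sup>+y. ennreal ((exp (- (t * s x y)) - exp (- t)) / t) * indicator {0<..} t \<partial>M b \<partial>M a) \<and> g t a b \<ge> 0" for t a b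
  proof (cases "t > 0")
    case True
    have e: "exp (- (t * s x y)) = exp (- (t * \<delta> / A)) * exp (- (t / A) * (norm (x - y))\<^sup>2)" for x y
      unfolding s_def exp_add[symmetric] by (simp add: distrib_left add_divide_distrib)
    let ?h = "\<lambda>x y. (exp (- (t * \<delta> / A)) * exp (- (t / A) * (norm (x - y))\<^sup>2) - exp (- t)) / t"
    have i1: "integrable (M b) (\<lambda>y. exp (- (t / A) * (norm (x - y))\<^sup>2))" for x b
      by (rule integrable_const_bound[where B=1]) (use True A in auto)
    have ih: "integrable (M b) (?h x)" for x by (intro integrable_divide Bochner_Integration.integrable_diff integrable_mult_right i1) auto
    have vh: "(\<integral>y. ?h x y \<partial>M b) = (exp (- (t * \<delta> / A)) * (\<integral>y. exp (- (t / A) * (norm (x - y))\<^sup>2) \<partial>M b) - exp (- t)) / t" for x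
      using i1 by (simp add: prob_space)
    have i2: "integrable (M a) (\<lambda>x. \<integral>y. exp (- (t / A) * (norm (x - y))\<^sup>2) \<partial>M b)"
    proof (rule integrable_const_bound[where B=1])
      show "AE x in M a. norm (\<integral>y. exp (- (t / A) * (norm (x - y))\<^sup>2) \<partial>M b) \<le> 1"
      proof (rule AE_I2)
        fix x
        have "(\<integral>y. exp (- (t / A) * (norm (x - y))\<^sup>2) \<partial>M b) \<le> (\<integral>y. 1 \<partial>M b)"
          by (intro integral_mono i1) (use True A in auto)
        moreover have "0 \<le> (\<integral>y. exp (- (t / A) * (norm (x - y))\<^sup>2) \<partial>M b)" by (intro integral_nonneg_AE) auto
        ultimately show "norm (\<integral>y. exp (- (t / A) * (norm (x - y))\<^sup>2) \<partial>M b) \<le> 1" by (simp add: prob_space)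
      qed
    qed measurable
    have ih2: "integrable (M a) (\<lambda>x. \<integral>y. ?h x y \<partial>M b)"
      unfolding vh by (intro integrable_divide Bochner_Integration.integrable_diff integrable_mult_right i2) auto
    have vh2: "(\<integral>x. \<integral>y. ?h x y \<partial>M b \<partial>M a) = g t a b"
      unfolding vh g_def G_def using i2 True by (simp add: prob_space)
    have h0: "?h x y \<ge> 0" if "norm x \<le> r" "norm y \<le> r" for x y :: "real^2"
    proof -
      have "t * s x y \<le> t" using True s1[OF that] by (intro mult_left_le) auto
      thus ?thesis unfolding e[symmetric] using True by simp
    qed
    have nh: "AE x in M a. 0 \<le> (\<integral>y. ?h x y \<partial>M b)"
      using M(3)[of a]
    proof eventually_elim
      case (elim x)
      show ?case by (rule integral_nonneg_AE) (use M(3)[of b] h0[OF elim] in \<open>auto elim!: eventually_mono\<close>)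
    qed
    have "ennreal (\<integral>x. \<integral>y. ?h x y \<partial>M b \<partial>M a) = (\<integral>\<^sup>+x. ennreal (\<integral>y. ?h x y \<partial>M b) \<partial>M a)"
      by (rule nn_integral_eq_integral[OF ih2 nh, symmetric])
    also have "\<dots> = (\<integral>\<^sup>+x. \<integral>\<^sup>+y. ennreal (?h x y) \<partial>M b \<partial>M a)"
    proof (rule nn_integral_cong_AE)
      show "AE x in M a. ennreal (\<integral>y. ?h x y \<partial>M b) = (\<integral>\<^sup>+y. ennreal (?h x y) \<partial>M b)"
        using M(3)[of a]
      proof eventually_elim
        case (elim x)
        show ?case
          by (rule nn_integral_eq_integral[OF ih, symmetric]) (use M(3)[of b] h0[OF elim] in \<open>auto elim!: eventually_mono\<close>)
      qed
    qed
    finally show ?thesis unfolding vh2 using True integral_nonneg_AE[OF nh] unfolding vh2 by (simp add: e)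
  qed (simp add: g_def)
  have gE: "(\<integral>\<^sup>+t. ennreal (g t a b) \<partial>lborel) = ennreal (E a b)" for a b
  proof -
    have "(\<integral>\<^sup>+t. ennreal (g t a b) \<partial>lborel) = (\<integral>\<^sup>+t. \<integral>\<^sup>+x. \<integral>\<^sup>+y. ennreal ((exp (- (t * s x y)) - exp (- t)) / t) * indicator {0<..} t \<partial>M b \<partial>M a \<partial>lborel)"
      using g by simp
    also have "\<dots> = (\<integral>\<^sup>+x. \<integral>\<^sup>+t. \<integral>\<^sup>+y. ennreal ((exp (- (t * s x y)) - exp (- t)) / t) * indicator {0<..} t \<partial>M b \<partial>lborel \<partial>M a)"
      unfolding s_def by (rule P.Fubini') measurable
    also have "\<dots> = (\<integral>\<^sup>+x. \<integral>\<^sup>+y. \<integral>\<^sup>+t. ennreal ((exp (- (t * s x y)) - exp (- t)) / t) * indicator {0<..} t \<partial>lborel \<partial>M b \<partial>M a)"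
      unfolding s_def by (intro nn_integral_cong P.Fubini') measurable
    also have "\<dots> = (\<integral>\<^sup>+x. ennreal (\<integral>y. k x y \<partial>M b) \<partial>M a)"
    proof (rule nn_integral_cong_AE)
      show "AE x in M a. (\<integral>\<^sup>+y. \<integral>\<^sup>+t. ennreal ((exp (- (t * s x y)) - exp (- t)) / t) * indicator {0<..} t \<partial>lborel \<partial>M b) = ennreal (\<integral>y. k x y \<partial>M b)"
        using M(3)[of a]
      proof eventually_elim
        case (elim x)
        have "(\<integral>\<^sup>+y. \<integral>\<^sup>+t. ennreal ((exp (- (t * s x y)) - exp (- t)) / t) * indicator {0<..} t \<partial>lborel \<partial>M b)
          = (\<integral>\<^sup>+y. ennreal (k x y) \<partial>M b)"
          by (rule nn_integral_cong_AE)
             (use M(3)[of b] s1[OF elim] s0 in \<open>auto elim!: eventually_mono simp: k_def intro!: frullani_exp\<close>)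
        also have "\<dots> = ennreal (\<integral>y. k x y \<partial>M b)"
          by (rule nn_integral_eq_integral[OF ik[OF elim]]) (use M(3)[of b] k0[OF elim] in \<open>auto elim!: eventually_mono\<close>)
        finally show ?case .
      qed
    qed
    also have "\<dots> = ennreal (E a b)" unfolding E_def
      by (rule nn_integral_eq_integral[OF ik2]) (use M(3)[of a] nk in \<open>auto elim!: eventually_mono\<close>)
    finally show ?thesis .
  qed
  have E0: "E a b \<ge> 0" for a b unfolding E_def
    by (rule integral_nonneg_AE) (use M(3)[of a] nk in \<open>auto elim!: eventually_mono\<close>)
  have [measurable]: "(\<lambda>t. G (t / A) a b) \<in> borel_measurable borel" for a b
    unfolding G_def by measurable
  have [measurable]: "(\<lambda>t. g t a b) \<in> borel_measurable borel" for a b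
    unfolding g_def by measurable
  have ig: "integrable lborel (\<lambda>t. g t a b)" for a b
    by (rule integrableI_nonneg) (use g gE in auto)
  have vg: "(\<integral>t. g t a b \<partial>lborel) = E a b" for a b
    using g gE[of a b] E0 by (subst integral_eq_nn_integral) auto
  have cc: "(\<Sum>a\<in>I. \<Sum>b\<in>I. c a * c b) = 0" using c by (simp add: sum_product[symmetric])
  have "0 \<le> (\<Sum>a\<in>I. \<Sum>b\<in>I. c a * c b * g t a b)" for t
  proof (cases "t > 0")
    case True
    let ?e = "exp (- (t * \<delta> / A)) / t"
    have "(\<Sum>a\<in>I. \<Sum>b\<in>I. c a * c b * g t a b) = (\<Sum>a\<in>I. \<Sum>b\<in>I. ?e * (c a * c b * G (t / A) a b) - exp (- t) / t * (c a * c b))"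
      using True by (intro sum.cong refl) (simp add: g_def field_simps)
    also have "\<dots> = ?e * (\<Sum>a\<in>I. \<Sum>b\<in>I. c a * c b * G (t / A) a b) - exp (- t) / t * (\<Sum>a\<in>I. \<Sum>b\<in>I. c a * c b)"
      by (simp only: sum_subtractf sum_distrib_left)
    also have "\<dots> \<ge> 0" unfolding cc G_def
      using True A gauss_psd[OF M(1,2), where t="t / A" and c=c and I=I] by simp
    finally show ?thesis .
  qed (simp add: g_def)
  hence "0 \<le> (\<integral>t. (\<Sum>a\<in>I. \<Sum>b\<in>I. c a * c b * g t a b) \<partial>lborel)" by simp
  also have "\<dots> = (\<Sum>a\<in>I. \<Sum>b\<in>I. c a * c b * E a b)"
    using ig vg by (simp add: Bochner_Integration.integral_sum)
  finally have psd: "0 \<le> (\<Sum>a\<in>I. \<Sum>b\<in>I. c a * c b * E a b)" .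
  have EE: "(\<integral>x. \<integral>y. - ln ((norm (x - y))\<^sup>2 + \<delta>) / 2 \<partial>M b \<partial>M a) = (E a b - ln A) / 2" for a b
  proof -
    have kk: "- ln ((norm (x - y))\<^sup>2 + \<delta>) / 2 = (k x y - ln A) / 2" for x y
    proof -
      have "(norm (x - y))\<^sup>2 + \<delta> > 0" using \<delta> by (simp add: add_nonneg_pos)
      thus ?thesis using A by (simp add: k_def s_def ln_div)
    qed
    have "(\<integral>x. \<integral>y. (k x y - ln A) / 2 \<partial>M b \<partial>M a) = (\<integral>x. ((\<integral>y. k x y \<partial>M b) - ln A) / 2 \<partial>M a)"
    proof (rule integral_cong_AE)
      show "AE x in M a. (\<integral>y. (k x y - ln A) / 2 \<partial>M b) = ((\<integral>y. k x y \<partial>M b) - ln A) / 2"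
        using M(3)[of a] by eventually_elim (use ik in \<open>simp add: prob_space\<close>)
    qed measurable
    also have "\<dots> = (E a b - ln A) / 2" unfolding E_def using ik2 by (simp add: prob_space)
    finally show ?thesis unfolding kk .
  qed
  have "(\<Sum>a\<in>I. \<Sum>b\<in>I. c a * c b * ((E a b - ln A) / 2)) = (\<Sum>a\<in>I. \<Sum>b\<in>I. (1/2) * (c a * c b * E a b) - ln A / 2 * (c a * c b))"
    by (intro sum.cong refl) (simp add: field_simps)
  also have "\<dots> = (1/2) * (\<Sum>a\<in>I. \<Sum>b\<in>I. c a * c b * E a b) - ln A / 2 * (\<Sum>a\<in>I. \<Sum>b\<in>I. c a * c b)"
    by (simp only: sum_subtractf sum_distrib_left)
  finally show ?thesis unfolding EE cc using psd by simp
qed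

text \<open>The disc potential is the derivative in \<open>T\<close> of the potential of the density \<open>(T - |w|^2)_+\<close>,
  a multiple of \<open>kap (sqrt T)\<close>.\<close>

lemma disc_potential:
  assumes T: "T > 0" and x: "(norm x)\<^sup>2 \<le> T"
  shows "(\<integral>w. lnk (w - x) * indicator (cball 0 (sqrt T)) w \<partial>lborel) = - (pi / 2) * (T * ln T - T + (norm x)\<^sup>2)"
proof -
  define v where "v = (norm x)\<^sup>2"
  define p where "p S w = max 0 (S - (norm w)\<^sup>2)" for S and w :: "real^2"
  have pk: "p S w = pi * S\<^sup>2 / 2 * kap (sqrt S) w" if "S > 0" for S w
    using that by (simp add: p_def kap_def max_def field_simps power2_eq_square)
  have ip: "integrable lborel (\<lambda>w. lnk (w - x) * p S w)" if "S > 0" for S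
  proof -
    have "integrable lborel (\<lambda>w. pi * S\<^sup>2 / 2 * (lnk (w - x) * kap (sqrt S) (w - 0)))"
      by (intro integrable_mult_right integrable_smear_lnk) (use that in auto)
    thus ?thesis by (simp add: pk[OF that] mult_ac)
  qed
  \<comment> \<open>This is \<open>pi * S\<^sup>2 / 2 * Lprof S v\<close> written out, the potential
    at \<open>x\<close> of the density \<open>p S\<close>. As \<open>vp\<close> covers only
    \<open>S \<ge> T\<close>, the derivative at \<open>T\<close> is taken along the positive
    increments \<open>1 / (n + 1)\<close>.\<close>
  define \<phi> where "\<phi> S = pi / 2 * (- S\<^sup>2 * ln S / 2 + (S\<^sup>2 - S * v) / 2 + (S - v)\<^sup>2 / 4)" for S
  have vp: "(\<integral>w. lnk (w - x) * p S w \<partial>lborel) = \<phi> S" if "S \<ge> T" for S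
  proof -
    have S: "S > 0" "v \<le> S" using that T x by (auto simp: v_def)
    have "(\<integral>w. lnk (w - x) * p S w \<partial>lborel) = (\<integral>w. pi * S\<^sup>2 / 2 * (lnk (w - x) * kap (sqrt S) (w - 0)) \<partial>lborel)"
      by (simp add: pk[OF S(1)] mult_ac)
    also have "\<dots> = pi * S\<^sup>2 / 2 * Lk (sqrt S) (- x)"
      using S smear_lnk[of "sqrt S" x 0] by simp
    also have "Lk (sqrt S) (- x) = Lprof S v" using S by (simp add: Lk_Lprof v_def)
    also have "Lprof S v = - ln S / 2 + (1 - v / S) / 2 + (1 - v / S)\<^sup>2 / 4"
      using S by (cases "v = S") (auto simp: Lprof_def)
    also have "pi * S\<^sup>2 / 2 * \<dots> = \<phi> S" unfolding \<phi>_def using S by (simp add: field_simps power2_eq_square)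
    finally show ?thesis .
  qed
  let ?h = "\<lambda>n. 1 / real (Suc n)"
  have d: "(\<phi> has_real_derivative - (pi / 2) * (T * ln T - T + v)) (at T)"
    unfolding \<phi>_def using T by (auto intro!: derivative_eq_intros simp: field_simps power2_eq_square)
  have "filterlim ?h (at 0) sequentially" by real_asymp
  hence lim1: "(\<lambda>n. (\<phi> (T + ?h n) - \<phi> T) / ?h n) \<longlonglongrightarrow> - (pi / 2) * (T * ln T - T + v)"
    by (rule filterlim_compose[OF d[unfolded DERIV_def]])
  let ?R = "sqrt (T + 1)"
  have lim2: "(\<lambda>n. \<integral>w. lnk (w - x) * ((p (T + ?h n) w - p T w) / ?h n) \<partial>lborel)
     \<longlonglongrightarrow> (\<integral>w. lnk (w - x) * indicator (cball 0 (sqrt T)) w \<partial>lborel)"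
  proof (rule integral_dominated_convergence[where w="\<lambda>w. norm (lnk (w - x) * indicator (cball 0 ?R) w)"])
    have [measurable]: "cball 0 (sqrt T) \<in> sets (borel :: (real^2) measure)" by simp
    show "(\<lambda>w. lnk (w - x) * indicator (cball 0 (sqrt T)) w) \<in> borel_measurable lborel" by measurable
    show "(\<lambda>w. lnk (w - x) * ((p (T + ?h n) w - p T w) / ?h n)) \<in> borel_measurable lborel" for n
      unfolding p_def by measurable
    show "integrable lborel (\<lambda>w. norm (lnk (w - x) * indicator (cball 0 ?R) w))"
      by (intro integrable_norm integrable_lnk_mult[where B=1 and r="?R"]) (auto simp: indicator_def)
    show "AE w in lborel. (\<lambda>n. lnk (w - x) * ((p (T + ?h n) w - p T w) / ?h n)) \<longlonglongrightarrow> lnk (w - x) * indicator (cball 0 (sqrt T)) w"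
    proof (rule AE_I2, rule tendsto_mult[OF tendsto_const])
      fix w
      show "(\<lambda>n. (p (T + ?h n) w - p T w) / ?h n) \<longlonglongrightarrow> indicator (cball 0 (sqrt T)) w"
      proof (cases "(norm w)\<^sup>2 \<le> T")
        case True
        hence "norm w \<le> sqrt T" by (rule real_le_rsqrt)
        moreover have "(p (T + ?h n) w - p T w) / ?h n = 1" for n
        proof -
          have h: "?h n > 0" by simp
          have "p (T + ?h n) w = T + ?h n - (norm w)\<^sup>2" unfolding p_def using True h by (intro max_absorb2) linarith
          moreover have "p T w = T - (norm w)\<^sup>2" unfolding p_def using True by (intro max_absorb2) linarith
          ultimately have "p (T + ?h n) w - p T w = ?h n" by linarith
          thus ?thesis using h by (simp only: divide_self)
        qed
        ultimately show ?thesis by simp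
      next
        case False
        have "\<not> norm w \<le> sqrt T"
        proof
          assume "norm w \<le> sqrt T"
          hence "(norm w)\<^sup>2 \<le> (sqrt T)\<^sup>2" by (intro power_mono) auto
          thus False using False T by simp
        qed
        moreover obtain n0 where n0: "?h n0 < (norm w)\<^sup>2 - T" using False nat_approx_posE[of "(norm w)\<^sup>2 - T"] by auto
        have "(p (T + ?h n) w - p T w) / ?h n = 0" if "n \<ge> n0" for n
        proof -
          have "?h n \<le> ?h n0" using that by (intro divide_left_mono) auto
          thus ?thesis using n0 False by (simp add: p_def max_def)
        qed
        hence "eventually (\<lambda>n. (p (T + ?h n) w - p T w) / ?h n = 0) sequentially"
          by (rule eventually_sequentiallyI)
        hence "(\<lambda>n. (p (T + ?h n) w - p T w) / ?h n) \<longlonglongrightarrow> 0" by (rule tendsto_eventually)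
        ultimately show ?thesis by simp
      qed
    qed
    show "AE w in lborel. norm (lnk (w - x) * ((p (T + ?h n) w - p T w) / ?h n)) \<le> norm (lnk (w - x) * indicator (cball 0 ?R) w)" for n
    proof (rule AE_I2)
      fix w
      have h: "?h n > 0" "?h n \<le> 1" by auto
      have gen: "0 \<le> max 0 (T + \<eta> - u) - max 0 (T - u)" "max 0 (T + \<eta> - u) - max 0 (T - u) \<le> \<eta>"
        if "\<eta> > 0" for \<eta> u :: real using that by (auto simp: max_def)
      have "0 \<le> p (T + ?h n) w - p T w" "p (T + ?h n) w - p T w \<le> ?h n"
        unfolding p_def using gen[OF h(1)] by blast+
      hence a: "0 \<le> (p (T + ?h n) w - p T w) / ?h n" "(p (T + ?h n) w - p T w) / ?h n \<le> 1"
        using h by (auto simp only: divide_le_eq_1_pos divide_nonneg_pos)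
      have "\<bar>(p (T + ?h n) w - p T w) / ?h n\<bar> \<le> indicator (cball 0 ?R) w"
      proof (cases "norm w \<le> ?R")
        case False
        have "(norm w)\<^sup>2 > T + 1"
        proof (rule ccontr)
          assume "\<not> (norm w)\<^sup>2 > T + 1"
          hence "norm w \<le> ?R" by (intro real_le_rsqrt) simp
          thus False using False by simp
        qed
        hence "p (T + ?h n) w = 0" "p T w = 0" unfolding p_def using h by (intro max_absorb1, linarith)+
        thus ?thesis by simp
      qed (use a in simp)
      thus "norm (lnk (w - x) * ((p (T + ?h n) w - p T w) / ?h n)) \<le> norm (lnk (w - x) * indicator (cball 0 ?R) w)"
        unfolding norm_mult by (intro mult_left_mono) auto
    qed
  qed
  have "(\<integral>w. lnk (w - x) * ((p (T + ?h n) w - p T w) / ?h n) \<partial>lborel) = (\<phi> (T + ?h n) - \<phi> T) / ?h n" for n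
  proof -
    have e: "lnk (w - x) * ((p (T + ?h n) w - p T w) / ?h n) = (lnk (w - x) * p (T + ?h n) w - lnk (w - x) * p T w) / ?h n" for w
      by (simp add: algebra_simps)
    have "T + ?h n > 0" using T by (simp add: add_pos_pos)
    thus ?thesis unfolding e using ip[of "T + ?h n"] ip[OF T] vp[of "T + ?h n"] vp[of T] by simp
  qed
  thus ?thesis using lim1 lim2 unfolding v_def using LIMSEQ_unique by auto
qed

text \<open>Frullani's integral represents \<open>kd \<delta>\<close> as a mixture of Gaussians, up to a constant; unlike \<open>lnk\<close>
  it has finite self-energy for point charges.\<close>

definition kd :: "real \<Rightarrow> real^2 \<Rightarrow> real" where
  "kd \<delta> u = - ln ((norm u)\<^sup>2 + \<delta>) / 2"

lemma kd_measurable[measurable]: "kd \<delta> \<in> borel_measurable borel"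
  unfolding kd_def by measurable

lemma kd_minus: "kd \<delta> (x - y) = kd \<delta> (y - x)"
  by (simp add: kd_def norm_minus_commute)

lemma kd_le: "\<delta> > 0 \<Longrightarrow> kd \<delta> u \<le> - ln \<delta> / 2"
  unfolding kd_def by (simp add: ln_mono)

lemma kd_le_lnk:
  assumes "\<delta> > 0" "u \<noteq> 0" shows "kd \<delta> u \<le> lnk u"
proof -
  have "ln ((norm u)\<^sup>2) \<le> ln ((norm u)\<^sup>2 + \<delta>)" using assms by (intro ln_mono) auto
  thus ?thesis using assms by (simp add: kd_def lnk_def ln_realpow)
qed

text \<open>In the squared norm \<open>kd \<delta>\<close> is the logarithm shifted by
  \<open>\<delta>\<close>. A shift lowers the profile of \<open>Lk 1\<close> by at most
  \<open>\<delta>\<close>, as its derivative is at least -1, and the shifted profile lies below the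
  logarithm.\<close>

lemma Lk_le_kd:
  assumes "\<delta> > 0" shows "Lk 1 u \<le> kd \<delta> u + \<delta>"
proof -
  define \<rho> where "\<rho> = (norm u)\<^sup>2"
  have \<rho>: "\<rho> \<ge> 0" by (simp add: \<rho>_def)
  have "\<exists>z. z > \<rho> \<and> z < \<rho> + \<delta> \<and> Lprof 1 (\<rho> + \<delta>) - Lprof 1 \<rho> = (\<rho> + \<delta> - \<rho>) * Lprof1 1 z"
    by (rule MVT2) (use assms Lprof_deriv(1)[of 1] in auto)
  then obtain z where z: "z > \<rho>" "Lprof 1 (\<rho> + \<delta>) - Lprof 1 \<rho> = \<delta> * Lprof1 1 z" by auto
  have "Lprof1 1 z \<ge> -1"
  proof (cases "z < 1")
    case False
    hence "1 / (2 * z) \<le> 1" by (simp add: divide_simps)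
    thus ?thesis using False by (simp add: Lprof1_def)
  qed (use z \<rho> in \<open>simp add: Lprof1_def\<close>)
  hence "\<delta> * Lprof1 1 z \<ge> \<delta> * (-1)" using assms by (intro mult_left_mono) auto
  moreover have "Lprof 1 t \<le> - ln t / 2" if "t > 0" for t
  proof (cases "t < 1")
    case True
    have "Lprof 1 t = (1 - t) / 2 + (1 - t)\<^sup>2 / 4" using True by (simp add: Lprof_def)
    thus ?thesis using ln_ge_quadratic[of t] that True by linarith
  qed (simp add: Lprof_def)
  hence "Lprof 1 (\<rho> + \<delta>) \<le> - ln (\<rho> + \<delta>) / 2" using \<rho> assms by simp
  moreover have "Lk 1 u = Lprof 1 \<rho>" using Lk_Lprof[of 1 u] by (simp add: \<rho>_def)
  ultimately show ?thesis using z(2) unfolding kd_def \<rho>_def[symmetric] by linarith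
qed

lemma kd_disc_integrable: "\<delta> > 0 \<Longrightarrow> integrable lborel (\<lambda>w. kd \<delta> (w - x) * indicator (cball 0 r) w)"
proof -
  assume \<delta>: "\<delta> > 0"
  have "continuous_on (cball 0 r) (\<lambda>w. kd \<delta> (w - x))"
    unfolding kd_def using \<delta>
    by (intro continuous_intros) (auto simp: add_nonneg_eq_0_iff)
  hence "integrable lborel (\<lambda>w. indicator (cball 0 r) w *\<^sub>R kd \<delta> (w - x))"
    by (intro borel_integrable_compact) auto
  thus ?thesis by (simp add: mult.commute)
qed

text \<open>For the second bound, \<open>lnk - kd \<delta>\<close> is
  \<open>ln (1 + \<delta> / v) / 2\<close> with \<open>v\<close> the squared distance, hence at most
  \<open>sqrt (\<delta> / v) / 2\<close>. The inverse distance is integrable in the plane;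
  integrating over the disc of radius \<open>2 * r\<close> around \<open>x\<close> gives
  \<open>2 * pi * sqrt \<delta> * r\<close>.\<close>

lemma kd_disc:
  assumes \<delta>: "\<delta> > 0" and r: "r \<ge> 0" and x: "norm x \<le> r"
  shows "(\<integral>w. kd \<delta> (w - x) * indicator (cball 0 r) w \<partial>lborel) \<le> (\<integral>w. lnk (w - x) * indicator (cball 0 r) w \<partial>lborel)"
    "(\<integral>w. lnk (w - x) * indicator (cball 0 r) w \<partial>lborel) - 2 * pi * sqrt \<delta> * r \<le> (\<integral>w. kd \<delta> (w - x) * indicator (cball 0 r) w \<partial>lborel)"
proof -
  have [measurable]: "cball 0 r \<in> sets (borel :: (real^2) measure)" by simp
  have i: "integrable lborel (\<lambda>w. lnk (w - x) * indicator (cball 0 r) w)"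
    by (rule integrable_lnk_mult[where B=1 and r=r]) (auto simp: indicator_def)
  note ik = kd_disc_integrable[OF \<delta>, of x r]
  have le: "AE w in lborel. kd \<delta> (w - x) \<le> lnk (w - x)"
    using AE_lborel_neq[of x] by eventually_elim (use kd_le_lnk[OF \<delta>] in auto)
  show "(\<integral>w. kd \<delta> (w - x) * indicator (cball 0 r) w \<partial>lborel) \<le> (\<integral>w. lnk (w - x) * indicator (cball 0 r) w \<partial>lborel)"
    by (rule integral_mono_AE[OF ik i]) (use le in \<open>auto elim!: eventually_mono simp: indicator_def\<close>)
  let ?d = "\<lambda>w. (lnk (w - x) - kd \<delta> (w - x)) * indicator (cball 0 r) w"
  have id: "integrable lborel ?d" using Bochner_Integration.integrable_diff[OF i ik] by (simp add: left_diff_distrib)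
  have d: "(\<integral>w. ?d w \<partial>lborel) = (\<integral>w. lnk (w - x) * indicator (cball 0 r) w \<partial>lborel) - (\<integral>w. kd \<delta> (w - x) * indicator (cball 0 r) w \<partial>lborel)"
    using Bochner_Integration.integral_diff[OF i ik] by (simp add: left_diff_distrib)
  let ?f = "\<lambda>t. ennreal (sqrt \<delta> / 2 * t powr (-1/2)) * indicator {..4 * r\<^sup>2} t"
  have "ennreal (\<integral>w. ?d w \<partial>lborel) = (\<integral>\<^sup>+w. ennreal (?d w) \<partial>lborel)"
    by (rule nn_integral_eq_integral[OF id, symmetric]) (use le in \<open>auto elim!: eventually_mono simp: indicator_def\<close>)
  also have "\<dots> \<le> (\<integral>\<^sup>+w. ?f ((norm (w - x))\<^sup>2) \<partial>lborel)"
  proof (rule nn_integral_mono_AE)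
    show "AE w in lborel. ennreal (?d w) \<le> ?f ((norm (w - x))\<^sup>2)"
      using AE_lborel_neq[of x]
    proof eventually_elim
      case (elim w)
      show ?case
      proof (cases "norm w \<le> r")
        case True
        define v where "v = (norm (w - x))\<^sup>2"
        have v: "v > 0" using elim by (simp add: v_def)
        have "norm (w - x) \<le> 2 * r" using norm_triangle_ineq4[of w x] True x by linarith
        hence "v \<le> (2 * r)\<^sup>2" unfolding v_def by (intro power_mono) auto
        hence v4: "v \<le> 4 * r\<^sup>2" by (simp add: power_mult_distrib)
        have b: "ln (1 + z) / 2 \<le> sqrt z / 2" if "z > 0" for z :: real
        proof -
          define q where "q = sqrt z"
          have q: "q > 0" "z = q\<^sup>2" using that by (auto simp: q_def)
          \<comment> \<open>The derivative of \<open>F\<close> is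
            \<open>(1 - s)\<^sup>2 / (1 + s\<^sup>2)\<close>, a perfect square over a positive term,
            which gives \<open>ln (1 + z) \<le> sqrt z\<close> with
            \<open>z = q\<^sup>2\<close>.\<close>
          define F where "F = (\<lambda>q::real. q - ln (1 + q\<^sup>2))"
          have "F 0 \<le> F q"
          proof (rule DERIV_nonneg_imp_nondecreasing[where f=F and a=0 and b=q])
            fix s :: real assume s: "0 \<le> s" "s \<le> q"
            have p: "1 + s\<^sup>2 > 0" by (simp add: add_pos_nonneg)
            have "(F has_real_derivative (1 - s)\<^sup>2 / (1 + s\<^sup>2)) (at s)"
              unfolding F_def using p by (auto intro!: derivative_eq_intros simp: field_simps power2_eq_square)
            thus "\<exists>y. (F has_real_derivative y) (at s) \<and> y \<ge> 0" using p by fastforce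
          qed (use q in simp)
          thus ?thesis using q by (simp add: F_def)
        qed
        have "lnk (w - x) - kd \<delta> (w - x) = ln (1 + \<delta> / v) / 2"
        proof -
          have "v + \<delta> = v * (1 + \<delta> / v)" using v by (simp add: distrib_left)
          hence "ln (v + \<delta>) = ln (v * (1 + \<delta> / v))" by (rule arg_cong)
          also have "\<dots> = ln v + ln (1 + \<delta> / v)" using v \<delta> by (intro ln_mult_pos) (auto intro: add_pos_pos)
          finally have "ln (v + \<delta>) = ln v + ln (1 + \<delta> / v)" .
          moreover have "lnk (w - x) = - ln v / 2" using elim by (simp add: lnk_def v_def ln_realpow)
          moreover have "kd \<delta> (w - x) = - ln (v + \<delta>) / 2" by (simp add: kd_def v_def)
          ultimately show ?thesis by argo
        qed
        also have "\<dots> \<le> sqrt (\<delta> / v) / 2" using v \<delta> by (intro b) auto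
        also have "\<dots> = sqrt \<delta> / 2 * v powr (-1/2)"
          using v \<delta> by (simp add: real_sqrt_divide powr_minus_divide powr_half_sqrt)
        finally show ?thesis using True v4 by (simp add: v_def ennreal_leI)
      qed simp
    qed
  qed
  also have "\<dots> = (\<integral>\<^sup>+w. ?f ((norm (w::real^2))\<^sup>2) \<partial>lborel)"
    using nn_integral_distr[of "\<lambda>z. - x + z" lborel borel "\<lambda>w. ?f ((norm (w::real^2))\<^sup>2)"]
    unfolding lborel_distr_plus by simp
  also have "\<dots> = ennreal pi * (\<integral>\<^sup>+t. ?f t * indicator {0..} t \<partial>lborel)"
    by (rule nn_integral_radial) measurable
  also have "(\<integral>\<^sup>+t. ?f t * indicator {0..} t \<partial>lborel) = (\<integral>\<^sup>+t. ennreal (sqrt \<delta> / 2 * t powr (-1/2)) * indicator {0..4 * r\<^sup>2} t \<partial>lborel)"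
    by (intro nn_integral_cong) (auto simp: indicator_def)
  also have "\<dots> = ennreal (sqrt \<delta> / 2 * ((4 * r\<^sup>2) powr (-1/2+1) / (-1/2+1)))"
    by (rule nn_integral_has_integral_lebesgue')
       (use has_integral_mult_right[OF has_integral_powr_from_0[of "-1/2" "4 * r\<^sup>2"], of "sqrt \<delta> / 2"] \<delta> in auto)
  also have "(4 * r\<^sup>2) powr (-1/2+1) / (-1/2+1) = 4 * r"
  proof -
    have "(4 * r\<^sup>2) powr (1/2) = sqrt ((2 * r)\<^sup>2)" by (simp add: powr_half_sqrt power_mult_distrib)
    also have "\<dots> = 2 * r" using r by (intro real_sqrt_unique) auto
    finally show ?thesis by simp
  qed
  also have "ennreal pi * ennreal (sqrt \<delta> / 2 * (4 * r)) = ennreal (2 * pi * sqrt \<delta> * r)"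
    using r \<delta> by (subst ennreal_mult[symmetric]) auto
  finally have "(\<integral>w. ?d w \<partial>lborel) \<le> 2 * pi * sqrt \<delta> * r"
    using r \<delta> by (subst (asm) ennreal_le_iff) auto
  thus "(\<integral>w. lnk (w - x) * indicator (cball 0 r) w \<partial>lborel) - 2 * pi * sqrt \<delta> * r \<le> (\<integral>w. kd \<delta> (w - x) * indicator (cball 0 r) w \<partial>lborel)"
    unfolding d by linarith
qed

lemma integral_norm_square_disc:
  assumes "r \<ge> 0"
  shows "integrable lborel (\<lambda>w::real^2. (norm w)\<^sup>2 * indicator (cball 0 r) w)"
    "(\<integral>w. (norm (w::real^2))\<^sup>2 * indicator (cball 0 r) w \<partial>lborel) = pi * r ^ 4 / 2"
proof -
  have [measurable]: "cball 0 r \<in> sets (borel :: (real^2) measure)" by simp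
  have e: "ennreal ((norm w)\<^sup>2 * indicator (cball 0 r) w) = ennreal ((norm w)\<^sup>2) * indicator {..r\<^sup>2} ((norm w)\<^sup>2)" for w :: "real^2"
  proof -
    have "norm w \<le> r \<longleftrightarrow> (norm w)\<^sup>2 \<le> r\<^sup>2" using assms by (simp add: power2_le_iff_abs_le)
    thus ?thesis by (simp add: indicator_def)
  qed
  have "(\<integral>\<^sup>+w. ennreal ((norm (w::real^2))\<^sup>2 * indicator (cball 0 r) w) \<partial>lborel)
      = ennreal pi * (\<integral>\<^sup>+t. (ennreal t * indicator {..r\<^sup>2} t) * indicator {0..} t \<partial>lborel)"
    unfolding e by (rule nn_integral_radial) measurable
  also have "(\<integral>\<^sup>+t. (ennreal t * indicator {..r\<^sup>2} t) * indicator {0..} t \<partial>lborel) = (\<integral>\<^sup>+t. ennreal t * indicator {0..r\<^sup>2} t \<partial>lborel)"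
    by (intro nn_integral_cong) (auto simp: indicator_def)
  also have "\<dots> = ennreal ((r\<^sup>2)\<^sup>2 / 2 - 0\<^sup>2 / 2)"
    by (rule nn_integral_FTC_Icc[where F="\<lambda>t. t\<^sup>2 / 2"]) (auto intro!: derivative_eq_intros)
  also have "ennreal pi * \<dots> = ennreal (pi * r ^ 4 / 2)"
    by (subst ennreal_mult[symmetric]) auto
  finally have f: "(\<integral>\<^sup>+w. ennreal ((norm (w::real^2))\<^sup>2 * indicator (cball 0 r) w) \<partial>lborel) = ennreal (pi * r ^ 4 / 2)" .
  show "integrable lborel (\<lambda>w::real^2. (norm w)\<^sup>2 * indicator (cball 0 r) w)"
    by (rule integrableI_nonneg) (use f in \<open>auto simp: indicator_def\<close>)
  show "(\<integral>w. (norm (w::real^2))\<^sup>2 * indicator (cball 0 r) w \<partial>lborel) = pi * r ^ 4 / 2"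
    using f by (subst integral_eq_nn_integral) (auto simp: indicator_def)
qed

section \<open>A priori bound on the whole system\<close>

text \<open>The kernel is bounded only on differences of points of the supports. Cutting it off
  elsewhere makes Fubini applicable and changes neither iterated integral.\<close>

lemma double_integral_swap:
  fixes k :: "real^2 \<Rightarrow> real"
  assumes A: "prob_space A" "sets A = sets borel" "AE x in A. norm x \<le> r"
    and B: "prob_space B" "sets B = sets borel" "AE x in B. norm x \<le> r"
    and k: "k \<in> borel_measurable borel" "\<And>u. norm u \<le> 2 * r \<Longrightarrow> \<bar>k u\<bar> \<le> K"
  shows "(\<integral>x. \<integral>y. k (x - y) \<partial>B \<partial>A) = (\<integral>y. \<integral>x. k (x - y) \<partial>A \<partial>B)"
proof -
  interpret A: prob_space A by fact
  interpret B: prob_space B by fact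
  interpret P: pair_prob_space A B ..
  note [measurable_cong] = A(2) B(2)
  note [measurable] = k(1)
  define h where "h x y = (if norm x \<le> r \<and> norm y \<le> r then k (x - y) else 0)" for x y
  have [measurable]: "(\<lambda>p. h (fst p) (snd p)) \<in> borel_measurable (borel \<Otimes>\<^sub>M borel)"
    "h x \<in> borel_measurable borel" "(\<lambda>x. h x y) \<in> borel_measurable borel" for x y
    unfolding h_def by measurable
  have "\<bar>h x y\<bar> \<le> \<bar>K\<bar>" for x y
  proof (cases "norm x \<le> r \<and> norm y \<le> r")
    case True
    hence "norm (x - y) \<le> 2 * r" using norm_triangle_ineq4[of x y] by linarith
    thus ?thesis using k(2)[of "x - y"] True by (simp add: h_def)
  qed (auto simp: h_def)
  hence "integrable (A \<Otimes>\<^sub>M B) (\<lambda>(x, y). h x y)"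
    by (intro P.integrable_const_bound[where B="\<bar>K\<bar>"]) (auto simp: split_beta')
  hence s: "(\<integral>y. \<integral>x. h x y \<partial>A \<partial>B) = (\<integral>x. \<integral>y. h x y \<partial>B \<partial>A)"
    by (rule P.Fubini_integral)
  have 1: "(\<integral>x. \<integral>y. k (x - y) \<partial>B \<partial>A) = (\<integral>x. \<integral>y. h x y \<partial>B \<partial>A)"
  proof (rule integral_cong_AE)
    show "AE x in A. (\<integral>y. k (x - y) \<partial>B) = (\<integral>y. h x y \<partial>B)"
      using A(3)
    proof eventually_elim
      case (elim x)
      show ?case by (rule integral_cong_AE) (use B(3) elim in \<open>auto elim!: eventually_mono simp: h_def\<close>)
    qed
  qed (unfold h_def, measurable)
  have 2: "(\<integral>y. \<integral>x. k (x - y) \<partial>A \<partial>B) = (\<integral>y. \<integral>x. h x y \<partial>A \<partial>B)"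
  proof (rule integral_cong_AE)
    show "AE y in B. (\<integral>x. k (x - y) \<partial>A) = (\<integral>x. h x y \<partial>A)"
      using B(3)
    proof eventually_elim
      case (elim y)
      show ?case by (rule integral_cong_AE) (use A(3) elim in \<open>auto elim!: eventually_mono simp: h_def\<close>)
    qed
  qed (unfold h_def, measurable)
  show ?thesis using s 1 2 by simp
qed

lemma disc_volume: "r \<ge> 0 \<Longrightarrow> (\<integral>w. indicator (cball 0 r) w \<partial>(lborel :: (real^2) measure)) = pi * r\<^sup>2"
  "r \<ge> 0 \<Longrightarrow> measure (lborel :: (real^2) measure) (cball a r) = pi * r\<^sup>2"
  "r \<ge> 0 \<Longrightarrow> emeasure (lborel :: (real^2) measure) (cball a r) = ennreal (pi * r\<^sup>2)"
  by (simp_all add: content_cball unit_ball_vol_2 emeasure_cball)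

lemma Sigma_disk_volume:
  "measure lborel (Sigma_disk N) = real N" "emeasure lborel (Sigma_disk N) = ennreal (real N)"
  using disc_volume(2,3)[of "sqrt (real N / pi)" 0] by (simp_all add: Sigma_disk_def)

text \<open>Minus \<open>bg N\<close> is the potential at the origin of the background of density
  one on \<open>Sigma_disk N\<close>.\<close>

definition bg :: "nat \<Rightarrow> real" where
  "bg N = real N / 2 * (ln (real N / pi) - 1)"

lemma background_potential:
  assumes N: "N \<ge> 1" and x: "x \<in> Sigma_disk N"
  shows "integrable lborel (\<lambda>w. lnk (w - x) * indicator (Sigma_disk N) w)"
    "(\<integral>w. lnk (w - x) * indicator (Sigma_disk N) w \<partial>lborel) = - (pi / 2) * (norm x)\<^sup>2 - bg N"
proof -
  let ?r = "sqrt (real N / pi)"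
  have T: "real N / pi > 0" using N by simp
  show "integrable lborel (\<lambda>w. lnk (w - x) * indicator (Sigma_disk N) w)"
    unfolding Sigma_disk_def by (rule integrable_lnk_mult[where B=1 and r="?r"]) (auto simp: indicator_def)
  have "(norm x)\<^sup>2 \<le> ?r\<^sup>2" using x unfolding Sigma_disk_def by (intro power_mono) auto
  hence "(norm x)\<^sup>2 \<le> real N / pi" using T by simp
  from disc_potential[OF T this]
  have "(\<integral>w. lnk (w - x) * indicator (Sigma_disk N) w \<partial>lborel)
      = - (pi / 2) * (real N / pi * ln (real N / pi) - real N / pi + (norm x)\<^sup>2)"
    unfolding Sigma_disk_def .
  also have "\<dots> = - (pi * (real N / pi)) / 2 * (ln (real N / pi) - 1) - pi / 2 * (norm x)\<^sup>2"
    by (simp only: algebra_simps) (simp add: algebra_simps)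
  also have "pi * (real N / pi) = real N" by simp
  finally show "(\<integral>w. lnk (w - x) * indicator (Sigma_disk N) w \<partial>lborel) = - (pi / 2) * (norm x)\<^sup>2 - bg N"
    unfolding bg_def by (simp add: algebra_simps)
qed

lemma integral_background:
  assumes N: "N \<ge> 1"
  shows "integrable lborel (\<lambda>w. (norm w)\<^sup>2 * indicator (Sigma_disk N) w)"
    "(\<integral>w. (norm w)\<^sup>2 * indicator (Sigma_disk N) w \<partial>lborel) = (real N)\<^sup>2 / (2 * pi)"
proof -
  let ?r = "sqrt (real N / pi)"
  have r2: "?r\<^sup>2 = real N / pi" by simp
  have "?r ^ 4 = (?r\<^sup>2)\<^sup>2" by (simp only: power_mult[symmetric]) simp
  also have "\<dots> = (real N / pi)\<^sup>2" by (simp only: r2)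
  finally have "?r ^ 4 = (real N / pi)\<^sup>2" .
  thus "integrable lborel (\<lambda>w. (norm w)\<^sup>2 * indicator (Sigma_disk N) w)"
    "(\<integral>w. (norm w)\<^sup>2 * indicator (Sigma_disk N) w \<partial>lborel) = (real N)\<^sup>2 / (2 * pi)"
    using integral_norm_square_disc[of ?r] by (simp_all add: Sigma_disk_def power_divide power2_eq_square)
qed

lemma sum_sum_remove:
  fixes f :: "'a \<Rightarrow> real"
  assumes "finite J"
  shows "(\<Sum>i\<in>J. \<Sum>j\<in>J - {i}. f j) = (real (card J) - 1) * (\<Sum>j\<in>J. f j)"
proof -
  have "(\<Sum>i\<in>J. \<Sum>j\<in>J - {i}. f j) = (\<Sum>i\<in>J. (\<Sum>j\<in>J. f j) - f i)"
    using assms by (intro sum.cong refl) (simp add: sum_diff1)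
  also have "\<dots> = real (card J) * (\<Sum>j\<in>J. f j) - (\<Sum>j\<in>J. f j)" by (simp add: sum_subtractf)
  finally show ?thesis by (simp add: algebra_simps)
qed

text \<open>Jensen's inequality for a charge moved uniformly over the whole disc.\<close>

lemma settled_energy_bound:
  assumes N: "N \<ge> 1" and \<beta>: "\<beta> > 0" and x: "\<And>j. j < N \<Longrightarrow> x j \<in> Sigma_disk N"
    and S: "settled \<beta> T {..<N} x (Sigma_disk N)"
  shows "(\<Sum>i<N. \<Sum>j\<in>{..<N} - {i}. lnk (x i - x j)) + pi / 2 * (\<Sum>j<N. (norm (x j))\<^sup>2)
    \<le> - (pi / 2) * ((real N - 1) / real N) * (\<Sum>j<N. (norm (x j))\<^sup>2) - (real N - 1) * bg N + (real N)\<^sup>2 / 4 + real N * T"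
proof -
  let ?S = "Sigma_disk N"
  have Sm[measurable]: "?S \<in> sets borel" by (simp add: Sigma_disk_def)
  define p where "p w = indicator ?S w / real N" for w
  have ip: "integrable lborel (\<lambda>w. indicator ?S w :: real)"
    by (intro integrable_real_indicator) (auto simp: Sigma_disk_volume)
  have p: "integrable lborel p" "(\<integral>w. p w \<partial>lborel) = 1" "\<And>w. p w \<ge> 0"
    unfolding p_def using N ip by (simp_all add: Sigma_disk_volume)
  define s where "s = (\<Sum>j<N. (norm (x j))\<^sup>2)"
  have V: "pot ({..<N} - {i}) x (x i) \<le> (\<Sum>j\<in>{..<N} - {i}. - (pi / 2) * (norm (x j))\<^sup>2 - bg N) / real N + real N / 4 + T"
    if i: "i < N" for i
  proof -
    let ?V = "pot ({..<N} - {i}) x"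
    have e: "?V w * p w = ((\<Sum>j\<in>{..<N} - {i}. lnk (w - x j) * indicator ?S w) + pi / 2 * ((norm w)\<^sup>2 * indicator ?S w)) / real N" for w
      by (simp add: pot_def p_def sum_distrib_right distrib_right add_divide_distrib)
    have iV: "integrable lborel (\<lambda>w. ?V w * p w)"
      unfolding e using background_potential(1)[OF N x] integral_background(1)[OF N]
      by (intro integrable_divide Bochner_Integration.integrable_add Bochner_Integration.integrable_sum integrable_mult_right) auto
    have vV: "(\<integral>w. ?V w * p w \<partial>lborel) = (\<Sum>j\<in>{..<N} - {i}. - (pi / 2) * (norm (x j))\<^sup>2 - bg N) / real N + real N / 4"
    proof -
      have "(\<integral>w. ?V w * p w \<partial>lborel) = ((\<Sum>j\<in>{..<N} - {i}. \<integral>w. lnk (w - x j) * indicator ?S w \<partial>lborel)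
        + pi / 2 * (\<integral>w. (norm w)\<^sup>2 * indicator ?S w \<partial>lborel)) / real N"
      proof -
        have i1: "integrable lborel (\<lambda>w. lnk (w - x j) * indicator ?S w)" if "j \<in> {..<N} - {i}" for j
          using background_potential(1)[OF N x] that by auto
        have i2: "integrable lborel (\<lambda>w. pi / 2 * ((norm w)\<^sup>2 * indicator ?S w))"
          by (intro integrable_mult_right integral_background(1)[OF N])
        show ?thesis unfolding e integral_divide_zero
          by (subst Bochner_Integration.integral_add[OF Bochner_Integration.integrable_sum[OF i1] i2])
             (simp_all only: Bochner_Integration.integral_sum[OF i1] integral_mult_right_zero)
      qed
      also have "(\<Sum>j\<in>{..<N} - {i}. \<integral>w. lnk (w - x j) * indicator ?S w \<partial>lborel) = (\<Sum>j\<in>{..<N} - {i}. - (pi / 2) * (norm (x j))\<^sup>2 - bg N)"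
        by (intro sum.cong refl background_potential(2)[OF N] x) auto
      also have "(\<integral>w. (norm w)\<^sup>2 * indicator ?S w \<partial>lborel) = (real N)\<^sup>2 / (2 * pi)" by (rule integral_background(2)[OF N])
      finally show ?thesis using N by (simp add: add_divide_distrib power2_eq_square)
    qed
    have "ennreal (exp (\<beta> * (?V (x i) - (\<integral>w. ?V w * p w \<partial>lborel)))) \<le> (\<integral>\<^sup>+y. ennreal (exp (\<beta> * (?V (x i) - ?V y)) * p y) \<partial>lborel)"
      by (rule jensen_exp[OF p iV])
    \<comment> \<open>The uniform density is \<open>1 / N \<le> 1\<close> on the disc, so it may be
      dropped to reach the unnormalised integral in \<open>settled\<close>.\<close>
    also have "\<dots> \<le> (\<integral>\<^sup>+y. ennreal (exp (\<beta> * (?V (x i) - ?V y))) * indicator ?S y \<partial>lborel)"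
      using N by (intro nn_integral_mono) (auto simp: p_def indicator_def divide_simps intro!: ennreal_leI)
    also have "\<dots> \<le> ennreal (exp (\<beta> * T))" using S x[OF i] i unfolding settled_def by auto
    finally have "?V (x i) - (\<integral>w. ?V w * p w \<partial>lborel) \<le> T" using \<beta> by simp
    thus ?thesis unfolding vV by linarith
  qed
  \<comment> \<open>On the left the sum runs over ordered pairs; on the right each charge is counted
    \<open>N - 1\<close> times, which produces the factor \<open>(N - 1) / N\<close>.\<close>
  have "(\<Sum>i<N. pot ({..<N} - {i}) x (x i)) \<le> (\<Sum>i<N. (\<Sum>j\<in>{..<N} - {i}. - (pi / 2) * (norm (x j))\<^sup>2 - bg N) / real N + real N / 4 + T)"
    by (intro sum_mono V) auto
  also have "\<dots> = (real N - 1) * (\<Sum>j<N. - (pi / 2) * (norm (x j))\<^sup>2 - bg N) / real N + real N * (real N / 4 + T)"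
    using sum_sum_remove[of "{..<N}" "\<lambda>j. - (pi / 2) * (norm (x j))\<^sup>2 - bg N"]
    by (simp add: sum.distrib sum_divide_distrib[symmetric] algebra_simps)
  also have "(\<Sum>j<N. - (pi / 2) * (norm (x j))\<^sup>2 - bg N) = - (pi / 2) * s - real N * bg N"
    by (simp add: s_def sum_subtractf sum_distrib_left sum_negf sum_divide_distrib)
  also have "(real N - 1) * (- (pi / 2) * s - real N * bg N) / real N = - (pi / 2) * ((real N - 1) / real N) * s - (real N - 1) * bg N"
    using N by (simp add: field_simps)
  also have "(\<Sum>i<N. pot ({..<N} - {i}) x (x i)) = (\<Sum>i<N. \<Sum>j\<in>{..<N} - {i}. lnk (x i - x j)) + pi / 2 * s"
    by (simp add: pot_def sum.distrib s_def sum_distrib_left)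
  finally show ?thesis unfolding s_def[symmetric] by (simp add: power2_eq_square algebra_simps)
qed

lemma density_prob:
  fixes p :: "real^2 \<Rightarrow> real"
  assumes p: "integrable lborel p" "(\<integral>w. p w \<partial>lborel) = 1" "\<And>w. p w \<ge> 0" and s: "\<And>w. norm w > r \<Longrightarrow> p w = 0"
  shows "prob_space (density lborel (\<lambda>w. ennreal (p w)))"
    "AE x in density lborel (\<lambda>w. ennreal (p w)). norm x \<le> r"
    "\<And>f :: real^2 \<Rightarrow> real. f \<in> borel_measurable borel \<Longrightarrow>
      (\<integral>x. f x \<partial>density lborel (\<lambda>w. ennreal (p w))) = (\<integral>x. f x * p x \<partial>lborel)"
proof -
  have [measurable]: "p \<in> borel_measurable borel" using p(1) by auto
  show "prob_space (density lborel (\<lambda>w. ennreal (p w)))"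
    by (rule prob_spaceI) (use p in \<open>simp add: emeasure_density nn_integral_eq_integral\<close>)
  show "AE x in density lborel (\<lambda>w. ennreal (p w)). norm x \<le> r"
    by (subst AE_density) (use s in \<open>auto simp: not_less[symmetric]\<close>)
  show "(\<integral>x. f x \<partial>density lborel (\<lambda>w. ennreal (p w))) = (\<integral>x. f x * p x \<partial>lborel)" if "f \<in> borel_measurable borel" for f :: "real^2 \<Rightarrow> real"
    using integral_density[of f lborel p] that p(3) by (simp add: mult.commute)
qed

text \<open>Positive semidefiniteness is tested with the charges minus the background minus \<open>sqrt N\<close> times
  the difference of a point charge at \<open>y\<close> and a smeared charge around \<open>y'\<close>.\<close>

lemma spot_oscillation_top:
  assumes N: "N \<ge> 3" and \<beta>: "\<beta> > 0" and x: "\<And>j. j < N \<Longrightarrow> x j \<in> Sigma_disk N" and inj: "inj_on x {..<N}"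
    and S: "settled \<beta> T {..<N} x (Sigma_disk N)" and T: "T \<ge> 0"
    and y: "y \<in> Sigma_disk N" and y': "y' \<in> Sigma_disk N" "cball y' 1 \<subseteq> Sigma_disk N"
  shows "spot 1 {..<N} x y \<le> spot 1 {..<N} x y' + sqrt (real N) * (9 + T + 4 * ln (real N)) / 2 + 6"
proof -
  let ?S = "Sigma_disk N"
  define r where "r = sqrt (real N / pi)"
  have S_r: "?S = cball 0 r" by (simp add: Sigma_disk_def r_def)
  have r0: "r \<ge> 0" by (simp add: r_def)
  have r2: "r\<^sup>2 = real N / pi" unfolding r_def by simp
  define L where "L = ln (real N)"
  have N0: "real N > 0" "N \<ge> 1" using N by auto
  have "exp 1 \<le> real N" using exp_le N by linarith
  hence L1: "L \<ge> 1" unfolding L_def using N0 by (simp add: ln_ge_iff)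
  \<comment> \<open>With \<open>\<delta> = 1 / N\<close> a self-energy costs \<open>ln N / 2\<close>
    per charge, comparing \<open>Lk 1\<close> with \<open>kd \<delta>\<close> costs 1 over all
    charges together, and the background potential changes by a bounded amount since the radius is
    of order \<open>sqrt N\<close>.\<close>
  define \<delta> where "\<delta> = 1 / real N"
  have \<delta>: "\<delta> > 0" using N0 by (simp add: \<delta>_def)
  have ln\<delta>: "ln \<delta> = - L" using N0 by (simp add: \<delta>_def L_def ln_div)
  have Sm[measurable]: "?S \<in> sets borel" by (simp add: Sigma_disk_def)
  let ?k = "kd \<delta>"
  have kup: "?k u \<le> L / 2" for u using kd_le[OF \<delta>, of u] ln\<delta> by simp
  have klow: "?k u \<ge> - L" if "norm u \<le> 2 * r" for u
  proof -
    have "(norm u)\<^sup>2 \<le> (2 * r)\<^sup>2" using that by (intro power_mono) auto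
    hence "(norm u)\<^sup>2 \<le> 4 * (real N / pi)" using r2 by (simp add: power_mult_distrib)
    also have "\<dots> \<le> 4 * (real N / 3)" using pi_gt3 N0 by (intro mult_left_mono divide_left_mono) auto
    finally have "(norm u)\<^sup>2 \<le> 4 / 3 * real N" by simp
    moreover have "\<delta> \<le> 1" using N by (simp add: \<delta>_def)
    ultimately have "(norm u)\<^sup>2 + \<delta> \<le> 4 / 3 * real N + 1" by linarith
    also have "\<dots> \<le> real N * real N"
    proof -
      have "3 * real N \<le> real N * real N" using N by (intro mult_right_mono) auto
      thus ?thesis using N by linarith
    qed
    finally have "ln ((norm u)\<^sup>2 + \<delta>) \<le> ln (real N * real N)" using \<delta> by (intro ln_mono) (auto simp: add_nonneg_pos)
    also have "\<dots> = 2 * L" using N0 by (simp add: L_def ln_mult)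
    finally show ?thesis by (simp add: kd_def)
  qed
  have kabs: "\<bar>?k u\<bar> \<le> L" if "norm u \<le> 2 * r" for u
    using klow[OF that] kup[of u] L1 by (simp add: abs_le_iff)

  \<comment> \<open>The probability measures carrying the test charges\<close>
  define pU where "pU w = indicator ?S w / real N" for w
  define pK where "pK w = kap 1 (w - y')" for w
  have pU: "integrable lborel pU" "(\<integral>w. pU w \<partial>lborel) = 1" "\<And>w. pU w \<ge> 0" "\<And>w. norm w > r \<Longrightarrow> pU w = 0"
    unfolding pU_def using N0 by (auto simp: Sigma_disk_volume S_r intro!: integrable_divide integrable_real_indicator)
       (auto simp: S_r[symmetric] Sigma_disk_volume)
  have pK: "integrable lborel pK" "(\<integral>w. pK w \<partial>lborel) = 1" "\<And>w. pK w \<ge> 0" "\<And>w. norm w > r \<Longrightarrow> pK w = 0"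
  proof -
    show "integrable lborel pK" "(\<integral>w. pK w \<partial>lborel) = 1" unfolding pK_def using integral_kap_centered[of 1 y'] by auto
    show "pK w \<ge> 0" for w by (simp add: pK_def kap_nonneg)
    show "pK w = 0" if "norm w > r" for w
    proof -
      have "w \<notin> cball y' 1" using that y'(2) S_r by auto
      thus ?thesis unfolding pK_def by (intro kap_outside) (auto simp: dist_norm norm_minus_commute)
    qed
  qed
  define MU where "MU = density lborel (\<lambda>w. ennreal (pU w))"
  define MK where "MK = density lborel (\<lambda>w. ennreal (pK w))"
  have U: "prob_space MU" "AE x in MU. norm x \<le> r"
    "\<And>f :: real^2 \<Rightarrow> real. f \<in> borel_measurable borel \<Longrightarrow> (\<integral>x. f x \<partial>MU) = (\<integral>x. f x * pU x \<partial>lborel)"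
    unfolding MU_def using density_prob[OF pU(1-3), of r] pU(4) by blast+
  have K: "prob_space MK" "AE x in MK. norm x \<le> r"
    "\<And>f :: real^2 \<Rightarrow> real. f \<in> borel_measurable borel \<Longrightarrow> (\<integral>x. f x \<partial>MK) = (\<integral>x. f x * pK x \<partial>lborel)"
    unfolding MK_def using density_prob[OF pK(1-3), of r] pK(4) by blast+
  \<comment> \<open>\<open>log_kernel_psd\<close> asks for a probability measure on the disc at
    every index, so indices outside \<open>I\<close> receive default measures: a point mass at 0, or
    \<open>MK\<close>.\<close>
  define M :: "nat + nat \<Rightarrow> (real^2) measure" where
    "M i = (case i of Inl j \<Rightarrow> return borel (if j < N then x j else 0)
        | Inr n \<Rightarrow> if n = 0 then MU else if n = 1 then return borel y else MK)" for i
  have inr: "norm (if j < N then x j else 0) \<le> r" for j using x[of j] r0 by (simp add: S_r)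
  have yr: "norm y \<le> r" "norm y' \<le> r" using y y' by (auto simp: S_r)
  have AEret: "norm z \<le> r \<Longrightarrow> AE x in return borel z. norm x \<le> r" for z :: "real^2" by (subst AE_return) auto
  have M: "prob_space (M i)" "sets (M i) = sets borel" "AE x in M i. norm x \<le> r" for i
    unfolding M_def using U(1,2) K(1,2) inr yr(1)
    by (auto split: sum.split simp: prob_space_return AEret MU_def[THEN arg_cong[where f=sets]] MK_def[THEN arg_cong[where f=sets]] intro!: AEret)
  \<comment> \<open>The weights sum to zero. The quadratic form with dipole amplitude
    \<open>h\<close> reads \<open>uu - 2 * h * br + h\<^sup>2 * w\<close>, and its nonnegativity
    bounds \<open>br\<close> by \<open>uu / (2 * h) + h * w / 2\<close>. As \<open>uu\<close> is of
    order \<open>N * ln N\<close> and \<open>w\<close> of order \<open>ln N\<close>, the two terms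
    balance at \<open>h = sqrt N\<close>.\<close>
  define c :: "nat + nat \<Rightarrow> real" where
    "c i = (case i of Inl j \<Rightarrow> 1 | Inr n \<Rightarrow> if n = 0 then - real N else if n = 1 then - sqrt (real N) else sqrt (real N))" for i
  define I :: "(nat + nat) set" where "I = Inl ` {..<N} \<union> {Inr 0, Inr 1, Inr 2}"
  have sumI: "(\<Sum>i\<in>I. f i) = (\<Sum>j<N. f (Inl j)) + f (Inr 0) + f (Inr 1) + f (Inr 2)" for f :: "nat + nat \<Rightarrow> real"
  proof -
    have "(\<Sum>i\<in>I. f i) = (\<Sum>i\<in>Inl ` {..<N}. f i) + (\<Sum>i\<in>{Inr 0, Inr 1, Inr 2}. f i)"
      unfolding I_def by (rule sum.union_disjoint) auto
    also have "(\<Sum>i\<in>Inl ` {..<N}. f i) = (\<Sum>j<N. f (Inl j))" by (subst sum.reindex) auto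
    finally show ?thesis by simp
  qed

  \<comment> \<open>Entries of the energy matrix\<close>
  define E where "E a b = (\<integral>x. \<integral>y. ?k (x - y) \<partial>M b \<partial>M a)" for a b
  have psd: "0 \<le> (\<Sum>a\<in>I. \<Sum>b\<in>I. c a * c b * E a b)"
    unfolding E_def kd_def using log_kernel_psd[OF M \<delta>, of c I] by (simp add: sumI c_def)
  have sym: "E a b = E b a" for a b
  proof -
    have "E a b = (\<integral>y. \<integral>x. ?k (x - y) \<partial>M a \<partial>M b)"
      unfolding E_def by (rule double_integral_swap[OF M M kd_measurable kabs])
    thus ?thesis unfolding E_def by (simp add: kd_minus)
  qed
  define Kf where "Kf v = (\<integral>w. ?k (w - v) * indicator ?S w \<partial>lborel)" for v
  have Kf_up: "Kf v \<le> - (pi / 2) * (norm v)\<^sup>2 - bg N" if "v \<in> ?S" for v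
    using kd_disc(1)[OF \<delta> r0, of v] background_potential(2)[OF N0(2) that] that by (simp add: Kf_def S_r)
  \<comment> \<open>\<open>sqrt \<delta> * r\<close> equals \<open>1 / sqrt pi\<close> whatever
    \<open>N\<close> is, so the smoothing error of the background potential is the constant
    \<open>2 * sqrt pi\<close>, at most 4.\<close>
  have Kf_low: "Kf v \<ge> - (pi / 2) * (norm v)\<^sup>2 - bg N - 4" if "v \<in> ?S" for v
  proof -
    have "2 * pi * sqrt \<delta> * r = 2 * sqrt pi"
    proof -
      have "sqrt \<delta> * r = 1 / sqrt pi" unfolding \<delta>_def r_def using N0 by (simp add: real_sqrt_divide)
      hence "2 * pi * (sqrt \<delta> * r) = 2 * (pi / sqrt pi)" by simp
      also have "pi / sqrt pi = sqrt pi" by (rule real_div_sqrt) simp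
      finally show ?thesis by (simp add: mult_ac)
    qed
    also have "\<dots> \<le> 4" using real_sqrt_le_mono[of pi 4] pi_less_4 by simp
    finally have "2 * pi * sqrt \<delta> * r \<le> 4" .
    moreover have "norm v \<le> r" using that by (simp add: S_r)
    note kd_disc(2)[OF \<delta> r0 this]
    moreover note background_potential(2)[OF N0(2) that]
    ultimately show ?thesis unfolding Kf_def S_r by linarith
  qed
  have [measurable]: "Kf \<in> borel_measurable borel" unfolding Kf_def by measurable
  have intU: "(\<integral>w. ?k (v - w) \<partial>MU) = Kf v / real N" for v
    by (subst U(3)) (auto simp: pU_def Kf_def kd_minus[of \<delta> v])
  have intK: "(\<integral>w. ?k (v - w) \<partial>MK) = (\<integral>w. ?k (v - w) * kap 1 (w - y') \<partial>lborel)" for v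
    by (subst K(3)) (auto simp: pK_def)
  have ret: "(\<integral>w. f w \<partial>return borel v) = f v" if "f \<in> borel_measurable borel" for f :: "real^2 \<Rightarrow> real" and v
    using that by (intro integral_return) auto
  define q where "q j = Kf (x j)" for j
  define a where "a j = ?k (x j - y)" for j
  define b where "b j = (\<integral>w. ?k (x j - w) * kap 1 (w - y') \<partial>lborel)" for j
  define k2 where "k2 = (\<integral>w. Kf w * kap 1 (w - y') \<partial>lborel)"
  define e00 where "e00 = (\<integral>w. Kf w * indicator ?S w \<partial>lborel)"
  have E1: "E (Inl i) (Inl j) = ?k (x i - x j)" if "i < N" "j < N" for i j
    using that by (simp add: E_def M_def ret)
  have E2: "E (Inl j) (Inr 0) = q j / real N" "E (Inr 0) (Inl j) = q j / real N" if "j < N" for j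
  proof -
    show "E (Inl j) (Inr 0) = q j / real N" using that by (simp add: E_def M_def ret intU q_def)
    thus "E (Inr 0) (Inl j) = q j / real N" by (simp add: sym)
  qed
  have E3: "E (Inl j) (Inr 1) = a j" "E (Inr 1) (Inl j) = a j" if "j < N" for j
    using that kd_minus[of \<delta> y "x j"] by (simp_all add: E_def M_def ret a_def)
  have E4: "E (Inl j) (Inr 2) = b j" "E (Inr 2) (Inl j) = b j" if "j < N" for j
  proof -
    have "(\<lambda>xa. \<integral>w. ?k (xa - w) * kap 1 (w - y') \<partial>lborel) \<in> borel_measurable borel" by measurable
    thus "E (Inl j) (Inr 2) = b j" using that by (simp add: E_def M_def ret intK b_def)
    thus "E (Inr 2) (Inl j) = b j" by (simp add: sym)
  qed
  have E5: "E (Inr 0) (Inr 0) = e00 / real N / real N"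
    by (simp add: E_def M_def intU, subst U(3)) (auto simp: pU_def e00_def)
  have E6: "E (Inr 1) (Inr 0) = Kf y / real N" "E (Inr 0) (Inr 1) = Kf y / real N"
  proof -
    show "E (Inr 1) (Inr 0) = Kf y / real N" by (simp add: E_def M_def ret intU)
    thus "E (Inr 0) (Inr 1) = Kf y / real N" by (simp add: sym)
  qed
  have E7: "E (Inr 2) (Inr 0) = k2 / real N" "E (Inr 0) (Inr 2) = k2 / real N"
  proof -
    show "E (Inr 2) (Inr 0) = k2 / real N"
      by (simp add: E_def M_def intU, subst K(3)) (auto simp: pK_def k2_def)
    thus "E (Inr 0) (Inr 2) = k2 / real N" by (simp add: sym)
  qed
  define w where "w = E (Inr 1) (Inr 1) - 2 * E (Inr 1) (Inr 2) + E (Inr 2) (Inr 2)"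
  define Sk where "Sk = (\<Sum>i<N. \<Sum>j<N. ?k (x i - x j))"
  define uu where "uu = Sk - 2 * (\<Sum>j<N. q j) + e00"
  define br where "br = (\<Sum>j<N. a j) - (\<Sum>j<N. b j) - Kf y + k2"
  have tot: "(\<Sum>a\<in>I. \<Sum>b\<in>I. c a * c b * E a b) = uu - 2 * sqrt (real N) * br + real N * w"
  proof -
    have "(\<Sum>i<N. \<Sum>j<N. E (Inl i) (Inl j)) = Sk" unfolding Sk_def by (intro sum.cong refl E1) auto
    moreover have "(\<Sum>j<N. E (Inl j) (Inr 0)) = (\<Sum>j<N. q j) / real N" "(\<Sum>j<N. E (Inr 0) (Inl j)) = (\<Sum>j<N. q j) / real N"
      by (simp_all add: E2 sum_divide_distrib)
    moreover have "(\<Sum>j<N. E (Inl j) (Inr 1)) = (\<Sum>j<N. a j)" "(\<Sum>j<N. E (Inr 1) (Inl j)) = (\<Sum>j<N. a j)"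
      "(\<Sum>j<N. E (Inl j) (Inr 2)) = (\<Sum>j<N. b j)" "(\<Sum>j<N. E (Inr 2) (Inl j)) = (\<Sum>j<N. b j)"
      using E3 E4 by (auto intro!: sum.cong)
    moreover have "sqrt (real N) * sqrt (real N) = real N" by simp
    moreover have "E (Inr 2) (Inr 1) = E (Inr 1) (Inr 2)" by (rule sym)
    ultimately show ?thesis
      unfolding sumI c_def using N0
      by (simp add: E5 E6 E6[unfolded One_nat_def] E7 sum.distrib sum_subtractf sum_negf sum_distrib_left[symmetric] sum_distrib_right[symmetric]
          uu_def br_def w_def field_simps power2_eq_square)
  qed

  \<comment> \<open>Bounds on the terms of the quadratic form\<close>
  have ww: "w \<le> 3 * L"
  proof -
    have "E (Inr 1) (Inr 1) \<le> L / 2" using kup by (simp add: E_def M_def ret)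
    moreover have "E (Inr 2) (Inr 2) \<le> L / 2"
    proof -
      interpret MK: prob_space MK by (rule K(1))
      have [measurable_cong]: "sets MK = sets borel" by (simp add: MK_def)
      have bd: "AE u in MK. \<bar>?k (v - u)\<bar> \<le> L" if "norm v \<le> r" for v
        using K(2)
      proof eventually_elim
        case (elim u)
        have "norm (v - u) \<le> 2 * r" using norm_triangle_ineq4[of v u] that elim by linarith
        thus ?case using klow[of "v - u"] kup[of "v - u"] L1 by linarith
      qed
      have inn: "\<bar>\<integral>u. ?k (v - u) \<partial>MK\<bar> \<le> L \<and> (\<integral>u. ?k (v - u) \<partial>MK) \<le> L / 2" if "norm v \<le> r" for v
      proof -
        have i: "integrable MK (\<lambda>u. ?k (v - u))"
          by (rule MK.integrable_const_bound[where B=L]) (use bd[OF that] in auto)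
        have "(\<integral>u. ?k (v - u) \<partial>MK) \<le> (\<integral>u. L / 2 \<partial>MK)" by (rule integral_mono[OF i]) (use kup in auto)
        moreover have "(\<integral>u. - L \<partial>MK) \<le> (\<integral>u. ?k (v - u) \<partial>MK)"
          by (rule integral_mono_AE[OF _ i]) (use bd[OF that] in \<open>auto elim!: eventually_mono\<close>)
        ultimately show ?thesis using L1 by (simp add: MK.prob_space)
      qed
      have i: "integrable MK (\<lambda>v. \<integral>u. ?k (v - u) \<partial>MK)"
        by (rule MK.integrable_const_bound[where B=L]) (use K(2) inn in \<open>auto elim!: eventually_mono\<close>)
      have "(\<integral>v. \<integral>u. ?k (v - u) \<partial>MK \<partial>MK) \<le> (\<integral>v. L / 2 \<partial>MK)"
        by (rule integral_mono_AE[OF i]) (use K(2) inn in \<open>auto elim!: eventually_mono\<close>)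
      thus ?thesis by (simp add: E_def M_def MK.prob_space)
    qed
    moreover have "E (Inr 1) (Inr 2) \<ge> - L"
    proof -
      have m: "(\<lambda>xa. \<integral>w. ?k (xa - w) * kap 1 (w - y') \<partial>lborel) \<in> borel_measurable borel" by measurable
      have e: "E (Inr 1) (Inr 2) = (\<integral>u. ?k (y - u) \<partial>MK)" using m by (simp add: E_def M_def ret intK)
      interpret MK: prob_space MK by (rule K(1))
      have [measurable_cong]: "sets MK = sets borel" by (simp add: MK_def)
      have bd: "AE u in MK. - L \<le> ?k (y - u) \<and> \<bar>?k (y - u)\<bar> \<le> L"
        using K(2)
      proof eventually_elim
        case (elim u)
        have "norm (y - u) \<le> 2 * r" using norm_triangle_ineq4[of y u] yr elim by linarith
        thus ?case using klow[of "y - u"] kup[of "y - u"] L1 by linarith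
      qed
      have i: "integrable MK (\<lambda>u. ?k (y - u))"
        by (rule MK.integrable_const_bound[where B=L]) (use bd in auto)
      have "(\<integral>u. - L \<partial>MK) \<le> (\<integral>u. ?k (y - u) \<partial>MK)"
        by (rule integral_mono_AE[OF _ i]) (use bd in \<open>auto elim!: eventually_mono\<close>)
      thus ?thesis unfolding e by (simp add: MK.prob_space)
    qed
    ultimately show ?thesis unfolding w_def using L1 by linarith
  qed
  define s where "s = (\<Sum>j<N. (norm (x j))\<^sup>2)"
  define D where "D = (\<Sum>i<N. \<Sum>j\<in>{..<N} - {i}. lnk (x i - x j))"
  have en: "D + pi / 2 * s \<le> - (pi / 2) * ((real N - 1) / real N) * s - (real N - 1) * bg N + (real N)\<^sup>2 / 4 + real N * T"
    unfolding D_def s_def by (rule settled_energy_bound[OF N0(2) \<beta> x S])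
  have Sk_le: "Sk \<le> D + real N * (L / 2)"
  proof -
    have "Sk = (\<Sum>i<N. ?k (x i - x i) + (\<Sum>j\<in>{..<N} - {i}. ?k (x i - x j)))"
      unfolding Sk_def by (intro sum.cong refl sum.remove) auto
    also have "\<dots> \<le> (\<Sum>i<N. L / 2 + (\<Sum>j\<in>{..<N} - {i}. lnk (x i - x j)))"
      using inj by (intro sum_mono add_mono kup kd_le_lnk \<delta>) (auto simp: inj_on_def)
    finally show ?thesis by (simp add: D_def sum.distrib)
  qed
  have q_ge: "- (\<Sum>j<N. q j) \<le> pi / 2 * s + real N * (bg N + 4)"
  proof -
    have "- (\<Sum>j<N. q j) \<le> (\<Sum>j<N. pi / 2 * (norm (x j))\<^sup>2 + (bg N + 4))"
      unfolding sum_negf[symmetric] q_def using Kf_low x by (intro sum_mono) force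
    thus ?thesis by (simp add: sum.distrib s_def sum_distrib_left)
  qed
  have Kf_abs: "\<bar>Kf v\<bar> \<le> real N * L" if "v \<in> ?S" for v
  proof -
    have "\<bar>Kf v\<bar> \<le> (\<integral>w. \<bar>?k (w - v) * indicator ?S w\<bar> \<partial>lborel)" unfolding Kf_def by (rule integral_abs_bound)
    also have "\<dots> \<le> (\<integral>w. L * indicator ?S w \<partial>lborel)"
    proof (rule integral_mono)
      show "integrable lborel (\<lambda>w. \<bar>?k (w - v) * indicator ?S w\<bar>)" using kd_disc_integrable[OF \<delta>, of v r] by (simp add: S_r)
      show "integrable lborel (\<lambda>w. L * indicator ?S w)"
        by (intro integrable_mult_right integrable_real_indicator) (auto simp: Sigma_disk_volume)
      fix w
      show "\<bar>?k (w - v) * indicator ?S w\<bar> \<le> L * indicator ?S w"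
      proof (cases "w \<in> ?S")
        case True
        have "norm (w - v) \<le> 2 * r" using norm_triangle_ineq4[of w v] that True by (simp add: S_r)
        thus ?thesis using klow[of "w - v"] kup[of "w - v"] L1 True by (simp add: abs_le_iff) 
      qed simp
    qed
    also have "\<dots> = real N * L" by (simp add: Sigma_disk_volume)
    finally show ?thesis .
  qed
  have iKf: "integrable lborel (\<lambda>w. Kf w * p w)" if "integrable lborel p" "\<And>w. w \<notin> ?S \<Longrightarrow> p w = 0" for p :: "real^2 \<Rightarrow> real"
  proof (rule Bochner_Integration.integrable_bound)
    show "integrable lborel (\<lambda>w. real N * L * p w)" using that(1) by simp
    show "(\<lambda>w. Kf w * p w) \<in> borel_measurable lborel" using that(1) by auto
    show "AE w in lborel. norm (Kf w * p w) \<le> norm (real N * L * p w)"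
    proof (rule AE_I2)
      fix w
      show "norm (Kf w * p w) \<le> norm (real N * L * p w)"
        using Kf_abs[of w] that(2)[of w] L1 by (cases "w \<in> ?S") (auto simp: abs_mult intro!: mult_right_mono)
    qed
  qed
  have e00_le: "e00 \<le> - (real N)\<^sup>2 / 4 - real N * bg N"
  proof -
    have iS: "integrable lborel (\<lambda>w. indicator ?S w :: real)" by (intro integrable_real_indicator) (auto simp: Sigma_disk_volume)
    have "e00 \<le> (\<integral>w. - (pi / 2) * ((norm w)\<^sup>2 * indicator ?S w) - bg N * indicator ?S w \<partial>lborel)"
      unfolding e00_def
    proof (rule integral_mono)
      show "integrable lborel (\<lambda>w. Kf w * indicator ?S w)" by (rule iKf[OF iS]) auto
      show "integrable lborel (\<lambda>w. - (pi / 2) * ((norm w)\<^sup>2 * indicator ?S w) - bg N * indicator ?S w)"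
        by (intro Bochner_Integration.integrable_diff integrable_mult_right integral_background N0 iS)
      show "Kf w * indicator ?S w \<le> - (pi / 2) * ((norm w)\<^sup>2 * indicator ?S w) - bg N * indicator ?S w" for w
        using Kf_up[of w] by (simp add: indicator_def)
    qed
    also have "\<dots> = - (pi / 2) * ((real N)\<^sup>2 / (2 * pi)) - bg N * real N"
      using integral_background[OF N0(2)] iS by (simp add: Sigma_disk_volume)
    also have "\<dots> = - (real N)\<^sup>2 / 4 - real N * bg N" by simp
    finally show ?thesis .
  qed
  have s_le: "s \<le> real N * (real N / pi)"
  proof -
    have "s \<le> (\<Sum>j<N. r\<^sup>2)" unfolding s_def using x by (intro sum_mono power_mono) (auto simp: S_r)
    thus ?thesis by (simp add: r2)
  qed
  have bg_le: "bg N \<le> real N * L / 2"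
  proof -
    have "ln (real N / pi) \<le> L" unfolding L_def using N0 pi_ge_two by (intro ln_mono) (auto simp: divide_simps)
    hence "bg N \<le> real N / 2 * L" unfolding bg_def using N0 by (intro mult_left_mono) auto
    thus ?thesis by simp
  qed
  \<comment> \<open>The leading terms cancel: \<open>pi * s\<close>, the multiples of
    \<open>N * bg N\<close> and \<open>N\<^sup>2 / 4\<close> from the three bounds. There remain one
    \<open>bg N\<close>, the self-energies and the tolerance \<open>T\<close>, all at most of order
    \<open>N * (T + ln N)\<close>.\<close>
  have uu_le: "uu \<le> real N * (9 + T + L)"
  proof -
    have "- (pi / 2) * ((real N - 1) / real N) * s = pi * s / (2 * real N) - pi * s / 2" using N0 by (simp add: field_simps)
    moreover have "pi / 2 * s = pi * s / 2" by simp
    ultimately have en': "D \<le> - (pi * s) + pi * s / (2 * real N) - (real N - 1) * bg N + (real N)\<^sup>2 / 4 + real N * T"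
      using en by argo
    have "pi * s / (2 * real N) \<le> real N / 2" using s_le N0 by (simp add: field_simps)
    moreover have "uu \<le> D + real N * (L / 2) + 2 * (pi / 2 * s + real N * (bg N + 4)) + (- (real N)\<^sup>2 / 4 - real N * bg N)"
      unfolding uu_def using Sk_le q_ge e00_le by argo
    ultimately show ?thesis using en' bg_le by (simp add: algebra_simps) 
  qed
  \<comment> \<open>The two ends of the dipole need opposite inequalities. At \<open>y\<close> a
    point charge gives a lower bound for \<open>kd \<delta>\<close> through \<open>Lk_le_kd\<close>;
    at \<open>y'\<close> the upper bound by \<open>lnk\<close> becomes \<open>Lk 1\<close> only
    after smearing. The constant 6 covers \<open>1 + pi / 6 + 4\<close>.\<close>
  have br_ge: "br \<ge> spot 1 {..<N} x y - spot 1 {..<N} x y' - 6"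
  proof -
    have "(\<Sum>j<N. Lk 1 (y - x j)) \<le> (\<Sum>j<N. a j + \<delta>)"
      unfolding a_def using Lk_le_kd[OF \<delta>] kd_minus[of \<delta>] by (intro sum_mono) metis
    hence 1: "(\<Sum>j<N. a j) \<ge> spot 1 {..<N} x y - pi / 2 * (norm y)\<^sup>2 - 1"
      using N0 by (simp add: spot_def sum.distrib \<delta>_def)
    have 2: "- Kf y \<ge> pi / 2 * (norm y)\<^sup>2 + bg N" using Kf_up[OF y] by simp
    have "(\<Sum>j<N. b j) \<le> (\<Sum>j<N. Lk 1 (y' - x j))"
    proof (intro sum_mono)
      fix j
      have "b j \<le> (\<integral>w. lnk (w - x j) * kap 1 (w - y') \<partial>lborel)"
        unfolding b_def
      proof (rule integral_mono_AE)
        show "integrable lborel (\<lambda>w. lnk (w - x j) * kap 1 (w - y'))" by (rule integrable_smear_lnk) simp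
        show "integrable lborel (\<lambda>w. ?k (x j - w) * kap 1 (w - y'))"
        proof (rule integrable_compact_supp[where r="norm y' + 1"])
          have "(norm u)\<^sup>2 + \<delta> \<noteq> 0" for u :: "real^2" using \<delta> by (simp add: add_nonneg_eq_0_iff)
          thus "continuous_on UNIV (\<lambda>w. ?k (x j - w) * kap 1 (w - y'))"
            unfolding kd_def by (intro continuous_intros continuous_on_compose2[OF kap_continuous[of UNIV]]) auto
          fix w :: "real^2" assume "norm w > norm y' + 1"
          hence "norm (w - y') \<ge> 1" using norm_triangle_ineq2[of w y'] by linarith
          thus "?k (x j - w) * kap 1 (w - y') = 0" using kap_outside[of 1] by simp
        qed
        show "AE w in lborel. ?k (x j - w) * kap 1 (w - y') \<le> lnk (w - x j) * kap 1 (w - y')"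
          using AE_lborel_neq[of "x j"]
          by eventually_elim (use kd_le_lnk[OF \<delta>] kd_minus[of \<delta>] in \<open>auto intro!: mult_right_mono kap_nonneg\<close>)
      qed
      thus "b j \<le> Lk 1 (y' - x j)" using smear_lnk[of 1 "x j" y'] by simp
    qed
    hence 3: "(\<Sum>j<N. b j) \<le> spot 1 {..<N} x y' - pi / 2 * (norm y')\<^sup>2" by (simp add: spot_def)
    have "(\<integral>w. - (pi / 2) * ((norm w)\<^sup>2 * kap 1 (w - y')) - (bg N + 4) * kap 1 (w - y') \<partial>lborel) \<le> k2"
      unfolding k2_def
    proof (rule integral_mono)
      show "integrable lborel (\<lambda>w. Kf w * kap 1 (w - y'))"
        using iKf[OF pK(1)] pK(4) unfolding pK_def by (simp add: S_r)
      show "integrable lborel (\<lambda>w. - (pi / 2) * ((norm w)\<^sup>2 * kap 1 (w - y')) - (bg N + 4) * kap 1 (w - y'))"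
        using smear_norm_square[of 1 y'] integral_kap_centered[of 1 y'] by simp
      fix w
      show "- (pi / 2) * ((norm w)\<^sup>2 * kap 1 (w - y')) - (bg N + 4) * kap 1 (w - y') \<le> Kf w * kap 1 (w - y')"
      proof (cases "w \<in> ?S")
        case True
        have "(- (pi / 2) * (norm w)\<^sup>2 - bg N - 4) * kap 1 (w - y') \<le> Kf w * kap 1 (w - y')"
          by (rule mult_right_mono[OF Kf_low[OF True] kap_nonneg])
        thus ?thesis by (simp add: algebra_simps)
      next
        case False
        hence "kap 1 (w - y') = 0" using pK(4)[of w] by (simp add: pK_def S_r)
        thus ?thesis by simp
      qed
    qed
    hence "k2 \<ge> - (pi / 2) * ((norm y')\<^sup>2 + 1 / 3) - (bg N + 4)"
      using smear_norm_square[of 1 y'] integral_kap_centered[of 1 y'] by simp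
    hence 4: "k2 \<ge> - (pi / 2 * (norm y')\<^sup>2) - pi / 6 - bg N - 4" by (simp add: algebra_simps)
    show ?thesis unfolding br_def using 1 2 3 4 pi_less_4 by linarith
  qed
  have "2 * sqrt (real N) * br \<le> uu + real N * w" using psd tot by linarith
  also have "\<dots> \<le> real N * (9 + T + L) + real N * (3 * L)" using uu_le mult_left_mono[OF ww, of "real N"] by linarith
  also have "\<dots> = real N * (9 + T + 4 * L)" by (simp add: algebra_simps)
  also have "\<dots> = sqrt (real N) * (sqrt (real N) * (9 + T + 4 * L))" by (simp only: mult.assoc[symmetric] real_sqrt_mult_self abs_of_nat)
  finally have "sqrt (real N) * (2 * br) \<le> sqrt (real N) * (sqrt (real N) * (9 + T + 4 * L))" by (simp add: mult_ac)
  hence "2 * br \<le> sqrt (real N) * (9 + T + 4 * L)" by (rule mult_left_le_imp_le) (use N0 in simp)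
  thus ?thesis using br_ge unfolding L_def by linarith
qed

section \<open>Resampling a charge\<close>

text \<open>The energy up to an additive constant, see \<open>energy_conf_of_points\<close>.\<close>

definition En :: "nat \<Rightarrow> (nat \<Rightarrow> real^2) \<Rightarrow> real" where
  "En N x = 1 / 2 * (\<Sum>i<N. \<Sum>j\<in>{..<N} - {i}. lnk (x i - x j)) + pi / 2 * (\<Sum>j<N. (norm (x j))\<^sup>2)"

text \<open>Charge \<open>i\<close> occurs in both orders in the double sum, which cancels the
  factor \<open>1 / 2\<close>; the bracket does not depend on \<open>x i\<close>. This makes the
  effect of a move readable from \<open>pot\<close>.\<close>

lemma En_remove:
  assumes i: "i < N"
  shows "En N x = pot ({..<N} - {i}) x (x i)
    + (1 / 2 * (\<Sum>k\<in>{..<N} - {i}. \<Sum>j\<in>{..<N} - {i} - {k}. lnk (x k - x j)) + pi / 2 * (\<Sum>j\<in>{..<N} - {i}. (norm (x j))\<^sup>2))"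
proof -
  let ?J = "{..<N} - {i}"
  have "(\<Sum>k<N. \<Sum>j\<in>{..<N} - {k}. lnk (x k - x j)) = (\<Sum>j\<in>?J. lnk (x i - x j)) + (\<Sum>k\<in>?J. \<Sum>j\<in>{..<N} - {k}. lnk (x k - x j))"
    using i by (intro sum.remove) auto
  also have "(\<Sum>k\<in>?J. \<Sum>j\<in>{..<N} - {k}. lnk (x k - x j)) = (\<Sum>k\<in>?J. lnk (x i - x k) + (\<Sum>j\<in>?J - {k}. lnk (x k - x j)))"
  proof (intro sum.cong refl)
    fix k assume k: "k \<in> ?J"
    have "(\<Sum>j\<in>{..<N} - {k}. lnk (x k - x j)) = lnk (x k - x i) + (\<Sum>j\<in>{..<N} - {k} - {i}. lnk (x k - x j))"
      using i k by (intro sum.remove) auto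
    moreover have "{..<N} - {k} - {i} = ?J - {k}" by auto
    moreover have "lnk (x k - x i) = lnk (x i - x k)" using lnk_minus[of "x i - x k"] by simp
    ultimately show "(\<Sum>j\<in>{..<N} - {k}. lnk (x k - x j)) = lnk (x i - x k) + (\<Sum>j\<in>?J - {k}. lnk (x k - x j))" by simp
  qed
  also have "\<dots> = (\<Sum>j\<in>?J. lnk (x i - x j)) + (\<Sum>k\<in>?J. \<Sum>j\<in>?J - {k}. lnk (x k - x j))"
    by (rule sum.distrib)
  finally have 1: "(\<Sum>k<N. \<Sum>j\<in>{..<N} - {k}. lnk (x k - x j)) = (\<Sum>j\<in>?J. lnk (x i - x j)) + ((\<Sum>j\<in>?J. lnk (x i - x j)) + (\<Sum>k\<in>?J. \<Sum>j\<in>?J - {k}. lnk (x k - x j)))" .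
  have 2: "(\<Sum>j<N. (norm (x j))\<^sup>2) = (norm (x i))\<^sup>2 + (\<Sum>j\<in>?J. (norm (x j))\<^sup>2)"
    using i by (intro sum.remove) auto
  show ?thesis unfolding En_def 1 2 pot_def by (simp add: algebra_simps)
qed

lemma En_move:
  assumes i: "i < N"
  shows "En N (x(i := y)) - En N x = pot ({..<N} - {i}) x y - pot ({..<N} - {i}) x (x i)"
proof -
  have "pot ({..<N} - {i}) (x(i := y)) z = pot ({..<N} - {i}) x z" for z
    unfolding pot_def by (intro arg_cong2[where f="(+)"] sum.cong refl) auto
  moreover have "(\<Sum>k\<in>{..<N} - {i}. \<Sum>j\<in>{..<N} - {i} - {k}. lnk ((x(i := y)) k - (x(i := y)) j))
    = (\<Sum>k\<in>{..<N} - {i}. \<Sum>j\<in>{..<N} - {i} - {k}. lnk (x k - x j))"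
    by (intro sum.cong refl) auto
  moreover have "(\<Sum>j\<in>{..<N} - {i}. (norm ((x(i := y)) j))\<^sup>2) = (\<Sum>j\<in>{..<N} - {i}. (norm (x j))\<^sup>2)"
    by (intro sum.cong refl) auto
  ultimately show ?thesis unfolding En_remove[OF i] by simp
qed

definition gibbs :: "real \<Rightarrow> nat \<Rightarrow> (nat \<Rightarrow> real^2) \<Rightarrow> ennreal" where
  "gibbs \<beta> N x = ennreal (exp (- \<beta> * En N x))"

abbreviation disk_leb :: "nat \<Rightarrow> (real^2) measure" where
  "disk_leb N \<equiv> restrict_space lborel (Sigma_disk N)"

lemma Sigma_disk_borel[measurable]: "Sigma_disk N \<in> sets borel"
  by (simp add: Sigma_disk_def)

lemma emeasure_disk_leb: "emeasure (disk_leb N) (space (disk_leb N)) = ennreal (real N)"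
  by (simp add: emeasure_restrict_space space_restrict_space Sigma_disk_volume)

lemma finite_measure_disk_leb: "finite_measure (disk_leb N)"
  by (rule finite_measureI) (simp only: emeasure_disk_leb, simp)

lemma product_sigma_finite_disk_leb: "product_sigma_finite (\<lambda>_. disk_leb N)"
  by (intro product_sigma_finite.intro finite_measure.axioms(1)[OF finite_measure_disk_leb])

lemma space_ocp_base: "x \<in> space (ocp_base N) \<Longrightarrow> j < N \<Longrightarrow> x j \<in> Sigma_disk N"
  by (auto simp: ocp_base_def space_PiM space_restrict_space PiE_iff)

lemma component_measurable[measurable (raw)]:
  assumes "j < N" shows "(\<lambda>x. x j) \<in> measurable (ocp_base N) borel"
proof -
  have "(\<lambda>x. x j) \<in> measurable (ocp_base N) (disk_leb N)"
    unfolding ocp_base_def by (rule measurable_component_singleton) (use assms in auto)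
  thus ?thesis by (simp add: measurable_restrict_space2_iff)
qed

lemma En_measurable[measurable]: "En N \<in> borel_measurable (ocp_base N)"
  unfolding En_def by (intro borel_measurable_add borel_measurable_times borel_measurable_const borel_measurable_sum
     measurable_compose[OF _ lnk_measurable] borel_measurable_diff borel_measurable_power borel_measurable_norm component_measurable) auto

lemma gibbs_measurable[measurable]: "gibbs \<beta> N \<in> borel_measurable (ocp_base N)"
  unfolding gibbs_def by measurable

lemma pot_measurable2:
  assumes "J \<subseteq> {..<N}" "g \<in> measurable M (ocp_base N)" "h \<in> measurable M borel"
  shows "(\<lambda>p. pot J (g p) (h p)) \<in> borel_measurable M"
proof -
  have "(\<lambda>p. g p j) \<in> measurable M borel" if "j \<in> J" for j
    using measurable_compose[OF assms(2) component_measurable[of j]] that assms(1) by auto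
  thus ?thesis unfolding pot_def using assms(3)
    by (intro borel_measurable_add borel_measurable_times borel_measurable_const borel_measurable_sum
       measurable_compose[OF _ lnk_measurable] borel_measurable_diff borel_measurable_power borel_measurable_norm) auto
qed

text \<open>This is the reversibility behind resampling. Once \<open>y\<close> replaces the
  coordinate \<open>i\<close> in \<open>f\<close>, the old position enters only through
  \<open>g\<close> and integrates out on its own, while \<open>y\<close> takes over the role of the
  coordinate.\<close>

lemma PiM_swap:
  fixes M :: "'a measure" and I :: "'i set"
  assumes M: "product_sigma_finite (\<lambda>_::'i. M)" and I: "finite I" "i \<in> I"
    and f: "f \<in> borel_measurable (PiM I (\<lambda>_. M))" and g: "g \<in> borel_measurable M"
  shows "(\<integral>\<^sup>+x. g (x i) * (\<integral>\<^sup>+y. f (x(i := y)) \<partial>M) \<partial>PiM I (\<lambda>_. M)) = (\<integral>\<^sup>+y. g y \<partial>M) * (\<integral>\<^sup>+x. f x \<partial>PiM I (\<lambda>_. M))"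
proof -
  interpret product_sigma_finite "\<lambda>_::'i. M" by (rule M)
  let ?J = "I - {i}"
  have J: "finite ?J" "i \<notin> ?J" "insert i ?J = I" using I by auto
  have up: "(\<lambda>(x, y). x(i := y)) \<in> measurable (PiM ?J (\<lambda>_. M) \<Otimes>\<^sub>M M) (PiM I (\<lambda>_. M))"
    using measurable_add_dim[of i ?J "\<lambda>_. M"] J(3) by (simp add: split_beta')
  have fu: "(\<lambda>(x, y). f (x(i := y))) \<in> borel_measurable (PiM ?J (\<lambda>_. M) \<Otimes>\<^sub>M M)"
    using measurable_compose[OF up f] by (simp add: split_beta')
  have up2: "(\<lambda>(x, y). x(i := y)) \<in> measurable (PiM I (\<lambda>_. M) \<Otimes>\<^sub>M M) (PiM I (\<lambda>_. M))"
    using measurable_add_dim[of i I "\<lambda>_. M"] I by (simp add: split_beta' insert_absorb)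
  have fu2: "(\<lambda>(x, y). f (x(i := y))) \<in> borel_measurable (PiM I (\<lambda>_. M) \<Otimes>\<^sub>M M)"
    using measurable_compose[OF up2 f] by (simp add: split_beta')
  have m2: "(\<lambda>x. \<integral>\<^sup>+y. f (x(i := y)) \<partial>M) \<in> borel_measurable (PiM I (\<lambda>_. M))"
    using sigma_finite_measure.borel_measurable_nn_integral[OF sigma_finite_measures fu2] by simp
  have mJ: "(\<lambda>x. \<integral>\<^sup>+y. f (x(i := y)) \<partial>M) \<in> borel_measurable (PiM ?J (\<lambda>_. M))"
    using sigma_finite_measure.borel_measurable_nn_integral[OF sigma_finite_measures fu] by simp
  have gi: "(\<lambda>x. g (x i)) \<in> borel_measurable (PiM I (\<lambda>_. M))"
  proof -
    have "(\<lambda>x. x i) \<in> measurable (PiM I (\<lambda>_. M)) M"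
      using measurable_component_singleton[OF I(2), of "\<lambda>_. M"] by simp
    from measurable_compose[OF this g] show ?thesis .
  qed
  have "(\<integral>\<^sup>+x. g (x i) * (\<integral>\<^sup>+y. f (x(i := y)) \<partial>M) \<partial>PiM I (\<lambda>_. M))
     = (\<integral>\<^sup>+x. \<integral>\<^sup>+z. g z * (\<integral>\<^sup>+y. f (x(i := y)) \<partial>M) \<partial>M \<partial>PiM ?J (\<lambda>_. M))"
    using product_nn_integral_insert[OF J(1,2), of "\<lambda>x. g (x i) * (\<integral>\<^sup>+y. f (x(i := y)) \<partial>M)"] J(3) gi m2 by simp
  also have "\<dots> = (\<integral>\<^sup>+x. (\<integral>\<^sup>+z. g z \<partial>M) * (\<integral>\<^sup>+y. f (x(i := y)) \<partial>M) \<partial>PiM ?J (\<lambda>_. M))"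
    by (intro nn_integral_cong nn_integral_multc g)
  also have "\<dots> = (\<integral>\<^sup>+z. g z \<partial>M) * (\<integral>\<^sup>+x. \<integral>\<^sup>+y. f (x(i := y)) \<partial>M \<partial>PiM ?J (\<lambda>_. M))"
    by (rule nn_integral_cmult[OF mJ])
  also have "(\<integral>\<^sup>+x. \<integral>\<^sup>+y. f (x(i := y)) \<partial>M \<partial>PiM ?J (\<lambda>_. M)) = (\<integral>\<^sup>+x. f x \<partial>PiM I (\<lambda>_. M))"
    using product_nn_integral_insert[OF J(1,2), of f] J(3) f by simp
  finally show ?thesis .
qed

section \<open>Probability that a disc is unsettled\<close>

definition move_integral :: "real \<Rightarrow> nat \<Rightarrow> (real^2) set \<Rightarrow> nat \<Rightarrow> (nat \<Rightarrow> real^2) \<Rightarrow> ennreal" where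
  "move_integral \<beta> N B i x =
     (\<integral>\<^sup>+y. ennreal (exp (\<beta> * (pot ({..<N} - {i}) x (x i) - pot ({..<N} - {i}) x y))) * indicator B y \<partial>lborel)"

lemma move_integral_measurable:
  assumes [measurable]: "B \<in> sets borel" and i: "i < N"
  shows "move_integral \<beta> N B i \<in> borel_measurable (ocp_base N)"
proof -
  have "(\<lambda>p. pot ({..<N} - {i}) (fst p) (snd p)) \<in> borel_measurable (ocp_base N \<Otimes>\<^sub>M lborel)"
    by (rule pot_measurable2) auto
  moreover have "(\<lambda>p. pot ({..<N} - {i}) (fst p) (fst p i)) \<in> borel_measurable (ocp_base N \<Otimes>\<^sub>M lborel)"
    using i by (intro pot_measurable2 measurable_compose[OF measurable_fst component_measurable]) auto
  ultimately have "(\<lambda>p. ennreal (exp (\<beta> * (pot ({..<N} - {i}) (fst p) (fst p i) - pot ({..<N} - {i}) (fst p) (snd p)))) * indicator B (snd p))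
    \<in> borel_measurable (ocp_base N \<Otimes>\<^sub>M lborel)" by measurable
  from lborel.borel_measurable_nn_integral[OF this[folded split_beta'[of "\<lambda>x y. ennreal (exp (\<beta> * (pot ({..<N} - {i}) x (x i) - pot ({..<N} - {i}) x y))) * indicator B y"]]]
  show ?thesis unfolding move_integral_def[abs_def] .
qed

definition ncount :: "nat \<Rightarrow> (real^2) set \<Rightarrow> (nat \<Rightarrow> real^2) \<Rightarrow> nat" where
  "ncount N B x = card {j\<in>{..<N}. x j \<in> B}"

lemma ncount_measurable:
  assumes "B \<in> sets borel"
  shows "(\<lambda>x. real (ncount N B x)) \<in> borel_measurable (ocp_base N)"
proof -
  have e: "real (ncount N B x) = (\<Sum>j<N. indicator B (x j))" for x
    unfolding ncount_def by (simp add: indicator_def sum.If_cases Int_def conj_commute)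
  show ?thesis unfolding e
    by (intro borel_measurable_sum measurable_compose[OF component_measurable borel_measurable_indicator]) (use assms in auto)
qed

lemma ncount_update: "x i \<in> B \<Longrightarrow> y \<in> B \<Longrightarrow> ncount N B (x(i := y)) = ncount N B x"
  unfolding ncount_def by (rule arg_cong[where f=card]) auto

text \<open>The bound on the number of charges is part of the event: the estimate sums over the
  charges in \<open>B\<close>, and a small disc could not afford the trivial factor
  \<open>N\<close>.\<close>

definition unsettled :: "real \<Rightarrow> real \<Rightarrow> real \<Rightarrow> nat \<Rightarrow> (real^2) set \<Rightarrow> (nat \<Rightarrow> real^2) set" where
  "unsettled \<beta> T m N B = {x \<in> space (ocp_base N). real (ncount N B x) \<le> m \<and> \<not> settled \<beta> T {..<N} x B}"

lemma unsettled_sets: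
  assumes B: "B \<in> sets borel"
  shows "unsettled \<beta> T m N B \<in> sets (ocp_base N)"
proof -
  have "unsettled \<beta> T m N B = {x \<in> space (ocp_base N). real (ncount N B x) \<le> m} \<inter>
    (\<Union>i<N. {x \<in> space (ocp_base N). x i \<in> B} \<inter> {x \<in> space (ocp_base N). ennreal (exp (\<beta> * T)) < move_integral \<beta> N B i x})"
    unfolding unsettled_def settled_def move_integral_def by (auto simp: not_le)
  moreover have "{x \<in> space (ocp_base N). real (ncount N B x) \<le> m} \<in> sets (ocp_base N)"
    using ncount_measurable[OF B] by measurable
  moreover have "{x \<in> space (ocp_base N). x i \<in> B} \<in> sets (ocp_base N)" if "i < N" for i
    using measurable_sets[OF component_measurable[OF that] B] by (simp add: vimage_def Int_def conj_commute)
  moreover have "{x \<in> space (ocp_base N). ennreal (exp (\<beta> * T)) < move_integral \<beta> N B i x} \<in> sets (ocp_base N)" if "i < N" for i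
    using move_integral_measurable[OF B that] by measurable
  ultimately show ?thesis by auto
qed

text \<open>Resampling a charge in \<open>B\<close> changes neither the number of charges in \<open>B\<close> nor, after
  exchanging the old and the new position, the Gibbs weight.\<close>

lemma unsettled_weight:
  assumes B: "B \<in> sets borel" "B \<subseteq> Sigma_disk N" and m: "m \<ge> 0"
  shows "ennreal (exp (\<beta> * T)) * (\<integral>\<^sup>+x. gibbs \<beta> N x * indicator (unsettled \<beta> T m N B) x \<partial>ocp_base N)
    \<le> emeasure lborel B * ennreal m * (\<integral>\<^sup>+x. gibbs \<beta> N x \<partial>ocp_base N)"
proof -
  let ?U = "unsettled \<beta> T m N B"
  have [measurable]: "unsettled \<beta> T m N B \<in> sets (ocp_base N)" by (rule unsettled_sets[OF B(1)])
  let ?C = "{x. real (ncount N B x) \<le> m}"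
  define F where "F i x = gibbs \<beta> N x * indicator ?C x * indicator B (x i)" for i x
  have Cm: "{x \<in> space (ocp_base N). real (ncount N B x) \<le> m} \<in> sets (ocp_base N)"
    using ncount_measurable[OF B(1)] by measurable
  have iC: "(\<lambda>x. indicator ?C x :: ennreal) \<in> borel_measurable (ocp_base N)"
    using Cm by (subst borel_measurable_indicator_iff) (simp add: Int_def conj_commute)
  have iB: "(\<lambda>x. indicator B (x i) :: ennreal) \<in> borel_measurable (ocp_base N)" if "i < N" for i
    by (rule measurable_compose[OF component_measurable[OF that]]) (use B in auto)
  have iBd: "(indicator B :: _ \<Rightarrow> ennreal) \<in> borel_measurable (disk_leb N)"
    by (rule measurable_restrict_space1) (use B in auto)
  have Fm: "F i \<in> borel_measurable (ocp_base N)" if "i < N" for i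
    unfolding F_def using iC iB[OF that] by measurable
  have key: "F i x * move_integral \<beta> N B i x = indicator B (x i) * (\<integral>\<^sup>+y. F i (x(i := y)) \<partial>disk_leb N)"
    if i: "i < N" for i x
  proof (cases "x i \<in> B")
    case False thus ?thesis by (simp add: F_def)
  next
    case True
    have "(\<integral>\<^sup>+y. F i (x(i := y)) \<partial>disk_leb N) = (\<integral>\<^sup>+y. F i (x(i := y)) * indicator (Sigma_disk N) y \<partial>lborel)"
      by (rule nn_integral_restrict_space) simp
    also have "\<dots> = (\<integral>\<^sup>+y. (gibbs \<beta> N x * indicator ?C x) * (ennreal (exp (\<beta> * (pot ({..<N} - {i}) x (x i) - pot ({..<N} - {i}) x y))) * indicator B y) \<partial>lborel)"
    proof (intro nn_integral_cong)
      fix y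
      show "F i (x(i := y)) * indicator (Sigma_disk N) y =
        (gibbs \<beta> N x * indicator ?C x) * (ennreal (exp (\<beta> * (pot ({..<N} - {i}) x (x i) - pot ({..<N} - {i}) x y))) * indicator B y)"
      proof (cases "y \<in> B")
        case y: True
        have "- \<beta> * En N (x(i := y)) = - \<beta> * En N x + \<beta> * (pot ({..<N} - {i}) x (x i) - pot ({..<N} - {i}) x y)"
          using arg_cong[OF En_move[OF i, of x y], of "\<lambda>t. - \<beta> * t"] by (simp add: algebra_simps)
        hence "gibbs \<beta> N (x(i := y)) = gibbs \<beta> N x * ennreal (exp (\<beta> * (pot ({..<N} - {i}) x (x i) - pot ({..<N} - {i}) x y)))"
          unfolding gibbs_def by (simp only: exp_add ennreal_mult exp_ge_zero)
        thus ?thesis using y True B(2) ncount_update[of x i B y N, OF True y] by (auto simp: F_def indicator_def mult_ac)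
      qed (simp add: F_def)
    qed
    also have "\<dots> = (gibbs \<beta> N x * indicator ?C x) * move_integral \<beta> N B i x"
      unfolding move_integral_def
    proof (rule nn_integral_cmult)
      have [measurable]: "B \<in> sets borel" by (rule B)
      show "(\<lambda>y. ennreal (exp (\<beta> * (pot ({..<N} - {i}) x (x i) - pot ({..<N} - {i}) x y))) * indicator B y) \<in> borel_measurable lborel" by measurable
    qed
    finally show ?thesis using True by (simp add: F_def)
  qed
  have "ennreal (exp (\<beta> * T)) * (\<integral>\<^sup>+x. gibbs \<beta> N x * indicator ?U x \<partial>ocp_base N)
      = (\<integral>\<^sup>+x. ennreal (exp (\<beta> * T)) * (gibbs \<beta> N x * indicator ?U x) \<partial>ocp_base N)"
    by (intro nn_integral_cmult[symmetric]) measurable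
  \<comment> \<open>Markov's inequality for a charge that violates the bound, followed by a sum over
    all charges.\<close>
  also have "\<dots> \<le> (\<integral>\<^sup>+x. (\<Sum>i<N. F i x * move_integral \<beta> N B i x) \<partial>ocp_base N)"
  proof (intro nn_integral_mono)
    fix x
    show "ennreal (exp (\<beta> * T)) * (gibbs \<beta> N x * indicator ?U x) \<le> (\<Sum>i<N. F i x * move_integral \<beta> N B i x)"
    proof (cases "x \<in> ?U")
      case True
      then obtain i where i: "i < N" "x i \<in> B" "ennreal (exp (\<beta> * T)) < move_integral \<beta> N B i x"
        unfolding unsettled_def settled_def move_integral_def by (auto simp: not_le)
      have "ennreal (exp (\<beta> * T)) * (gibbs \<beta> N x * indicator ?U x) \<le> F i x * move_integral \<beta> N B i x"
        using True i by (simp add: F_def unsettled_def mult.commute mult_left_mono less_imp_le)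
      also have "\<dots> \<le> (\<Sum>i<N. F i x * move_integral \<beta> N B i x)"
        using i by (intro member_le_sum) auto
      finally show ?thesis .
    qed simp
  qed
  also have "\<dots> = (\<Sum>i<N. \<integral>\<^sup>+x. F i x * move_integral \<beta> N B i x \<partial>ocp_base N)"
    by (intro nn_integral_sum borel_measurable_times_ennreal Fm move_integral_measurable B) auto
  also have "\<dots> = (\<Sum>i<N. \<integral>\<^sup>+x. indicator B (x i) * (\<integral>\<^sup>+y. F i (x(i := y)) \<partial>disk_leb N) \<partial>ocp_base N)"
    by (intro sum.cong refl nn_integral_cong key) auto
  also have "\<dots> = (\<Sum>i<N. (\<integral>\<^sup>+y. indicator B y \<partial>disk_leb N) * (\<integral>\<^sup>+x. F i x \<partial>ocp_base N))"
    unfolding ocp_base_def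
    using Fm iBd unfolding ocp_base_def
    by (intro sum.cong refl PiM_swap product_sigma_finite_disk_leb) auto
  also have "(\<integral>\<^sup>+y. indicator B y \<partial>disk_leb N) = emeasure lborel B"
    using B by (subst nn_integral_restrict_space) (auto simp: indicator_inter_arith[symmetric] Int_absorb2)
  also have "(\<Sum>i<N. emeasure lborel B * (\<integral>\<^sup>+x. F i x \<partial>ocp_base N)) = emeasure lborel B * (\<integral>\<^sup>+x. (\<Sum>i<N. F i x) \<partial>ocp_base N)"
    using Fm by (subst nn_integral_sum) (auto simp: sum_distrib_left)
  also have "\<dots> \<le> emeasure lborel B * (\<integral>\<^sup>+x. ennreal m * gibbs \<beta> N x \<partial>ocp_base N)"
  proof (intro mult_left_mono nn_integral_mono)
    fix x
    show "(\<Sum>i<N. F i x) \<le> ennreal m * gibbs \<beta> N x"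
    proof (cases "real (ncount N B x) \<le> m")
      case True
      have e: "(\<Sum>i<N. F i x) = gibbs \<beta> N x * (\<Sum>i<N. indicator B (x i))"
        using True by (simp add: F_def sum_distrib_left)
      have "(\<Sum>i<N. indicator B (x i) :: ennreal) = ennreal (real (ncount N B x))"
        unfolding ncount_def by (simp add: indicator_def sum.If_cases Int_def conj_commute ennreal_of_nat_eq_real_of_nat)
      also have "\<dots> \<le> ennreal m" using True by (rule ennreal_leI)
      finally have "gibbs \<beta> N x * (\<Sum>i<N. indicator B (x i)) \<le> gibbs \<beta> N x * ennreal m"
        by (rule mult_left_mono) simp
      thus ?thesis unfolding e by (simp only: mult.commute)
    qed (simp add: F_def)
  qed simp
  also have "\<dots> = emeasure lborel B * ennreal m * (\<integral>\<^sup>+x. gibbs \<beta> N x \<partial>ocp_base N)"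
    by (subst nn_integral_cmult) (auto simp: mult.assoc)
  finally show ?thesis .
qed

text \<open>This is \<open>ocp\<close> with the factor coming from \<open>energy_const N\<close>
  cancelled between weight and normalisation, as \<open>ocp_eq_gibbs_measure\<close> shows for
  \<open>N \<ge> 1\<close>.\<close>

definition gibbs_measure :: "real \<Rightarrow> nat \<Rightarrow> (nat \<Rightarrow> real^2) measure" where
  "gibbs_measure \<beta> N = density (ocp_base N) (\<lambda>x. gibbs \<beta> N x / (\<integral>\<^sup>+y. gibbs \<beta> N y \<partial>ocp_base N))"

lemma unsettled_prob:
  assumes B: "B \<in> sets borel" "B \<subseteq> Sigma_disk N" and m: "m \<ge> 0"
  shows "emeasure (gibbs_measure \<beta> N) (unsettled \<beta> T m N B) \<le> emeasure lborel B * ennreal (m * exp (- \<beta> * T))"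
proof -
  define Z where "Z = (\<integral>\<^sup>+y. gibbs \<beta> N y \<partial>ocp_base N)"
  let ?I = "\<integral>\<^sup>+x. gibbs \<beta> N x * indicator (unsettled \<beta> T m N B) x \<partial>ocp_base N"
  have U[measurable]: "unsettled \<beta> T m N B \<in> sets (ocp_base N)" by (rule unsettled_sets[OF B(1)])
  have "emeasure (gibbs_measure \<beta> N) (unsettled \<beta> T m N B) = (\<integral>\<^sup>+x. gibbs \<beta> N x / Z * indicator (unsettled \<beta> T m N B) x \<partial>ocp_base N)"
    unfolding gibbs_measure_def Z_def[symmetric] using U by (subst emeasure_density) auto
  also have "\<dots> = (\<integral>\<^sup>+x. (gibbs \<beta> N x * indicator (unsettled \<beta> T m N B) x) * inverse Z \<partial>ocp_base N)"
    by (simp add: divide_ennreal_def mult_ac)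
  also have "\<dots> = ?I * inverse Z"
    using U by (intro nn_integral_multc) measurable
  also have "?I = ennreal (exp (- \<beta> * T)) * (ennreal (exp (\<beta> * T)) * ?I)"
    by (simp add: mult.assoc[symmetric] ennreal_mult[symmetric] exp_add[symmetric])
  also have "\<dots> * inverse Z \<le> ennreal (exp (- \<beta> * T)) * (emeasure lborel B * ennreal m * Z) * inverse Z"
    unfolding Z_def by (intro mult_right_mono mult_left_mono unsettled_weight B m) auto
  also have "\<dots> = emeasure lborel B * ennreal (m * exp (- \<beta> * T)) * (Z * inverse Z)"
    using m by (simp add: ennreal_mult mult_ac)
  \<comment> \<open>The inequality also holds when \<open>Z\<close> is 0 or infinite, the product
    being 0 then; hence the bound is independent of any information on the partition
    function.\<close>
  also have "Z * inverse Z \<le> 1"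
  proof (cases Z)
    case (real r)
    thus ?thesis by (cases "r = 0") (auto simp: inverse_ennreal ennreal_mult[symmetric])
  qed simp
  finally show ?thesis by (simp add: mult_left_mono)
qed

text \<open>The exceptional event collects the unsettled discs at all scales \<open>8^k * R\<close>
  up to order \<open>sqrt N\<close>, together with the event that the whole system is unsettled. Off
  it the descent is deterministic. The threshold \<open>N0\<close> depends on \<open>R\<close> but
  not on the centre.\<close>

lemma local_law:
  fixes \<beta> c :: real
  assumes \<beta>: "\<beta> > 0" and c: "c > 0"
  shows "\<exists>C R0. \<forall>R\<ge>R0. \<exists>N0. \<forall>N\<ge>N0. \<forall>a. cball a (c * sqrt (real N)) \<subseteq> Sigma_disk N \<longrightarrow>
    (\<exists>U\<in>sets (ocp_base N). emeasure (gibbs_measure \<beta> N) U \<le> ennreal (C / R\<^sup>2 + 1 / (real N)\<^sup>2) \<and>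
      (\<forall>x\<in>space (ocp_base N) - U. inj_on x {..<N} \<longrightarrow>
        (\<exists>m. (\<forall>y\<in>cball a (R - 1). m \<le> spot 1 {..<N} x y) \<and>
          (\<forall>y\<in>cball a (R / 2). spot 1 {..<N} x y \<le> m + tau (6 / \<beta> * ln R) R))))"
proof -
  define Tf where "Tf \<rho> = 6 / \<beta> * ln \<rho>" for \<rho>
  \<comment> \<open>The 32 comes from \<open>charge_count_bound\<close>. The second term makes the
    trivial count \<open>N\<close> admissible at the top scale, where \<open>sqrt N\<close> is at
    most \<open>16 / c\<close> times the radius.\<close>
  define C1 where "C1 = 32 + 256 / c\<^sup>2"
  have C1: "C1 \<ge> 32" by (simp add: C1_def)
  define b where "b = 6 / \<beta>"
  have b: "b > 0" using \<beta> by (simp add: b_def)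
  have "eventually (\<lambda>\<rho>. 17 * (b * ln (8 * \<rho>) + ln (2 * (8 * \<rho>)) + 7) < (\<rho> / 8)\<^sup>2) at_top"
    using b by real_asymp
  then obtain r0 where r0: "\<And>\<rho>. \<rho> \<ge> r0 \<Longrightarrow> 17 * (b * ln (8 * \<rho>) + ln (2 * (8 * \<rho>)) + 7) < (\<rho> / 8)\<^sup>2"
    by (auto simp: eventually_at_top_linorder)
  define R0 where "R0 = max 16 r0"
  have T: "0 \<le> tau (Tf (8 * \<rho>)) (8 * \<rho>) \<and> tau (Tf (8 * \<rho>)) (8 * \<rho>) < (\<rho> / 8)\<^sup>2 \<and> tau (Tf (8 * \<rho>)) (8 * \<rho>) + 1 \<le> \<rho>\<^sup>2"
    if \<rho>: "\<rho> \<ge> R0" for \<rho>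
  proof -
    have \<rho>1: "\<rho> \<ge> 16" "\<rho> \<ge> r0" using \<rho> by (auto simp: R0_def)
    have 1: "tau (Tf (8 * \<rho>)) (8 * \<rho>) < (\<rho> / 8)\<^sup>2" using r0[OF \<rho>1(2)] by (simp add: tau_def Tf_def b_def)
    have "ln (8 * \<rho>) \<ge> 0" "ln (2 * (8 * \<rho>)) \<ge> 0" using \<rho>1 by auto
    hence 2: "0 \<le> tau (Tf (8 * \<rho>)) (8 * \<rho>)" using \<beta> by (simp add: tau_def Tf_def)
    have "16\<^sup>2 \<le> \<rho>\<^sup>2" using \<rho>1 by (intro power_mono) auto
    hence "(\<rho> / 8)\<^sup>2 + 1 \<le> \<rho>\<^sup>2" by (simp add: power_divide)
    thus ?thesis using 1 2 by linarith
  qed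
  \<comment> \<open>The whole disc has area \<open>N\<close> and holds \<open>N\<close> charges, so
    the tolerance \<open>4 / \<beta> * ln N\<close> leaves probability at most
    \<open>N * N / N^4\<close>.\<close>
  define B where "B = 4 / \<beta>"
  have B: "B > 0" using \<beta> by (simp add: B_def)
  define C where "C = 2 * pi * C1"
  have "\<exists>N0. \<forall>N\<ge>N0. \<forall>a. cball a (c * sqrt (real N)) \<subseteq> Sigma_disk N \<longrightarrow>
    (\<exists>U\<in>sets (ocp_base N). emeasure (gibbs_measure \<beta> N) U \<le> ennreal (C / R\<^sup>2 + 1 / (real N)\<^sup>2) \<and>
      (\<forall>x\<in>space (ocp_base N) - U. inj_on x {..<N} \<longrightarrow>
        (\<exists>m. (\<forall>y\<in>cball a (R - 1). m \<le> spot 1 {..<N} x y) \<and>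
          (\<forall>y\<in>cball a (R / 2). spot 1 {..<N} x y \<le> m + tau (Tf R) R))))"
    if R: "R \<ge> R0" for R
  proof -
    have R16: "R \<ge> 16" using R by (simp add: R0_def)
    \<comment> \<open>The a priori oscillation, of order \<open>sqrt N * ln N\<close>, must lie
      below the square of one eighth of the top radius, which is of order \<open>N\<close>. The 128
      is \<open>2 * 8 * 8\<close>: the choice \<open>c / 2\<close>, the gap between consecutive
      scales, and the paraboloid radius \<open>R / 8\<close>.\<close>
    have "eventually (\<lambda>t. sqrt t * (9 + B * ln t + 4 * ln t) / 2 + 6 < (c / 128)\<^sup>2 * t) at_top"
    proof -
      have "((\<lambda>t. (sqrt t * (9 + B * ln t + 4 * ln t) / 2 + 6) / t) \<longlongrightarrow> 0) at_top" using B by real_asymp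
      moreover have "0 < (c / 128)\<^sup>2" using c by simp
      ultimately have "eventually (\<lambda>t. (sqrt t * (9 + B * ln t + 4 * ln t) / 2 + 6) / t < (c / 128)\<^sup>2) at_top"
        by (rule order_tendstoD(2))
      thus ?thesis using eventually_gt_at_top[of "0::real"]
        by eventually_elim (simp add: divide_less_eq)
    qed
    then obtain t0 where t0: "\<And>t. t \<ge> t0 \<Longrightarrow> sqrt t * (9 + B * ln t + 4 * ln t) / 2 + 6 < (c / 128)\<^sup>2 * t"
      by (auto simp: eventually_at_top_linorder)
    define N0 where "N0 = max 3 (nat \<lceil>max t0 (4 * (R / c)\<^sup>2)\<rceil>)"
    show ?thesis
    proof (intro exI[of _ N0] allI impI)
      fix N a assume N: "N \<ge> N0" and a: "cball a (c * sqrt (real N)) \<subseteq> Sigma_disk N"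
      have N3: "N \<ge> 3" using N by (simp add: N0_def)
      have Nt: "real N \<ge> t0" "real N \<ge> 4 * (R / c)\<^sup>2" using N unfolding N0_def by linarith+
      have "sqrt (4 * (R / c)\<^sup>2) \<le> sqrt (real N)" using Nt(2) by (rule real_sqrt_le_mono)
      hence "2 * (R / c) \<le> sqrt (real N)" using c R16 by (simp add: real_sqrt_mult)
      hence Rc: "R \<le> c / 2 * sqrt (real N)" using c by (simp add: field_simps)
      \<comment> \<open>The last scale within half of the bulk distance, so that enlarged discs
        still lie in \<open>Sigma_disk N\<close>; by maximality it is comparable to
        \<open>sqrt N\<close>.\<close>
      define K where "K = (GREATEST k. 8^k * R \<le> c / 2 * sqrt (real N))"
      have bound: "k \<le> nat \<lceil>c / 2 * sqrt (real N)\<rceil>" if "8^k * R \<le> c / 2 * sqrt (real N)" for k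
      proof -
        have "real k \<le> 8^k" using of_nat_less_two_power[of k, where 'a=real] power_mono[of 2 "8::real" k] by linarith
        also have "\<dots> \<le> 8^k * R" using R16 by simp
        finally show ?thesis using that by linarith
      qed
      have K: "8^K * R \<le> c / 2 * sqrt (real N)"
        unfolding K_def by (rule GreatestI_nat[where k=0 and b="nat \<lceil>c / 2 * sqrt (real N)\<rceil>"]) (use Rc bound in auto)
      have K': "c / 2 * sqrt (real N) < 8^Suc K * R"
      proof (rule ccontr)
        assume "\<not> ?thesis"
        hence "Suc K \<le> K" unfolding K_def
          by (intro Greatest_le_nat[where b="nat \<lceil>c / 2 * sqrt (real N)\<rceil>"]) (use bound in \<open>auto simp: K_def\<close>)
        thus False by simp
      qed
      have big: "8^k * R \<ge> 16" for k
      proof -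
        have "R \<le> 8^k * R" using R16 by simp
        thus ?thesis using R16 by linarith
      qed
      have inS: "cball a (8^k * R + 1) \<subseteq> Sigma_disk N" if "k \<le> K" for k
      proof -
        have "8^k * R \<le> 8^K * R" using that R16 by (intro mult_right_mono power_increasing) auto
        hence "8^k * R + 1 \<le> c * sqrt (real N)" using K big[of K] by linarith
        hence "cball a (8^k * R + 1) \<subseteq> cball a (c * sqrt (real N))" by auto
        thus ?thesis using a by blast
      qed
      define U1 where "U1 k = unsettled \<beta> (Tf (8^k * R)) (C1 * (8^k * R)\<^sup>2) N (cball a (8^k * R))" for k
      define U2 where "U2 = unsettled \<beta> (B * ln (real N)) (real N) N (Sigma_disk N)"
      define U where "U = (\<Union>k\<in>{..K}. U1 k) \<union> U2"
      have U1s: "U1 k \<in> sets (gibbs_measure \<beta> N)" for k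
        unfolding U1_def gibbs_measure_def by (simp add: unsettled_sets)
      have U2s: "U2 \<in> sets (gibbs_measure \<beta> N)"
        unfolding U2_def gibbs_measure_def by (simp add: unsettled_sets)
      have Us: "U \<in> sets (ocp_base N)"
        using U1s U2s unfolding U_def gibbs_measure_def by auto
      have p1: "emeasure (gibbs_measure \<beta> N) (U1 k) \<le> ennreal (pi * C1 / R\<^sup>2 * (1 / 64)^k)" if k: "k \<le> K" for k
      proof -
        define \<rho> where "\<rho> = 8^k * R"
        have \<rho>: "\<rho> \<ge> 16" using big[of k] by (simp add: \<rho>_def)
        have "cball a \<rho> \<subseteq> Sigma_disk N" using inS[OF k] by (auto simp: \<rho>_def)
        hence "emeasure (gibbs_measure \<beta> N) (U1 k) \<le> emeasure lborel (cball a \<rho>) * ennreal (C1 * \<rho>\<^sup>2 * exp (- \<beta> * Tf \<rho>))"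
          unfolding U1_def \<rho>_def[symmetric] using C1 by (intro unsettled_prob) auto
        also have "emeasure lborel (cball a \<rho>) = ennreal (pi * \<rho>\<^sup>2)" using \<rho> by (intro disc_volume) auto
        also have "exp (- \<beta> * Tf \<rho>) = 1 / \<rho> ^ 6"
        proof -
          have "- \<beta> * Tf \<rho> = - (6 * ln \<rho>)" using \<beta> by (simp add: Tf_def)
          also have "\<dots> = - ln (\<rho> ^ 6)" using \<rho> by (simp add: ln_realpow)
          finally show ?thesis using \<rho> by (simp add: exp_minus divide_inverse)
        qed
        also have "ennreal (pi * \<rho>\<^sup>2) * ennreal (C1 * \<rho>\<^sup>2 * (1 / \<rho> ^ 6)) = ennreal (pi * \<rho>\<^sup>2 * (C1 * \<rho>\<^sup>2 * (1 / \<rho> ^ 6)))"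
          using C1 by (intro ennreal_mult[symmetric]) auto
        also have "pi * \<rho>\<^sup>2 * (C1 * \<rho>\<^sup>2 * (1 / \<rho> ^ 6)) = pi * C1 / \<rho>\<^sup>2"
          using \<rho> by (simp add: divide_simps power_numeral_reduce)
        also have "\<dots> = pi * C1 / R\<^sup>2 * (1 / 64)^k"
        proof -
          have "\<rho>\<^sup>2 = 64^k * R\<^sup>2" by (simp add: \<rho>_def power_mult_distrib power2_eq_square flip: power_mult_distrib)
          thus ?thesis by (simp add: power_divide)
        qed
        finally show ?thesis .
      qed
      have p2: "emeasure (gibbs_measure \<beta> N) U2 \<le> ennreal (1 / (real N)\<^sup>2)"
      proof -
        have "emeasure (gibbs_measure \<beta> N) U2 \<le> emeasure lborel (Sigma_disk N) * ennreal (real N * exp (- \<beta> * (B * ln (real N))))"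
          unfolding U2_def by (intro unsettled_prob) auto
        also have "emeasure lborel (Sigma_disk N) = ennreal (real N)" by (rule Sigma_disk_volume)
        also have "exp (- \<beta> * (B * ln (real N))) = 1 / real N ^ 4"
        proof -
          have "- \<beta> * (B * ln (real N)) = - (4 * ln (real N))" using \<beta> by (simp add: B_def)
          also have "\<dots> = - ln (real N ^ 4)" using N3 by (simp add: ln_realpow)
          finally show ?thesis using N3 by (simp add: exp_minus divide_inverse)
        qed
        also have "ennreal (real N) * ennreal (real N * (1 / real N ^ 4)) = ennreal (real N * (real N * (1 / real N ^ 4)))"
          by (intro ennreal_mult[symmetric]) auto
        also have "real N * (real N * (1 / real N ^ 4)) = 1 / (real N)\<^sup>2"
          using N3 by (simp add: divide_simps power_numeral_reduce)
        finally show ?thesis .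
      qed
      have h1: "emeasure (gibbs_measure \<beta> N) U \<le> emeasure (gibbs_measure \<beta> N) (\<Union>k\<in>{..K}. U1 k) + emeasure (gibbs_measure \<beta> N) U2"
        unfolding U_def using U1s U2s by (intro emeasure_subadditive) auto
      have "emeasure (gibbs_measure \<beta> N) (\<Union>k\<in>{..K}. U1 k) \<le> (\<Sum>k\<le>K. emeasure (gibbs_measure \<beta> N) (U1 k))"
        using U1s by (intro emeasure_subadditive_finite) auto
      also have "\<dots> \<le> (\<Sum>k\<le>K. ennreal (pi * C1 / R\<^sup>2 * (1 / 64)^k))"
        by (intro sum_mono p1) auto
      also have "\<dots> = ennreal (\<Sum>k\<le>K. pi * C1 / R\<^sup>2 * (1 / 64)^k)" using C1 by (intro sum_ennreal) auto
      \<comment> \<open>The series over the scales is geometric, so the bound does not depend on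
        their number and hence not on \<open>N\<close>.\<close>
      also have "(\<Sum>k\<le>K. pi * C1 / R\<^sup>2 * (1 / 64)^k) \<le> C / R\<^sup>2"
      proof -
        have "(\<Sum>k\<le>K. (1 / 64 :: real)^k) \<le> (\<Sum>k. (1 / 64 :: real)^k)"
          by (intro sum_le_suminf summable_geometric) auto
        also have "\<dots> \<le> 2" by (subst suminf_geometric) auto
        finally have "pi * C1 / R\<^sup>2 * (\<Sum>k\<le>K. (1 / 64 :: real)^k) \<le> pi * C1 / R\<^sup>2 * 2"
          using C1 by (intro mult_left_mono) auto
        thus ?thesis by (simp add: sum_distrib_left C_def mult_ac)
      qed
      finally have h2: "emeasure (gibbs_measure \<beta> N) (\<Union>k\<in>{..K}. U1 k) \<le> ennreal (C / R\<^sup>2)"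
        by (simp add: ennreal_leI)
      have "emeasure (gibbs_measure \<beta> N) U \<le> ennreal (C / R\<^sup>2) + ennreal (1 / (real N)\<^sup>2)"
        using h1 add_mono[OF h2 p2] by (rule order_trans)
      hence pU: "emeasure (gibbs_measure \<beta> N) U \<le> ennreal (C / R\<^sup>2 + 1 / (real N)\<^sup>2)"
        using C1 by (subst ennreal_plus) (auto simp: C_def)
      have good: "\<exists>m. (\<forall>y\<in>cball a (R - 1). m \<le> spot 1 {..<N} x y) \<and>
          (\<forall>y\<in>cball a (R / 2). spot 1 {..<N} x y \<le> m + tau (Tf R) R)"
        if x: "x \<in> space (ocp_base N) - U" and inj: "inj_on x {..<N}" for x
      proof (rule spot_descent[where K=K and ?C1.0=C1 and \<beta>=\<beta> and \<Theta>="sqrt (real N) * (9 + B * ln (real N) + 4 * ln (real N)) / 2 + 6"])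
        show "settled \<beta> (Tf (8^k * R)) {..<N} x (cball a (8^k * R))"
          if "k \<le> K" "real (card {j \<in> {..<N}. x j \<in> cball a (8^k * R)}) \<le> C1 * (8^k * R)\<^sup>2" for k
          using x that unfolding U_def U1_def unsettled_def ncount_def by auto
        show "real (card {j \<in> {..<N}. x j \<in> cball a (8^K * R)}) \<le> C1 * (8^K * R)\<^sup>2"
        proof -
          have "card {j \<in> {..<N}. x j \<in> cball a (8^K * R)} \<le> card {..<N}" by (intro card_mono) auto
          hence "real (card {j \<in> {..<N}. x j \<in> cball a (8^K * R)}) \<le> real N" by simp
          also have "real N = (sqrt (real N))\<^sup>2" by simp
          also have "\<dots> \<le> (16 / c * (8^K * R))\<^sup>2" using K' c by (intro power_mono) (auto simp: field_simps)
          also have "\<dots> = 256 / c\<^sup>2 * (8^K * R)\<^sup>2" by (simp add: power_mult_distrib power_divide)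
          also have "\<dots> \<le> C1 * (8^K * R)\<^sup>2" unfolding C1_def by (intro mult_right_mono) auto
          finally show ?thesis .
        qed
        show "spot 1 {..<N} x y \<le> spot 1 {..<N} x y' + (sqrt (real N) * (9 + B * ln (real N) + 4 * ln (real N)) / 2 + 6)"
          if y: "y \<in> cball a (8^K * R)" "y' \<in> cball a (8^K * R)" for y y'
        proof -
          have sub: "cball a (8^K * R) \<subseteq> Sigma_disk N" "cball y' 1 \<subseteq> Sigma_disk N"
          proof -
            show "cball a (8^K * R) \<subseteq> Sigma_disk N" using inS[of K] by auto
            show "cball y' 1 \<subseteq> Sigma_disk N"
            proof
              fix z assume "z \<in> cball y' 1"
              hence "dist a z \<le> 8^K * R + 1" using y(2) dist_triangle[of a z y'] by simp
              thus "z \<in> Sigma_disk N" using inS[of K] by auto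
            qed
          qed
          have st: "settled \<beta> (B * ln (real N)) {..<N} x (Sigma_disk N)"
          proof -
            have "card {j \<in> {..<N}. x j \<in> Sigma_disk N} \<le> card {..<N}" by (intro card_mono) auto
            thus ?thesis using x unfolding U_def U2_def unsettled_def ncount_def by auto
          qed
          have "spot 1 {..<N} x y \<le> spot 1 {..<N} x y' + sqrt (real N) * (9 + B * ln (real N) + 4 * ln (real N)) / 2 + 6"
            by (rule spot_oscillation_top[OF N3 \<beta> _ inj st]) (use x space_ocp_base sub y B N3 in auto)
          thus ?thesis by simp
        qed
        show "sqrt (real N) * (9 + B * ln (real N) + 4 * ln (real N)) / 2 + 6 < (8^K * R / 8)\<^sup>2"
        proof -
          have "c / 128 * sqrt (real N) \<le> 8^K * R / 8" using K' by simp
          hence "(c / 128 * sqrt (real N))\<^sup>2 \<le> (8^K * R / 8)\<^sup>2" using c by (intro power_mono) auto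
          moreover have "(c / 128 * sqrt (real N))\<^sup>2 = (c / 128)\<^sup>2 * real N" by (simp add: power_mult_distrib power_divide)
          ultimately show ?thesis using t0[OF Nt(1)] by linarith
        qed
      qed (use inj \<beta> R16 C1 T R in auto)
      show "\<exists>U\<in>sets (ocp_base N). emeasure (gibbs_measure \<beta> N) U \<le> ennreal (C / R\<^sup>2 + 1 / (real N)\<^sup>2) \<and>
        (\<forall>x\<in>space (ocp_base N) - U. inj_on x {..<N} \<longrightarrow>
          (\<exists>m. (\<forall>y\<in>cball a (R - 1). m \<le> spot 1 {..<N} x y) \<and>
            (\<forall>y\<in>cball a (R / 2). spot 1 {..<N} x y \<le> m + tau (Tf R) R)))"
        using Us pU good by blast
    qed
  qed
  thus ?thesis unfolding Tf_def by blast
qed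

section \<open>Configurations\<close>

lemma mult_at_finite: "finite {x \<in> cball 0 r. mult_at X x \<noteq> 0}"
  using mult_at[of X] by auto

lemma mult_at_restrict: "mult_at (conf_restrict X A) x = (if x \<in> A then mult_at X x else 0)"
proof -
  have "finite {x \<in> cball 0 r. (if x \<in> A then mult_at X x else 0) \<noteq> 0}" for r
    by (rule finite_subset[OF _ mult_at_finite[of r X]]) auto
  thus ?thesis unfolding conf_restrict_def by (subst Abs_conf_inverse) auto
qed

lemma mult_at_points: "mult_at (conf_of_points N x) z = card {i. i < N \<and> x i = z}"
proof -
  have "finite {z \<in> cball 0 r. card {i. i < N \<and> x i = z} \<noteq> 0}" for r
    by (rule finite_subset[of _ "x ` {..<N}"]) (auto simp: card_eq_0_iff)
  hence "(\<lambda>z. card {i. i < N \<and> x i = z}) \<in> {m. \<forall>r. finite {x \<in> cball 0 r. m x \<noteq> 0}}" by blast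
  thus ?thesis by (simp only: conf_of_points_def Abs_conf_inverse)
qed

lemma sets_conf_measure[measurable_cong, simp]: "sets (conf_measure X) = sets borel"
  by (simp add: conf_measure_def)

lemma space_conf_measure[simp]: "space (conf_measure X) = UNIV"
  by (simp add: conf_measure_def)

lemma nn_integral_conf_measure:
  assumes "f \<in> borel_measurable borel"
  shows "(\<integral>\<^sup>+z. f z \<partial>conf_measure X) = (\<integral>\<^sup>+z. of_nat (mult_at X z) * f z \<partial>count_space UNIV)"
  unfolding conf_measure_def using assms
  by (subst nn_integral_distr) (auto simp: nn_integral_density)

lemma conf_measure_finite_integral:
  fixes f :: "real^2 \<Rightarrow> real"
  assumes f: "f \<in> borel_measurable borel" and F: "finite F" "\<And>z. mult_at X z \<noteq> 0 \<Longrightarrow> f z \<noteq> 0 \<Longrightarrow> z \<in> F"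
  shows "integrable (conf_measure X) f" "(\<integral>z. f z \<partial>conf_measure X) = (\<Sum>z\<in>F. real (mult_at X z) * f z)"
proof -
  have fin: "finite {z. real (mult_at X z) * f z \<noteq> 0}" by (rule finite_subset[OF _ F(1)]) (use F(2) in auto)
  have d: "density (count_space UNIV) (\<lambda>x. of_nat (mult_at X x)) = density (count_space UNIV) (\<lambda>x. ennreal (real (mult_at X x)))"
    by (simp add: ennreal_of_nat_eq_real_of_nat)
  have i: "integrable (density (count_space UNIV) (\<lambda>x. of_nat (mult_at X x))) f"
    unfolding d
  proof (subst integrable_density)
    have "(\<integral>\<^sup>+z. ennreal (norm (real (mult_at X z) * f z)) \<partial>count_space UNIV) = (\<Sum>z\<in>F. ennreal (norm (real (mult_at X z) * f z)))"
      by (rule nn_integral_count_space') (use F in auto)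
    also have "\<dots> < \<infinity>" by (simp add: sum_ennreal)
    finally show "integrable (count_space UNIV) (\<lambda>x. real (mult_at X x) *\<^sub>R f x)"
      by (intro integrableI_bounded) auto
  qed auto
  show "integrable (conf_measure X) f"
    unfolding conf_measure_def using f i by (subst integrable_distr_eq) auto
  have "(\<integral>z. f z \<partial>conf_measure X) = (\<integral>z. f z \<partial>density (count_space UNIV) (\<lambda>x. ennreal (real (mult_at X x))))"
    unfolding conf_measure_def using f d by (subst integral_distr) auto
  also have "\<dots> = (\<integral>z. real (mult_at X z) * f z \<partial>count_space UNIV)"
    by (subst integral_density) auto
  also have "\<dots> = (\<Sum>z | z \<in> UNIV \<and> real (mult_at X z) * f z \<noteq> 0. real (mult_at X z) * f z)"
    by (rule lebesgue_integral_count_space_finite_support) (use fin in auto)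
  also have "\<dots> = (\<Sum>z\<in>F. real (mult_at X z) * f z)"
    by (rule sum.mono_neutral_left) (use F in auto)
  finally show "(\<integral>z. f z \<partial>conf_measure X) = (\<Sum>z\<in>F. real (mult_at X z) * f z)" .
qed

lemma emeasure_conf_measure:
  assumes "A \<in> sets borel" "finite F" "\<And>z. mult_at X z \<noteq> 0 \<Longrightarrow> z \<in> A \<Longrightarrow> z \<in> F" "F \<subseteq> A"
  shows "emeasure (conf_measure X) A = of_nat (\<Sum>z\<in>F. mult_at X z)"
proof -
  have "emeasure (conf_measure X) A = (\<integral>\<^sup>+z. indicator A z \<partial>conf_measure X)"
    using assms(1) by simp
  also have "\<dots> = (\<integral>\<^sup>+z. of_nat (mult_at X z) * indicator A z \<partial>count_space UNIV)"
    using assms(1) by (subst nn_integral_conf_measure) auto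
  also have "\<dots> = (\<Sum>z\<in>F. of_nat (mult_at X z) * indicator A z)"
    by (rule nn_integral_count_space') (use assms in \<open>auto simp: indicator_def\<close>)
  also have "\<dots> = (\<Sum>z\<in>F. of_nat (mult_at X z))" using assms(4) by (intro sum.cong) auto
  finally show ?thesis by simp
qed

lemma sigma_finite_conf_measure: "sigma_finite_measure (conf_measure X)"
proof
  have "emeasure (conf_measure X) (cball 0 (real n)) \<noteq> \<infinity>" for n
  proof -
    have "emeasure (conf_measure X) (cball 0 (real n)) = of_nat (\<Sum>z\<in>{z \<in> cball 0 (real n). mult_at X z \<noteq> 0}. mult_at X z)"
      by (rule emeasure_conf_measure[OF _ mult_at_finite]) auto
    thus ?thesis by (simp only: infinity_ennreal_def ennreal_of_nat_neq_top not_False_eq_True)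
  qed
  thus "\<exists>A. countable A \<and> A \<subseteq> sets (conf_measure X) \<and> \<Union>A = space (conf_measure X) \<and> (\<forall>a\<in>A. emeasure (conf_measure X) a \<noteq> \<infinity>)"
    by (intro exI[of _ "range (\<lambda>n. cball 0 (real n))"]) (auto simp: real_arch_simple)
qed

text \<open>The first factor lives on the finite set \<open>S\<close>, so a product integral reduces
  to one-variable integrals at the atoms, and integrability has to be known only there.\<close>

lemma conf_pair_integral:
  fixes F :: "real^2 \<Rightarrow> real^2 \<Rightarrow> real"
  assumes \<nu>: "sigma_finite_measure \<nu>" "sets \<nu> = sets borel" and S: "finite S" "\<And>z. mult_at X z \<noteq> 0 \<Longrightarrow> z \<in> S"
    and F: "(\<lambda>p. F (fst p) (snd p)) \<in> borel_measurable (borel \<Otimes>\<^sub>M borel)" and i: "\<And>z. z \<in> S \<Longrightarrow> integrable \<nu> (F z)"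
  shows "integrable (conf_measure X \<Otimes>\<^sub>M \<nu>) (\<lambda>p. F (fst p) (snd p))"
    "(\<integral>p. F (fst p) (snd p) \<partial>(conf_measure X \<Otimes>\<^sub>M \<nu>)) = (\<Sum>z\<in>S. real (mult_at X z) * (\<integral>y. F z y \<partial>\<nu>))"
proof -
  interpret N: sigma_finite_measure \<nu> by (rule \<nu>)
  interpret C: sigma_finite_measure "conf_measure X" by (rule sigma_finite_conf_measure)
  interpret P: pair_sigma_finite "conf_measure X" \<nu> ..
  note [measurable_cong] = \<nu>(2)
  note [measurable] = F
  have Fm: "(\<lambda>p. F (fst p) (snd p)) \<in> borel_measurable (conf_measure X \<Otimes>\<^sub>M \<nu>)"
    using F by (simp add: measurable_cong_sets[OF sets_pair_measure_cong[OF sets_conf_measure \<nu>(2)] refl])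
  have m1: "(\<lambda>x. \<integral>y. norm (F x y) \<partial>\<nu>) \<in> borel_measurable borel"
    using N.borel_measurable_lebesgue_integral[of "\<lambda>x y. norm (F x y)" "borel"] F
    by (simp add: split_beta' measurable_cong_sets[OF sets_pair_measure_cong[OF refl \<nu>(2)] refl])
  have m2: "(\<lambda>x. \<integral>y. F x y \<partial>\<nu>) \<in> borel_measurable borel"
    using N.borel_measurable_lebesgue_integral[of "\<lambda>x y. F x y" "borel"] F
    by (simp add: split_beta' measurable_cong_sets[OF sets_pair_measure_cong[OF refl \<nu>(2)] refl])
  have ae: "AE z in conf_measure X. z \<in> S"
  proof (rule AE_I[of _ _ "- S"])
    show "emeasure (conf_measure X) (- S) = 0"
      using emeasure_conf_measure[of "- S" "{}" X] S by (auto simp: borel_comp finite_imp_closed)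
    show "- S \<in> sets (conf_measure X)" using S(1) by (auto simp: borel_comp finite_imp_closed)
  qed auto
  show int: "integrable (conf_measure X \<Otimes>\<^sub>M \<nu>) (\<lambda>p. F (fst p) (snd p))"
  proof (rule P.Fubini_integrable[OF Fm])
    show "integrable (conf_measure X) (\<lambda>x. \<integral>y. norm (F (fst (x, y)) (snd (x, y))) \<partial>\<nu>)"
      using conf_measure_finite_integral(1)[OF m1 S(1), of X] S(2) by simp
    show "AE x in conf_measure X. integrable \<nu> (\<lambda>y. F (fst (x, y)) (snd (x, y)))"
      using ae by eventually_elim (use i in simp)
  qed
  have "(\<integral>p. F (fst p) (snd p) \<partial>(conf_measure X \<Otimes>\<^sub>M \<nu>)) = (\<integral>x. \<integral>y. F x y \<partial>\<nu> \<partial>conf_measure X)"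
    using P.integral_fst'[OF int] by simp
  also have "\<dots> = (\<Sum>z\<in>S. real (mult_at X z) * (\<integral>y. F z y \<partial>\<nu>))"
    by (rule conf_measure_finite_integral(2)[OF m2 S(1)]) (use S(2) in auto)
  finally show "(\<integral>p. F (fst p) (snd p) \<partial>(conf_measure X \<Otimes>\<^sub>M \<nu>)) = (\<Sum>z\<in>S. real (mult_at X z) * (\<integral>y. F z y \<partial>\<nu>))" .
qed

lemma sum_mult_at_points:
  "(\<Sum>z\<in>x ` {..<N}. real (mult_at (conf_of_points N x) z) * g z) = (\<Sum>i<N. g (x i))"
proof -
  have "(\<Sum>i<N. g (x i)) = (\<Sum>z\<in>x ` {..<N}. \<Sum>i | i \<in> {..<N} \<and> x i = z. g (x i))"
    by (rule sum.image_gen) simp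
  also have "\<dots> = (\<Sum>z\<in>x ` {..<N}. real (mult_at (conf_of_points N x) z) * g z)"
    by (intro sum.cong refl) (simp add: mult_at_points lessThan_def)
  finally show ?thesis by simp
qed

lemma mult_at_points_supp: "mult_at (conf_of_points N x) z \<noteq> 0 \<Longrightarrow> z \<in> x ` {..<N}"
  by (auto simp: mult_at_points card_eq_0_iff)

lemma conf_points_integral:
  fixes f :: "real^2 \<Rightarrow> real"
  assumes "f \<in> borel_measurable borel"
  shows "integrable (conf_measure (conf_of_points N x)) f" "(\<integral>z. f z \<partial>conf_measure (conf_of_points N x)) = (\<Sum>i<N. f (x i))"
  using conf_measure_finite_integral[OF assms, of "x ` {..<N}" "conf_of_points N x"] mult_at_points_supp sum_mult_at_points[of N x f]
  by auto

text \<open>The constant part of the interaction between charges and background, plus the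
  self-energy of the background.\<close>

definition energy_const :: "nat \<Rightarrow> real" where
  "energy_const N = real N * bg N + 1 / 2 *
     (LINT z:{(x, y). x \<in> Sigma_disk N \<and> y \<in> Sigma_disk N \<and> x \<noteq> y}|(lborel \<Otimes>\<^sub>M lborel). - ln (norm (fst z - snd z)))"

text \<open>Inside the disc the background potential is a quadratic polynomial, so the two cross
  terms of the bilinear expansion together give the confinement \<open>pi / 2\<close> times the
  squared norms. This is how a Riesz-type double integral becomes the explicit
  \<open>En\<close>.\<close>

lemma energy_conf_of_points:
  assumes N: "N \<ge> 1" and x: "\<And>j. j < N \<Longrightarrow> x j \<in> Sigma_disk N"
  shows "energy N (conf_of_points N x) = En N x + energy_const N"
proof -
  let ?S = "Sigma_disk N"
  let ?A = "{(x, y). x \<in> ?S \<and> y \<in> ?S \<and> x \<noteq> y}"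
  let ?c = "conf_measure (conf_of_points N x)"
  define F where "F z w = indicator ?A (z, w) * lnk (z - w)" for z w
  have "?A \<in> sets (borel \<Otimes>\<^sub>M borel)"
  proof -
    have "?A = (?S \<times> ?S) \<inter> {p. fst p \<noteq> snd p}" by auto
    moreover have "{p :: (real^2) \<times> (real^2). fst p \<noteq> snd p} \<in> sets (borel \<Otimes>\<^sub>M borel)"
    proof -
      have "open {p :: (real^2) \<times> (real^2). fst p \<noteq> snd p}" by (intro open_Collect_neq continuous_intros)
      thus ?thesis by (subst borel_prod) (rule borel_open)
    qed
    ultimately show ?thesis by auto
  qed
  note [measurable] = this
  have Fm: "(\<lambda>p. F (fst p) (snd p)) \<in> borel_measurable (borel \<Otimes>\<^sub>M borel)"
    unfolding F_def by measurable
  have set_eq: "(LINT z:?A|M. - ln (norm (fst z - snd z))) = (\<integral>p. F (fst p) (snd p) \<partial>M)" for M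
    unfolding set_lebesgue_integral_def F_def lnk_def by simp
  have Fsym: "F z w = F w z" for z w
    unfolding F_def using lnk_minus[of "z - w"] by (auto simp: indicator_def)
  \<comment> \<open>At \<open>w = z\<close> both sides vanish because \<open>ln 0 = 0\<close>; thus
    removing the diagonal agrees with \<open>lnk\<close>, also for coincident charges.\<close>
  have Fz: "F z w = indicator ?S w * lnk (z - w)" if "z \<in> ?S" for z w
    using that by (auto simp: F_def indicator_def lnk_def)
  have S: "finite (x ` {..<N})" by simp
  note pm = conf_pair_integral[where X="conf_of_points N x", OF _ _ S mult_at_points_supp Fm]
  have A1: "(\<integral>p. F (fst p) (snd p) \<partial>(?c \<Otimes>\<^sub>M ?c)) = (\<Sum>i<N. \<Sum>j\<in>{..<N} - {i}. lnk (x i - x j))"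
  proof -
    have m: "F z \<in> borel_measurable borel" for z using measurable_Pair2[OF Fm, of z] by simp
    have "(\<integral>p. F (fst p) (snd p) \<partial>(?c \<Otimes>\<^sub>M ?c)) = (\<Sum>z\<in>x ` {..<N}. real (mult_at (conf_of_points N x) z) * (\<integral>y. F z y \<partial>?c))"
      by (rule pm(2)) (auto intro: sigma_finite_conf_measure conf_points_integral m)
    also have "\<dots> = (\<Sum>i<N. \<integral>y. F (x i) y \<partial>?c)" by (rule sum_mult_at_points)
    also have "\<dots> = (\<Sum>i<N. \<Sum>j<N. F (x i) (x j))" by (intro sum.cong refl conf_points_integral m)
    also have "\<dots> = (\<Sum>i<N. \<Sum>j\<in>{..<N} - {i}. lnk (x i - x j))"
    proof (rule sum.cong[OF refl])
      fix i assume i: "i \<in> {..<N}"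
      have "(\<Sum>j<N. F (x i) (x j)) = F (x i) (x i) + (\<Sum>j\<in>{..<N} - {i}. F (x i) (x j))"
        using i by (intro sum.remove) auto
      also have "\<dots> = (\<Sum>j\<in>{..<N} - {i}. lnk (x i - x j))"
        using x i by (auto simp: Fz lnk_def intro!: sum.cong)
      finally show "(\<Sum>j<N. F (x i) (x j)) = (\<Sum>j\<in>{..<N} - {i}. lnk (x i - x j))" .
    qed
    finally show ?thesis .
  qed
  have iL: "integrable lborel (F z) \<and> (\<integral>y. F z y \<partial>lborel) = - (pi / 2) * (norm z)\<^sup>2 - bg N" if z: "z \<in> ?S" for z
  proof -
    have "F z = (\<lambda>w. lnk (w - z) * indicator ?S w)"
      using lnk_minus[of "z - w" for w] by (auto simp: Fz[OF z] fun_eq_iff mult.commute)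
    thus ?thesis using background_potential[OF N z] by simp
  qed
  have inS: "z \<in> ?S" if "z \<in> x ` {..<N}" for z using that x by auto
  have A2i: "integrable (?c \<Otimes>\<^sub>M lborel) (\<lambda>p. F (fst p) (snd p))"
    by (rule pm(1)) (use iL inS in \<open>auto intro: lborel.sigma_finite_measure_axioms\<close>)
  have A2: "(\<integral>p. F (fst p) (snd p) \<partial>(?c \<Otimes>\<^sub>M lborel)) = (\<Sum>i<N. - (pi / 2) * (norm (x i))\<^sup>2 - bg N)"
  proof -
    have "(\<integral>p. F (fst p) (snd p) \<partial>(?c \<Otimes>\<^sub>M lborel)) = (\<Sum>z\<in>x ` {..<N}. real (mult_at (conf_of_points N x) z) * (\<integral>y. F z y \<partial>lborel))"
      by (rule pm(2)) (use iL inS in \<open>auto intro: lborel.sigma_finite_measure_axioms\<close>)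
    also have "\<dots> = (\<Sum>i<N. \<integral>y. F (x i) y \<partial>lborel)" by (rule sum_mult_at_points)
    also have "\<dots> = (\<Sum>i<N. - (pi / 2) * (norm (x i))\<^sup>2 - bg N)" using iL x by (intro sum.cong refl) auto
    finally show ?thesis .
  qed
  \<comment> \<open>The kernel is symmetric, so the remaining cross term equals \<open>A2\<close>
    after exchanging the factors.\<close>
  have A3: "(\<integral>p. F (fst p) (snd p) \<partial>(lborel \<Otimes>\<^sub>M ?c)) = (\<integral>p. F (fst p) (snd p) \<partial>(?c \<Otimes>\<^sub>M lborel))"
  proof -
    interpret C: sigma_finite_measure ?c by (rule sigma_finite_conf_measure)
    interpret P: pair_sigma_finite lborel ?c ..
    have m: "(\<lambda>(z, w). F z w) \<in> borel_measurable (lborel \<Otimes>\<^sub>M ?c)"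
      using Fm by (simp add: split_beta' measurable_cong_sets[OF sets_pair_measure_cong[OF sets_lborel sets_conf_measure] refl])
    show ?thesis using P.integral_product_swap[OF m] Fsym by (simp add: split_beta')
  qed
  show ?thesis
    unfolding energy_def diff_integral_def set_eq A1 A2 A3 energy_const_def En_def
    by (simp add: sum_subtractf sum_negf sum_distrib_left algebra_simps)
qed

lemma ocp_eq_gibbs_measure:
  assumes N: "N \<ge> 1" shows "ocp \<beta> N = gibbs_measure \<beta> N"
proof -
  define c where "c = ennreal (exp (- \<beta> * energy_const N))"
  have c: "c \<noteq> 0" "c \<noteq> \<top>" by (auto simp: c_def)
  have w: "ocp_weight \<beta> N x = c * gibbs \<beta> N x" if "x \<in> space (ocp_base N)" for x
  proof -
    have "- \<beta> * energy N (conf_of_points N x) = - \<beta> * energy_const N + - \<beta> * En N x"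
      using energy_conf_of_points[OF N, of x] space_ocp_base[OF that] by (simp add: algebra_simps)
    thus ?thesis unfolding ocp_weight_def gibbs_def c_def by (simp only: exp_add ennreal_mult exp_ge_zero)
  qed
  have "(\<integral>\<^sup>+y. ocp_weight \<beta> N y \<partial>ocp_base N) = (\<integral>\<^sup>+y. c * gibbs \<beta> N y \<partial>ocp_base N)"
    by (intro nn_integral_cong w)
  also have "\<dots> = c * (\<integral>\<^sup>+y. gibbs \<beta> N y \<partial>ocp_base N)" by (rule nn_integral_cmult) simp
  finally have Z: "(\<integral>\<^sup>+y. ocp_weight \<beta> N y \<partial>ocp_base N) = c * (\<integral>\<^sup>+y. gibbs \<beta> N y \<partial>ocp_base N)" .
  have can: "c * u / (c * v) = u / v" for u v
  proof -
    have "c * inverse c = 1" by (simp add: c_def inverse_ennreal ennreal_mult[symmetric])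
    moreover have "inverse (c * v) = inverse c * inverse v"
      using c by (intro ennreal_inverse_mult') (auto simp: less_top zero_less_iff_neq_zero)
    ultimately show ?thesis unfolding divide_ennreal_def by (metis mult.assoc mult.commute mult_1)
  qed
  show ?thesis unfolding ocp_def gibbs_measure_def Z
  proof (rule density_cong)
    show "(\<lambda>x. ocp_weight \<beta> N x / (c * (\<integral>\<^sup>+y. gibbs \<beta> N y \<partial>ocp_base N))) \<in> borel_measurable (ocp_base N)"
      by (subst measurable_cong[where g="\<lambda>x. c * gibbs \<beta> N x / (c * (\<integral>\<^sup>+y. gibbs \<beta> N y \<partial>ocp_base N))"]) (auto simp: w)
    show "AE x in ocp_base N. ocp_weight \<beta> N x / (c * (\<integral>\<^sup>+y. gibbs \<beta> N y \<partial>ocp_base N)) = gibbs \<beta> N x / (\<integral>\<^sup>+y. gibbs \<beta> N y \<partial>ocp_base N)"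
      by (rule AE_I2) (simp add: w can)
  qed simp
qed

lemma AE_disk_leb_neq: "AE z in disk_leb N. z \<noteq> w"
  by (subst AE_restrict_space_iff) (use AE_lborel_neq[of w] in \<open>auto elim!: eventually_mono\<close>)

text \<open>For each pair the coordinate \<open>i\<close> is integrated before the others; a single
  point has measure zero.\<close>

lemma AE_distinct: "AE x in ocp_base N. inj_on x {..<N}"
proof -
  have ne: "AE x in ocp_base N. x i \<noteq> x j" if ij: "i < N" "j < N" "i \<noteq> j" for i j
  proof -
    interpret product_sigma_finite "\<lambda>_::nat. disk_leb N" by (rule product_sigma_finite_disk_leb)
    let ?J = "{..<N} - {i}"
    have J: "finite ?J" "i \<notin> ?J" "insert i ?J = {..<N}" using ij by auto
    define f where "f x = (indicator {0} (x i - x j) :: ennreal)" for x :: "nat \<Rightarrow> real^2"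
    have fm: "f \<in> borel_measurable (ocp_base N)" unfolding f_def
      using component_measurable[OF ij(1)] component_measurable[OF ij(2)] by measurable
    have "(\<integral>\<^sup>+x. f x \<partial>ocp_base N) = (\<integral>\<^sup>+x. \<integral>\<^sup>+z. f (x(i := z)) \<partial>disk_leb N \<partial>PiM ?J (\<lambda>_. disk_leb N))"
      using product_nn_integral_insert[OF J(1,2), of f] J(3) fm unfolding ocp_base_def by simp
    also have "\<dots> = (\<integral>\<^sup>+x. 0 \<partial>PiM ?J (\<lambda>_. disk_leb N))"
    proof (intro nn_integral_cong)
      fix x
      have "(\<integral>\<^sup>+z. f (x(i := z)) \<partial>disk_leb N) = (\<integral>\<^sup>+z. 0 \<partial>disk_leb N)"
        by (rule nn_integral_cong_AE) (use AE_disk_leb_neq[where N=N and w="x j"] ij in \<open>auto elim!: eventually_mono simp: f_def\<close>)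
      thus "(\<integral>\<^sup>+z. f (x(i := z)) \<partial>disk_leb N) = 0" by simp
    qed
    finally have "(\<integral>\<^sup>+x. f x \<partial>ocp_base N) = 0" by simp
    hence "AE x in ocp_base N. f x = 0" using fm by (subst (asm) nn_integral_0_iff_AE) auto
    thus ?thesis by eventually_elim (auto simp: f_def indicator_def split: if_splits)
  qed
  have "AE x in ocp_base N. \<forall>p\<in>{..<N} \<times> {..<N}. fst p \<noteq> snd p \<longrightarrow> x (fst p) \<noteq> x (snd p)"
    by (subst AE_finite_all) (auto intro: ne)
  thus ?thesis by eventually_elim (auto simp: inj_on_def)
qed

text \<open>Continuity is checked on the generating sets of the vague topology, where it is that of
  a finite sum of test function values. It serves to make the map measurable: the Borel sets come
  from arbitrary unions of generators, which measurability of single integrals would not reach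
  directly.\<close>

lemma continuous_conf_of_points: "continuous_on UNIV (\<lambda>x :: nat \<Rightarrow> real^2. conf_of_points N (\<lambda>i. x i - a))"
  unfolding continuous_on_open_vimage[OF open_UNIV]
proof (intro allI impI)
  fix B :: "conf set" assume "open B"
  hence "generate_topology {{X. (LINT x|conf_measure X. f x) \<in> V} | (f :: real^2 \<Rightarrow> real) V.
        continuous_on UNIV f \<and> compact (closure {x. f x \<noteq> 0}) \<and> open V} B"
    by (simp add: open_conf_def)
  thus "open ((\<lambda>x. conf_of_points N (\<lambda>i. x i - a)) -` B \<inter> UNIV)"
  proof (induction B)
    case (Int A B)
    have "(\<lambda>x. conf_of_points N (\<lambda>i. x i - a)) -` (A \<inter> B) \<inter> UNIV
      = ((\<lambda>x. conf_of_points N (\<lambda>i. x i - a)) -` A \<inter> UNIV) \<inter> ((\<lambda>x. conf_of_points N (\<lambda>i. x i - a)) -` B \<inter> UNIV)" by auto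
    thus ?case using Int by (auto intro: open_Int)
  next
    case (UN K)
    have "(\<lambda>x. conf_of_points N (\<lambda>i. x i - a)) -` (\<Union>K) \<inter> UNIV = (\<Union>B\<in>K. (\<lambda>x. conf_of_points N (\<lambda>i. x i - a)) -` B \<inter> UNIV)" by auto
    thus ?case using UN by (auto intro: open_UN)
  next
    case (Basis S)
    then obtain f V where S: "S = {X. (LINT x|conf_measure X. f x) \<in> V}" and f: "continuous_on UNIV (f :: real^2 \<Rightarrow> real)" and V: "open V" by auto
    have "f \<in> borel_measurable borel" using f by (rule borel_measurable_continuous_onI)
    hence "(\<lambda>x. conf_of_points N (\<lambda>i. x i - a)) -` S \<inter> UNIV = (\<lambda>x. \<Sum>i<N. f (x i - a)) -` V"
      unfolding S by (auto simp: conf_points_integral)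
    moreover have "continuous_on UNIV (\<lambda>x. \<Sum>i<N. f (x i - a))"
      by (intro continuous_intros continuous_on_compose2[OF f] continuous_on_coordinatewise_then_product continuous_on_product_coordinates) auto
    ultimately show ?case using V by (simp add: open_vimage)
  qed simp
qed

lemma conf_of_points_measurable:
  "(\<lambda>x. conf_of_points N (\<lambda>i. x i - a)) \<in> measurable (gibbs_measure \<beta> N) borel"
proof -
  have 1: "(\<lambda>x :: nat \<Rightarrow> real^2. conf_of_points N (\<lambda>i. x i - a)) \<in> measurable borel borel"
    by (rule borel_measurable_continuous_onI[OF continuous_conf_of_points])
  have 2: "(\<lambda>x. x) \<in> measurable (ocp_base N) (PiM UNIV (\<lambda>_. borel))"
  proof (rule measurable_PiM_single')
    fix i :: nat
    show "(\<lambda>x. x i) \<in> measurable (ocp_base N) borel"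
    proof (cases "i < N")
      case False
      \<comment> \<open>Elements of the finite product are \<open>undefined\<close> off the index
        set, so these coordinates are constant.\<close>
      have "x i = undefined" if "x \<in> space (ocp_base N)" for x
        using that False by (auto simp: ocp_base_def space_PiM PiE_def extensional_def)
      thus ?thesis by (subst measurable_cong[where g="\<lambda>_. undefined"]) auto
    qed (rule component_measurable)
  qed auto
  have "(\<lambda>x. x) \<in> measurable (ocp_base N) (borel :: (nat \<Rightarrow> real^2) measure)"
    using 2 by (simp add: measurable_cong_sets[OF refl sets_PiM_equal_borel])
  from measurable_compose[OF this 1] show ?thesis
    by (simp add: gibbs_measure_def measurable_cong_sets[OF sets_density refl])
qed

section \<open>Fluctuations in the limit\<close>

lemma C2_along_mult:
  assumes "C2_along v f f1 f2" "C2_along v g g1 g2"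
  shows "C2_along v (\<lambda>y. f y * g y) (\<lambda>y. f1 y * g y + f y * g1 y) (\<lambda>y. f2 y * g y + 2 * f1 y * g1 y + f y * g2 y)"
  unfolding C2_along_def has_dderiv_def
proof (intro conjI allI)
  note a = assms[unfolded C2_along_def has_dderiv_def]
  fix y
  have d: "((\<lambda>t. f (y + t *\<^sub>R v)) has_real_derivative f1 y) (at 0)" "((\<lambda>t. f1 (y + t *\<^sub>R v)) has_real_derivative f2 y) (at 0)"
    "((\<lambda>t. g (y + t *\<^sub>R v)) has_real_derivative g1 y) (at 0)" "((\<lambda>t. g1 (y + t *\<^sub>R v)) has_real_derivative g2 y) (at 0)"
    using a by auto
  show "((\<lambda>t. f (y + t *\<^sub>R v) * g (y + t *\<^sub>R v)) has_real_derivative f1 y * g y + f y * g1 y) (at 0)"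
    by (rule derivative_eq_intros d refl)+ simp
  show "((\<lambda>t. f1 (y + t *\<^sub>R v) * g (y + t *\<^sub>R v) + f (y + t *\<^sub>R v) * g1 (y + t *\<^sub>R v)) has_real_derivative
      f2 y * g y + 2 * f1 y * g1 y + f y * g2 y) (at 0)"
    by (rule derivative_eq_intros d refl)+ (simp add: algebra_simps)
qed (use assms in \<open>auto simp: C2_along_def intro!: continuous_intros\<close>)

lemma smooth_fun_C2_along:
  assumes "smooth_fun f"
  shows "C2_along v f (iter_deriv f [v]) (iter_deriv f [v, v])"
proof -
  have d: "iter_deriv f vs differentiable (at x)" for vs x using assms by (simp add: smooth_fun_def)
  have c: "continuous_on UNIV (iter_deriv f vs)" for vs
    by (intro continuous_at_imp_continuous_on ballI differentiable_imp_continuous_within d)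
  have dd: "has_dderiv (iter_deriv f vs) v (iter_deriv f (v # vs))" for vs
    unfolding has_dderiv_def
  proof
    fix y
    let ?D = "frechet_derivative (iter_deriv f vs) (at y)"
    have lin: "linear ?D" by (rule linear_frechet_derivative[OF d])
    have D: "(iter_deriv f vs has_derivative ?D) (at (y + 0 *\<^sub>R v))"
      using iffD1[OF frechet_derivative_works d[of vs y]] by simp
    have "((\<lambda>t. y + t *\<^sub>R v) has_derivative (\<lambda>t. t *\<^sub>R v)) (at 0)" by (auto intro!: derivative_eq_intros)
    from has_derivative_compose[OF this D]
    have "((\<lambda>t. iter_deriv f vs (y + t *\<^sub>R v)) has_derivative (\<lambda>t. ?D (t *\<^sub>R v))) (at 0)" .
    moreover have "?D (t *\<^sub>R v) = ?D v * t" for t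
      using linear_cmul[OF lin, of t v] by simp
    ultimately show "((\<lambda>t. iter_deriv f vs (y + t *\<^sub>R v)) has_real_derivative iter_deriv f (v # vs) y) (at 0)"
      by (simp add: has_field_derivative_def)
  qed
  show ?thesis unfolding C2_along_def using dd[of "[]"] dd[of "[v]"] c[of "[]"] c[of "[v]"] c[of "[v, v]"] by simp
qed

lemma C2_along_zero_open:
  assumes f: "C2_along v f f1 f2" and O: "open O'" "\<And>y. y \<in> O' \<Longrightarrow> f y = 0" and y: "y \<in> O'"
  shows "f2 y = 0"
proof -
  have *: "g' y = 0" if d: "has_dderiv g v g'" and 0: "\<And>y. y \<in> O' \<Longrightarrow> g y = 0" and y: "y \<in> O'" for g g' y
  proof -
    have "open ((\<lambda>t. y + t *\<^sub>R v) -` O')" by (intro open_vimage continuous_intros O)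
    hence ev: "eventually (\<lambda>t. t \<in> (\<lambda>t. y + t *\<^sub>R v) -` O') (nhds 0)"
      by (rule eventually_nhds_in_open) (use y in simp)
    have "((\<lambda>t. g (y + t *\<^sub>R v)) has_real_derivative 0) (at 0)"
      by (subst DERIV_cong_ev[OF refl _ refl, where g="\<lambda>_. 0"])
         (use ev in \<open>auto elim!: eventually_mono intro: 0\<close>)
    moreover have "((\<lambda>t. g (y + t *\<^sub>R v)) has_real_derivative g' y) (at 0)"
      using d by (auto simp: has_dderiv_def)
    ultimately show ?thesis using DERIV_unique by blast
  qed
  have "f1 z = 0" if "z \<in> O'" for z using *[of f f1] f O(2) that by (auto simp: C2_along_def)
  thus ?thesis using *[of f1 f2] f y by (auto simp: C2_along_def)
qed

text \<open>The gradient of the logarithm of the norm is inversion in the unit circle. The exact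
  distortion of distances under inversion therefore controls the gradient of a dipole
  potential.\<close>

lemma inversion_dist:
  fixes z w :: "'a::real_inner"
  assumes "z \<noteq> 0" "w \<noteq> 0"
  shows "norm ((1 / (norm z)\<^sup>2) *\<^sub>R z - (1 / (norm w)\<^sup>2) *\<^sub>R w) = norm (z - w) / (norm z * norm w)"
proof -
  define A where "A = (norm z)\<^sup>2"
  define B where "B = (norm w)\<^sup>2"
  have AB: "A > 0" "B > 0" using assms by (auto simp: A_def B_def)
  have zz: "z \<bullet> z = A" "w \<bullet> w = B" by (simp_all add: A_def B_def power2_norm_eq_inner)
  have "(norm ((1 / A) *\<^sub>R z - (1 / B) *\<^sub>R w))\<^sup>2 = (1 / A)\<^sup>2 * A - 2 * (1 / A) * (1 / B) * (z \<bullet> w) + (1 / B)\<^sup>2 * B"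
    unfolding power2_norm_eq_inner inner_diff_left inner_diff_right inner_scaleR_left inner_scaleR_right zz
    using AB by (simp add: inner_commute power2_eq_square field_simps)
  also have "\<dots> = (A - 2 * (z \<bullet> w) + B) / (A * B)" using AB by (simp add: field_simps power2_eq_square)
  also have "A - 2 * (z \<bullet> w) + B = (norm (z - w))\<^sup>2"
    unfolding power2_norm_eq_inner inner_diff_left inner_diff_right zz by (simp add: inner_commute)
  also have "(norm (z - w))\<^sup>2 / (A * B) = (norm (z - w) / (norm z * norm w))\<^sup>2"
    by (simp add: A_def B_def power_divide power_mult_distrib)
  finally show ?thesis unfolding A_def[symmetric] B_def[symmetric]
    by (rule power2_eq_imp_eq) auto
qed

text \<open>The part of the partition of unity at scale \<open>2^i\<close>, times the potential of a dipole
  \<open>\<delta>_x - \<delta>_0\<close>; on the support of \<open>\<phi> i\<close> the smoothing of the logarithm has no effect.\<close>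

definition dip :: "(nat \<Rightarrow> real^2 \<Rightarrow> real) \<Rightarrow> nat \<Rightarrow> real^2 \<Rightarrow> real^2 \<Rightarrow> real" where
  "dip \<phi> i x y = \<phi> i y * (Lk (2^i / 4) (y - x) - Lk (2^i / 4) y)"

text \<open>The product rule gives three terms. On the annulus carrying \<open>\<phi> i\<close> both
  \<open>y\<close> and \<open>y - x\<close> have norm at least \<open>s\<close>, so the potential is
  a difference of logarithms: it is harmonic, of size \<open>norm x / 2^i\<close> with gradient of
  size \<open>norm x / 4^i\<close>. Paired with second and first derivatives of
  \<open>\<phi> i\<close>, both remaining terms are of order \<open>8^(-i)\<close>.\<close>

lemma has_lap_dip:
  assumes \<phi>: "smooth_fun (\<phi> i)" "\<And>y. \<not> (2^i / 2 \<le> norm y \<and> norm y \<le> 2 * 2^i) \<Longrightarrow> \<phi> i y = 0"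
    and C: "C \<ge> 0" "\<And>vs y. length vs \<le> 2 \<Longrightarrow> (\<forall>v\<in>set vs. norm v \<le> 1) \<Longrightarrow> \<bar>iter_deriv (\<phi> i) vs y\<bar> \<le> C / 2 ^ (i * length vs)"
    and x: "norm x \<le> 2^i / 4"
  shows "\<exists>l. has_lap (dip \<phi> i x) l \<and> (\<forall>y. \<bar>l y\<bar> \<le> 72 * C * norm x / 8 ^ i)"
proof -
  define s :: real where "s = 2^i / 4"
  have s: "s > 0" by (simp add: s_def)
  define g where "g y = Lk s (y - x) - Lk s y" for y
  define g1 where "g1 v y = 2 * ((y - x) \<bullet> v) * Lprof1 (s\<^sup>2) ((norm (y - x))\<^sup>2) - 2 * (y \<bullet> v) * Lprof1 (s\<^sup>2) ((norm y)\<^sup>2)" for v y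
  define L2 where "L2 v y = 4 * (y \<bullet> v)\<^sup>2 * Lprof2 (s\<^sup>2) ((norm y)\<^sup>2) + 2 * (norm v)\<^sup>2 * Lprof1 (s\<^sup>2) ((norm y)\<^sup>2)" for v y :: "real^2"
  define g2 where "g2 v y = L2 v (y - x) - L2 v y" for v y
  have gC: "C2_along v g (g1 v) (g2 v)" for v
    unfolding g_def[abs_def] g1_def[abs_def] g2_def[abs_def]
    using C2_along_diff[OF C2_along_translate[OF C2_along_Lk[OF s], where x=x] C2_along_Lk[OF s]] unfolding L2_def .
  define p1 where "p1 v = iter_deriv (\<phi> i) [v]" for v
  define p2 where "p2 v = iter_deriv (\<phi> i) [v, v]" for v
  define h2 where "h2 v y = p2 v y * g y + 2 * p1 v y * g1 v y + \<phi> i y * g2 v y" for v y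
  have fC: "C2_along v (dip \<phi> i x) (\<lambda>y. p1 v y * g y + \<phi> i y * g1 v y) (h2 v)" for v
    using C2_along_mult[OF smooth_fun_C2_along[OF \<phi>(1)] gC[of v], folded p1_def p2_def]
    unfolding dip_def[abs_def] g_def[abs_def] s_def h2_def[abs_def] .
  let ?e = "\<lambda>k. axis k 1 :: real^2"
  define l where "l y = h2 (?e 1) y + h2 (?e 2) y" for y
  have lap: "has_lap (dip \<phi> i x) l"
    unfolding has_lap_def l_def[abs_def] using fC by blast
  have ne: "norm (?e k) = 1" for k by (simp add: norm_axis_1)
  have "\<bar>l y\<bar> \<le> 72 * C * norm x / 8 ^ i" for y
  proof (cases "2^i / 2 \<le> norm y \<and> norm y \<le> 2 * 2^i")
    case False
    let ?O = "{y :: real^2. norm y < 2^i / 2} \<union> {y. norm y > 2 * 2^i}"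
    have "open ?O" by (intro open_Un open_Collect_less continuous_intros)
    hence "h2 (?e k) y = 0" for k
      by (rule C2_along_zero_open[OF fC]) (use False \<phi>(2) in \<open>auto simp: dip_def\<close>)
    thus ?thesis using C by (simp add: l_def)
  next
    case True
    hence y: "norm y \<ge> 2 * s" by (simp add: s_def)
    have xs: "norm x \<le> s" using x by (simp add: s_def)
    have yx: "norm (y - x) \<ge> s" using y xs norm_triangle_ineq2[of y x] by linarith
    have ys: "norm y \<ge> s" using y s by linarith
    have n0: "y \<noteq> 0" "y - x \<noteq> 0" using y yx s by auto
    have q: "\<not> (norm (y - x))\<^sup>2 < s\<^sup>2" "\<not> (norm y)\<^sup>2 < s\<^sup>2" using yx ys s by (simp_all add: not_less power_mono)
    have g_le: "\<bar>g y\<bar> \<le> norm x / s"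
    proof -
      have lnb: "\<bar>ln b - ln a\<bar> \<le> \<bar>b - a\<bar> / s" if "a \<ge> s" "b \<ge> s" for a b :: real
      proof -
        have up: "ln b - ln a \<le> \<bar>b - a\<bar> / s" if ab: "a \<ge> s" "b \<ge> s" for a b :: real
        proof -
          have "ln b - ln a = ln (b / a)" using ab s by (simp add: ln_div)
          also have "\<dots> \<le> b / a - 1" using ab s by (intro ln_le_minus_one) auto
          also have "\<dots> = (b - a) / a" using ab s by (simp add: field_simps)
          also have "\<dots> \<le> \<bar>b - a\<bar> / a" using ab s by (intro divide_right_mono) auto
          also have "\<dots> \<le> \<bar>b - a\<bar> / s" using ab s by (intro divide_left_mono) auto
          finally show ?thesis .
        qed
        show ?thesis using up[OF that] up[OF that(2,1)] by (simp add: abs_le_iff abs_minus_commute)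
      qed
      have "g y = ln (norm y) - ln (norm (y - x))" unfolding g_def using yx ys by (simp add: Lk_def)
      hence "\<bar>g y\<bar> \<le> \<bar>norm y - norm (y - x)\<bar> / s" using lnb[OF yx ys] by simp
      also have "\<bar>norm y - norm (y - x)\<bar> \<le> norm x" using norm_triangle_ineq3[of y "y - x"] by simp
      finally show ?thesis using s by (simp add: divide_right_mono)
    qed
    have g1_le: "\<bar>g1 (?e k) y\<bar> \<le> norm x / (2 * s\<^sup>2)" for k
    proof -
      have "g1 (?e k) y = ((1 / (norm y)\<^sup>2) *\<^sub>R y - (1 / (norm (y - x))\<^sup>2) *\<^sub>R (y - x)) \<bullet> ?e k"
        unfolding g1_def Lprof1_def using q by (simp add: inner_diff_left diff_divide_distrib)
      hence "\<bar>g1 (?e k) y\<bar> \<le> norm ((1 / (norm y)\<^sup>2) *\<^sub>R y - (1 / (norm (y - x))\<^sup>2) *\<^sub>R (y - x))"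
        using Cauchy_Schwarz_ineq2[of "(1 / (norm y)\<^sup>2) *\<^sub>R y - (1 / (norm (y - x))\<^sup>2) *\<^sub>R (y - x)" "?e k"] ne by simp
      also have "\<dots> = norm x / (norm y * norm (y - x))" using inversion_dist[OF n0] by simp
      also have "\<dots> \<le> norm x / (2 * s * s)" using y yx s n0 by (intro divide_left_mono mult_mono mult_pos_pos) auto
      finally show ?thesis by (simp add: power2_eq_square)
    qed
    \<comment> \<open>The second derivatives do not vanish separately, only their sum over the two
      axes does.\<close>
    have g2_0: "g2 (?e 1) y + g2 (?e 2) y = 0"
    proof -
      have L: "L2 (?e 1) z + L2 (?e 2) z = 0" if z: "\<not> (norm z)\<^sup>2 < s\<^sup>2" for z
      proof -
        have "(norm z)\<^sup>2 > 0" using z s by (smt (verit) zero_less_power)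
        moreover have "L2 (?e 1) z + L2 (?e 2) z = 4 * (norm z)\<^sup>2 * Lprof2 (s\<^sup>2) ((norm z)\<^sup>2) + 4 * Lprof1 (s\<^sup>2) ((norm z)\<^sup>2)"
          unfolding L2_def ne by (simp add: norm_square_real2[of z] algebra_simps)
        ultimately show ?thesis using z by (simp add: Lprof1_def Lprof2_def power2_eq_square)
      qed
      show ?thesis unfolding g2_def using L[OF q(1)] L[OF q(2)] by linarith
    qed
    have p1_le: "\<bar>p1 (?e k) y\<bar> \<le> C / 2^i" for k using C(2)[of "[?e k]" y] ne by (simp add: p1_def)
    have p2_le: "\<bar>p2 (?e k) y\<bar> \<le> C / 4^i" for k
    proof -
      have e: "(2::real) ^ (i + i) = 4 ^ i" "(2::real) ^ (i * 2) = 4 ^ i" by (simp_all add: power_add power_mult mult.commute[of i 2] flip: power_mult_distrib)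
      show ?thesis using C(2)[of "[?e k, ?e k]" y] ne by (simp add: p2_def e)
    qed
    have t1: "\<bar>p2 (?e k) y * g y\<bar> \<le> C / 4^i * (norm x / s)" for k
      unfolding abs_mult using p2_le g_le C by (intro mult_mono) auto
    have t2: "\<bar>p1 (?e k) y * g1 (?e k) y\<bar> \<le> C / 2^i * (norm x / (2 * s\<^sup>2))" for k
      unfolding abs_mult using p1_le g1_le C by (intro mult_mono) auto
    have ly: "l y = p2 (?e 1) y * g y + p2 (?e 2) y * g y + 2 * (p1 (?e 1) y * g1 (?e 1) y) + 2 * (p1 (?e 2) y * g1 (?e 2) y) + \<phi> i y * (g2 (?e 1) y + g2 (?e 2) y)"
      unfolding l_def h2_def by (simp add: algebra_simps)
    have gen: "\<bar>a + b + 2 * c + 2 * d\<bar> \<le> 2 * A + 4 * B"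
      if "\<bar>a\<bar> \<le> A" "\<bar>b\<bar> \<le> A" "\<bar>c\<bar> \<le> B" "\<bar>d\<bar> \<le> B" for a b c d A B :: real
      using that by linarith
    have "\<bar>l y\<bar> \<le> 2 * (C / 4^i * (norm x / s)) + 4 * (C / 2^i * (norm x / (2 * s\<^sup>2)))"
      using gen[OF t1[of 1] t1[of 2] t2[of 1] t2[of 2]] unfolding ly g2_0 mult_zero_right add_0_right .
    also have "C / 4^i * (norm x / s) = 4 * (C * norm x / 8^i)"
    proof -
      have "(4::real)^i * 2^i = 8^i" by (simp flip: power_mult_distrib)
      thus ?thesis by (simp add: s_def)
    qed
    also have "C / 2^i * (norm x / (2 * s\<^sup>2)) = 8 * (C * norm x / 8^i)"
    proof -
      have "(2::real)^i * (2^i)\<^sup>2 = 8^i" by (simp add: power2_eq_square flip: power_mult_distrib)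
      thus ?thesis by (simp add: s_def power_divide)
    qed
    \<comment> \<open>The terms add up to 40; the constant 72 leaves room.\<close>
    also have "2 * (4 * (C * norm x / 8^i)) + 4 * (8 * (C * norm x / 8^i)) \<le> 72 * C * norm x / 8 ^ i"

    proof -
      have "0 \<le> C * norm x / 8 ^ i" using C(1) by simp
      thus ?thesis by (simp add: mult.assoc)
    qed
    finally show ?thesis .
  qed
  thus ?thesis using lap by blast
qed

section \<open>Passing fluctuation bounds to the limit\<close>

definition fluct :: "conf \<Rightarrow> (real^2 \<Rightarrow> real) \<Rightarrow> real" where
  "fluct X f = (LINT y|conf_measure X. f y) - (LINT y|lborel. f y)"

text \<open>The Lebesgue term is constant in \<open>X\<close>, and the other term is one of the
  functions whose preimages generate the vague topology.\<close>

lemma continuous_fluct: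
  assumes "continuous_on UNIV f" "\<And>y. norm y > r \<Longrightarrow> f y = 0"
  shows "continuous_on UNIV (\<lambda>X. fluct X f)"
proof -
  have "compact (closure {x. f x \<noteq> 0})"
  proof -
    have "{x. f x \<noteq> 0} \<subseteq> cball 0 r" using assms(2) by force
    thus ?thesis by (meson bounded_cball bounded_subset compact_closure)
  qed
  have "continuous_on UNIV (\<lambda>X. LINT y|conf_measure X. f y)"
    unfolding continuous_on_open_vimage[OF open_UNIV]
  proof (intro allI impI)
    fix V :: "real set" assume V: "open V"
    have "open {X. (LINT x|conf_measure X. f x) \<in> V}"
      unfolding open_conf_def
      by (rule generate_topology.Basis) (use assms(1) \<open>compact _\<close> V in blast)
    thus "open ((\<lambda>X. LINT y|conf_measure X. f y) -` V \<inter> UNIV)" by (simp add: vimage_def)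
  qed
  thus ?thesis unfolding fluct_def by (intro continuous_intros)
qed

text \<open>One boundary point decides: the radial projection of \<open>a N\<close> onto the circle
  lies at distance \<open>r - norm (a N)\<close>, so a lower bound for the distance to the boundary
  is room for a concentric ball. At the origin any direction serves.\<close>

lemma in_bulk_ball:
  assumes "in_bulk a"
  shows "\<exists>c>0. eventually (\<lambda>N. cball (a N) (c * sqrt (real N)) \<subseteq> Sigma_disk N) sequentially"
proof -
  from assms have "0 < liminf (\<lambda>N. ereal (infdist (a N) (frontier (Sigma_disk N)) / sqrt (real N)))"
    by (simp add: in_bulk_def)
  then obtain c where c: "0 < ereal c" "ereal c < liminf (\<lambda>N. ereal (infdist (a N) (frontier (Sigma_disk N)) / sqrt (real N)))"
    using ereal_dense2 by blast
  have "eventually (\<lambda>N. ereal c < ereal (infdist (a N) (frontier (Sigma_disk N)) / sqrt (real N))) sequentially"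
    using c(2) by (rule less_LiminfD)
  hence "eventually (\<lambda>N. cball (a N) (c * sqrt (real N)) \<subseteq> Sigma_disk N) sequentially"
    using eventually_ge_at_top[of 1]
  proof eventually_elim
    case (elim N)
    define r where "r = sqrt (real N / pi)"
    have r: "r > 0" using elim by (simp add: r_def)
    have S: "Sigma_disk N = cball 0 r" by (simp add: Sigma_disk_def r_def)
    obtain u :: "real^2" where u: "norm u = 1" "a N = norm (a N) *\<^sub>R u"
    proof (cases "a N = 0")
      case True thus ?thesis using that[of "axis 1 1"] by (simp add: norm_axis_1)
    next
      case False thus ?thesis using that[of "a N /\<^sub>R norm (a N)"] by simp
    qed
    have aN: "norm (a N) \<le> r" using assms elim S by (auto simp: in_bulk_def)
    have "r *\<^sub>R u \<in> frontier (Sigma_disk N)" using u r by (simp add: S)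
    hence "infdist (a N) (frontier (Sigma_disk N)) \<le> dist (a N) (r *\<^sub>R u)" by (rule infdist_le)
    also have "dist (a N) (r *\<^sub>R u) = norm ((norm (a N) - r) *\<^sub>R u)"
      unfolding dist_norm by (subst (1) u(2)) (simp add: scaleR_diff_left)
    also have "\<dots> = r - norm (a N)" using u aN by simp
    finally have "c * sqrt (real N) < r - norm (a N)" using elim by (simp add: field_simps)
    thus ?case unfolding S
    proof -
      assume le: "c * sqrt (real N) < r - norm (a N)"
      show "cball (a N) (c * sqrt (real N)) \<subseteq> cball 0 r"
      proof
        fix z assume z: "z \<in> cball (a N) (c * sqrt (real N))"
        have "norm z \<le> norm (z - a N) + norm (a N)" using norm_triangle_ineq[of "z - a N" "a N"] by simp
        thus "z \<in> cball 0 r" using z le by (simp add: dist_norm norm_minus_commute)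
      qed
    qed
  qed
  thus ?thesis using c(1) by auto
qed

text \<open>The bound for finite systems passes to the limit because the event is open.\<close>

lemma limit_fluctuation:
  assumes \<beta>: "\<beta> > 0" and a: "in_bulk a" and P: "ocp_limit_point \<beta> a P"
  shows "\<exists>C R0. \<forall>R\<ge>R0. \<forall>(Q :: 'q set) f B. finite Q \<longrightarrow> B \<ge> 0 \<longrightarrow>
     (\<forall>q\<in>Q. (\<exists>l. has_lap (f q) l \<and> (\<forall>y. \<bar>l y\<bar> \<le> B)) \<and> (\<forall>y. norm y > R / 4 \<longrightarrow> f q y = 0)) \<longrightarrow>
     emeasure P {X. \<exists>q\<in>Q. \<bar>fluct X (f q)\<bar> > B * (R / 4 + 1)\<^sup>2 * (tau (6 / \<beta> * ln R) R + 1)} \<le> ennreal (C / R\<^sup>2)"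
proof -
  from P obtain r where P1: "prob_space P" "sets P = sets borel" and r: "strict_mono r"
    and w: "weak_conv_conf (\<lambda>n. ocp_seen_from \<beta> (r n) (a (r n))) P"
    by (auto simp: ocp_limit_point_def)
  interpret P: prob_space P by (rule P1)
  obtain c where c: "c > 0" and bulk: "eventually (\<lambda>N. cball (a N) (c * sqrt (real N)) \<subseteq> Sigma_disk N) sequentially"
    using in_bulk_ball[OF a] by blast
  obtain C R1 where CR: "\<And>R. R \<ge> R1 \<Longrightarrow> \<exists>N0. \<forall>N\<ge>N0. \<forall>a. cball a (c * sqrt (real N)) \<subseteq> Sigma_disk N \<longrightarrow>
    (\<exists>U\<in>sets (ocp_base N). emeasure (gibbs_measure \<beta> N) U \<le> ennreal (C / R\<^sup>2 + 1 / (real N)\<^sup>2) \<and>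
      (\<forall>x\<in>space (ocp_base N) - U. inj_on x {..<N} \<longrightarrow>
        (\<exists>m. (\<forall>y\<in>cball a (R - 1). m \<le> spot 1 {..<N} x y) \<and>
          (\<forall>y\<in>cball a (R / 2). spot 1 {..<N} x y \<le> m + tau (6 / \<beta> * ln R) R))))"
    using local_law[OF \<beta> c] by blast
  show ?thesis
  proof (rule exI[of _ "max C 0"], rule exI[of _ "max R1 16"], intro allI impI)
    fix R :: real and Q :: "'q set" and f :: "'q \<Rightarrow> real^2 \<Rightarrow> real" and B :: real
    assume R: "R \<ge> max R1 16" and Q: "finite Q" and B: "B \<ge> 0"
      and f: "\<forall>q\<in>Q. (\<exists>l. has_lap (f q) l \<and> (\<forall>y. \<bar>l y\<bar> \<le> B)) \<and> (\<forall>y. norm y > R / 4 \<longrightarrow> f q y = 0)"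
    have R16: "R \<ge> 16" "R \<ge> R1" using R by auto
    have "ln R \<ge> 0" "ln (2 * R) \<ge> 0" using R16 by auto
    hence tau0: "tau (6 / \<beta> * ln R) R \<ge> 0" using \<beta> by (simp add: tau_def)
    define b where "b = B * (R / 4 + 1)\<^sup>2 * (tau (6 / \<beta> * ln R) R + 1)"
    \<comment> \<open>A continuous function that is positive exactly on the event; continuity is the
      reason for restricting to finite \<open>Q\<close>.\<close>
    define u where "u X = (\<Sum>q\<in>Q. max 0 (\<bar>fluct X (f q)\<bar> - b))" for X
    have fc: "continuous_on UNIV (f q)" if "q \<in> Q" for q using f that has_lap_continuous(1) by blast
    have uc: "continuous_on UNIV u"
      unfolding u_def using f fc by (intro continuous_intros continuous_fluct[where r="R / 4"]) auto
    have u0: "u X \<ge> 0" for X unfolding u_def by (intro sum_nonneg) auto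
    have Ou: "{X. \<exists>q\<in>Q. \<bar>fluct X (f q)\<bar> > b} = {X. u X > 0}"
    proof -
      have "(u X > 0) = (\<exists>q\<in>Q. \<bar>fluct X (f q)\<bar> > b)" for X
      proof
        assume "u X > 0"
        show "\<exists>q\<in>Q. \<bar>fluct X (f q)\<bar> > b"
        proof (rule ccontr)
          assume "\<not> ?thesis"
          hence "u X = 0" unfolding u_def by (intro sum.neutral) (auto simp: not_less)
          thus False using \<open>u X > 0\<close> by simp
        qed
      next
        assume "\<exists>q\<in>Q. \<bar>fluct X (f q)\<bar> > b"
        thus "u X > 0" unfolding u_def using Q by (auto intro!: sum_pos2)
      qed
      thus ?thesis by auto
    qed
    \<comment> \<open>Bounded continuous functions increasing to the indicator of the open event.
      Weak convergence is used for each fixed \<open>k\<close>, and only then does \<open>k\<close>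
      tend to infinity.\<close>
    define \<theta> where "\<theta> k X = min 1 (real k * u X)" for k X
    have \<theta>c: "continuous_on UNIV (\<theta> k)" for k unfolding \<theta>_def by (intro continuous_intros uc)
    have \<theta>01: "0 \<le> \<theta> k X" "\<theta> k X \<le> 1" for k X unfolding \<theta>_def using u0 by auto
    have \<theta>b: "bounded (range (\<theta> k))" for k
      by (rule boundedI[where B=1]) (use \<theta>01 in auto)
    have [measurable]: "\<theta> k \<in> borel_measurable borel" for k by (rule borel_measurable_continuous_onI[OF \<theta>c])
    obtain N0 where N0: "\<And>N a. N \<ge> N0 \<Longrightarrow> cball a (c * sqrt (real N)) \<subseteq> Sigma_disk N \<Longrightarrow>
      (\<exists>U\<in>sets (ocp_base N). emeasure (gibbs_measure \<beta> N) U \<le> ennreal (C / R\<^sup>2 + 1 / (real N)\<^sup>2) \<and>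
        (\<forall>x\<in>space (ocp_base N) - U. inj_on x {..<N} \<longrightarrow>
          (\<exists>m. (\<forall>y\<in>cball a (R - 1). m \<le> spot 1 {..<N} x y) \<and>
            (\<forall>y\<in>cball a (R / 2). spot 1 {..<N} x y \<le> m + tau (6 / \<beta> * ln R) R))))"
      using CR[OF R16(2)] by blast
    have fin: "(LINT X|ocp_seen_from \<beta> N (a N). \<theta> k X) \<le> max C 0 / R\<^sup>2 + 1 / (real N)\<^sup>2"
      if N: "N \<ge> N0" "N \<ge> 1" and aN: "cball (a N) (c * sqrt (real N)) \<subseteq> Sigma_disk N" for N k
    proof -
      obtain U where U: "U \<in> sets (ocp_base N)" "emeasure (gibbs_measure \<beta> N) U \<le> ennreal (C / R\<^sup>2 + 1 / (real N)\<^sup>2)"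
        and good: "\<And>x. x \<in> space (ocp_base N) - U \<Longrightarrow> inj_on x {..<N} \<Longrightarrow>
          (\<exists>m. (\<forall>y\<in>cball (a N) (R - 1). m \<le> spot 1 {..<N} x y) \<and>
            (\<forall>y\<in>cball (a N) (R / 2). spot 1 {..<N} x y \<le> m + tau (6 / \<beta> * ln R) R))"
        using N0[OF N(1) aN] by blast
      let ?T = "\<lambda>x. conf_of_points N (\<lambda>i. x i - a N)"
      have zero: "u (?T x) = 0" if x: "x \<in> space (ocp_base N) - U" "inj_on x {..<N}" for x
      proof -
        obtain m where m: "\<forall>y\<in>cball (a N) (R - 1). m \<le> spot 1 {..<N} x y"
          "\<forall>y\<in>cball (a N) (R / 2). spot 1 {..<N} x y \<le> m + tau (6 / \<beta> * ln R) R"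
          using good[OF x] by blast
        have "\<bar>fluct (?T x) (f q)\<bar> \<le> b" if q: "q \<in> Q" for q
        proof -
          obtain l where l: "has_lap (f q) l" "\<And>y. \<bar>l y\<bar> \<le> B" using f q by blast
          have f0: "f q y = 0" if "norm y > R / 4" for y using f q that by blast
          have fm: "f q \<in> borel_measurable borel" by (rule borel_measurable_continuous_onI[OF fc[OF q]])
          have "fluct (?T x) (f q) = (\<Sum>j\<in>{..<N}. f q (x j - a N)) - (\<integral>y. f q (y - a N) \<partial>lborel)"
            unfolding fluct_def using fm by (simp add: conf_points_integral(2) integral_lborel_translate)
          also have "\<bar>\<dots>\<bar> \<le> B * (R / 4 + 1)\<^sup>2 * (tau (6 / \<beta> * ln R) R + 1)"
          proof (rule fluctuation_bound[where m=m and a="a N"])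
            show "has_lap (\<lambda>y. f q (y - a N)) (\<lambda>y. l (y - a N))" by (rule has_lap_translate[OF l(1)])
            show "f q (y - a N) = 0" if "y \<notin> cball (a N) (R / 4)" for y
              by (rule f0) (use that in \<open>simp add: dist_norm norm_minus_commute\<close>)
            \<comment> \<open>The support radius \<open>R / 4\<close> leaves the margins of
              \<open>fluctuation_bound\<close>: for \<open>R \<ge> 16\<close> both
              \<open>R / 4 + 2 \<le> R - 1\<close> and \<open>R / 4 + 1 \<le> R / 2\<close>
              hold.\<close>
            show "m \<le> spot 1 {..<N} x y" if "y \<in> cball (a N) (R / 4 + 2)" for y using m(1) that R16 by auto
            show "spot 1 {..<N} x y \<le> m + tau (6 / \<beta> * ln R) R" if "y \<in> cball (a N) (R / 4 + 1)" for y using m(2) that R16 by auto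
          qed (use l tau0 R16 in auto)
          finally show ?thesis by (simp add: b_def)
        qed
        thus ?thesis unfolding u_def by (intro sum.neutral) auto
      qed
      have sg: "sets (gibbs_measure \<beta> N) = sets (ocp_base N)" "space (gibbs_measure \<beta> N) = space (ocp_base N)"
        by (simp_all add: gibbs_measure_def)
      have AEinj: "AE x in gibbs_measure \<beta> N. inj_on x {..<N}"
        unfolding gibbs_measure_def by (subst AE_density) (use AE_distinct[of N] in \<open>auto elim!: eventually_mono\<close>)
      have "(LINT X|ocp_seen_from \<beta> N (a N). \<theta> k X) = (LINT x|gibbs_measure \<beta> N. \<theta> k (?T x))"
        unfolding ocp_seen_from_def ocp_eq_gibbs_measure[OF N(2)]
        by (rule integral_distr[OF conf_of_points_measurable]) simp
      also have "\<dots> = enn2real (\<integral>\<^sup>+x. ennreal (\<theta> k (?T x)) \<partial>gibbs_measure \<beta> N)"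
        by (rule integral_eq_nn_integral) (use \<theta>01 measurable_compose[OF conf_of_points_measurable, of "\<theta> k"] in auto)
      also have "\<dots> \<le> max C 0 / R\<^sup>2 + 1 / (real N)\<^sup>2"
      proof (rule enn2real_leI)
        have "(\<integral>\<^sup>+x. ennreal (\<theta> k (?T x)) \<partial>gibbs_measure \<beta> N) \<le> (\<integral>\<^sup>+x. indicator U x \<partial>gibbs_measure \<beta> N)"
        proof (rule nn_integral_mono_AE)
          show "AE x in gibbs_measure \<beta> N. ennreal (\<theta> k (?T x)) \<le> indicator U x"
            using AEinj AE_space
          proof eventually_elim
            case (elim x)
            show ?case
            proof (cases "x \<in> U")
              case True thus ?thesis using \<theta>01[of k "?T x"] by simp
            next
              case False
              hence "u (?T x) = 0" using elim by (intro zero) (auto simp: sg)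
              thus ?thesis by (simp add: \<theta>_def)
            qed
          qed
        qed
        also have "\<dots> = emeasure (gibbs_measure \<beta> N) U" using U(1) by (simp add: sg)
        also have "\<dots> \<le> ennreal (max C 0 / R\<^sup>2 + 1 / (real N)\<^sup>2)"
          using U(2) by (rule order_trans) (intro ennreal_leI add_mono divide_right_mono, auto)
        finally show "(\<integral>\<^sup>+x. ennreal (\<theta> k (?T x)) \<partial>gibbs_measure \<beta> N) \<le> ennreal (max C 0 / R\<^sup>2 + 1 / (real N)\<^sup>2)" .
      qed auto
      finally show ?thesis .
    qed
    have lim: "(LINT X|P. \<theta> k X) \<le> max C 0 / R\<^sup>2" for k
    proof (rule LIMSEQ_le)
      show "(\<lambda>n. LINT X|ocp_seen_from \<beta> (r n) (a (r n)). \<theta> k X) \<longlonglongrightarrow> (LINT X|P. \<theta> k X)"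
        using w \<theta>c \<theta>b by (auto simp: weak_conv_conf_def)
      have "(\<lambda>N. 1 / (real N)\<^sup>2) \<longlonglongrightarrow> 0" by real_asymp
      from LIMSEQ_subseq_LIMSEQ[OF this r] have "(\<lambda>n. 1 / (real (r n))\<^sup>2) \<longlonglongrightarrow> 0" by (simp add: o_def)
      hence "(\<lambda>n. max C 0 / R\<^sup>2 + 1 / (real (r n))\<^sup>2) \<longlonglongrightarrow> max C 0 / R\<^sup>2 + 0" by (intro tendsto_add tendsto_const)
      thus "(\<lambda>n. max C 0 / R\<^sup>2 + 1 / (real (r n))\<^sup>2) \<longlonglongrightarrow> max C 0 / R\<^sup>2" by simp
      have "eventually (\<lambda>N. N \<ge> max N0 1 \<and> cball (a N) (c * sqrt (real N)) \<subseteq> Sigma_disk N) sequentially"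
        using bulk eventually_ge_at_top[of "max N0 1"] by eventually_elim auto
      hence "eventually (\<lambda>n. r n \<ge> max N0 1 \<and> cball (a (r n)) (c * sqrt (real (r n))) \<subseteq> Sigma_disk (r n)) sequentially"
        using filterlim_subseq[OF r] by (rule eventually_compose_filterlim)
      hence "eventually (\<lambda>n. (LINT X|ocp_seen_from \<beta> (r n) (a (r n)). \<theta> k X) \<le> max C 0 / R\<^sup>2 + 1 / (real (r n))\<^sup>2) sequentially"
        by eventually_elim (rule fin, auto)
      thus "\<exists>N. \<forall>n\<ge>N. (LINT X|ocp_seen_from \<beta> (r n) (a (r n)). \<theta> k X) \<le> max C 0 / R\<^sup>2 + 1 / (real (r n))\<^sup>2"
        by (simp add: eventually_sequentially)
    qed
    have \<theta>mP: "\<theta> k \<in> borel_measurable P" for k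
      using borel_measurable_continuous_onI[OF \<theta>c[of k]] by (simp add: measurable_cong_sets[OF P1(2) refl])
    have "open {X. u X > 0}" using open_Collect_less[OF continuous_on_const uc, of 0] by simp
    hence Om: "{X. u X > 0} \<in> sets P" unfolding P1(2) by (rule borel_open)
    have conv: "(\<lambda>k. LINT X|P. \<theta> k X) \<longlonglongrightarrow> (LINT X|P. indicator {X. u X > 0} X)"
    proof (rule integral_dominated_convergence[where w="\<lambda>_. 1"])
      show "AE X in P. (\<lambda>k. \<theta> k X) \<longlonglongrightarrow> indicator {X. u X > 0} X"
      proof (rule AE_I2)
        fix X
        show "(\<lambda>k. \<theta> k X) \<longlonglongrightarrow> indicator {X. u X > 0} X"
        proof (cases "u X > 0")
          case True
          obtain k0 :: nat where k0: "real k0 \<ge> 1 / u X" using real_arch_simple by blast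
          have "\<theta> k X = 1" if "k \<ge> k0" for k
          proof -
            have "real k \<ge> 1 / u X" using k0 that by linarith
            thus ?thesis using True by (simp add: \<theta>_def field_simps)
          qed
          hence "eventually (\<lambda>k. \<theta> k X = 1) sequentially" by (rule eventually_sequentiallyI)
          thus ?thesis using True by (simp add: tendsto_eventually)
        next
          case False
          hence "u X = 0" using u0[of X] by simp
          thus ?thesis by (simp add: \<theta>_def)
        qed
      qed
    qed (use \<theta>mP \<theta>01 Om in auto)
    have "(LINT X|P. indicator {X. u X > 0} X) \<le> max C 0 / R\<^sup>2"
      by (rule LIMSEQ_le_const2[OF conv]) (use lim in auto)
    hence "measure P {X. u X > 0} \<le> max C 0 / R\<^sup>2" using Om by simp
    thus "emeasure P {X. \<exists>q\<in>Q. \<bar>fluct X (f q)\<bar> > B * (R / 4 + 1)\<^sup>2 * (tau (6 / \<beta> * ln R) R + 1)} \<le> ennreal (max C 0 / R\<^sup>2)"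
      unfolding b_def[symmetric] Ou by (simp add: P.emeasure_eq_measure ennreal_leI)
  qed
qed

lemma dyadic_partition_facts:
  assumes "dyadic_partition \<phi>"
  obtains C where "C \<ge> 0"
    and "\<And>i vs y. length vs \<le> 2 \<Longrightarrow> (\<forall>v\<in>set vs. norm v \<le> 1) \<Longrightarrow> \<bar>iter_deriv (\<phi> i) vs y\<bar> \<le> C / 2 ^ (i * length vs)"
    and "\<And>i. smooth_fun (\<phi> i)" and "\<And>i. continuous_on UNIV (\<phi> i)"
    and "\<And>i y. i \<ge> 1 \<Longrightarrow> \<not> (2^i / 2 \<le> norm y \<and> norm y \<le> 2 * 2^i) \<Longrightarrow> \<phi> i y = 0"
    and "\<And>i y. norm y > 2 * 2^i \<Longrightarrow> \<phi> i y = 0"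
    and "\<And>i y. \<bar>\<phi> i y\<bar> \<le> 1"
proof -
  note D = assms[unfolded dyadic_partition_def]
  have sm: "smooth_fun (\<phi> i)" and nn: "\<phi> i x \<ge> 0" and sums: "(\<lambda>i. \<phi> i x) sums 1"
    and s0: "x \<notin> cball 0 2 \<Longrightarrow> \<phi> 0 x = 0" for i x
    using D by (simp_all del: mem_cball)
  have s1: "\<phi> i x = 0" if "i \<ge> 1" "x \<notin> cball 0 (2 ^ (i + 1)) - cball 0 (2 ^ (i - 1))" for i x
    using D[THEN conjunct2, THEN conjunct2, THEN conjunct2, THEN conjunct2, THEN conjunct1] that by presburger
  from D[THEN conjunct2, THEN conjunct2, THEN conjunct2, THEN conjunct2, THEN conjunct2]
  obtain C where C: "\<forall>i. \<forall>k\<le>3. \<forall>vs x. length vs = k \<and> (\<forall>v\<in>set vs. norm v \<le> 1) \<longrightarrow>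
        \<bar>iter_deriv (\<phi> i) vs x\<bar> \<le> C / 2 ^ (i * k)" by (elim exE)
  have C: "\<bar>iter_deriv (\<phi> i) vs x\<bar> \<le> C / 2 ^ (i * k)" if "k \<le> 3" "length vs = k" "\<forall>v\<in>set vs. norm v \<le> 1" for i k vs x
    using C that by simp
  have "0 \<le> C" using order_trans[OF abs_ge_zero C[of 0 "[]" 0 0]] by simp
  show ?thesis
  proof (rule that[of C])
    show "C \<ge> 0" by fact
    show "\<bar>iter_deriv (\<phi> i) vs y\<bar> \<le> C / 2 ^ (i * length vs)" if "length vs \<le> 2" "\<forall>v\<in>set vs. norm v \<le> 1" for i vs y
      using C[OF _ refl that(2)] that(1) by simp
    show "smooth_fun (\<phi> i)" for i by (rule sm)
    show "continuous_on UNIV (\<phi> i)" for i using smooth_fun_C2_along[OF sm, of 0 i] by (simp add: C2_along_def)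
    show z: "\<phi> i y = 0" if i: "i \<ge> 1" "\<not> (2^i / 2 \<le> norm y \<and> norm y \<le> 2 * 2^i)" for i y
    proof (rule s1[OF i(1)])
      obtain j where "i = Suc j" using i(1) by (cases i) auto
      thus "y \<notin> cball 0 (2 ^ (i + 1)) - cball 0 (2 ^ (i - 1))" using i(2) by auto
    qed
    show "\<phi> i y = 0" if "norm y > 2 * 2^i" for i y
      using z[of i y] s0[of y] that by (cases "i = 0") auto
    show "\<bar>\<phi> i y\<bar> \<le> 1" for i y
    proof -
      have "(\<Sum>j\<in>{i}. \<phi> j y) \<le> (\<Sum>j. \<phi> j y)"
        by (rule sum_le_suminf) (use sums nn in \<open>auto simp: sums_iff\<close>)
      thus ?thesis using sums[of y] nn[of i y] by (simp add: sums_iff)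
    qed
  qed
qed

lemma summable_Suc_half: "summable (\<lambda>i. real (Suc i) * (1 / 2) ^ i)"
proof (rule summable_ratio_test[where c="3 / 4" and N=1])
  fix n :: nat assume n: "n \<ge> 1"
  have "real (Suc (Suc n)) * (1 / 2) \<le> 3 / 4 * real (Suc n)" using n by simp
  hence "real (Suc (Suc n)) * (1 / 2) * (1 / 2) ^ n \<le> 3 / 4 * real (Suc n) * (1 / 2) ^ n" by (rule mult_right_mono) simp
  thus "norm (real (Suc (Suc n)) * (1 / 2) ^ Suc n) \<le> 3 / 4 * norm (real (Suc n) * (1 / 2) ^ n)" by (simp add: mult_ac)
qed simp

text \<open>The threshold of \<open>limit_fluctuation\<close> for Laplacians bounded by
  \<open>K / 8 ^ i\<close> at \<open>R = 8 * 2^i\<close>; then \<open>R / 4\<close> is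
  \<open>2 * 2^i\<close>, the outer radius of the support of \<open>\<phi> i\<close>.\<close>

definition scale_bound :: "real \<Rightarrow> real \<Rightarrow> nat \<Rightarrow> real" where
  "scale_bound \<beta> K i = K / 8 ^ i * (2 * 2^i + 1)\<^sup>2 * (tau (6 / \<beta> * ln (8 * 2^i)) (8 * 2^i) + 1)"

lemma summable_scale_bound:
  assumes "\<beta> > 0" "K \<ge> 0"
  shows "summable (scale_bound \<beta> K)"
proof (rule summable_comparison_test_ev)
  \<comment> \<open>\<open>D\<close> collects the coefficients of \<open>i + 1\<close>:
    \<open>ln (8 * 2^i)\<close> is at most \<open>3 * (i + 1)\<close>, \<open>ln (16 * 2^i)\<close>
    at most \<open>4 * (i + 1)\<close>, and the constants 7 and 1 are absorbed likewise.\<close>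
  define D where "D = 17 * (6 / \<beta> * 3 + 4 + 7) + 1"
  show "summable (\<lambda>i. K * 9 * D * (real (Suc i) * (1 / 2) ^ i))" by (intro summable_mult summable_Suc_half)
  show "eventually (\<lambda>i. norm (scale_bound \<beta> K i) \<le> K * 9 * D * (real (Suc i) * (1 / 2) ^ i)) sequentially"
  proof (rule always_eventually, rule allI)
    fix i :: nat
    have l2: "ln 2 \<le> (1::real)" "ln 2 \<ge> (0::real)" using ln_le_minus_one[of "2::real"] by auto
    have m: "(real i + c) * ln 2 \<le> c * real (Suc i)" if "c \<ge> 1" for c
    proof -
      have "(real i + c) * ln 2 \<le> (real i + c) * 1" using l2(1) that by (intro mult_left_mono) auto
      also have "\<dots> \<le> c * real i + c" using that mult_right_mono[of 1 c "real i"] by simp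
      finally show ?thesis by (simp add: algebra_simps)
    qed
    have ln8: "ln (8 * 2^i :: real) = (real i + 3) * ln 2"
    proof -
      have "(8 * 2^i :: real) = 2 ^ (i + 3)" by (simp add: power_add)
      thus ?thesis by (simp add: ln_realpow)
    qed
    have ln16: "ln (2 * (8 * 2^i) :: real) = (real i + 4) * ln 2"
    proof -
      have "(2 * (8 * 2^i) :: real) = 2 ^ (i + 4)" by (simp add: power_add)
      thus ?thesis by (simp add: ln_realpow)
    qed
    have a: "ln (8 * 2^i :: real) \<le> 3 * real (Suc i)" "ln (8 * 2^i :: real) \<ge> 0"
      unfolding ln8 using m[of 3] l2(2) by auto
    have b: "ln (2 * (8 * 2^i) :: real) \<le> 4 * real (Suc i)" "ln (2 * (8 * 2^i) :: real) \<ge> 0"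
      unfolding ln16 using m[of 4] l2(2) by auto
    have g1: "6 / \<beta> * ln (8 * 2^i) \<le> 6 / \<beta> * (3 * real (Suc i))" using assms a by (intro mult_left_mono) auto
    have eq: "(17 * (6 / \<beta> * 3 + 4 + 7) + 1) * real (Suc i)
      = 17 * (6 / \<beta> * (3 * real (Suc i)) + 4 * real (Suc i) + 7 * real (Suc i)) + real (Suc i)"
      by (simp only: distrib_right distrib_left mult.assoc mult_1_left)
    have gen: "17 * (u + v + 7) + 1 \<le> z" if "u \<le> u'" "z = 17 * (u' + 4 * n + 7 * n) + n" "v \<le> 4 * n" "n \<ge> 1" for u u' v n z :: real
      using that by argo
    have t: "tau (6 / \<beta> * ln (8 * 2^i)) (8 * 2^i) + 1 \<le> D * real (Suc i)"
      unfolding tau_def D_def by (rule gen[OF g1 eq b(1)]) simp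
    have t0: "0 \<le> tau (6 / \<beta> * ln (8 * 2^i)) (8 * 2^i) + 1"
      unfolding tau_def using assms a(2) b(2) by simp
    have "(2 * 2^i + 1 :: real) \<le> 3 * 2^i" by simp
    hence "(2 * 2^i + 1 :: real)\<^sup>2 \<le> (3 * 2^i)\<^sup>2" by (intro power_mono) auto
    also have "(3 * 2^i :: real)\<^sup>2 = 9 * 4^i" by (simp add: power_mult_distrib power2_eq_square flip: power_mult_distrib)
    finally have s: "(2 * 2^i + 1 :: real)\<^sup>2 \<le> 9 * 4^i" .
    have "scale_bound \<beta> K i \<le> K / 8^i * (9 * 4^i) * (D * real (Suc i))"
      unfolding scale_bound_def using assms t s t0 by (intro mult_mono) auto
    also have "\<dots> = K * 9 * D * (real (Suc i) * (1 / 2) ^ i)"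
    proof -
      have "(8::real)^i = 4^i * 2^i" by (simp flip: power_mult_distrib)
      thus ?thesis by (simp add: power_one_over field_simps)
    qed
    finally have "scale_bound \<beta> K i \<le> K * 9 * D * (real (Suc i) * (1 / 2) ^ i)" .
    moreover have "scale_bound \<beta> K i \<ge> 0" unfolding scale_bound_def using assms t0 by auto
    ultimately show "norm (scale_bound \<beta> K i) \<le> K * 9 * D * (real (Suc i) * (1 / 2) ^ i)" by simp
  qed
qed

lemma dip_continuous:
  assumes "continuous_on UNIV (\<phi> i)" shows "continuous_on UNIV (dip \<phi> i x)"
  unfolding dip_def by (intro continuous_intros assms continuous_on_compose2[OF Lk_continuous[of _ UNIV]]) auto

lemma integrable_conf_measure_compact:
  fixes f :: "real^2 \<Rightarrow> real"
  assumes "f \<in> borel_measurable borel" "\<And>y. norm y > r \<Longrightarrow> f y = 0"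
  shows "integrable (conf_measure X) f"
  by (rule conf_measure_finite_integral(1)[OF assms(1) mult_at_finite[of r X]]) (use assms(2) in force)

text \<open>Continuity in the position of the dipole, needed to extend a bound from a dense set of
  positions to all of them. The common support of the dipoles gives the dominating function for both
  measures.\<close>

lemma fluct_dip_tendsto:
  assumes \<phi>: "continuous_on UNIV (\<phi> i)" "\<And>y. \<bar>\<phi> i y\<bar> \<le> 1" "\<And>y. norm y > 2 * 2^i \<Longrightarrow> \<phi> i y = 0"
    and q: "q \<longlonglongrightarrow> x"
  shows "(\<lambda>n. fluct X (dip \<phi> i (q n))) \<longlonglongrightarrow> fluct X (dip \<phi> i x)"
proof -
  define s :: real where "s = 2^i / 4"
  have s: "s > 0" by (simp add: s_def)
  have "bounded (range q)" by (rule convergent_imp_bounded[OF q])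
  then obtain D where D: "D > 0" "\<And>n. norm (q n) \<le> D" unfolding bounded_pos by auto
  define \<rho> where "\<rho> = 2 * 2^i + D"
  have "compact (Lk s ` cball 0 \<rho>)" by (intro compact_continuous_image Lk_continuous s) auto
  hence "bounded (Lk s ` cball 0 \<rho>)" by (rule compact_imp_bounded)
  then obtain B where B: "B > 0" "\<And>y. norm y \<le> \<rho> \<Longrightarrow> \<bar>Lk s y\<bar> \<le> B" unfolding bounded_pos by auto
  let ?w = "\<lambda>y. (2 * B) * indicator (cball 0 (2 * 2^i)) y :: real"
  have wb: "norm (dip \<phi> i (q n) y) \<le> ?w y" for n y
  proof (cases "norm y > 2 * 2^i")
    case False
    have 1: "norm (y - q n) \<le> \<rho>" using norm_triangle_ineq4[of y "q n"] D(2)[of n] False unfolding \<rho>_def by linarith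
    have 2: "norm y \<le> \<rho>" using False D(1) unfolding \<rho>_def by linarith
    have "\<bar>Lk s (y - q n) - Lk s y\<bar> \<le> 2 * B" using B(2)[OF 1] B(2)[OF 2] by linarith
    hence "\<bar>\<phi> i y\<bar> * \<bar>Lk s (y - q n) - Lk s y\<bar> \<le> 1 * (2 * B)" using \<phi>(2) by (intro mult_mono) auto
    thus ?thesis using False by (simp add: dip_def s_def abs_mult)
  qed (simp add: dip_def \<phi>(3))
  have lim: "(\<lambda>n. dip \<phi> i (q n) y) \<longlonglongrightarrow> dip \<phi> i x y" for y
  proof -
    have "isCont (Lk s) (y - x)" using Lk_continuous[OF s, of UNIV] by (simp add: continuous_on_eq_continuous_at)
    hence "(\<lambda>n. Lk s (y - q n)) \<longlonglongrightarrow> Lk s (y - x)" by (rule isCont_tendsto_compose) (intro tendsto_intros q)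
    thus ?thesis unfolding dip_def s_def by (intro tendsto_intros)
  qed
  have m: "dip \<phi> i z \<in> borel_measurable borel" for z by (rule borel_measurable_continuous_onI[OF dip_continuous[where \<phi>=\<phi> and i=i, OF \<phi>(1)]])
  have wm: "?w \<in> borel_measurable borel" by (intro borel_measurable_times borel_measurable_indicator borel_measurable_const) simp
  have 1: "(\<lambda>n. LINT y|lborel. dip \<phi> i (q n) y) \<longlonglongrightarrow> (LINT y|lborel. dip \<phi> i x y)"
  proof (rule integral_dominated_convergence[where w="?w"])
    show "integrable lborel ?w"
      by (intro integrable_mult_right integrable_real_indicator) (use emeasure_bounded_finite[OF bounded_cball] in auto)
  qed (use m lim wb in auto)
  have 2: "(\<lambda>n. LINT y|conf_measure X. dip \<phi> i (q n) y) \<longlonglongrightarrow> (LINT y|conf_measure X. dip \<phi> i x y)"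
  proof (rule integral_dominated_convergence[where w="?w"])
    show "integrable (conf_measure X) ?w"
      by (rule integrable_conf_measure_compact[OF wm, where r="2 * 2^i"]) auto
    show "dip \<phi> i x \<in> borel_measurable (conf_measure X)" using m by (simp add: measurable_cong_sets[OF sets_conf_measure refl])
    show "dip \<phi> i (q n) \<in> borel_measurable (conf_measure X)" for n using m by (simp add: measurable_cong_sets[OF sets_conf_measure refl])
    show "AE y in conf_measure X. (\<lambda>n. dip \<phi> i (q n) y) \<longlonglongrightarrow> dip \<phi> i x y" by (rule AE_I2) (rule lim)
    show "AE y in conf_measure X. norm (dip \<phi> i (q n) y) \<le> ?w y" for n by (rule AE_I2) (rule wb)
  qed
  show ?thesis unfolding fluct_def by (intro tendsto_diff 1 2)
qed

text \<open>Uncountably many positions are reached in three steps: finite families, for which the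
  limit bound has a constant independent of the family; their increasing union, a countable dense
  set; and continuity in the position. The failure probabilities decay at least like
  \<open>2^(-i)\<close>, so Borel-Cantelli applies.\<close>

lemma AE_dipole_fluctuations:
  assumes \<beta>: "\<beta> > 0" and a: "in_bulk a" and P: "ocp_limit_point \<beta> a P" and \<phi>: "dyadic_partition \<phi>" and \<rho>: "\<rho> > 0"
  shows "\<exists>b :: nat \<Rightarrow> real. summable b \<and>
    (AE X in P. eventually (\<lambda>i. \<forall>x\<in>ball 0 \<rho>. \<bar>fluct X (dip \<phi> i x)\<bar> \<le> b i) sequentially)"
proof -
  from P have P1: "prob_space P" "sets P = sets borel" by (auto simp: ocp_limit_point_def)
  interpret P: prob_space P by (rule P1)
  obtain C where C: "C \<ge> 0"
    and Cd: "\<And>i vs y. length vs \<le> 2 \<Longrightarrow> (\<forall>v\<in>set vs. norm v \<le> 1) \<Longrightarrow> \<bar>iter_deriv (\<phi> i) vs y\<bar> \<le> C / 2 ^ (i * length vs)"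
    and sm: "\<And>i. smooth_fun (\<phi> i)" and cont: "\<And>i. continuous_on UNIV (\<phi> i)"
    and supp: "\<And>i y. i \<ge> 1 \<Longrightarrow> \<not> (2^i / 2 \<le> norm y \<and> norm y \<le> 2 * 2^i) \<Longrightarrow> \<phi> i y = 0"
    and supp2: "\<And>i y. norm y > 2 * 2^i \<Longrightarrow> \<phi> i y = 0"
    and le1: "\<And>i y. \<bar>\<phi> i y\<bar> \<le> 1"
    by (rule dyadic_partition_facts[OF \<phi>]) (rule that; assumption)
  have "\<exists>C R0. \<forall>R\<ge>R0. \<forall>(Q :: (real^2) set) f B. finite Q \<longrightarrow> B \<ge> 0 \<longrightarrow>
     (\<forall>q\<in>Q. (\<exists>l. has_lap (f q) l \<and> (\<forall>y. \<bar>l y\<bar> \<le> B)) \<and> (\<forall>y. norm y > R / 4 \<longrightarrow> f q y = 0)) \<longrightarrow>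
     emeasure P {X. \<exists>q\<in>Q. \<bar>fluct X (f q)\<bar> > B * (R / 4 + 1)\<^sup>2 * (tau (6 / \<beta> * ln R) R + 1)} \<le> ennreal (C / R\<^sup>2)"
    by (rule limit_fluctuation[OF \<beta> a P])
  then obtain C2 R0 where lf0: "\<forall>R\<ge>R0. \<forall>(Q :: (real^2) set) f B. finite Q \<longrightarrow> B \<ge> 0 \<longrightarrow>
     (\<forall>q\<in>Q. (\<exists>l. has_lap (f q) l \<and> (\<forall>y. \<bar>l y\<bar> \<le> B)) \<and> (\<forall>y. norm y > R / 4 \<longrightarrow> f q y = 0)) \<longrightarrow>
     emeasure P {X. \<exists>q\<in>Q. \<bar>fluct X (f q)\<bar> > B * (R / 4 + 1)\<^sup>2 * (tau (6 / \<beta> * ln R) R + 1)} \<le> ennreal (C2 / R\<^sup>2)"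
    by (elim exE)
  note lf = lf0[THEN spec, THEN mp, THEN spec, THEN spec, THEN spec, THEN mp, THEN mp, THEN mp]
  define K where "K = 72 * C * \<rho>"
  have K: "K \<ge> 0" using C \<rho> by (simp add: K_def)
  define b where "b = scale_bound \<beta> K"
  obtain D :: "(real^2) set" where D: "countable D" "\<And>X. open X \<Longrightarrow> X \<noteq> {} \<Longrightarrow> \<exists>d\<in>D. d \<in> X"
    using countable_dense_exists by blast
  \<comment> \<open>Intersecting with the open ball keeps density in the ball, so every
    \<open>x\<close> there is a limit of points of \<open>Q\<close>.\<close>
  define Q where "Q = D \<inter> ball 0 \<rho>"
  have Qne: "Q \<noteq> {}" using D(2)[of "ball 0 \<rho>"] \<rho> by (auto simp: Q_def)
  have Qc: "countable Q" using D(1) by (simp add: Q_def)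
  define e where "e = from_nat_into Q"
  have eQ: "range e = Q" unfolding e_def by (rule range_from_nat_into[OF Qne Qc])
  define A where "A i = {X. \<exists>q\<in>Q. \<bar>fluct X (dip \<phi> i q)\<bar> > b i}" for i
  define An where "An i n = {X. \<exists>q\<in>e ` {..n}. \<bar>fluct X (dip \<phi> i q)\<bar> > b i}" for i n
  have fo: "open {X. \<bar>fluct X (dip \<phi> i q)\<bar> > b i}" for i q
  proof (rule open_Collect_less[OF continuous_on_const continuous_on_rabs])
    have "dip \<phi> i q y = 0" if "norm y > 2 * 2^i" for y unfolding dip_def supp2[OF that] by simp
    thus "continuous_on UNIV (\<lambda>X. fluct X (dip \<phi> i q))"
      by (rule continuous_fluct[OF dip_continuous[where \<phi>=\<phi> and i=i, OF cont]])
  qed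
  have "An i n = (\<Union>q\<in>e ` {..n}. {X. \<bar>fluct X (dip \<phi> i q)\<bar> > b i})" for i n by (auto simp: An_def)
  hence Ano: "open (An i n)" for i n using fo by auto
  have Ans: "An i n \<in> sets P" for i n unfolding P1(2) using Ano by (rule borel_open)
  have AU: "A i = (\<Union>n. An i n)" for i unfolding A_def An_def eQ[symmetric] by auto
  have As: "A i \<in> sets P" for i unfolding AU using Ans by auto
  have small: "emeasure P (A i) \<le> ennreal (C2 / (8 * 2^i)\<^sup>2)"
    if i: "8 * 2^i \<ge> R0" "\<rho> \<le> 2^i / 4" "i \<ge> 1" for i
  proof -
    have An: "emeasure P (An i n) \<le> ennreal (C2 / (8 * 2^i)\<^sup>2)" for n
    proof -
      have "\<forall>q\<in>e ` {..n}. (\<exists>l. has_lap (dip \<phi> i q) l \<and> (\<forall>y. \<bar>l y\<bar> \<le> K / 8^i)) \<and> (\<forall>y. norm y > (8 * 2^i) / 4 \<longrightarrow> dip \<phi> i q y = 0)"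
      proof
        fix q assume "q \<in> e ` {..n}"
        hence "q \<in> Q" using eQ by auto
        hence q: "norm q < \<rho>" by (simp add: Q_def)
        obtain l where l: "has_lap (dip \<phi> i q) l" "\<And>y. \<bar>l y\<bar> \<le> 72 * C * norm q / 8 ^ i"
          using has_lap_dip[where \<phi>=\<phi> and i=i and C=C and x=q, OF sm supp[OF i(3)] C Cd] q i(2) by auto
        have "72 * C * norm q / 8^i \<le> K / 8^i" unfolding K_def using C q by (intro divide_right_mono mult_left_mono) auto
        hence "\<forall>y. \<bar>l y\<bar> \<le> K / 8^i" using l(2) order_trans by blast
        thus "(\<exists>l. has_lap (dip \<phi> i q) l \<and> (\<forall>y. \<bar>l y\<bar> \<le> K / 8^i)) \<and> (\<forall>y. norm y > (8 * 2^i) / 4 \<longrightarrow> dip \<phi> i q y = 0)"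
          using l(1) supp2[of i] by (auto simp: dip_def)
      qed
      from lf[OF i(1) _ _ this] K
      have "emeasure P {X. \<exists>q\<in>e ` {..n}. \<bar>fluct X (dip \<phi> i q)\<bar> > K / 8^i * (8 * 2^i / 4 + 1)\<^sup>2 * (tau (6 / \<beta> * ln (8 * 2^i)) (8 * 2^i) + 1)} \<le> ennreal (C2 / (8 * 2^i)\<^sup>2)"
        by simp
      thus ?thesis unfolding An_def b_def scale_bound_def by simp
    qed
    \<comment> \<open>The bound on \<open>An i n\<close> is the same for all \<open>n\<close>, so
      continuity from below gives it for the countable family without any union bound.\<close>
    have "incseq (An i)" unfolding incseq_def An_def by fastforce
    hence "emeasure P (A i) = (SUP n. emeasure P (An i n))"
      unfolding AU using Ans by (intro SUP_emeasure_incseq[symmetric]) auto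
    also have "\<dots> \<le> ennreal (C2 / (8 * 2^i)\<^sup>2)" by (intro SUP_least An)
    finally show ?thesis .
  qed
  have ev: "eventually (\<lambda>i. 8 * 2^i \<ge> R0 \<and> \<rho> \<le> 2^i / 4 \<and> i \<ge> 1) sequentially"
  proof -
    have "filterlim (\<lambda>i. 8 * 2^i :: real) at_top sequentially" "filterlim (\<lambda>i. 2^i / 4 :: real) at_top sequentially"
      by real_asymp+
    hence "eventually (\<lambda>i. 8 * 2^i \<ge> R0) sequentially" "eventually (\<lambda>i. \<rho> \<le> 2^i / 4) sequentially"
      by (auto simp: filterlim_at_top)
    thus ?thesis using eventually_ge_at_top[of 1] by eventually_elim auto
  qed
  have sA: "summable (\<lambda>i. measure P (A i))"
  proof (rule summable_comparison_test_ev)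
    show "summable (\<lambda>i. \<bar>C2\<bar> * (1 / 2)^i)" by (intro summable_mult summable_geometric) auto
    show "eventually (\<lambda>i. norm (measure P (A i)) \<le> \<bar>C2\<bar> * (1 / 2)^i) sequentially"
      using ev
    proof eventually_elim
      case (elim i)
      have "C2 / (8 * 2^i)\<^sup>2 \<le> \<bar>C2\<bar> / 2^i"
      proof -
        have "(1::real) \<le> 8 * 2^i" using one_le_power[of "2::real" i] by linarith
        hence "1 * (2^i :: real) \<le> (8 * 2^i) * (8 * 2^i)" by (intro mult_mono) auto
        hence "\<bar>C2\<bar> / (8 * 2^i)\<^sup>2 \<le> \<bar>C2\<bar> / 2^i" by (intro divide_left_mono) (auto simp: power2_eq_square)
        moreover have "C2 / (8 * 2^i)\<^sup>2 \<le> \<bar>C2\<bar> / (8 * 2^i)\<^sup>2" by (intro divide_right_mono) auto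
        ultimately show ?thesis by linarith
      qed
      hence "emeasure P (A i) \<le> ennreal (\<bar>C2\<bar> / 2^i)" using small[of i] elim by (meson ennreal_leI order_trans)
      hence "measure P (A i) \<le> \<bar>C2\<bar> / 2^i" by (simp add: P.emeasure_eq_measure)
      thus ?case by (simp add: power_one_over)
    qed
  qed
  have "AE X in P. eventually (\<lambda>i. X \<in> space P - A i) sequentially"
    by (rule borel_cantelli_AE1[OF As _ sA]) (simp add: P.emeasure_eq_measure)
  hence "AE X in P. eventually (\<lambda>i. \<forall>x\<in>ball 0 \<rho>. \<bar>fluct X (dip \<phi> i x)\<bar> \<le> b i) sequentially"
  proof eventually_elim
    case (elim X)
    thus ?case
    proof eventually_elim
      case (elim i)
      show ?case
      proof
        fix x :: "real^2" assume x: "x \<in> ball 0 \<rho>"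
        have "\<exists>d. d \<in> D \<and> d \<in> ball x (1 / real (Suc n)) \<inter> ball 0 \<rho>" for n
        proof -
          have "x \<in> ball x (1 / real (Suc n)) \<inter> ball 0 \<rho>" using x by simp
          thus ?thesis using D(2)[of "ball x (1 / real (Suc n)) \<inter> ball 0 \<rho>"] by blast
        qed
        hence "\<forall>n. \<exists>d. d \<in> D \<and> d \<in> ball x (1 / real (Suc n)) \<inter> ball 0 \<rho>" by (rule allI)
        from choice[OF this] obtain q where q0: "\<forall>n. q n \<in> D \<and> q n \<in> ball x (1 / real (Suc n)) \<inter> ball 0 \<rho>" by (elim exE)
        have q: "q n \<in> D" "q n \<in> ball x (1 / real (Suc n))" "q n \<in> ball 0 \<rho>" for n
          using spec[OF q0, of n] by simp_all
        have "(\<lambda>n. dist (q n) x) \<longlonglongrightarrow> 0"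
        proof (rule tendsto_sandwich[OF _ _ tendsto_const])
          show "(\<lambda>n. 1 / real (Suc n)) \<longlonglongrightarrow> 0" by real_asymp
          show "eventually (\<lambda>n. dist (q n) x \<le> 1 / real (Suc n)) sequentially"
            using q(2) by (intro always_eventually allI) (simp add: dist_commute less_imp_le)
          show "eventually (\<lambda>n. 0 \<le> dist (q n) x) sequentially" by simp
        qed
        hence qx: "q \<longlonglongrightarrow> x" by (rule iffD2[OF tendsto_dist_iff])
        have lim: "(\<lambda>n. \<bar>fluct X (dip \<phi> i (q n))\<bar>) \<longlonglongrightarrow> \<bar>fluct X (dip \<phi> i x)\<bar>"
          by (rule tendsto_rabs[OF fluct_dip_tendsto[where \<phi>=\<phi> and i=i, OF cont le1 supp2 qx]])
        have "\<bar>fluct X (dip \<phi> i (q n))\<bar> \<le> b i" for n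
        proof -
          have "q n \<in> Q" using q(1,3)[of n] by (simp add: Q_def)
          moreover have "\<not> (\<exists>q\<in>Q. \<bar>fluct X (dip \<phi> i q)\<bar> > b i)" using elim by (simp add: A_def)
          ultimately show ?thesis by (simp add: not_less)
        qed
        thus "\<bar>fluct X (dip \<phi> i x)\<bar> \<le> b i" by (intro LIMSEQ_le_const2[OF lim] exI allI impI)
      qed
    qed
  qed
  thus ?thesis using summable_scale_bound[OF \<beta> K] unfolding b_def by (intro exI conjI)
qed

section \<open>Convergence of the energy of a move\<close>

text \<open>The bilinear expansion collapses to a signed sum over atoms. Integrability at each atom
  is what allows the four separate integrals to be recombined.\<close>

lemma diff_integral_conf:
  fixes f :: "real^2 \<Rightarrow> real^2 \<Rightarrow> real"
  assumes \<mu>: "sigma_finite_measure \<mu>" "sets \<mu> = sets borel" and \<nu>: "sigma_finite_measure \<nu>" "sets \<nu> = sets borel"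
    and S: "finite S" "\<And>z. mult_at Y z \<noteq> 0 \<Longrightarrow> z \<in> S" "\<And>z. mult_at Z z \<noteq> 0 \<Longrightarrow> z \<in> S"
    and F: "(\<lambda>p. indicator A p *\<^sub>R f (fst p) (snd p)) \<in> borel_measurable (borel \<Otimes>\<^sub>M borel)"
    and i: "\<And>z. z \<in> S \<Longrightarrow> integrable \<mu> (\<lambda>y. indicator A (z, y) *\<^sub>R f z y)" "\<And>z. z \<in> S \<Longrightarrow> integrable \<nu> (\<lambda>y. indicator A (z, y) *\<^sub>R f z y)"
  shows "diff_integral (conf_measure Y) (conf_measure Z) \<mu> \<nu> A f =
    (\<Sum>z\<in>S. (real (mult_at Y z) - real (mult_at Z z)) *
       ((LINT y|\<mu>. indicator A (z, y) *\<^sub>R f z y) - (LINT y|\<nu>. indicator A (z, y) *\<^sub>R f z y)))"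
proof -
  have F': "(\<lambda>p. indicator A (fst p, snd p) *\<^sub>R f (fst p) (snd p)) \<in> borel_measurable (borel \<Otimes>\<^sub>M borel)"
    using F by simp
  have c: "(LINT p|(conf_measure W \<Otimes>\<^sub>M \<kappa>). indicator A p *\<^sub>R f (fst p) (snd p)) =
      (\<Sum>z\<in>S. real (mult_at W z) * (LINT y|\<kappa>. indicator A (z, y) *\<^sub>R f z y))"
    if "sigma_finite_measure \<kappa>" "sets \<kappa> = sets borel" "\<forall>z. mult_at W z \<noteq> 0 \<longrightarrow> z \<in> S"
      "\<forall>z\<in>S. integrable \<kappa> (\<lambda>y. indicator A (z, y) *\<^sub>R f z y)" for W \<kappa>
    using conf_pair_integral(2)[where F="\<lambda>z y. indicator A (z, y) *\<^sub>R f z y", OF that(1,2) S(1) _ F', of W] that(3,4) by simp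
  have S': "\<forall>z. mult_at Y z \<noteq> 0 \<longrightarrow> z \<in> S" "\<forall>z. mult_at Z z \<noteq> 0 \<longrightarrow> z \<in> S" using S by auto
  have i': "\<forall>z\<in>S. integrable \<mu> (\<lambda>y. indicator A (z, y) *\<^sub>R f z y)" "\<forall>z\<in>S. integrable \<nu> (\<lambda>y. indicator A (z, y) *\<^sub>R f z y)" using i by auto
  show ?thesis
    unfolding diff_integral_def set_lebesgue_integral_def
      c[OF \<mu> S'(1) i'(1)] c[OF \<nu> S'(1) i'(2)] c[OF \<mu> S'(2) i'(1)] c[OF \<nu> S'(2) i'(2)]
    by (simp add: algebra_simps sum.distrib sum_subtractf)
qed

lemma conf_restrict_integral:
  fixes f :: "real^2 \<Rightarrow> real"
  assumes "f \<in> borel_measurable borel" "\<And>y. norm y > r \<Longrightarrow> f y = 0" "\<And>y. y \<notin> A \<Longrightarrow> f y = 0"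
  shows "(LINT y|conf_measure (conf_restrict X A). f y) = (LINT y|conf_measure X. f y)"
proof -
  let ?F = "{x \<in> cball 0 r. mult_at X x \<noteq> 0}"
  have F: "z \<in> ?F" if "mult_at X z \<noteq> 0" "f z \<noteq> 0" for z using that assms(2)[of z] by force
  have "(LINT y|conf_measure (conf_restrict X A). f y) = (\<Sum>z\<in>?F. real (mult_at (conf_restrict X A) z) * f z)"
    by (rule conf_measure_finite_integral(2)[OF assms(1) mult_at_finite]) (rule F, auto simp: mult_at_restrict split: if_splits)
  also have "\<dots> = (\<Sum>z\<in>?F. real (mult_at X z) * f z)"
    by (intro sum.cong refl) (use assms(3) in \<open>auto simp: mult_at_restrict\<close>)
  also have "\<dots> = (LINT y|conf_measure X. f y)"
    by (rule conf_measure_finite_integral(2)[OF assms(1) mult_at_finite, symmetric]) (rule F)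
  finally show ?thesis .
qed

lemma fluct_add:
  assumes "continuous_on UNIV f" "\<And>y. norm y > r \<Longrightarrow> f y = 0" "continuous_on UNIV g" "\<And>y. norm y > r \<Longrightarrow> g y = 0"
  shows "fluct X (\<lambda>y. f y + g y) = fluct X f + fluct X g"
proof -
  note m = borel_measurable_continuous_onI[OF assms(1)] borel_measurable_continuous_onI[OF assms(3)]
  show ?thesis unfolding fluct_def
    by (simp add: Bochner_Integration.integral_add integrable_compact_supp[OF assms(1,2)]
        integrable_compact_supp[OF assms(3,4)] integrable_conf_measure_compact[OF m(1) assms(2)]
        integrable_conf_measure_compact[OF m(2) assms(4)])
qed

text \<open>Once \<open>2 ^ Suc p\<close> is large against \<open>\<rho>\<close>, the support of
  \<open>\<phi> (Suc p)\<close> avoids \<open>\<Lambda>\<close>. There the restriction to the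
  complement has no effect and the logarithm equals its smoothing, so the increment is a combination
  of fluctuations of smooth compactly supported functions.\<close>

lemma truncated_move_difference:
  assumes \<phi>: "dyadic_partition \<phi>" and \<Lambda>: "\<Lambda> \<in> sets borel" "\<Lambda> \<subseteq> ball 0 \<rho>" "\<rho> \<le> 2 ^ Suc p / 4"
    and S: "finite S" "S \<subseteq> \<Lambda>" "\<And>z. mult_at X' z \<noteq> 0 \<Longrightarrow> z \<in> S" "\<And>z. mult_at (conf_restrict X \<Lambda>) z \<noteq> 0 \<Longrightarrow> z \<in> S"
    and eq: "(\<Sum>z\<in>S. mult_at X' z) = (\<Sum>z\<in>S. mult_at (conf_restrict X \<Lambda>) z)"
  shows "truncated_move \<phi> \<Lambda> X' X (Suc p) - truncated_move \<phi> \<Lambda> X' X p =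
    (\<Sum>z\<in>S. (real (mult_at X' z) - real (mult_at (conf_restrict X \<Lambda>) z)) * fluct X (dip \<phi> (Suc p) z))"
proof -
  obtain C where cont: "\<And>i. continuous_on UNIV (\<phi> i)"
    and supp: "\<And>i y. i \<ge> 1 \<Longrightarrow> \<not> (2^i / 2 \<le> norm y \<and> norm y \<le> 2 * 2^i) \<Longrightarrow> \<phi> i y = 0"
    and supp2: "\<And>i y. norm y > 2 * 2^i \<Longrightarrow> \<phi> i y = 0"
    and le1: "\<And>i y. \<bar>\<phi> i y\<bar> \<le> 1"
    by (rule dyadic_partition_facts[OF \<phi>]) (rule that; assumption)
  define i where "i = Suc p"
  define s :: real where "s = 2 ^ i / 4"
  have s: "s > 0" "\<rho> \<le> s" using \<Lambda>(3) by (simp_all add: s_def i_def)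
  let ?\<mu> = "conf_measure (conf_restrict X (- \<Lambda>))"
  let ?c = "\<lambda>z. real (mult_at X' z) - real (mult_at (conf_restrict X \<Lambda>) z)"
  define F where "F q z y = indicator (\<Lambda> \<times> (- \<Lambda>)) (z, y) *\<^sub>R (- ln (norm (z - y)) * (\<Sum>j\<le>q. \<phi> j y))" for q z y
  have Fl: "F q z = (\<lambda>y. indicator (\<Lambda> \<times> (- \<Lambda>)) (z, y) *\<^sub>R (- ln (norm (z - y)) * (\<Sum>j\<le>q. \<phi> j y)))" for q z
    by (rule ext) (rule F_def)
  have \<phi>m[measurable]: "\<phi> j \<in> borel_measurable borel" for j by (rule borel_measurable_continuous_onI[OF cont])
  have wm: "(\<lambda>y. indicator (- \<Lambda>) y * (\<Sum>j\<le>q. \<phi> j y)) \<in> borel_measurable borel" for q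
    using \<Lambda>(1) by (intro borel_measurable_times borel_measurable_indicator borel_measurable_sum \<phi>m) (auto simp: borel_comp)
  have far: "(\<Sum>j\<le>q. \<phi> j y) = 0" if "norm y > 2 * 2 ^ q" for q y
  proof (rule sum.neutral, rule ballI)
    fix j assume "j \<in> {..q}"
    hence "(2::real) ^ j \<le> 2 ^ q" by (intro power_increasing) auto
    thus "\<phi> j y = 0" using that by (intro supp2) linarith
  qed
  have Fm: "(\<lambda>w. indicator (\<Lambda> \<times> (- \<Lambda>)) w *\<^sub>R (- ln (norm (fst w - snd w)) * (\<Sum>j\<le>q. \<phi> j (snd w))))
      \<in> borel_measurable (borel \<Otimes>\<^sub>M borel)" for q
  proof -
    have "\<Lambda> \<times> (- \<Lambda>) \<in> sets (borel \<Otimes>\<^sub>M borel)" using \<Lambda>(1) by (intro pair_measureI) (auto simp: borel_comp)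
    thus ?thesis by measurable
  qed
  have F_eq: "F q z = (\<lambda>y. lnk (y - z) * (indicator (- \<Lambda>) y * (\<Sum>j\<le>q. \<phi> j y)))" if "z \<in> S" for q z
    using that S(2) by (auto simp: F_def lnk_def norm_minus_commute indicator_def fun_eq_iff)
  have Fz: "F q z y = 0" if "z \<in> S" "norm y > 2 * 2 ^ q" for q z y
    using far[OF that(2)] by (simp add: F_def)
  have Fb: "F q z \<in> borel_measurable borel" if "z \<in> S" for q z
    unfolding F_eq[OF that] using wm[of q] by measurable
  have il: "integrable lborel (F q z)" if "z \<in> S" for q z
    unfolding F_eq[OF that]
  proof (rule integrable_lnk_mult[OF wm])
    fix y :: "real^2"
    have "\<bar>\<Sum>j\<le>q. \<phi> j y\<bar> \<le> (\<Sum>j\<le>q. 1)" by (rule order_trans[OF sum_abs]) (intro sum_mono le1)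
    thus "\<bar>indicator (- \<Lambda>) y * (\<Sum>j\<le>q. \<phi> j y)\<bar> \<le> real (Suc q)" by (auto simp: indicator_def)
    show "indicator (- \<Lambda>) y * (\<Sum>j\<le>q. \<phi> j y) = 0" if "norm y > 2 * 2 ^ q" using far[OF that] by simp
  qed
  have ic: "integrable ?\<mu> (F q z)" if "z \<in> S" for q z
    by (rule integrable_conf_measure_compact[OF Fb[OF that] Fz[OF that]])
  define G where "G q z = (LINT y|?\<mu>. F q z y) - (LINT y|lborel. F q z y)" for q z
  have T: "truncated_move \<phi> \<Lambda> X' X q = (\<Sum>z\<in>S. ?c z * G q z)" for q
    unfolding truncated_move_def G_def F_def
    by (rule diff_integral_conf[OF sigma_finite_conf_measure sets_conf_measure sigma_finite_lborel sets_lborel S(1,3,4) Fm])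
       (assumption | erule ic[unfolded Fl] il[unfolded Fl])+
  \<comment> \<open>The potential of a single charge at scale \<open>i\<close>. It splits into the
    dipole part and \<open>h 0\<close>, which does not depend on \<open>z\<close>.\<close>
  define h where "h z y = \<phi> i y * Lk s (y - z)" for z y
  have hd: "h z = (\<lambda>y. dip \<phi> i z y + h 0 y)" for z
    by (auto simp: h_def dip_def s_def algebra_simps)
  have hc: "continuous_on UNIV (h z)" for z
    unfolding h_def by (intro continuous_on_mult cont continuous_on_compose2[OF Lk_continuous[OF s(1), of UNIV]] continuous_intros) auto
  have hr: "h z y = 0" if "norm y > 2 * 2 ^ i" for z y using supp2[OF that] by (simp add: h_def)
  have dr: "dip \<phi> i z y = 0" if "norm y > 2 * 2 ^ i" for z y using supp2[OF that] by (simp add: dip_def)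
  have inc: "F (Suc p) z y - F p z y = h z y" and h\<Lambda>: "y \<in> \<Lambda> \<Longrightarrow> h z y = 0" if z: "z \<in> S" for z y
  proof -
    have nz: "norm z < \<rho>" using z S(2) \<Lambda>(2) by auto
    have A: "norm y \<ge> 2 * s" if "\<phi> i y \<noteq> 0" using supp[of i y] that by (auto simp: s_def i_def)
    have B: "y \<notin> \<Lambda>" "Lk s (y - z) = lnk (y - z)" if "\<phi> i y \<noteq> 0"
    proof -
      show "y \<notin> \<Lambda>" using A[OF that] s \<Lambda>(2) by auto
      show "Lk s (y - z) = lnk (y - z)"
        using A[OF that] nz s norm_triangle_ineq2[of y z] by (intro Lk_eq_lnk) linarith
    qed
    show "F (Suc p) z y - F p z y = h z y"
      unfolding F_eq[OF z] h_def using B by (cases "\<phi> i y = 0") (auto simp: i_def algebra_simps)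
    show "h z y = 0" if "y \<in> \<Lambda>" using B(1) that unfolding h_def by (cases "\<phi> i y = 0") auto
  qed
  have GG: "G (Suc p) z - G p z = fluct X (dip \<phi> i z) + fluct X (h 0)" if z: "z \<in> S" for z
  proof -
    have "G (Suc p) z - G p z = (LINT y|?\<mu>. F (Suc p) z y - F p z y) - (LINT y|lborel. F (Suc p) z y - F p z y)"
      unfolding G_def by (simp add: Bochner_Integration.integral_diff[OF ic[OF z] ic[OF z]] Bochner_Integration.integral_diff[OF il[OF z] il[OF z]])
    also have "\<dots> = (LINT y|?\<mu>. h z y) - (LINT y|lborel. h z y)" by (simp only: inc[OF z])
    also have "(LINT y|?\<mu>. h z y) = (LINT y|conf_measure X. h z y)"
      by (rule conf_restrict_integral[OF borel_measurable_continuous_onI[OF hc] hr]) (use h\<Lambda>[OF z] in auto)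
    also have "\<dots> - (LINT y|lborel. h z y) = fluct X (h z)" by (simp add: fluct_def)
    also have "\<dots> = fluct X (dip \<phi> i z) + fluct X (h 0)"
      unfolding hd[of z] by (rule fluct_add[OF dip_continuous[where \<phi>=\<phi> and i=i, OF cont] dr hc hr])
    finally show ?thesis .
  qed
  \<comment> \<open>Equality of the numbers of points enters here: the common term
    \<open>fluct X (h 0)\<close>, which has no useful bound, gets coefficient zero.\<close>
  have c0: "(\<Sum>z\<in>S. ?c z) = 0"
    using arg_cong[OF eq, of real] by (simp add: sum_subtractf)
  have "truncated_move \<phi> \<Lambda> X' X (Suc p) - truncated_move \<phi> \<Lambda> X' X p = (\<Sum>z\<in>S. ?c z * (G (Suc p) z - G p z))"
    unfolding T by (simp add: right_diff_distrib sum_subtractf)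
  also have "\<dots> = (\<Sum>z\<in>S. ?c z * fluct X (dip \<phi> i z) + ?c z * fluct X (h 0))"
    by (intro sum.cong refl) (simp only: GG distrib_left)
  also have "\<dots> = (\<Sum>z\<in>S. ?c z * fluct X (dip \<phi> i z)) + (\<Sum>z\<in>S. ?c z) * fluct X (h 0)"
    by (simp only: sum.distrib sum_distrib_right)
  finally show ?thesis unfolding c0 i_def by simp
qed

theorem theorem0:
  fixes \<beta> :: real and a :: "nat \<Rightarrow> real^2" and P :: "conf measure"
    and \<phi> :: "nat \<Rightarrow> real^2 \<Rightarrow> real" and \<Lambda> :: "(real^2) set"
  assumes "\<beta> > 0"
    and "in_bulk a"
    and "ocp_limit_point \<beta> a P"
    and "dyadic_partition \<phi>"
    and "\<Lambda> \<in> sets borel" and "bounded \<Lambda>"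
  shows "AE X in P. \<forall>X'. (\<forall>x. mult_at X' x \<noteq> 0 \<longrightarrow> x \<in> \<Lambda>)
      \<and> emeasure (conf_measure X') \<Lambda> = emeasure (conf_measure X) \<Lambda>
      \<longrightarrow> convergent (\<lambda>p. truncated_move \<phi> \<Lambda> X' X p)"
proof -
  obtain \<rho> where \<rho>: "\<rho> > 0" "\<Lambda> \<subseteq> ball 0 \<rho>"
    using bounded_subset_ballD[OF assms(6), of 0] by blast
  from AE_dipole_fluctuations[OF assms(1-4) \<rho>(1)] obtain b where b: "summable b"
    and ae: "AE X in P. eventually (\<lambda>i. \<forall>x\<in>ball 0 \<rho>. \<bar>fluct X (dip \<phi> i x)\<bar> \<le> b i) sequentially"
    by (elim exE conjE)
  \<comment> \<open>The null set is fixed before \<open>X'\<close> is chosen, because the bound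
    holds for all positions in the ball at once.\<close>
  from ae show ?thesis
  proof eventually_elim
    case (elim X)
    show ?case
    proof (intro allI impI, elim conjE)
      fix X' assume X': "\<forall>x. mult_at X' x \<noteq> 0 \<longrightarrow> x \<in> \<Lambda>"
        and N: "emeasure (conf_measure X') \<Lambda> = emeasure (conf_measure X) \<Lambda>"
      define S where "S = {z \<in> \<Lambda>. mult_at X' z \<noteq> 0} \<union> {z \<in> \<Lambda>. mult_at X z \<noteq> 0}"
      have fin: "finite S"
        unfolding S_def by (rule finite_subset[of _ "{z \<in> cball 0 \<rho>. mult_at X' z \<noteq> 0} \<union> {z \<in> cball 0 \<rho>. mult_at X z \<noteq> 0}"])
          (use \<rho>(2) mult_at_finite[of \<rho>] in \<open>auto simp: subset_iff less_imp_le\<close>)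
      have S\<Lambda>: "S \<subseteq> \<Lambda>" by (auto simp: S_def)
      have S': "z \<in> S" if "mult_at X' z \<noteq> 0" for z using that X' by (auto simp: S_def)
      have SX: "z \<in> S" if "mult_at (conf_restrict X \<Lambda>) z \<noteq> 0" for z
        using that by (auto simp: S_def mult_at_restrict split: if_splits)
      \<comment> \<open>Both masses are finite sums of multiplicities over the same finite set, so
        the equality of extended reals descends to natural numbers.\<close>
      have "of_nat (\<Sum>z\<in>S. mult_at X' z) = (of_nat (\<Sum>z\<in>S. mult_at X z) :: ennreal)"
        using N emeasure_conf_measure[OF assms(5) fin _ S\<Lambda>, of X'] emeasure_conf_measure[OF assms(5) fin _ S\<Lambda>, of X] S'
        by (simp add: S_def)
      hence "(\<Sum>z\<in>S. mult_at X' z) = (\<Sum>z\<in>S. mult_at X z)" by (simp only: of_nat_eq_iff)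
      also have "\<dots> = (\<Sum>z\<in>S. mult_at (conf_restrict X \<Lambda>) z)"
        using S\<Lambda> by (intro sum.cong refl) (auto simp: mult_at_restrict)
      finally have eq: "(\<Sum>z\<in>S. mult_at X' z) = (\<Sum>z\<in>S. mult_at (conf_restrict X \<Lambda>) z)" .
      define c where "c z = real (mult_at X' z) - real (mult_at (conf_restrict X \<Lambda>) z)" for z
      define K where "K = (\<Sum>z\<in>S. \<bar>c z\<bar>)"
      let ?T = "\<lambda>p. truncated_move \<phi> \<Lambda> X' X p"
      have "filterlim (\<lambda>p. 2 ^ Suc p / 4 :: real) at_top sequentially" by real_asymp
      hence "eventually (\<lambda>p. \<rho> \<le> 2 ^ Suc p / 4) sequentially" unfolding filterlim_at_top by blast
      moreover have "eventually (\<lambda>p. \<forall>x\<in>ball 0 \<rho>. \<bar>fluct X (dip \<phi> (Suc p) x)\<bar> \<le> b (Suc p)) sequentially"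
        by (rule eventually_compose_filterlim[OF elim filterlim_Suc])
      ultimately have "eventually (\<lambda>p. norm (?T (Suc p) - ?T p) \<le> K * b (Suc p)) sequentially"
      proof eventually_elim
        case (elim p)
        have "?T (Suc p) - ?T p = (\<Sum>z\<in>S. c z * fluct X (dip \<phi> (Suc p) z))"
          unfolding c_def by (rule truncated_move_difference[OF assms(4,5) \<rho>(2) elim(1) fin S\<Lambda> S' SX eq])
        hence "norm (?T (Suc p) - ?T p) \<le> (\<Sum>z\<in>S. \<bar>c z * fluct X (dip \<phi> (Suc p) z)\<bar>)" by (simp add: sum_abs)
        also have "\<dots> \<le> (\<Sum>z\<in>S. \<bar>c z\<bar> * b (Suc p))"
          unfolding abs_mult using elim(2) S\<Lambda> \<rho>(2) by (intro sum_mono mult_left_mono) auto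
        finally show ?case by (simp add: K_def sum_distrib_right)
      qed
      moreover have "summable (\<lambda>p. K * b (Suc p))"
        using b by (intro summable_mult) (simp only: summable_Suc_iff)
      ultimately have "summable (\<lambda>p. ?T (Suc p) - ?T p)" by (rule summable_comparison_test_ev)
      \<comment> \<open>Partial sums of the increments telescope to
        \<open>?T n - ?T 0\<close>.\<close>
      hence "convergent (\<lambda>n. \<Sum>p<n. ?T (Suc p) - ?T p)" by (simp only: summable_iff_convergent)
      hence "convergent (\<lambda>n. (?T n - ?T 0) + ?T 0)"
        unfolding sum_lessThan_telescope by (intro convergent_add convergent_const)
      thus "convergent ?T" by simp
    qed
  qed
qed

end
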